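(* Let $N=3$, $4<p<6$, $a>0$, suppose $V,f,Q$ satisfy (V1)–(V3) and (D1)–(D2), and $\int_\Omega Q\phi_1^pdx<0$. Then there exists $\delta_0>0$ such that for each $\lambda_1(f_\Omega)\le\lambda<\lambda_1(f_\Omega)+\delta_0$ there is $\mu^*>0$ such that for all $\mu>\mu^*$, $J_{\mu,\lambda}$ has a minimizer on $\mathbf N^-_{\mu,\lambda}$.
   Context: Conditions on $V,f,Q:\mathbb{R}^3\to\mathbb{R}$: (V1) $V$ nonnegative and continuous; (V2) there is $c>0$ with $\{V<c\}$ nonempty of finite measure; (V3) $\Omega=\mathrm{int}\{V=0\}$ is a nonempty bounded smooth domain with $\overline\Omega=\{V=0\}$; (D1) $f\in L^{3/2}(\mathbb{R}^3)$, $f^+\not\equiv0$ in $\Omega$; (D2) $Q\in L^\infty(\mathbb{R}^3)$, $Q^+\not\equiv0$ in $\Omega$. $X=\{u\in H^1(\mathbb{R}^3):\int Vu^2<\infty\}$, $\|u\|_{D^{1,2}}^2=\int|\nabla u|^2$, $\|u\|_\mu^2=\int(|\nabla u|^2+\mu Vu^2)$. $J_{\mu,\lambda}(u)=\frac a4\|u\|_{D^{1,2}}^4+\frac12\|u\|_\mu^2-\frac1p\int Q|u|^p-\frac\lambda2\int fu^2$; $h_u(t)=J_{\mu,\lambda}(tu)$; $\mathbf N_{\mu,\lambda}=\{u\in X\setminus\{0\}:h_u'(1)=0\}$, $\mathbf N^-_{\mu,\lambda}=\{u\in\mathbf N_{\mu,\lambda}:h_u''(1)<0\}$. $\lambda_1(f_\Omega)$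 is the positive principal eigenvalue of $-\Delta u=\lambda f_\Omega u$ in $\Omega$, $u=0$ on $\partial\Omega$ ($f_\Omega=f|_{\overline\Omega}$), $\phi_1$ the positive principal eigenfunction with $\int_\Omega f_\Omega\phi_1^2=1$. A minimizer on $\mathbf N^-_{\mu,\lambda}$ is $u_0\in\mathbf N^-_{\mu,\lambda}$ with $J_{\mu,\lambda}(u_0)=\inf_{\mathbf N^-_{\mu,\lambda}}J_{\mu,\lambda}$. *)

theory Defs
  imports "HOL-Analysis.Analysis"
begin

definition partial :: "'n::finite \<Rightarrow> (real^'n \<Rightarrow> real) \<Rightarrow> real^'n \<Rightarrow> real" where
  "partial i f x = frechet_derivative f (at x) (axis i 1)"

fun iter_partial :: "'n::finite list \<Rightarrow> (real^'n \<Rightarrow> real) \<Rightarrow> real^'n \<Rightarrow> real" where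
  "iter_partial [] f = f"
| "iter_partial (i # is) f = partial i (iter_partial is f)"

definition smooth_on :: "(real^'n::finite) set \<Rightarrow> (real^'n \<Rightarrow> real) \<Rightarrow> bool" where
  "smooth_on S f \<longleftrightarrow> open S \<and>
     (\<forall>is. iter_partial is f differentiable_on S \<and> continuous_on S (iter_partial is f))"

definition smooth_bounded_domain :: "(real^3) set \<Rightarrow> bool" where
  "smooth_bounded_domain \<Omega> \<longleftrightarrow> open \<Omega> \<and> connected \<Omega> \<and> bounded \<Omega> \<and>
     (\<forall>x0\<in>frontier \<Omega>. \<exists>r>0. \<exists>T::real^3 \<Rightarrow> real^3. orthogonal_transformation T \<and>
        (\<exists>\<gamma>::real^2 \<Rightarrow> real. smooth_on UNIV \<gamma> \<and>
           \<Omega> \<inter> ball x0 r =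
             {x \<in> ball x0 r. T (x - x0) $ 3 < \<gamma> (vector [T (x - x0) $ 1, T (x - x0) $ 2])}))"

definition tsupp :: "(real^3 \<Rightarrow> real) \<Rightarrow> (real^3) set" where
  "tsupp \<phi> = closure {x. \<phi> x \<noteq> 0}"

definition test_fun :: "(real^3) set \<Rightarrow> (real^3 \<Rightarrow> real) \<Rightarrow> bool" where
  "test_fun U \<phi> \<longleftrightarrow> smooth_on UNIV \<phi> \<and> compact (tsupp \<phi>) \<and> tsupp \<phi> \<subseteq> U"

definition L2 :: "(real^3 \<Rightarrow> real) \<Rightarrow> bool" where
  "L2 u \<longleftrightarrow> u \<in> borel_measurable lebesgue \<and> integrable lebesgue (\<lambda>x. (u x)\<^sup>2)"

definition weak_grad :: "(real^3 \<Rightarrow> real) \<Rightarrow> (real^3 \<Rightarrow> real^3) \<Rightarrow> bool" where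
  "weak_grad u g \<longleftrightarrow> (\<forall>\<phi>. test_fun UNIV \<phi> \<longrightarrow> (\<forall>i.
      integrable lebesgue (\<lambda>x. u x * partial i \<phi> x) \<and>
      integrable lebesgue (\<lambda>x. g x $ i * \<phi> x) \<and>
      (\<integral>x. u x * partial i \<phi> x \<partial>lebesgue) = - (\<integral>x. g x $ i * \<phi> x \<partial>lebesgue)))"

definition H1 :: "(real^3 \<Rightarrow> real) \<Rightarrow> bool" where
  "H1 u \<longleftrightarrow> L2 u \<and> (\<exists>g. (\<forall>i. L2 (\<lambda>x. g x $ i)) \<and> weak_grad u g)"

text \<open>The weak gradient (unique up to null sets).\<close>
definition grad :: "(real^3 \<Rightarrow> real) \<Rightarrow> real^3 \<Rightarrow> real^3" where
  "grad u = (SOME g. (\<forall>i. L2 (\<lambda>x. g x $ i)) \<and> weak_grad u g)"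

definition D12_sq :: "(real^3 \<Rightarrow> real) \<Rightarrow> real" where
  "D12_sq u = (\<integral>x. (norm (grad u x))\<^sup>2 \<partial>lebesgue)"

text \<open>H_0^1(\<Omega>), functions extended by zero: the H^1-closure of C_c^infinity(\<Omega>).\<close>
definition H10 :: "(real^3) set \<Rightarrow> (real^3 \<Rightarrow> real) \<Rightarrow> bool" where
  "H10 \<Omega> u \<longleftrightarrow> H1 u \<and> (\<exists>\<phi>s. (\<forall>n. test_fun \<Omega> (\<phi>s n)) \<and>
      (\<lambda>n. (\<integral>x. (\<phi>s n x - u x)\<^sup>2 \<partial>lebesgue) + D12_sq (\<lambda>x. \<phi>s n x - u x)) \<longlonglongrightarrow> 0)"

text \<open>Weak Dirichlet eigenpair of \<open>-\<Delta>u = \<lambda> f_\<Omega> u\<close> in \<Omega>, u = 0 on \<partial>\<Omega>.\<close>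
definition dirichlet_eigenpair ::
  "(real^3) set \<Rightarrow> (real^3 \<Rightarrow> real) \<Rightarrow> real \<Rightarrow> (real^3 \<Rightarrow> real) \<Rightarrow> bool" where
  "dirichlet_eigenpair \<Omega> f lam u \<longleftrightarrow> H10 \<Omega> u \<and> \<not> (AE x in lebesgue. u x = 0) \<and>
     (\<forall>v. test_fun \<Omega> v \<longrightarrow>
        (\<integral>x. grad u x \<bullet> grad v x \<partial>lebesgue) = lam * (\<integral>x\<in>\<Omega>. f x * u x * v x \<partial>lebesgue))"

definition Xspace :: "(real^3 \<Rightarrow> real) \<Rightarrow> (real^3 \<Rightarrow> real) set" where
  "Xspace V = {u. H1 u \<and> integrable lebesgue (\<lambda>x. V x * (u x)\<^sup>2)}"

definition mu_norm_sq :: "(real^3 \<Rightarrow> real) \<Rightarrow> real \<Rightarrow> (real^3 \<Rightarrow> real) \<Rightarrow> real" where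
  "mu_norm_sq V \<mu> u = D12_sq u + \<mu> * (\<integral>x. V x * (u x)\<^sup>2 \<partial>lebesgue)"

definition Jfun :: "real \<Rightarrow> real \<Rightarrow> (real^3 \<Rightarrow> real) \<Rightarrow> (real^3 \<Rightarrow> real) \<Rightarrow> (real^3 \<Rightarrow> real)
    \<Rightarrow> real \<Rightarrow> real \<Rightarrow> (real^3 \<Rightarrow> real) \<Rightarrow> real" where
  "Jfun a p V f Q \<mu> lam u =
     a / 4 * (D12_sq u)\<^sup>2 + 1 / 2 * mu_norm_sq V \<mu> u
     - 1 / p * (\<integral>x. Q x * \<bar>u x\<bar> powr p \<partial>lebesgue)
     - lam / 2 * (\<integral>x. f x * (u x)\<^sup>2 \<partial>lebesgue)"

definition fiber :: "real \<Rightarrow> real \<Rightarrow> (real^3 \<Rightarrow> real) \<Rightarrow> (real^3 \<Rightarrow> real) \<Rightarrow> (real^3 \<Rightarrow> real)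
    \<Rightarrow> real \<Rightarrow> real \<Rightarrow> (real^3 \<Rightarrow> real) \<Rightarrow> real \<Rightarrow> real" where
  "fiber a p V f Q \<mu> lam u t = Jfun a p V f Q \<mu> lam (\<lambda>x. t * u x)"

definition Nehari :: "real \<Rightarrow> real \<Rightarrow> (real^3 \<Rightarrow> real) \<Rightarrow> (real^3 \<Rightarrow> real) \<Rightarrow> (real^3 \<Rightarrow> real)
    \<Rightarrow> real \<Rightarrow> real \<Rightarrow> (real^3 \<Rightarrow> real) set" where
  "Nehari a p V f Q \<mu> lam =
     {u \<in> Xspace V. \<not> (AE x in lebesgue. u x = 0) \<and>
        deriv (fiber a p V f Q \<mu> lam u) 1 = 0}"

definition Nehari_minus :: "real \<Rightarrow> real \<Rightarrow> (real^3 \<Rightarrow> real) \<Rightarrow> (real^3 \<Rightarrow> real) \<Rightarrow> (real^3 \<Rightarrow> real)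
    \<Rightarrow> real \<Rightarrow> real \<Rightarrow> (real^3 \<Rightarrow> real) set" where
  "Nehari_minus a p V f Q \<mu> lam =
     {u \<in> Nehari a p V f Q \<mu> lam. deriv (deriv (fiber a p V f Q \<mu> lam u)) 1 < 0}"

end

theory Submission
  imports Defs "HOL-Library.Diagonal_Subsequence"
begin

text \<open>Suppose \<open>u\<^sub>n \<in> X\<close> with \<open>\<integral> Q \<bar>u\<^sub>n\<bar>\<^sup>p > 0\<close>, \<open>\<parallel>u\<^sub>n\<parallel>\<^sub>\<mu> = 1\<close> and the quadratic form
  \<open>\<parallel>u\<^sub>n\<parallel>\<^sub>\<mu>\<^sup>2 - \<lambda> \<integral> f u\<^sub>n\<^sup>2\<close> tends to a limit \<open>\<le> 0\<close> while \<open>\<lambda> \<down> \<lambda>\<^sub>1\<close> and \<open>\<mu> \<rightarrow> \<infinity>\<close>. The almost everywhere limit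
  lies in \<open>H\<^sub>0\<^sup>1(\<Omega>)\<close> and has Rayleigh quotient at most \<open>\<lambda>\<^sub>1\<close>, so by Picone's inequality it is a multiple of
  \<open>\<phi>\<^sub>1\<close>, where the \<open>Q\<close>-integral is negative: a contradiction. Hence the quadratic form is coercive on
  \<open>\<integral> Q \<bar>u\<bar>\<^sup>p > 0\<close>, a set that contains \<open>N\<^sup>-\<close>, and minimizing sequences on \<open>N\<^sup>-\<close> are bounded and stay away from \<open>0\<close>.
  For large \<open>\<mu>\<close> the loss \<open>\<integral> Q \<bar>u\<^sub>n\<bar>\<^sup>p - \<integral> Q \<bar>u\<bar>\<^sup>p\<close> in the limit is at most a small multiple of the loss of
  \<open>\<parallel>u\<^sub>n\<parallel>\<^sub>\<mu>\<^sup>2\<close>, because a function concentrating where \<open>V\<close> is large has small \<open>L\<^sup>2\<close> norm. So projecting the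
  limit \<open>u\<close> to \<open>N\<^sup>-\<close> along its ray uses a factor \<open>t \<le> 1\<close> and does not increase the energy.
  Weak limits are avoided: averages of tails converge strongly, by the parallelogram law.\<close>

section \<open>Smooth functions and mollification\<close>

text \<open>\<open>lam1\<close> is given only through a positive weak solution. Picone's inequality
  therefore has to supply both the Rayleigh bound and the simplicity of the eigenvalue. The quotient
  \<open>v / \<phi>\<close> in it is singular where \<open>\<phi>\<close> degenerates, which
  explains the regularization \<open>G e\<close> and the detour through the bounded function
  \<open>arctan\<close>.

  The obstacle to minimization is the p-th power term on the whole space: only
  \<open>{x. V x < c}\<close> has finite measure, and a minimizing sequence may lose mass elsewhere.
  Exact convergence of \<open>Bn\<close> is out of reach. It is enough that its loss is at most
  \<open>\<delta> / 2\<close> times the loss of norm, since the Nehari condition tolerates the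
  factor \<open>1\<close>.

  The exponent \<open>p > 4\<close> enters twice: on the Nehari set \<open>J\<close> becomes a
  combination of \<open>(D12_sq u)\<^sup>2\<close> and \<open>qf \<mu> lam u\<close> with positive
  coefficients, and every ray with \<open>Bn u > 0\<close> and \<open>qf \<mu> lam u > 0\<close>
  meets \<open>Nminus\<close>. The gap \<open>\<delta>\<close> does not depend on
  \<open>lam\<close>, while the threshold for \<open>\<mu>\<close> may.\<close>

definition flat :: "nat \<Rightarrow> real \<Rightarrow> real" where
  "flat k t = (if t > 0 then exp (- (1 / t)) / t ^ k else 0)"

lemma flat_nonneg: "flat k t \<ge> 0"
  by (simp add: flat_def)

lemma flat_pos: "t > 0 \<Longrightarrow> flat k t > 0"
  by (simp add: flat_def)

text \<open>A single term of the exponential series suffices: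
  \<open>y ^ (k + 2) / fact (k + 2) \<le> exp y\<close> with \<open>y = 1 / t\<close>. The factor
  \<open>t\<^sup>2\<close> that is left over makes the difference quotient at \<open>0\<close>
  vanish.\<close>

lemma flat_le: "flat k t \<le> fact (k + 2) * t\<^sup>2"
proof (cases "t > 0")
  case True
  define y where "y = 1 / t"
  have y: "y > 0" using True by (simp add: y_def)
  have s: "summable (\<lambda>n. y ^ n /\<^sub>R fact n)"
    by (rule summable_exp_generic)
  have "(\<Sum>n\<in>{k + 2}. y ^ n /\<^sub>R fact n) \<le> (\<Sum>n. y ^ n /\<^sub>R fact n)"
    by (rule sum_le_suminf[OF s]) (use y in auto)
  then have "y ^ (k + 2) / fact (k + 2) \<le> exp y"
    by (simp add: exp_def divide_inverse mult.commute)
  then have "y ^ (k + 2) \<le> exp y * fact (k + 2)"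
    by (subst (asm) pos_divide_le_eq) auto
  then have 1: "y ^ (k + 2) * exp (- y) \<le> fact (k + 2)"
    by (simp add: exp_minus field_simps del: fact_Suc power_Suc)
  have "flat k t = y ^ (k + 2) * exp (- y) * t\<^sup>2"
    using True by (simp add: flat_def y_def power_add field_simps power2_eq_square)
  also have "\<dots> \<le> fact (k + 2) * t\<^sup>2"
    by (rule mult_right_mono[OF 1]) simp
  finally show ?thesis .
qed (simp add: flat_def)

text \<open>The index \<open>k\<close> is carried along because differentiation raises the power in
  the denominator. The family as a whole is then closed under derivatives, and every member has
  derivative \<open>0\<close> at the origin.\<close>

lemma flat_has_derivative:
  "(flat k has_real_derivative (flat (k + 2) t - of_nat k * flat (k + 1) t)) (at t)"
proof -
  consider "t > 0" | "t < 0" | "t = 0" by linarith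
  then show ?thesis
  proof cases
    case 1
    have "((\<lambda>t. exp (- (1 / t)) / t ^ k) has_real_derivative
        (flat (k + 2) t - of_nat k * flat (k + 1) t)) (at t)"
    proof (rule DERIV_cong[OF DERIV_divide[OF _ DERIV_pow]])
      show "((\<lambda>t. exp (- (1 / t))) has_real_derivative exp (- (1 / t)) / t\<^sup>2) (at t)"
        using 1 by (auto intro!: derivative_eq_intros simp: power2_eq_square)
      show "t ^ k \<noteq> 0" using 1 by simp
      show "(exp (- (1 / t)) / t\<^sup>2 * t ^ k - exp (- (1 / t)) * (real k * t ^ (k - Suc 0))) / (t ^ k * t ^ k) =
          flat (k + 2) t - of_nat k * flat (k + 1) t"
        using 1 by (cases k) (simp_all add: flat_def field_simps power2_eq_square)
    qed
    then show ?thesis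
      by (rule has_field_derivative_transform_within_open[of _ _ _ "{0<..}"])
        (use 1 in \<open>auto simp: flat_def\<close>)
  next
    case 2
    have "((\<lambda>t. 0) has_real_derivative 0) (at t)" by simp
    then have "(flat k has_real_derivative 0) (at t)"
      by (rule has_field_derivative_transform_within_open[of _ _ _ "{..<0}"])
        (use 2 in \<open>auto simp: flat_def\<close>)
    with 2 show ?thesis by (simp add: flat_def)
  next
    case 3
    have "((\<lambda>y. (flat k y - flat k 0) / (y - 0)) \<longlongrightarrow> 0) (at 0)"
    proof (rule Lim_null_comparison)
      have "norm ((flat k y - flat k 0) / (y - 0)) \<le> fact (k + 2) * \<bar>y\<bar>" for y
      proof (cases "y = 0")
        case False
        then show ?thesis
          using flat_le[of k y] flat_nonneg[of k y]
          by (auto simp: flat_def[of k 0] field_simps power2_eq_square abs_mult[symmetric] simp del: fact_Suc)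
      qed simp
      then show "\<forall>\<^sub>F y in at 0. norm ((flat k y - flat k 0) / (y - 0)) \<le> fact (k + 2) * \<bar>y\<bar>"
        by simp
      show "((\<lambda>y. fact (k + 2) * \<bar>y\<bar>) \<longlongrightarrow> 0) (at (0::real))"
        by (auto intro!: tendsto_eq_intros)
    qed
    then have "(flat k has_real_derivative 0) (at 0)"
      by (simp add: has_field_derivative_iff)
    with 3 show ?thesis by (simp add: flat_def)
  qed
qed

section \<open>Continuously differentiable functions with explicit gradients\<close>

definition C1 :: "(real^'n::finite \<Rightarrow> real) \<Rightarrow> (real^'n \<Rightarrow> real^'n) \<Rightarrow> bool" where
  "C1 z D \<longleftrightarrow> (\<forall>x. (z has_derivative (\<lambda>h. D x \<bullet> h)) (at x)) \<and> continuous_on UNIV D"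

definition C1c :: "(real^'n::finite \<Rightarrow> real) \<Rightarrow> (real^'n \<Rightarrow> real^'n) \<Rightarrow> bool" where
  "C1c z D \<longleftrightarrow> C1 z D \<and> (\<exists>R. \<forall>x. norm x > R \<longrightarrow> z x = 0)"

definition gr :: "(real^'n::finite \<Rightarrow> real) \<Rightarrow> real^'n \<Rightarrow> real^'n" where
  "gr f x = (\<chi> i. partial i f x)"

lemma partial_eq: "(f has_derivative f') (at x) \<Longrightarrow> partial i f x = f' (axis i 1)"
  unfolding partial_def using frechet_derivative_at by metis

lemma partial_C1: "C1 z D \<Longrightarrow> partial i z x = D x $ i"
  unfolding C1_def by (subst partial_eq[of z "\<lambda>h. D x \<bullet> h"]) (auto simp: inner_axis)

lemma gr_C1: "C1 z D \<Longrightarrow> gr z = D"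
  by (rule ext) (simp add: gr_def partial_C1 vec_eq_iff)

lemma linear_eq_inner_axis:
  fixes l :: "real^'n::finite \<Rightarrow> real"
  assumes "linear l" shows "l h = (\<chi> i. l (axis i 1)) \<bullet> h"
proof -
  have "l h = l (\<Sum>i\<in>UNIV. h $ i *\<^sub>R axis i 1)"
    by (simp add: basis_expansion flip: scalar_mult_eq_scaleR)
  also have "\<dots> = (\<Sum>i\<in>UNIV. h $ i *\<^sub>R l (axis i 1))"
    using assms by (simp add: linear_sum linear_cmul)
  finally show ?thesis by (simp add: inner_vec_def mult.commute)
qed

lemma smooth_on_C1: assumes "smooth_on UNIV f" shows "C1 f (gr f)"
proof -
  have d: "iter_partial is f differentiable_on UNIV" and c: "continuous_on UNIV (iter_partial is f)" for "is"
    using assms by (auto simp: smooth_on_def)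
  have "(f has_derivative frechet_derivative f (at x)) (at x)" for x
    using d[of "[]"] by (auto simp: differentiable_on_def frechet_derivative_works)
  moreover have "frechet_derivative f (at x) = (\<lambda>h. gr f x \<bullet> h)" if "(f has_derivative frechet_derivative f (at x)) (at x)" for x
    unfolding gr_def partial_def by (rule ext, rule linear_eq_inner_axis) (rule has_derivative_linear[OF that])
  moreover have "continuous_on UNIV (\<lambda>x. gr f x)"
    unfolding gr_def by (rule continuous_on_vec_lambda) (use c[of "[_]"] in simp)
  ultimately show ?thesis unfolding C1_def by (metis)
qed

text \<open>Iterated partial derivatives never leave \<open>F\<close>, so smoothness of all orders
  reduces to one differentiation inside \<open>F\<close>. It serves for the mollifier algebra, for
  convolutions and for sums.\<close>

lemma smooth_on_coinduct:
  assumes "f \<in> F" and "\<And>f x. f \<in> F \<Longrightarrow> f differentiable (at x)"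
    and "\<And>f i. f \<in> F \<Longrightarrow> partial i f \<in> F"
  shows "smooth_on UNIV f"
proof -
  have "iter_partial is f \<in> F" for "is" by (induction "is") (auto simp: assms)
  then show ?thesis unfolding smooth_on_def
    by (auto simp: differentiable_on_def assms(2) intro!: differentiable_imp_continuous_on)
qed

text \<open>\<open>iter_partial\<close> applies the head of the list last, whereas smoothness of
  \<open>partial i f\<close> asks for a derivative that is taken first.\<close>

lemma iter_partial_snoc: "iter_partial (is @ [i]) f = iter_partial is (partial i f)"
  by (induction "is") auto

lemma smooth_on_partial: "smooth_on UNIV f \<Longrightarrow> smooth_on UNIV (partial i f)"
  unfolding smooth_on_def by (metis iter_partial_snoc)

lemma smooth_on_differentiable: "smooth_on UNIV f \<Longrightarrow> f differentiable (at x)"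
  using smooth_on_C1 unfolding C1_def differentiable_def by blast

text \<open>An algebra containing the mollifiers and closed under partial derivatives, so that all its members are smooth.\<close>
inductive_set balg :: "(real^'n::finite \<Rightarrow> real) set" where
  const: "(\<lambda>x. c) \<in> balg"
| coord: "(\<lambda>x. x $ i) \<in> balg"
| add: "f \<in> balg \<Longrightarrow> g \<in> balg \<Longrightarrow> (\<lambda>x. f x + g x) \<in> balg"
| mult: "f \<in> balg \<Longrightarrow> g \<in> balg \<Longrightarrow> (\<lambda>x. f x * g x) \<in> balg"
| flat: "f \<in> balg \<Longrightarrow> (\<lambda>x. flat k (f x)) \<in> balg"

lemma balg_has_derivative:
  fixes f :: "real^'n::finite \<Rightarrow> real"
  shows "f \<in> balg \<Longrightarrow> \<exists>D. (\<forall>x. (f has_derivative (\<lambda>h. D x \<bullet> h)) (at x)) \<and> (\<forall>i. (\<lambda>x. D x $ i) \<in> balg)"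
proof (induction rule: balg.induct)
  case (const c)
  show ?case by (rule exI[of _ "\<lambda>x. 0"]) (auto intro: balg.const)
next
  case (coord i)
  have "(\<lambda>x::real^'n. axis i 1 $ j) \<in> (balg :: (real^'n \<Rightarrow> real) set)" for j by (rule balg.const)
  moreover have "((\<lambda>x::real^'n. x $ i) has_derivative (\<lambda>h. axis i 1 \<bullet> h)) (at x)" for x
    by (simp add: inner_axis' bounded_linear_vec_nth bounded_linear_imp_has_derivative)
  ultimately show ?case by (intro exI[of _ "\<lambda>x. axis i 1"]) auto
next
  case (add f g)
  then obtain D E where
    "\<forall>x. (f has_derivative (\<lambda>h. D x \<bullet> h)) (at x)" "\<forall>i. (\<lambda>x. D x $ i) \<in> balg"
    "\<forall>x. (g has_derivative (\<lambda>h. E x \<bullet> h)) (at x)" "\<forall>i. (\<lambda>x. E x $ i) \<in> balg" by blast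
  then show ?case
    by (intro exI[of _ "\<lambda>x. D x + E x"])
      (auto simp: inner_add_left intro!: has_derivative_add balg.add)
next
  case (mult f g)
  then obtain D E where DE:
    "\<forall>x. (f has_derivative (\<lambda>h. D x \<bullet> h)) (at x)" "\<forall>i. (\<lambda>x. D x $ i) \<in> balg"
    "\<forall>x. (g has_derivative (\<lambda>h. E x \<bullet> h)) (at x)" "\<forall>i. (\<lambda>x. E x $ i) \<in> balg" by blast
  have "((\<lambda>x. f x * g x) has_derivative (\<lambda>h. (f x *\<^sub>R E x + g x *\<^sub>R D x) \<bullet> h)) (at x)" for x
    using has_derivative_mult[OF DE(1)[rule_format] DE(3)[rule_format]]
    by (rule has_derivative_eq_rhs) (auto simp: inner_add_left algebra_simps)
  then show ?case
    using mult DE by (intro exI[of _ "\<lambda>x. f x *\<^sub>R E x + g x *\<^sub>R D x"]) (auto intro!: balg.intros)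
next
  case (flat f k)
  then obtain D where D:
    "\<forall>x. (f has_derivative (\<lambda>h. D x \<bullet> h)) (at x)" "\<forall>i. (\<lambda>x. D x $ i) \<in> balg" by blast
  define c where "c x = flat (k + 2) (f x) + (- of_nat k) * flat (k + 1) (f x)" for x
  have cb: "c \<in> balg" unfolding c_def using flat by (intro balg.intros)
  have "((\<lambda>x. flat k (f x)) has_derivative (\<lambda>h. (c x *\<^sub>R D x) \<bullet> h)) (at x)" for x
    using DERIV_compose_FDERIV[OF flat_has_derivative D(1)[rule_format], of k x]
    by (rule has_derivative_eq_rhs) (auto simp: c_def algebra_simps)
  then show ?case
    using cb D by (intro exI[of _ "\<lambda>x. c x *\<^sub>R D x"]) (auto intro!: balg.mult)
qed

lemma balg_smooth: assumes "f \<in> balg" shows "smooth_on UNIV f"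
proof (rule smooth_on_coinduct[OF assms])
  fix f :: "real^'n \<Rightarrow> real" and x i assume f: "f \<in> balg"
  then obtain D where D: "\<forall>x. (f has_derivative (\<lambda>h. D x \<bullet> h)) (at x)" "\<forall>i. (\<lambda>x. D x $ i) \<in> balg"
    using balg_has_derivative by blast
  show "f differentiable (at x)" using D(1) by (auto simp: differentiable_def)
  have "partial i f = (\<lambda>x. D x $ i)"
    by (rule ext) (simp add: partial_eq[OF D(1)[rule_format]] inner_axis)
  then show "partial i f \<in> balg" using D(2) by simp
qed

lemma C1c_imp_C1: "C1c z D \<Longrightarrow> C1 z D" by (simp add: C1c_def)

lemma C1_continuous: assumes "C1 z D" shows "continuous_on UNIV z" "continuous_on UNIV D"
  using assms by (auto simp: C1_def intro!: continuous_at_imp_continuous_on has_derivative_continuous)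

lemma C1_support:
  assumes "C1 z D" "open S" "x \<in> S" "\<And>y. y \<in> S \<Longrightarrow> z y = c" shows "D x = 0"
proof -
  have "((\<lambda>x. c) has_derivative (\<lambda>h. 0)) (at x)" by simp
  then have "(z has_derivative (\<lambda>h. 0)) (at x)"
    by (rule has_derivative_transform_within_open[OF _ assms(2,3)]) (simp add: assms(4))
  moreover have "(z has_derivative (\<lambda>h. D x \<bullet> h)) (at x)" using assms(1) by (simp add: C1_def)
  ultimately have "(\<lambda>h. D x \<bullet> h) = (\<lambda>h. 0)" by (rule has_derivative_unique[symmetric])
  then have "D x \<bullet> D x = 0" by metis
  then show ?thesis by simp
qed

lemma C1_support_norm:
  assumes "C1 z D" "\<And>x. norm x > R \<Longrightarrow> z x = 0" "norm x > R" shows "D x = 0"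
  by (rule C1_support[OF assms(1), of "{x. norm x > R}" _ 0]) (use assms in \<open>auto intro!: open_Collect_less continuous_intros\<close>)

lemma C1c_obtain:
  assumes "C1c z D"
  obtains R where "R > 0" "\<And>x. norm x > R \<Longrightarrow> z x = 0" "\<And>x. norm x > R \<Longrightarrow> D x = 0"
proof -
  from assms obtain R where R: "\<And>x. norm x > R \<Longrightarrow> z x = 0" by (auto simp: C1c_def)
  show thesis
    by (rule that[of "max R 1"]) (use C1_support_norm[OF C1c_imp_C1[OF assms] R] R in auto)
qed

lemma bounded_continuous_support:
  fixes k :: "'a::euclidean_space \<Rightarrow> 'b::real_normed_vector"
  assumes "continuous_on UNIV k" "\<And>x. norm x > R \<Longrightarrow> k x = 0"
  obtains C where "C > 0" "\<And>x. norm (k x) \<le> C"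
proof -
  have "compact (k ` cball 0 R)"
    by (rule compact_continuous_image) (auto intro: continuous_on_subset[OF assms(1)])
  then obtain B where B: "B > 0" "\<forall>y\<in>k ` cball 0 R. norm y \<le> B"
    using bounded_pos compact_imp_bounded by blast
  have "norm (k x) \<le> B" for x
    using B assms(2)[of x] by (cases "norm x > R") auto
  with B that show thesis by blast
qed

lemma uniform_continuous_support:
  fixes k :: "'a::euclidean_space \<Rightarrow> 'b::real_normed_vector"
  assumes "continuous_on UNIV k" "\<And>x. norm x > R \<Longrightarrow> k x = 0" "e > 0"
  obtains d where "d > 0" "\<And>x y. norm (x - y) < d \<Longrightarrow> norm (k x - k y) < e"
proof -
  have "uniformly_continuous_on (cball 0 (R + 1)) k"
    by (rule compact_uniformly_continuous) (auto intro: continuous_on_subset[OF assms(1)])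
  then obtain d where d: "d > 0" "\<And>x y. x \<in> cball 0 (R+1) \<Longrightarrow> y \<in> cball 0 (R+1) \<Longrightarrow> dist y x < d \<Longrightarrow> dist (k y) (k x) < e"
    using assms(3) unfolding uniformly_continuous_on_def by metis
  have "norm (k x - k y) < e" if "norm (x - y) < min d 1" for x y
  proof (cases "norm x > R \<and> norm y > R")
    case True then show ?thesis using assms by simp
  next
    case False
    have "norm x \<le> R + 1" "norm y \<le> R + 1"
      using False that norm_triangle_ineq2[of x y] norm_triangle_ineq3[of x y] by linarith+
    then show ?thesis using d(2)[of y x] that by (auto simp: dist_norm)
  qed
  with d(1) that[of "min d 1"] show thesis by auto
qed

section \<open>Convolution with compactly supported kernels\<close>

lemma continuous_measurable_lebesgue:
  "continuous_on UNIV k \<Longrightarrow> k \<in> borel_measurable lebesgue"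
  by (simp add: borel_measurable_continuous_onI measurable_completion)

definition loc_int :: "(real^'n::finite \<Rightarrow> real) \<Rightarrow> bool" where
  "loc_int u \<longleftrightarrow> u \<in> borel_measurable lebesgue \<and>
     (\<forall>R. integrable lebesgue (\<lambda>x. indicat_real (cball 0 R) x * u x))"

lemma loc_int_mult_integrable:
  assumes u: "loc_int u" and k: "continuous_on UNIV k" "\<And>x. norm x > R \<Longrightarrow> k x = 0"
  shows "integrable lebesgue (\<lambda>x. u x * k x)"
proof -
  obtain C where C: "C > 0" "\<And>x. norm (k x) \<le> C"
    using bounded_continuous_support[OF k] by blast
  have "integrable lebesgue (\<lambda>x. C * (indicat_real (cball 0 R) x * u x))"
    using u by (auto simp: loc_int_def)
  then show ?thesis
  proof (rule Bochner_Integration.integrable_bound)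
    show "(\<lambda>x. u x * k x) \<in> borel_measurable lebesgue"
      using u continuous_measurable_lebesgue[OF k(1)] by (auto simp: loc_int_def)
    have "norm (u x * k x) \<le> norm (C * (indicat_real (cball 0 R) x * u x))" for x
      using C k(2)[of x] by (auto simp: indicator_def abs_mult mult.commute mult_right_mono)
    then show "AE x in lebesgue. norm (u x * k x) \<le> norm (C * (indicat_real (cball 0 R) x * u x))"
      by simp
  qed
qed

text \<open>Convolution, with the kernel as first argument. The translation sits in the kernel, so
  derivatives fall on \<open>k\<close> and \<open>u\<close> need only be locally integrable.\<close>

definition ck :: "(real^'n::finite \<Rightarrow> real) \<Rightarrow> (real^'n \<Rightarrow> real) \<Rightarrow> real^'n \<Rightarrow> real" where
  "ck k u x = (\<integral>y. u y * k (x - y) \<partial>lebesgue)"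

lemma ck_integrable:
  fixes u k :: "real^'n::finite \<Rightarrow> real"
  assumes u: "loc_int u" and k: "continuous_on UNIV k" "\<And>x. norm x > R \<Longrightarrow> k x = 0"
  shows "integrable lebesgue (\<lambda>y. u y * k (x - y))"
proof (rule loc_int_mult_integrable[OF u, where R = "norm x + R"])
  show "continuous_on UNIV (\<lambda>y. k (x - y))"
    by (rule continuous_on_compose2[OF k(1)]) (auto intro!: continuous_intros)
  fix y :: "real^'n" assume "norm x + R < norm y"
  then have "norm (x - y) > R" using norm_triangle_ineq3[of x y] by linarith
  then show "k (x - y) = 0" by (rule k(2))
qed

text \<open>The error bound \<open>e\<close> depends on the oscillation of \<open>D\<close> alone.
  For uniformly continuous \<open>D\<close> it is uniform in the base point, which is what
  differentiation under the integral requires.\<close>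

lemma C1_linearization:
  fixes D :: "real^'n::finite \<Rightarrow> real^'n"
  assumes k: "C1 k D" and d: "\<And>y. norm (y - a) < d \<Longrightarrow> norm (D y - D a) \<le> e" and h: "norm h < d"
  shows "\<bar>k (a + h) - k a - D a \<bullet> h\<bar> \<le> e * norm h"
proof -
  have e: "e \<ge> 0" using d[of a] le_less_trans[OF norm_ge_zero h] by simp
  have "norm (k (a + h) - k a - (\<lambda>h. D a \<bullet> h) (a + h - a)) \<le> norm (a + h - a) * e"
  proof (rule differentiable_bound_linearization[where S = "ball a d" and f' = "\<lambda>x h. D x \<bullet> h"])
    fix t :: real assume t: "t \<in> {0..1}"
    have "norm (t *\<^sub>R h) \<le> 1 * norm h" unfolding norm_scaleR
      by (rule mult_right_mono) (use t in auto)
    then show "a + t *\<^sub>R (a + h - a) \<in> ball a d" using h by (simp add: dist_norm)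
  next
    show "a \<in> ball a d" using le_less_trans[OF norm_ge_zero h] by simp
  next
    fix y assume y: "y \<in> ball a d"
    show "(k has_derivative (\<lambda>h. D y \<bullet> h)) (at y within ball a d)"
      using k by (auto simp: C1_def intro: has_derivative_at_withinI)
  next
    fix y assume y: "y \<in> ball a d"
    show "onorm ((\<lambda>h. D y \<bullet> h) - (\<lambda>h. D a \<bullet> h)) \<le> e"
    proof (rule onorm_bound[OF e])
      fix v
      have "norm (((\<lambda>h. D y \<bullet> h) - (\<lambda>h. D a \<bullet> h)) v) = \<bar>(D y - D a) \<bullet> v\<bar>"
        by (simp add: inner_diff_left)
      also have "\<dots> \<le> norm (D y - D a) * norm v" by (rule Cauchy_Schwarz_ineq2)
      also have "\<dots> \<le> e * norm v"
        by (rule mult_right_mono[OF d]) (use y in \<open>auto simp: dist_norm norm_minus_commute\<close>)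
      finally show "norm (((\<lambda>h. D y \<bullet> h) - (\<lambda>h. D a \<bullet> h)) v) \<le> e * norm v" .
    qed
  qed
  then show ?thesis by (simp add: mult.commute)
qed

text \<open>Differentiation under the integral by direct estimate: the compact support makes
  \<open>D\<close> uniformly continuous, so the kernel's linearization error is at most
  \<open>e' * norm h\<close> everywhere, and it is integrated against the mass of \<open>u\<close>
  on a fixed ball.\<close>

lemma ck_has_derivative:
  fixes u k :: "real^'n::finite \<Rightarrow> real"
  assumes u: "loc_int u" and k: "C1c k D"
  shows "(ck k u has_derivative (\<lambda>h. (\<chi> i. ck (\<lambda>x. D x $ i) u x) \<bullet> h)) (at x)"
proof -
  obtain R where R: "R > 0" "\<And>x. norm x > R \<Longrightarrow> k x = 0" "\<And>x. norm x > R \<Longrightarrow> D x = 0"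
    using C1c_obtain[OF k] by blast
  note kc = C1_continuous[OF C1c_imp_C1[OF k]]
  have Dc: "continuous_on UNIV (\<lambda>x. D x $ i)" for i using kc(2) by (intro continuous_intros) auto
  have iD: "integrable lebesgue (\<lambda>y. u y * D (x - y) $ i)" for i
    using ck_integrable[OF u Dc, of R] R(3) by simp
  have ik: "integrable lebesgue (\<lambda>y. u y * k (x - y))" for x
    by (rule ck_integrable[OF u kc(1) R(2)])
  have eqD: "(\<lambda>y. u y * (D (x - y) \<bullet> h)) = (\<lambda>y. \<Sum>i\<in>UNIV. (u y * D (x - y) $ i) * h $ i)" for h
    by (auto simp: inner_vec_def sum_distrib_left mult.assoc)
  have iDh: "integrable lebesgue (\<lambda>y. u y * (D (x - y) \<bullet> h))" for h
    unfolding eqD using iD by (intro Bochner_Integration.integrable_sum integrable_mult_left) auto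
  have Dh: "(\<chi> i. ck (\<lambda>x. D x $ i) u x) \<bullet> h = (\<integral>y. u y * (D (x - y) \<bullet> h) \<partial>lebesgue)" for h
    unfolding eqD using iD by (subst Bochner_Integration.integral_sum) (auto simp: inner_vec_def ck_def)
  \<comment> \<open>The radius covers every \<open>y\<close> for which \<open>x - y\<close> or
    \<open>x - y + h\<close> can lie in the support of the kernel when
    \<open>norm h < 1\<close>.\<close>
  define B where "B = (\<integral>y. indicat_real (cball 0 (norm x + R + 1)) y * \<bar>u y\<bar> \<partial>lebesgue)"
  have iB: "integrable lebesgue (\<lambda>y. indicat_real (cball 0 (norm x + R + 1)) y * \<bar>u y\<bar>)"
  proof -
    have "integrable lebesgue (\<lambda>y. indicat_real (cball 0 (norm x + R + 1)) y * u y)"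
      using u by (auto simp: loc_int_def)
    from integrable_abs[OF this] show ?thesis by (simp add: abs_mult)
  qed
  have B0: "B \<ge> 0" unfolding B_def by (intro Bochner_Integration.integral_nonneg) auto
  show ?thesis
    unfolding has_derivative_at_alt
  proof (intro conjI allI impI)
    show "bounded_linear (\<lambda>h. (\<chi> i. ck (\<lambda>x. D x $ i) u x) \<bullet> h)"
      by (rule bounded_linear_inner_right)
    fix e :: real assume e: "e > 0"
    define e' where "e' = e / (B + 1)"
    have e': "e' > 0" using e B0 by (simp add: e'_def)
    obtain d where d: "d > 0" "\<And>x y. norm (x - y) < d \<Longrightarrow> norm (D x - D y) < e'"
      using uniform_continuous_support[OF kc(2) R(3) e'] by blast
    have kb: "\<bar>k (a + h) - k a - D a \<bullet> h\<bar> \<le> e' * norm h" if "norm h < d" for a h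
      by (rule C1_linearization[OF C1c_imp_C1[OF k] _ that]) (use d(2) e' in \<open>auto simp: less_imp_le\<close>)
    show "\<exists>d>0. \<forall>y. norm (y - x) < d \<longrightarrow>
        norm (ck k u y - ck k u x - (\<chi> i. ck (\<lambda>x. D x $ i) u x) \<bullet> (y - x)) \<le> e * norm (y - x)"
    proof (intro exI[of _ "min d 1"] conjI allI impI)
      show "0 < min d 1" using d by simp
      fix y assume y: "norm (y - x) < min d 1"
      define h where "h = y - x"
      let ?F = "\<lambda>z. u z * (k (x - z + h) - k (x - z) - D (x - z) \<bullet> h)"
      have "ck k u y - ck k u x - (\<chi> i. ck (\<lambda>x. D x $ i) u x) \<bullet> h = (\<integral>z. ?F z \<partial>lebesgue)"
      proof -
        have "(\<lambda>z. u z * k (y - z)) = (\<lambda>z. u z * k (x - z + h))" by (simp add: h_def algebra_simps)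
        then show ?thesis
          unfolding Dh unfolding ck_def using ik[of y] ik[of x] iDh[of h]
          by (simp add: right_diff_distrib)
      qed
      also have "\<bar>\<dots>\<bar> \<le> (\<integral>z. (indicat_real (cball 0 (norm x + R + 1)) z * \<bar>u z\<bar>) * (e' * norm h) \<partial>lebesgue)"
      proof (rule integral_abs_bound_integral)
        show "integrable lebesgue ?F"
        proof -
          have "(\<lambda>z. u z * k (y - z)) = (\<lambda>z. u z * k (x - z + h))" by (simp add: h_def algebra_simps)
          then show ?thesis using ik[of y] ik[of x] iDh[of h] by (simp add: right_diff_distrib)
        qed
        show "integrable lebesgue (\<lambda>z. (indicat_real (cball 0 (norm x + R + 1)) z * \<bar>u z\<bar>) * (e' * norm h))"
          using iB by (rule integrable_mult_left)
        fix z
        show "\<bar>?F z\<bar> \<le> (indicat_real (cball 0 (norm x + R + 1)) z * \<bar>u z\<bar>) * (e' * norm h)"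
        proof (cases "norm z \<le> norm x + R + 1")
          case True
          have "\<bar>u z\<bar> * \<bar>k (x - z + h) - k (x - z) - D (x - z) \<bullet> h\<bar> \<le> \<bar>u z\<bar> * (e' * norm h)"
            by (rule mult_left_mono[OF kb]) (use y in \<open>auto simp: h_def\<close>)
          then show ?thesis using True by (simp add: abs_mult)
        next
          case False
          then have "norm (x - z) > R" "norm (x - z + h) > R"
            using norm_triangle_ineq3[of x z] norm_diff_ineq[of "x - z" h] y by (auto simp: h_def)
          then show ?thesis using False R by simp
        qed
      qed
      also have "\<dots> = B * (e' * norm h)" by (simp add: B_def)
      also have "\<dots> \<le> e * norm h"
      proof -
        have "B * e' \<le> e" using e B0 by (simp add: e'_def field_simps)
        then show ?thesis by (metis mult.assoc mult_right_mono norm_ge_zero)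
      qed
      finally show "norm (ck k u y - ck k u x - (\<chi> i. ck (\<lambda>x. D x $ i) u x) \<bullet> (y - x)) \<le> e * norm (y - x)"
        by (simp add: h_def)
    qed
  qed
qed

lemma ck_partial:
  fixes u k :: "real^'n::finite \<Rightarrow> real"
  assumes u: "loc_int u" and k: "C1c k D"
  shows "partial i (ck k u) x = ck (\<lambda>x. D x $ i) u x"
  by (subst partial_eq[OF ck_has_derivative[OF assms]]) (simp add: inner_axis)

text \<open>Coinduction over the convolutions of \<open>u\<close> with smooth kernels of one common
  support radius: a partial derivative only exchanges the kernel.\<close>

lemma ck_smooth:
  fixes u k :: "real^'n::finite \<Rightarrow> real"
  assumes u: "loc_int u" and k: "smooth_on UNIV k" "\<And>x. norm x > R \<Longrightarrow> k x = 0"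
  shows "smooth_on UNIV (ck k u)"
proof (rule smooth_on_coinduct[where F = "{ck k u |k. smooth_on UNIV k \<and> (\<forall>x. norm x > R \<longrightarrow> k x = 0)}"])
  show "ck k u \<in> {ck k u |k. smooth_on UNIV k \<and> (\<forall>x. norm x > R \<longrightarrow> k x = 0)}" using k by auto
  fix f x i assume "f \<in> {ck k u |k. smooth_on UNIV k \<and> (\<forall>x. norm x > R \<longrightarrow> k x = 0)}"
  then obtain k where f: "f = ck k u" and k: "smooth_on UNIV k" "\<forall>x. norm x > R \<longrightarrow> k x = 0" by auto
  have C: "C1c k (gr k)" using smooth_on_C1[OF k(1)] k(2) by (auto simp: C1c_def)
  show "f differentiable (at x)" unfolding f using ck_has_derivative[OF u C] by (auto simp: differentiable_def)
  have "partial i f = ck (partial i k) u" unfolding f by (rule ext) (simp add: ck_partial[OF u C] gr_def)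
  moreover have "partial i k x = 0" if "norm x > R" for x
    using C1_support_norm[OF C1c_imp_C1[OF C], of R x] k(2) that by (simp add: gr_def vec_eq_iff)
  ultimately show "partial i f \<in> {ck k u |k. smooth_on UNIV k \<and> (\<forall>x. norm x > R \<longrightarrow> k x = 0)}"
    using smooth_on_partial[OF k(1)] by auto
qed

section \<open>Translations and reflections of Lebesgue measure\<close>

lemma lebesgue_distr_affine:
  fixes t :: "real^'n::finite"
  assumes "\<bar>s\<bar> = 1"
  shows "distr lebesgue lebesgue (\<lambda>x. t + s *\<^sub>R x) = lebesgue"
proof -
  have e: "(\<lambda>x. t + (\<Sum>j\<in>Basis. (s * (x \<bullet> j)) *\<^sub>R j)) = (\<lambda>x. t + s *\<^sub>R x)"
    unfolding scaleR_scaleR[symmetric] scaleR_sum_right[symmetric] by (simp add: euclidean_representation)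
  have "lebesgue = density (distr lebesgue lebesgue (\<lambda>x. t + s *\<^sub>R x)) (\<lambda>_. \<Prod>j\<in>(Basis::(real^'n) set). ennreal \<bar>s\<bar>)"
    using lebesgue_affine_euclidean[of "\<lambda>_. s" t] assms unfolding e by (auto simp: prod_ennreal)
  also have "\<dots> = distr lebesgue lebesgue (\<lambda>x. t + s *\<^sub>R x)" using assms by (simp add: density_1)
  finally show ?thesis by simp
qed

lemma affine_measurable_lebesgue:
  "\<bar>s\<bar> = 1 \<Longrightarrow> (\<lambda>x::real^'n::finite. t + s *\<^sub>R x) \<in> lebesgue \<rightarrow>\<^sub>M lebesgue"
  using lebesgue_affine_measurable[of "\<lambda>_. s" t]
  unfolding scaleR_scaleR[symmetric] scaleR_sum_right[symmetric] by (auto simp: euclidean_representation)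

lemma lebesgue_shift:
  fixes f :: "real^'n::finite \<Rightarrow> real" and t :: "real^'n"
  assumes "f \<in> borel_measurable lebesgue"
  shows "(\<lambda>x. f (x + t)) \<in> borel_measurable lebesgue" "(\<lambda>x. f (t - x)) \<in> borel_measurable lebesgue"
    "integrable lebesgue f \<longleftrightarrow> integrable lebesgue (\<lambda>x. f (x + t))"
    "integrable lebesgue f \<longleftrightarrow> integrable lebesgue (\<lambda>x. f (t - x))"
    "(\<integral>x. f (x + t) \<partial>lebesgue) = (\<integral>x. f x \<partial>lebesgue)"
    "(\<integral>x. f (t - x) \<partial>lebesgue) = (\<integral>x. f x \<partial>lebesgue)"
proof -
  have *: "(\<lambda>x. f (t + s *\<^sub>R x)) \<in> borel_measurable lebesgue \<and>
     (integrable lebesgue f \<longleftrightarrow> integrable lebesgue (\<lambda>x. f (t + s *\<^sub>R x))) \<and>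
     (\<integral>x. f (t + s *\<^sub>R x) \<partial>lebesgue) = (\<integral>x. f x \<partial>lebesgue)" if "\<bar>s\<bar> = 1" for s :: real
    using measurable_compose[OF affine_measurable_lebesgue[OF that] assms]
      integrable_distr_eq[OF affine_measurable_lebesgue[OF that] assms, of t]
      integral_distr[OF affine_measurable_lebesgue[OF that] assms, of t]
    by (simp add: lebesgue_distr_affine[OF that])
  from *[of 1] *[of "-1"] show
    "(\<lambda>x. f (x + t)) \<in> borel_measurable lebesgue" "(\<lambda>x. f (t - x)) \<in> borel_measurable lebesgue"
    "integrable lebesgue f \<longleftrightarrow> integrable lebesgue (\<lambda>x. f (x + t))"
    "integrable lebesgue f \<longleftrightarrow> integrable lebesgue (\<lambda>x. f (t - x))"
    "(\<integral>x. f (x + t) \<partial>lebesgue) = (\<integral>x. f x \<partial>lebesgue)"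
    "(\<integral>x. f (t - x) \<partial>lebesgue) = (\<integral>x. f x \<partial>lebesgue)"
    by (simp_all add: add.commute)
qed

lemma AE_lebesgue_shift:
  fixes t :: "real^'n::finite"
  assumes "AE x in lebesgue. P x" shows "AE x in lebesgue. P (x + t)" "AE x in lebesgue. P (t - x)"
proof -
  have "AE x in lebesgue. P (t + s *\<^sub>R x)" if "\<bar>s\<bar> = 1" for s :: real
  proof (rule AE_distrD[OF affine_measurable_lebesgue[OF that]])
    show "AE x in distr lebesgue lebesgue (\<lambda>x. t + s *\<^sub>R x). P x"
      unfolding lebesgue_distr_affine[OF that] by (rule assms)
  qed
  from this[of 1] this[of "-1"] show "AE x in lebesgue. P (x + t)" "AE x in lebesgue. P (t - x)"
    by (simp_all add: add.commute)
qed

lemma indicator_cball_integrable [simp]: "integrable lebesgue (\<lambda>x. indicat_real (cball a R) (x::real^'n::finite))"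
  by (rule integrable_real_indicator) (auto intro: emeasure_bounded_finite[unfolded infinity_ennreal_def])

lemma loc_int_1: "loc_int (\<lambda>x::real^'n::finite. 1)"
  by (auto simp: loc_int_def)

text \<open>Differentiate the constant convolution \<open>k * 1\<close>.\<close>
lemma integral_C1c_partial:
  assumes "C1c k D" shows "(\<integral>x. D x $ i \<partial>lebesgue) = 0"
proof -
  have Dm: "(\<lambda>x. D x $ i) \<in> borel_measurable lebesgue"
    using C1_continuous[OF C1c_imp_C1[OF assms]]
    by (intro continuous_measurable_lebesgue continuous_intros) auto
  have km: "k \<in> borel_measurable lebesgue"
    using C1_continuous[OF C1c_imp_C1[OF assms]] by (intro continuous_measurable_lebesgue)
  have "ck k (\<lambda>x. 1) = (\<lambda>x. \<integral>y. k y \<partial>lebesgue)"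
    by (rule ext) (simp add: ck_def lebesgue_shift[OF km])
  then have "partial i (ck k (\<lambda>x. 1)) 0 = 0"
    by (simp add: partial_eq[of _ "\<lambda>h. 0"])
  then show ?thesis
    using ck_partial[OF loc_int_1 assms, of i 0] lebesgue_shift(6)[OF Dm, of 0] by (simp add: ck_def)
qed

section \<open>Mollifiers\<close>

definition bump :: "real \<Rightarrow> real^'n::finite \<Rightarrow> real" where
  "bump e x = flat 0 (e\<^sup>2 - x \<bullet> x)"

definition rho :: "real \<Rightarrow> real^'n::finite \<Rightarrow> real" where
  "rho e x = bump e x / (\<integral>x. bump e (x::real^'n) \<partial>lebesgue)"

lemma bump_balg: "bump e \<in> balg"
proof -
  have s: "finite A \<Longrightarrow> (\<lambda>x. \<Sum>i\<in>A. x $ i * x $ i) \<in> (balg :: (real^'n::finite \<Rightarrow> real) set)" for A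
    by (induction A rule: finite_induct) (auto intro!: balg.intros)
  have "bump e = (\<lambda>x. flat 0 (e\<^sup>2 + (-1) * (\<Sum>i\<in>UNIV. x $ i * x $ i)))"
    by (auto simp: bump_def inner_vec_def)
  also have "\<dots> \<in> (balg :: (real^'n::finite \<Rightarrow> real) set)"
    by (intro balg.flat balg.add balg.const balg.mult s) auto
  finally show ?thesis .
qed

lemma bump_smooth: "smooth_on UNIV (bump e)"
  by (rule balg_smooth[OF bump_balg])

lemma rho_balg: "rho e \<in> balg"
proof -
  have "rho e = (\<lambda>x::real^'n. bump e x * (1 / (\<integral>x. bump e (x::real^'n) \<partial>lebesgue)))"
    by (auto simp: rho_def)
  also have "\<dots> \<in> balg" by (intro balg.mult balg.const bump_balg)
  finally show ?thesis .
qed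

lemma rho_smooth: "smooth_on UNIV (rho e)"
  by (rule balg_smooth[OF rho_balg])

text \<open>Together with the evenness of \<open>rho e\<close> this makes
  \<open>\<lambda>y. rho e (x - y)\<close> smooth, hence a test function.\<close>

lemma balg_shift: "f \<in> balg \<Longrightarrow> (\<lambda>y. f (y - t)) \<in> balg"
proof (induction rule: balg.induct)
  case (coord i)
  have "(\<lambda>y. y $ i + (- (t $ i))) \<in> balg" by (intro balg.intros)
  then show ?case by simp
qed (auto intro: balg.intros)

lemma rho_reflect: "rho e (x - y) = rho e (y - x)"
  by (simp add: rho_def bump_def inner_diff_left inner_diff_right algebra_simps inner_commute)

lemma bump_nonneg: "bump e x \<ge> 0"
  by (simp add: bump_def flat_nonneg)

lemma bump_eq_0: assumes "e > 0" "norm x \<ge> e" shows "bump e x = 0"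
proof -
  have "e\<^sup>2 \<le> (norm x)\<^sup>2" using assms by (intro power_mono) auto
  then show ?thesis by (simp add: bump_def flat_def dot_square_norm)
qed

lemma bump_pos: assumes "norm x < e" shows "bump e x > 0"
proof -
  have "(norm x)\<^sup>2 < e\<^sup>2" using assms by (intro power_strict_mono) auto
  then show ?thesis by (simp add: bump_def flat_pos dot_square_norm)
qed

lemma bump_integrable:
  assumes "e > 0" shows "integrable lebesgue (bump e :: real^'n::finite \<Rightarrow> real)"
proof -
  have "integrable lebesgue (\<lambda>x::real^'n. 1 * bump e x)"
    by (rule loc_int_mult_integrable[OF loc_int_1 C1_continuous(1)[OF smooth_on_C1[OF bump_smooth]], of e])
      (use assms in \<open>simp add: bump_eq_0\<close>)
  then show ?thesis by simp
qed

lemma bump_integral_pos: assumes "e > 0" shows "(\<integral>x. bump e (x::real^'n::finite) \<partial>lebesgue) > 0"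
proof -
  have "(\<integral>x. bump e (x::real^'n) \<partial>lebesgue) \<noteq> 0"
  proof
    assume "(\<integral>x. bump e (x::real^'n) \<partial>lebesgue) = 0"
    then have "AE x in lebesgue. bump e (x::real^'n) = 0"
      using integral_nonneg_eq_0_iff_AE[OF bump_integrable[OF assms, where 'n='n]] by (simp add: bump_nonneg)
    then have "AE x in lebesgue. (x::real^'n) \<notin> ball 0 e"
      by eventually_elim (use bump_pos in fastforce)
    then have "ball (0::real^'n) e \<in> null_sets lebesgue"
      by (subst (asm) AE_iff_null_sets[symmetric]) auto
    then have "negligible (ball (0::real^'n) e)" by (simp add: negligible_iff_null_sets)
    then show False using assms by (metis open_not_negligible open_ball ball_eq_empty not_le)
  qed
  moreover have "(\<integral>x. bump e (x::real^'n) \<partial>lebesgue) \<ge> 0"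
    by (intro Bochner_Integration.integral_nonneg) (simp add: bump_nonneg)
  ultimately show ?thesis by simp
qed

lemma rho_nonneg: "e > 0 \<Longrightarrow> rho e x \<ge> 0"
  unfolding rho_def by (intro divide_nonneg_pos bump_nonneg bump_integral_pos)

lemma rho_eq_0: "e > 0 \<Longrightarrow> norm x \<ge> e \<Longrightarrow> rho e x = 0"
  by (simp add: rho_def bump_eq_0)

lemma rho_integrable: "e > 0 \<Longrightarrow> integrable lebesgue (rho e :: real^'n::finite \<Rightarrow> real)"
  unfolding rho_def using bump_integrable by (intro integrable_divide)

lemma rho_integral: "e > 0 \<Longrightarrow> (\<integral>x. rho e (x::real^'n::finite) \<partial>lebesgue) = 1"
  using bump_integral_pos[of e, where 'n='n] unfolding rho_def by (subst integral_divide_zero) auto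

lemma rho_C1c: assumes "e > 0" shows "C1c (rho e :: real^'n::finite \<Rightarrow> real) (gr (rho e))"
  unfolding C1c_def
proof (intro conjI exI allI impI)
  show "C1 (rho e :: real^'n \<Rightarrow> real) (gr (rho e))" by (rule smooth_on_C1[OF rho_smooth])
  show "norm x > e \<Longrightarrow> rho e x = 0" for x :: "real^'n" using rho_eq_0[OF assms, of x] by simp
qed

lemma rho_continuous: "continuous_on UNIV (rho e)"
  using C1_continuous(1)[OF smooth_on_C1[OF rho_smooth]] .

abbreviation conv :: "real \<Rightarrow> (real^'n::finite \<Rightarrow> real) \<Rightarrow> real^'n \<Rightarrow> real" where
  "conv e \<equiv> ck (rho e)"

lemma conv_smooth: "e > 0 \<Longrightarrow> loc_int u \<Longrightarrow> smooth_on UNIV (conv e u)"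
  by (rule ck_smooth[OF _ rho_smooth, of _ e]) (auto simp: rho_eq_0)

section \<open>Square integrable functions\<close>

text \<open>The squared norm is used throughout, so the parallelogram law needs no roots. The price
  is the factor \<open>2\<close> in \<open>n2_triangle\<close>.\<close>

definition n2 :: "(real^3 \<Rightarrow> real) \<Rightarrow> real" where
  "n2 u = (\<integral>x. (u x)\<^sup>2 \<partial>lebesgue)"

lemma n2_nonneg [simp]: "n2 u \<ge> 0"
  by (simp add: n2_def)

lemma L2_meas: "L2 u \<Longrightarrow> u \<in> borel_measurable lebesgue"
  and L2_int: "L2 u \<Longrightarrow> integrable lebesgue (\<lambda>x. (u x)\<^sup>2)"
  by (auto simp: L2_def)

lemma L2_mult_integrable:
  assumes "L2 u" "L2 v" shows "integrable lebesgue (\<lambda>x. u x * v x)"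
proof (rule Bochner_Integration.integrable_bound)
  show "integrable lebesgue (\<lambda>x. (u x)\<^sup>2 + (v x)\<^sup>2)" using assms by (auto simp: L2_def)
  show "(\<lambda>x. u x * v x) \<in> borel_measurable lebesgue" using assms by (auto simp: L2_def)
  have "\<bar>a * b\<bar> \<le> a\<^sup>2 + b\<^sup>2" for a b :: real
  proof -
    have "2 * (\<bar>a\<bar> * \<bar>b\<bar>) \<le> a\<^sup>2 + b\<^sup>2" using sum_squares_bound[of "\<bar>a\<bar>" "\<bar>b\<bar>"] by simp
    moreover have "0 \<le> \<bar>a\<bar> * \<bar>b\<bar>" by simp
    ultimately show ?thesis unfolding abs_mult by linarith
  qed
  then show "AE x in lebesgue. norm (u x * v x) \<le> norm ((u x)\<^sup>2 + (v x)\<^sup>2)" by simp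
qed

lemma L2_bound:
  assumes "L2 u" "v \<in> borel_measurable lebesgue" "AE x in lebesgue. \<bar>v x\<bar> \<le> C * \<bar>u x\<bar>"
  shows "L2 v"
  unfolding L2_def
proof (intro conjI assms(2))
  show "integrable lebesgue (\<lambda>x. (v x)\<^sup>2)"
  proof (rule Bochner_Integration.integrable_bound)
    show "integrable lebesgue (\<lambda>x. C\<^sup>2 * (u x)\<^sup>2)" using assms by (auto simp: L2_def)
    show "(\<lambda>x. (v x)\<^sup>2) \<in> borel_measurable lebesgue" using assms by auto
    show "AE x in lebesgue. norm ((v x)\<^sup>2) \<le> norm (C\<^sup>2 * (u x)\<^sup>2)"
      using assms(3)
    proof eventually_elim
      case (elim x)
      have "\<bar>v x\<bar>\<^sup>2 \<le> (C * \<bar>u x\<bar>)\<^sup>2" by (rule power_mono[OF elim]) simp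
      then show ?case by (simp add: power_mult_distrib)
    qed
  qed
qed

lemma L2_add: assumes "L2 u" "L2 v" shows "L2 (\<lambda>x. u x + v x)"
proof -
  have "(\<lambda>x. (u x + v x)\<^sup>2) = (\<lambda>x. (u x)\<^sup>2 + (v x)\<^sup>2 + 2 * (u x * v x))"
    by (auto simp: power2_eq_square algebra_simps)
  then show ?thesis using assms L2_mult_integrable[OF assms] by (auto simp: L2_def)
qed

lemma L2_cmult: "L2 u \<Longrightarrow> L2 (\<lambda>x. c * u x)"
  by (auto simp: L2_def power_mult_distrib)

lemma L2_diff: assumes "L2 u" "L2 v" shows "L2 (\<lambda>x. u x - v x)"
  using L2_add[OF assms(1) L2_cmult[OF assms(2), of "-1"]] by simp

lemma L2_0 [simp]: "L2 (\<lambda>x. 0)" by (simp add: L2_def)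

lemma L2_bdd_mult:
  assumes "L2 u" "b \<in> borel_measurable lebesgue" "\<And>x. \<bar>b x\<bar> \<le> C"
  shows "L2 (\<lambda>x. b x * u x)"
  by (rule L2_bound[OF assms(1), of _ C])
    (use assms in \<open>auto simp: L2_def abs_mult intro!: mult_right_mono\<close>)

lemma n2_cmult: "n2 (\<lambda>x. c * u x) = c\<^sup>2 * n2 u"
  by (simp add: n2_def power_mult_distrib)

lemma n2_commute: "n2 (\<lambda>x. u x - v x) = n2 (\<lambda>x. v x - u x)"
  by (simp add: n2_def power2_commute)

lemma n2_expand:
  assumes "L2 u" "L2 v"
  shows "n2 (\<lambda>x. u x + v x) = n2 u + n2 v + 2 * (\<integral>x. u x * v x \<partial>lebesgue)"
    and "n2 (\<lambda>x. u x - v x) = n2 u + n2 v - 2 * (\<integral>x. u x * v x \<partial>lebesgue)"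
proof -
  have "(\<lambda>x. (u x + v x)\<^sup>2) = (\<lambda>x. (u x)\<^sup>2 + (v x)\<^sup>2 + 2 * (u x * v x))"
    "(\<lambda>x. (u x - v x)\<^sup>2) = (\<lambda>x. (u x)\<^sup>2 + (v x)\<^sup>2 - 2 * (u x * v x))"
    by (auto simp: power2_eq_square algebra_simps)
  then show "n2 (\<lambda>x. u x + v x) = n2 u + n2 v + 2 * (\<integral>x. u x * v x \<partial>lebesgue)"
    "n2 (\<lambda>x. u x - v x) = n2 u + n2 v - 2 * (\<integral>x. u x * v x \<partial>lebesgue)"
    using assms L2_mult_integrable[OF assms] by (auto simp: n2_def L2_def)
qed

lemma n2_parallelogram:
  assumes "L2 u" "L2 v"
  shows "n2 (\<lambda>x. u x + v x) + n2 (\<lambda>x. u x - v x) = 2 * n2 u + 2 * n2 v"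
  using n2_expand[OF assms] by simp

lemma n2_add_le: "L2 u \<Longrightarrow> L2 v \<Longrightarrow> n2 (\<lambda>x. u x + v x) \<le> 2 * n2 u + 2 * n2 v"
  using n2_parallelogram[of u v] n2_nonneg[of "\<lambda>x. u x - v x"] by linarith

lemma n2_diff_le: "L2 u \<Longrightarrow> L2 v \<Longrightarrow> n2 (\<lambda>x. u x - v x) \<le> 2 * n2 u + 2 * n2 v"
  using n2_parallelogram[of u v] n2_nonneg[of "\<lambda>x. u x + v x"] by linarith

lemma n2_triangle:
  assumes "L2 u" "L2 v" "L2 w"
  shows "n2 (\<lambda>x. u x - w x) \<le> 2 * n2 (\<lambda>x. u x - v x) + 2 * n2 (\<lambda>x. v x - w x)"
  using n2_add_le[OF L2_diff[OF assms(1,2)] L2_diff[OF assms(2,3)]] by simp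

lemma n2_mono:
  assumes "L2 u" "v \<in> borel_measurable lebesgue" "AE x in lebesgue. \<bar>v x\<bar> \<le> \<bar>u x\<bar>"
  shows "n2 v \<le> n2 u"
proof -
  have "L2 v" by (rule L2_bound[OF assms(1,2), of 1]) (use assms(3) in simp)
  then show ?thesis unfolding n2_def
    by (intro integral_mono_AE) (use assms in \<open>auto simp: L2_def abs_le_square_iff\<close>)
qed

lemma n2_eq_0: "L2 u \<Longrightarrow> n2 u = 0 \<longleftrightarrow> (AE x in lebesgue. u x = 0)"
  unfolding n2_def by (subst integral_nonneg_eq_0_iff_AE) (auto simp: L2_def)

lemma L2_cong_AE:
  assumes "L2 u" "v \<in> borel_measurable lebesgue" "AE x in lebesgue. v x = u x" shows "L2 v"
  by (rule L2_bound[OF assms(1,2), of 1]) (use assms(3) in auto)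

lemma n2_cong_AE:
  assumes "u \<in> borel_measurable lebesgue" "v \<in> borel_measurable lebesgue" "AE x in lebesgue. u x = v x"
  shows "n2 u = n2 v"
  unfolding n2_def by (rule integral_cong_AE) (use assms in auto)

lemma L2_Cauchy_Schwarz:
  assumes "L2 u" "L2 v"
  shows "(\<integral>x. u x * v x \<partial>lebesgue)\<^sup>2 \<le> n2 u * n2 v"
proof -
  define I where "I = (\<integral>x. u x * v x \<partial>lebesgue)"
  have q: "n2 u + t\<^sup>2 * n2 v + 2 * t * I \<ge> 0" for t
    using n2_expand(1)[OF assms(1) L2_cmult[OF assms(2), of t]] n2_nonneg[of "\<lambda>x. u x + t * v x"]
    by (simp add: n2_cmult I_def mult.left_commute[of _ t])
  show ?thesis
  proof (cases "n2 v = 0")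
    case True
    have "I = 0"
    proof (rule ccontr)
      assume "I \<noteq> 0"
      then have "2 * (- (n2 u + 1) / (2 * I)) * I = - (n2 u + 1)" by simp
      then show False using q[of "- (n2 u + 1) / (2 * I)"] unfolding True by linarith
    qed
    then show ?thesis by (simp add: I_def)
  next
    case False
    then have v: "n2 v > 0" using n2_nonneg[of v] by linarith
    have "n2 u + (I / n2 v)\<^sup>2 * n2 v - 2 * (I / n2 v) * I \<ge> 0" using q[of "- (I / n2 v)"] by simp
    then have "n2 u * n2 v \<ge> I\<^sup>2" using v by (simp add: power2_eq_square field_simps)
    then show ?thesis by (simp add: I_def)
  qed
qed

section \<open>Mean square convergence\<close>

definition L2lim :: "(nat \<Rightarrow> real^3 \<Rightarrow> real) \<Rightarrow> (real^3 \<Rightarrow> real) \<Rightarrow> bool" where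
  "L2lim us u \<longleftrightarrow> (\<forall>n. L2 (us n)) \<and> L2 u \<and> (\<lambda>n. n2 (\<lambda>x. us n x - u x)) \<longlonglongrightarrow> 0"

lemma L2limD: assumes "L2lim us u" shows "L2 (us n)" "L2 u" "(\<lambda>n. n2 (\<lambda>x. us n x - u x)) \<longlonglongrightarrow> 0"
  using assms by (auto simp: L2lim_def)

lemma L2lim_bound:
  assumes "\<And>n. L2 (us n)" "L2 u" "\<And>n. n2 (\<lambda>x. us n x - u x) \<le> c n" "c \<longlonglongrightarrow> 0"
  shows "L2lim us u"
  unfolding L2lim_def using assms
  by (auto intro: tendsto_sandwich[of "\<lambda>_. 0" _ _ c])

lemma L2lim_const: "L2 u \<Longrightarrow> L2lim (\<lambda>n. u) u"
  by (simp add: L2lim_def n2_def)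

lemma L2lim_subseq: "L2lim us u \<Longrightarrow> strict_mono r \<Longrightarrow> L2lim (\<lambda>n. us (r n)) u"
  unfolding L2lim_def using LIMSEQ_subseq_LIMSEQ[of "\<lambda>n. n2 (\<lambda>x. us n x - u x)" 0 r]
  by (auto simp: o_def)

lemma L2lim_add:
  assumes "L2lim us u" "L2lim vs v"
  shows "L2lim (\<lambda>n x. us n x + vs n x) (\<lambda>x. u x + v x)"
proof (rule L2lim_bound)
  note D = L2limD[OF assms(1)] L2limD[OF assms(2)]
  show "L2 (\<lambda>x. us n x + vs n x)" for n by (intro L2_add D)
  show "L2 (\<lambda>x. u x + v x)" by (intro L2_add D)
  show "n2 (\<lambda>x. us n x + vs n x - (u x + v x)) \<le> 2 * n2 (\<lambda>x. us n x - u x) + 2 * n2 (\<lambda>x. vs n x - v x)" for n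
  proof -
    have "(\<lambda>x. us n x + vs n x - (u x + v x)) = (\<lambda>x. (us n x - u x) + (vs n x - v x))" by auto
    then show ?thesis using n2_add_le[OF L2_diff[OF D(1)[of n] D(2)] L2_diff[OF D(4)[of n] D(5)]] by simp
  qed
  show "(\<lambda>n. 2 * n2 (\<lambda>x. us n x - u x) + 2 * n2 (\<lambda>x. vs n x - v x)) \<longlonglongrightarrow> 0"
    by (auto intro!: tendsto_eq_intros D)
qed

lemma L2lim_cmult: assumes "L2lim us u" shows "L2lim (\<lambda>n x. c * us n x) (\<lambda>x. c * u x)"
proof (rule L2lim_bound)
  note D = L2limD[OF assms]
  show "L2 (\<lambda>x. c * us n x)" "L2 (\<lambda>x. c * u x)" for n by (intro L2_cmult D)+
  show "n2 (\<lambda>x. c * us n x - c * u x) \<le> c\<^sup>2 * n2 (\<lambda>x. us n x - u x)" for n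
    by (simp add: n2_cmult flip: right_diff_distrib)
  show "(\<lambda>n. c\<^sup>2 * n2 (\<lambda>x. us n x - u x)) \<longlonglongrightarrow> 0"
    by (auto intro!: tendsto_eq_intros D)
qed

lemma L2lim_diff:
  assumes "L2lim us u" "L2lim vs v"
  shows "L2lim (\<lambda>n x. us n x - vs n x) (\<lambda>x. u x - v x)"
  using L2lim_add[OF assms(1) L2lim_cmult[OF assms(2), of "-1"]] by simp

lemma L2lim_norm:
  assumes "L2lim us u" shows "(\<lambda>n. n2 (us n)) \<longlonglongrightarrow> n2 u"
proof -
  note D = L2limD[OF assms]
  define d where "d n = n2 (\<lambda>x. us n x - u x)" for n
  define I where "I n = (\<integral>x. u x * (us n x - u x) \<partial>lebesgue)" for n
  have eq: "n2 (us n) = n2 u + d n + 2 * I n" for n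
    using n2_expand(1)[OF D(2) L2_diff[OF D(1)[of n] D(2)]] by (simp add: d_def I_def)
  have "(\<lambda>n. (I n)\<^sup>2) \<longlonglongrightarrow> 0"
  proof (rule tendsto_sandwich[of "\<lambda>_. 0" _ _ "\<lambda>n. n2 u * d n"])
    show "\<forall>\<^sub>F n in sequentially. (I n)\<^sup>2 \<le> n2 u * d n"
      using L2_Cauchy_Schwarz[OF D(2) L2_diff[OF D(1) D(2)]] by (simp add: d_def I_def)
    show "(\<lambda>n. n2 u * d n) \<longlonglongrightarrow> 0" using D(3) by (auto intro!: tendsto_eq_intros simp: d_def)
  qed auto
  then have "I \<longlonglongrightarrow> 0" by simp
  then show ?thesis unfolding eq using D(3) by (auto intro!: tendsto_eq_intros simp: d_def[symmetric])
qed

text \<open>Polarization: the inner product is a combination of squared norms, each of which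
  converges by \<open>L2lim_norm\<close>.\<close>

lemma L2lim_inner:
  assumes "L2lim us u" "L2lim vs v"
  shows "(\<lambda>n. \<integral>x. us n x * vs n x \<partial>lebesgue) \<longlonglongrightarrow> (\<integral>x. u x * v x \<partial>lebesgue)"
proof -
  note D = L2limD[OF assms(1)] L2limD[OF assms(2)]
  have e: "(\<integral>x. us n x * vs n x \<partial>lebesgue) = (n2 (\<lambda>x. us n x + vs n x) - n2 (us n) - n2 (vs n)) / 2" for n
    using n2_expand(1)[OF D(1)[of n] D(4)[of n]] by simp
  have e': "(\<integral>x. u x * v x \<partial>lebesgue) = (n2 (\<lambda>x. u x + v x) - n2 u - n2 v) / 2"
    using n2_expand(1)[OF D(2) D(5)] by simp
  show ?thesis unfolding e e'
    by (auto intro!: tendsto_intros L2lim_norm assms L2lim_add)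
qed

lemma L2lim_AE_subseq:
  assumes "L2lim us u"
  obtains r where "strict_mono r" "AE x in lebesgue. (\<lambda>n. us (r n) x) \<longlonglongrightarrow> u x"
proof -
  note D = L2limD[OF assms]
  have "\<exists>r. strict_mono r \<and> (AE x in lebesgue. (\<lambda>n. (us (r n) x - u x)\<^sup>2) \<longlonglongrightarrow> 0)"
    by (rule tendsto_L1_AE_subseq) (use D L2_diff[OF D(1) D(2)] in \<open>auto simp: n2_def L2_def\<close>)
  then obtain r where r: "strict_mono r" "AE x in lebesgue. (\<lambda>n. (us (r n) x - u x)\<^sup>2) \<longlonglongrightarrow> 0" by blast
  have "AE x in lebesgue. (\<lambda>n. us (r n) x) \<longlonglongrightarrow> u x"
    using r(2) by eventually_elim (simp add: LIM_zero_cancel)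
  with r(1) that show thesis by blast
qed

lemma L2lim_dominated:
  assumes m: "\<And>n. us n \<in> borel_measurable lebesgue" "u \<in> borel_measurable lebesgue"
    and w: "L2 w" "\<And>n. AE x in lebesgue. \<bar>us n x\<bar> \<le> \<bar>w x\<bar>"
    and l: "AE x in lebesgue. (\<lambda>n. us n x) \<longlonglongrightarrow> u x"
  shows "L2lim us u"
proof -
  have all: "AE x in lebesgue. \<forall>n. \<bar>us n x\<bar> \<le> \<bar>w x\<bar>" using w(2) by (simp add: AE_all_countable)
  have ub: "AE x in lebesgue. \<bar>u x\<bar> \<le> \<bar>w x\<bar>" using l all
  proof eventually_elim
    case (elim x)
    have "(\<lambda>n. \<bar>us n x\<bar>) \<longlonglongrightarrow> \<bar>u x\<bar>" using elim(1) by (rule tendsto_rabs)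
    then show ?case by (rule LIMSEQ_le_const2) (use elim(2) in auto)
  qed
  have L: "L2 (us n)" "L2 u" for n
    by (rule L2_bound[OF w(1), of _ 1]; use m ub w(2)[of n] in simp)+
  have "(\<lambda>n. \<integral>x. (us n x - u x)\<^sup>2 \<partial>lebesgue) \<longlonglongrightarrow> (\<integral>x. 0 \<partial>(lebesgue :: (real^3) measure))"
  proof (rule integral_dominated_convergence[where w = "\<lambda>x. 4 * (w x)\<^sup>2"])
    show "integrable lebesgue (\<lambda>x. 4 * (w x)\<^sup>2)" using w(1) by (simp add: L2_def)
    show "(\<lambda>x. (us n x - u x)\<^sup>2) \<in> borel_measurable lebesgue" for n using m by auto
    show "AE x in lebesgue. (\<lambda>n. (us n x - u x)\<^sup>2) \<longlonglongrightarrow> 0"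
      using l by eventually_elim (auto intro!: tendsto_eq_intros)
    show "AE x in lebesgue. norm ((us n x - u x)\<^sup>2) \<le> 4 * (w x)\<^sup>2" for n
      using all ub
    proof eventually_elim
      case (elim x)
      have "\<bar>us n x - u x\<bar> \<le> \<bar>us n x\<bar> + \<bar>u x\<bar>" by linarith
      also have "\<dots> \<le> 2 * \<bar>w x\<bar>" using elim by (metis add_mono mult_2)
      finally have "\<bar>us n x - u x\<bar>\<^sup>2 \<le> (2 * \<bar>w x\<bar>)\<^sup>2" by (rule power_mono) simp
      then show ?case by (simp add: power_mult_distrib)
    qed
  qed auto
  then show ?thesis using L by (simp add: L2lim_def n2_def)
qed

text \<open>Almost everywhere convergence of the bounded factors is enough. In
  \<open>b n * (us n - u) + b n * u\<close> the first term is controlled by \<open>C\<close>, the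
  second converges by dominated convergence. This is the tool for all later chain rules.\<close>

lemma L2lim_bdd_mult:
  assumes us: "L2lim us u" and b: "\<And>n. b n \<in> borel_measurable lebesgue" "b0 \<in> borel_measurable lebesgue"
    "\<And>n x. \<bar>b n x\<bar> \<le> C" "AE x in lebesgue. (\<lambda>n. b n x) \<longlonglongrightarrow> b0 x"
  shows "L2lim (\<lambda>n x. b n x * us n x) (\<lambda>x. b0 x * u x)"
proof -
  note D = L2limD[OF us]
  have C: "C \<ge> 0" using b(3)[of undefined undefined] abs_ge_zero order_trans by blast
  have "L2lim (\<lambda>n x. b n x * (us n x - u x)) (\<lambda>x. 0)"
  proof (rule L2lim_bound)
    show "L2 (\<lambda>x. b n x * (us n x - u x))" for n
      by (rule L2_bdd_mult[OF L2_diff[OF D(1) D(2)] b(1,3)])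
    show "n2 (\<lambda>x. b n x * (us n x - u x) - 0) \<le> C\<^sup>2 * n2 (\<lambda>x. us n x - u x)" for n
      unfolding n2_cmult[symmetric]
    proof (rule n2_mono)
      show "L2 (\<lambda>x. C * (us n x - u x))" by (rule L2_cmult[OF L2_diff[OF D(1) D(2)]])
      show "(\<lambda>x. b n x * (us n x - u x) - 0) \<in> borel_measurable lebesgue"
        using borel_measurable_times[OF b(1)[of n] L2_meas[OF L2_diff[OF D(1)[of n] D(2)]]] by simp
      have "\<bar>b n x * (us n x - u x) - 0\<bar> \<le> \<bar>C * (us n x - u x)\<bar>" for x
        using mult_right_mono[OF b(3)[of n x] abs_ge_zero[of "us n x - u x"]] C by (simp add: abs_mult)
      then show "AE x in lebesgue. \<bar>b n x * (us n x - u x) - 0\<bar> \<le> \<bar>C * (us n x - u x)\<bar>" by simp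
    qed
    show "(\<lambda>n. C\<^sup>2 * n2 (\<lambda>x. us n x - u x)) \<longlonglongrightarrow> 0" using D(3) by (auto intro!: tendsto_eq_intros)
  qed simp
  moreover have "L2lim (\<lambda>n x. b n x * u x) (\<lambda>x. b0 x * u x)"
  proof (rule L2lim_dominated)
    show "L2 (\<lambda>x. C * u x)" by (rule L2_cmult[OF D(2)])
    show "AE x in lebesgue. \<bar>b n x * u x\<bar> \<le> \<bar>C * u x\<bar>" for n
      using b(3) C by (auto simp: abs_mult intro!: mult_right_mono)
    show "AE x in lebesgue. (\<lambda>n. b n x * u x) \<longlonglongrightarrow> b0 x * u x"
      using b(4) by eventually_elim (auto intro!: tendsto_intros)
  qed (use b L2_meas[OF D(2)] in auto)
  ultimately have "L2lim (\<lambda>n x. b n x * (us n x - u x) + b n x * u x) (\<lambda>x. 0 + b0 x * u x)"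
    by (rule L2lim_add)
  then show ?thesis by (simp add: algebra_simps)
qed

lemma L2_continuous_support:
  fixes k :: "real^3 \<Rightarrow> real"
  assumes "continuous_on UNIV k" "\<And>x. norm x > R \<Longrightarrow> k x = 0" shows "L2 k"
  unfolding L2_def
proof
  show "k \<in> borel_measurable lebesgue" by (rule continuous_measurable_lebesgue[OF assms(1)])
  have "integrable lebesgue (\<lambda>x. 1 * (k x)\<^sup>2)"
    by (rule loc_int_mult_integrable[OF loc_int_1, of _ R]) (use assms in \<open>auto intro!: continuous_intros\<close>)
  then show "integrable lebesgue (\<lambda>x. (k x)\<^sup>2)" by simp
qed

lemma C1c_L2:
  assumes "C1c z D" shows "L2 z" "L2 (\<lambda>x. D x $ i)"
proof -
  obtain R where "R > 0" and R: "\<And>x. norm x > R \<Longrightarrow> z x = 0" "\<And>x. norm x > R \<Longrightarrow> D x = 0"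
    using C1c_obtain[OF assms] by blast
  note c = C1_continuous[OF C1c_imp_C1[OF assms]]
  show "L2 z" by (rule L2_continuous_support[OF c(1) R(1)])
  show "L2 (\<lambda>x. D x $ i)"
    by (rule L2_continuous_support[of _ R]) (use R(2) c(2) in \<open>auto intro!: continuous_intros\<close>)
qed

lemma L2_indicator_cball: "L2 (indicat_real (cball a R))"
proof -
  have "(\<lambda>x::real^3. (indicat_real (cball a R) x)\<^sup>2) = indicat_real (cball a R)"
    by (auto simp: indicator_def)
  then show ?thesis by (auto simp: L2_def intro!: borel_measurable_indicator)
qed

section \<open>Mollification of square integrable functions\<close>

lemma L2_loc_int: "L2 u \<Longrightarrow> loc_int u"
  unfolding loc_int_def using L2_mult_integrable[OF L2_indicator_cball] by (auto simp: L2_meas)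

text \<open>Expanding \<open>\<integral> (v - I)\<^sup>2 \<rho> \<ge> 0\<close> with \<open>I\<close> the \<open>\<rho>\<close>-mean of \<open>v\<close>.\<close>
lemma rho_Jensen:
  fixes v :: "real^'n::finite \<Rightarrow> real"
  assumes e: "e > 0" and i: "integrable lebesgue (\<lambda>y. v y * rho e (x - y))"
    "integrable lebesgue (\<lambda>y. (v y)\<^sup>2 * rho e (x - y))"
  shows "(\<integral>y. v y * rho e (x - y) \<partial>lebesgue)\<^sup>2 \<le> (\<integral>y. (v y)\<^sup>2 * rho e (x - y) \<partial>lebesgue)"
proof -
  define I where "I = (\<integral>y. v y * rho e (x - y) \<partial>lebesgue)"
  have m: "rho e \<in> borel_measurable (lebesgue :: (real^'n) measure)"
    by (rule continuous_measurable_lebesgue[OF rho_continuous])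
  have r: "integrable lebesgue (\<lambda>y. rho e (x - y))" "(\<integral>y. rho e (x - y) \<partial>lebesgue) = 1"
    using lebesgue_shift(4)[OF m, of x] lebesgue_shift(6)[OF m, of x] rho_integrable[OF e] rho_integral[OF e] by auto
  have eq: "(\<lambda>y. (v y - I)\<^sup>2 * rho e (x - y)) =
    (\<lambda>y. (v y)\<^sup>2 * rho e (x - y) - 2 * I * (v y * rho e (x - y)) + I\<^sup>2 * rho e (x - y))"
    by (auto simp: power2_eq_square algebra_simps)
  have "0 \<le> (\<integral>y. (v y - I)\<^sup>2 * rho e (x - y) \<partial>lebesgue)"
    by (intro Bochner_Integration.integral_nonneg) (simp add: rho_nonneg[OF e])
  also have "\<dots> = (\<integral>y. (v y)\<^sup>2 * rho e (x - y) \<partial>lebesgue) - 2 * I * I + I\<^sup>2"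
    unfolding eq using i r by (simp add: I_def)
  finally show ?thesis by (simp add: I_def power2_eq_square)
qed

lemma conv_continuous: "e > 0 \<Longrightarrow> loc_int u \<Longrightarrow> continuous_on UNIV (conv e u)"
  using C1_continuous(1)[OF smooth_on_C1[OF conv_smooth]] by blast

lemma rho_conv_integrable: "e > 0 \<Longrightarrow> loc_int u \<Longrightarrow> integrable lebesgue (\<lambda>y. u y * rho e (x - y))"
  by (rule ck_integrable[OF _ rho_continuous, of _ e]) (auto simp: rho_eq_0)

lemma ck_cong_AE:
  assumes "u \<in> borel_measurable lebesgue" "v \<in> borel_measurable lebesgue" "AE x in lebesgue. u x = v x"
    "continuous_on UNIV k"
  shows "ck k u x = ck k v x"
proof -
  have k: "(\<lambda>y. k (x - y)) \<in> borel_measurable lebesgue"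
    by (rule lebesgue_shift(2)[OF continuous_measurable_lebesgue[OF assms(4)]])
  show ?thesis
    unfolding ck_def by (rule integral_cong_AE) (use assms(1-3) k in auto)
qed

text \<open>Jensen's inequality for the probability density \<open>rho e (x - y)\<close> in
  \<open>y\<close>, then an exchange of integrals, after which the integral of the density over
  \<open>x\<close> is again \<open>1\<close>.\<close>

lemma conv_n2_le:
  assumes e: "e > 0" and u: "L2 u"
  shows "L2 (conv e u)" "n2 (conv e u) \<le> n2 u"
proof -
  \<comment> \<open>The exchange of integrals takes place on a product of Borel measures, hence a
    Borel representative of \<open>u\<close>; neither \<open>conv e u\<close> nor
    \<open>n2 u\<close> notices the change.\<close>
  obtain w where w: "w \<in> borel_measurable lborel" "AE x in lborel. u x = w x"
    using completion_ex_borel_measurable_real[of u lborel] L2_meas[OF u] by auto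
  have wl: "w \<in> borel_measurable lebesgue" using w(1) by (rule measurable_completion)
  have uw: "AE x in lebesgue. u x = w x" using w(2) by (rule AE_completion)
  have w2: "L2 w" by (rule L2_cong_AE[OF u wl]) (use uw in auto)
  have cu: "conv e u = conv e w"
    by (rule ext, rule ck_cong_AE[OF L2_meas[OF u] wl uw rho_continuous])
  have nw: "n2 u = n2 w" by (rule n2_cong_AE[OF L2_meas[OF u] wl uw])
  have li: "loc_int (\<lambda>x. (w x)\<^sup>2)"
  proof -
    have "integrable lebesgue (\<lambda>x. indicat_real (cball 0 R) x * (w x)\<^sup>2)" for R
    proof (rule Bochner_Integration.integrable_bound[OF L2_int[OF w2]])
      show "(\<lambda>x. indicat_real (cball 0 R) x * (w x)\<^sup>2) \<in> borel_measurable lebesgue"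
        by (intro borel_measurable_times borel_measurable_indicator borel_measurable_power wl) auto
    qed (auto simp: indicator_def)
    then show ?thesis using wl by (auto simp: loc_int_def)
  qed
  have J: "(conv e w x)\<^sup>2 \<le> (\<integral>y. (w y)\<^sup>2 * rho e (x - y) \<partial>lebesgue)" for x
    unfolding ck_def
    by (rule rho_Jensen[OF e rho_conv_integrable[OF e L2_loc_int[OF w2]] rho_conv_integrable[OF e li]])
  have rm: "(\<lambda>y. rho e (x - y)) \<in> borel_measurable borel" for x :: "real^3"
    by (intro borel_measurable_continuous_onI continuous_on_compose2[OF rho_continuous] continuous_intros) auto
  have J2: "ennreal ((conv e w x)\<^sup>2) \<le> (\<integral>\<^sup>+y. ennreal ((w y)\<^sup>2 * rho e (x - y)) \<partial>lborel)" for x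
  proof -
    have "ennreal ((conv e w x)\<^sup>2) \<le> ennreal (\<integral>y. (w y)\<^sup>2 * rho e (x - y) \<partial>lebesgue)"
      by (rule ennreal_leI[OF J])
    also have "\<dots> = (\<integral>\<^sup>+y. ennreal ((w y)\<^sup>2 * rho e (x - y)) \<partial>lebesgue)"
      by (rule nn_integral_eq_integral[symmetric, OF rho_conv_integrable[OF e li]]) (simp add: rho_nonneg[OF e])
    also have "\<dots> = (\<integral>\<^sup>+y. ennreal ((w y)\<^sup>2 * rho e (x - y)) \<partial>lborel)" by (rule nn_integral_completion)
    finally show ?thesis .
  qed
  have pm: "(\<lambda>(x, y). ennreal ((w y)\<^sup>2 * rho e (x - y))) \<in> borel_measurable (lborel \<Otimes>\<^sub>M lborel)"
  proof -
    have "(\<lambda>p. rho e (fst p - snd p :: real^3)) \<in> borel_measurable borel"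
      by (intro borel_measurable_continuous_onI continuous_on_compose2[OF rho_continuous] continuous_intros) auto
    then have "(\<lambda>p. rho e (fst p - snd p :: real^3)) \<in> borel_measurable (lborel \<Otimes>\<^sub>M lborel)"
      by (simp add: lborel_prod)
    moreover have "(\<lambda>p. w (snd p)) \<in> borel_measurable (lborel \<Otimes>\<^sub>M lborel)"
      using w(1) by measurable
    ultimately have "(\<lambda>p. ennreal ((w (snd p))\<^sup>2 * rho e (fst p - snd p :: real^3))) \<in> borel_measurable (lborel \<Otimes>\<^sub>M lborel)"
      by measurable
    then show ?thesis by (simp add: case_prod_beta')
  qed
  have one: "(\<integral>\<^sup>+x. ennreal (rho e (x - y)) \<partial>lborel) = 1" for y :: "real^3"
  proof -
    have m: "rho e \<in> borel_measurable (lebesgue :: (real^3) measure)"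
      by (rule continuous_measurable_lebesgue[OF rho_continuous])
    have i: "integrable lebesgue (\<lambda>x. rho e (x + (- y)))"
      using lebesgue_shift(3)[OF m, of "- y"] rho_integrable[OF e, where 'n=3] by blast
    have "(\<integral>\<^sup>+x. ennreal (rho e (x - y)) \<partial>lborel) = (\<integral>\<^sup>+x. ennreal (rho e (x + (- y))) \<partial>lebesgue)"
      by (simp add: nn_integral_completion)
    also have "\<dots> = ennreal (\<integral>x. rho e (x + (- y)) \<partial>lebesgue)"
      by (rule nn_integral_eq_integral[OF i]) (simp add: rho_nonneg[OF e])
    also have "\<dots> = 1" using lebesgue_shift(5)[OF m, of "- y"] rho_integral[OF e, where 'n=3] by simp
    finally show ?thesis .
  qed
  have nn: "(\<integral>\<^sup>+x. ennreal ((conv e w x)\<^sup>2) \<partial>lebesgue) \<le> ennreal (n2 w)"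
  proof -
    have "(\<integral>\<^sup>+x. ennreal ((conv e w x)\<^sup>2) \<partial>lebesgue) = (\<integral>\<^sup>+x. ennreal ((conv e w x)\<^sup>2) \<partial>lborel)"
      by (rule nn_integral_completion)
    also have "\<dots> \<le> (\<integral>\<^sup>+x. \<integral>\<^sup>+y. ennreal ((w y)\<^sup>2 * rho e (x - y)) \<partial>lborel \<partial>lborel)"
      by (rule nn_integral_mono) (simp add: J2)
    also have "\<dots> = (\<integral>\<^sup>+y. \<integral>\<^sup>+x. ennreal ((w y)\<^sup>2 * rho e (x - y)) \<partial>lborel \<partial>lborel)"
      using lborel_pair.Fubini'[OF pm] by simp
    also have "\<dots> = (\<integral>\<^sup>+y. ennreal ((w y)\<^sup>2) \<partial>lborel)"
    proof (rule nn_integral_cong)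
      fix y :: "real^3"
      have m: "(\<lambda>x. ennreal (rho e (x - y))) \<in> borel_measurable lborel"
      proof -
        have "(\<lambda>x. rho e (x - y)) \<in> borel_measurable borel"
          by (intro borel_measurable_continuous_onI continuous_on_compose2[OF rho_continuous] continuous_intros) auto
        then show ?thesis by simp
      qed
      have "(\<integral>\<^sup>+x. ennreal ((w y)\<^sup>2 * rho e (x - y)) \<partial>lborel) = (\<integral>\<^sup>+x. ennreal ((w y)\<^sup>2) * ennreal (rho e (x - y)) \<partial>lborel)"
        by (intro nn_integral_cong ennreal_mult) (auto simp: rho_nonneg[OF e])
      then show "(\<integral>\<^sup>+x. ennreal ((w y)\<^sup>2 * rho e (x - y)) \<partial>lborel) = ennreal ((w y)\<^sup>2)"
        by (simp add: nn_integral_cmult[OF m] one)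
    qed
    also have "\<dots> = (\<integral>\<^sup>+y. ennreal ((w y)\<^sup>2) \<partial>lebesgue)" by (rule nn_integral_completion[symmetric])
    also have "\<dots> = ennreal (n2 w)" unfolding n2_def
      by (rule nn_integral_eq_integral[OF L2_int[OF w2]]) simp
    finally show ?thesis .
  qed
  have cm: "conv e w \<in> borel_measurable lebesgue"
    by (rule continuous_measurable_lebesgue[OF conv_continuous[OF e L2_loc_int[OF w2]]])
  have ii: "integrable lebesgue (\<lambda>x. (conv e w x)\<^sup>2)"
    by (rule integrableI_bounded) (use cm nn le_less_trans[OF nn] in auto)
  then show "L2 (conv e u)" using cm by (simp add: cu L2_def)
  have "ennreal (n2 (conv e w)) \<le> ennreal (n2 w)"
    using nn nn_integral_eq_integral[OF ii] by (simp add: n2_def)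
  then show "n2 (conv e u) \<le> n2 u" by (simp add: cu nw)
qed

lemma conv_diff:
  assumes "e > 0" "loc_int u" "loc_int v"
  shows "conv e (\<lambda>x. u x - v x) x = conv e u x - conv e v x"
  using rho_conv_integrable[OF assms(1,2)] rho_conv_integrable[OF assms(1,3)]
  by (simp add: ck_def left_diff_distrib)

text \<open>Truncation in space by \<open>\<kappa>\<close> and in height by \<open>cl\<close>
  produces a bounded function supported in a ball. Continuous functions converging to
  \<open>u\<close> almost everywhere are truncated in the same way, so that dominated convergence
  applies to them as well.\<close>

lemma L2_approx_continuous:
  assumes u: "L2 u" and e: "e > 0"
  obtains k R where "continuous_on UNIV k" "\<And>x. norm x > R \<Longrightarrow> k x = 0" "n2 (\<lambda>x. k x - u x) < e"
proof -
  define \<kappa> where "\<kappa> M x = max 0 (min 1 (M + 1 - norm x))" for M and x :: "real^3"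
  define cl where "cl M t = max (- M) (min M t)" for M t :: real
  have kc: "continuous_on UNIV (\<kappa> M)" for M
  proof -
    have "continuous_on UNIV (\<lambda>x::real^3. max 0 (min 1 (M + 1 - norm x)))" by (intro continuous_intros)
    then show ?thesis by (simp add: \<kappa>_def[abs_def])
  qed
  have k0: "\<kappa> M x = 0" if "norm x > M + 1" for M x using that by (simp add: \<kappa>_def)
  have kb: "0 \<le> \<kappa> M x" "\<kappa> M x \<le> 1" for M x by (auto simp: \<kappa>_def)
  have km: "\<kappa> M \<in> borel_measurable lebesgue" for M by (rule continuous_measurable_lebesgue[OF kc])
  have clb: "\<bar>cl M t\<bar> \<le> M" "\<bar>cl M t\<bar> \<le> \<bar>t\<bar>" if "M \<ge> 0" for M t using that by (auto simp: cl_def)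
  have 1: "L2lim (\<lambda>n x. \<kappa> (real n) x * cl (real n) (u x)) u"
  proof (rule L2lim_dominated[OF _ _ u])
    show "(\<lambda>x. \<kappa> (real n) x * cl (real n) (u x)) \<in> borel_measurable lebesgue" for n
      using km[of "real n"] L2_meas[OF u] unfolding cl_def by measurable
    have "\<bar>\<kappa> (real n) x * cl (real n) (u x)\<bar> \<le> 1 * \<bar>u x\<bar>" for n x
      unfolding abs_mult by (rule mult_mono) (use kb clb in auto)
    then show "AE x in lebesgue. \<bar>\<kappa> (real n) x * cl (real n) (u x)\<bar> \<le> \<bar>u x\<bar>" for n by simp
    have "(\<lambda>n. \<kappa> (real n) x * cl (real n) (u x)) \<longlonglongrightarrow> u x" for x
    proof (rule tendsto_eventually)
      obtain N where N: "real N \<ge> norm x + \<bar>u x\<bar>" using real_arch_simple by blast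
      show "\<forall>\<^sub>F n in sequentially. \<kappa> (real n) x * cl (real n) (u x) = u x"
        using eventually_ge_at_top[of N]
      proof eventually_elim
        case (elim n)
        have "real n \<ge> real N" using elim by simp
        with N have "real n \<ge> norm x" "real n \<ge> \<bar>u x\<bar>"
          using norm_ge_zero[of x] abs_ge_zero[of "u x"] by linarith+
        then show ?case by (auto simp: \<kappa>_def cl_def min_def max_def)
      qed
    qed
    then show "AE x in lebesgue. (\<lambda>n. \<kappa> (real n) x * cl (real n) (u x)) \<longlonglongrightarrow> u x" by simp
  qed (rule L2_meas[OF u])
  have "\<forall>\<^sub>F n in sequentially. n2 (\<lambda>x. \<kappa> (real n) x * cl (real n) (u x) - u x) < e / 4"
    by (rule order_tendstoD(2)[OF L2limD(3)[OF 1]]) (use e in simp)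
  then obtain m where m: "n2 (\<lambda>x. \<kappa> (real m) x * cl (real m) (u x) - u x) < e / 4"
    by (auto dest: eventually_happens)
  have "u measurable_on UNIV"
    by (rule lebesgue_measurable_imp_measurable_on) (use L2_meas[OF u] in auto)
  then obtain N g where N: "negligible N" "\<And>n. continuous_on UNIV (g n)"
    "\<And>x. x \<notin> N \<Longrightarrow> (\<lambda>n. g n x) \<longlonglongrightarrow> u x"
    by (auto simp: measurable_on_def)
  have AEN: "AE x in lebesgue. x \<notin> N" using N(1) by (simp add: negligible_iff_null_sets AE_not_in)
  define k where "k n x = \<kappa> (real m) x * cl (real m) (g n x)" for n x
  have kkc: "continuous_on UNIV (k n)" for n unfolding k_def cl_def by (intro continuous_intros kc N)
  have 2: "L2lim k (\<lambda>x. \<kappa> (real m) x * cl (real m) (u x))"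
  proof (rule L2lim_dominated)
    show "k n \<in> borel_measurable lebesgue" for n by (rule continuous_measurable_lebesgue[OF kkc])
    show "(\<lambda>x. \<kappa> (real m) x * cl (real m) (u x)) \<in> borel_measurable lebesgue"
      using km[of "real m"] L2_meas[OF u] unfolding cl_def by measurable
    show "L2 (\<lambda>x. real m * \<kappa> (real m) x)" by (rule L2_cmult[OF L2_continuous_support[OF kc k0]])
    have "\<bar>k n x\<bar> \<le> \<bar>real m * \<kappa> (real m) x\<bar>" for n x
      using mult_right_mono[OF clb(1)[of "real m" "g n x"] kb(1)[of "real m" x]] kb(1)[of "real m" x]
      by (simp add: k_def abs_mult mult.commute)
    then show "AE x in lebesgue. \<bar>k n x\<bar> \<le> \<bar>real m * \<kappa> (real m) x\<bar>" for n by simp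
    show "AE x in lebesgue. (\<lambda>n. k n x) \<longlonglongrightarrow> \<kappa> (real m) x * cl (real m) (u x)"
      using AEN by eventually_elim (auto simp: k_def cl_def intro!: tendsto_intros N)
  qed
  have "\<forall>\<^sub>F n in sequentially. n2 (\<lambda>x. k n x - \<kappa> (real m) x * cl (real m) (u x)) < e / 4"
    by (rule order_tendstoD(2)[OF L2limD(3)[OF 2]]) (use e in simp)
  then obtain n where n: "n2 (\<lambda>x. k n x - \<kappa> (real m) x * cl (real m) (u x)) < e / 4"
    by (auto dest: eventually_happens)
  have "n2 (\<lambda>x. k n x - u x) < e"
    using n2_triangle[OF L2limD(1)[OF 2, of n] L2limD(1)[OF 1, of m] u] m n e by linarith
  moreover have "k n x = 0" if "norm x > real m + 1" for x using k0[OF that] by (simp add: k_def)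
  ultimately show thesis using that kkc by blast
qed

lemma conv_const_diff:
  fixes k :: "real^'n::finite \<Rightarrow> real"
  assumes e: "e > 0" and k: "loc_int k" and d: "\<And>y. norm (x - y) < e \<Longrightarrow> \<bar>k y - k x\<bar> \<le> c"
  shows "\<bar>conv e k x - k x\<bar> \<le> c"
proof -
  have m: "rho e \<in> borel_measurable (lebesgue :: (real^'n) measure)"
    by (rule continuous_measurable_lebesgue[OF rho_continuous])
  have r: "integrable lebesgue (\<lambda>y. rho e (x - y))" "(\<integral>y. rho e (x - y) \<partial>lebesgue) = 1"
    using lebesgue_shift(4)[OF m, of x] lebesgue_shift(6)[OF m, of x] rho_integrable[OF e] rho_integral[OF e] by auto
  have i: "integrable lebesgue (\<lambda>y. k y * rho e (x - y))" by (rule rho_conv_integrable[OF e k])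
  have "conv e k x - k x = (\<integral>y. (k y - k x) * rho e (x - y) \<partial>lebesgue)"
    using i r by (simp add: ck_def left_diff_distrib)
  also have "\<bar>\<dots>\<bar> \<le> (\<integral>y. c * rho e (x - y) \<partial>lebesgue)"
  proof (rule integral_abs_bound_integral)
    show "integrable lebesgue (\<lambda>y. (k y - k x) * rho e (x - y))" using i r by (simp add: left_diff_distrib)
    show "integrable lebesgue (\<lambda>y. c * rho e (x - y))" using r by simp
    show "\<bar>(k y - k x) * rho e (x - y)\<bar> \<le> c * rho e (x - y)" for y
    proof (cases "norm (x - y) < e")
      case True
      then show ?thesis using d[OF True] rho_nonneg[OF e, of "x - y"] by (simp add: abs_mult mult_right_mono)
    next
      case False
      then show ?thesis using rho_eq_0[OF e, of "x - y"] by simp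
    qed
  qed
  also have "\<dots> = c" using r by simp
  finally show ?thesis .
qed

lemma conv_eq_const:
  fixes k :: "real^'n::finite \<Rightarrow> real"
  assumes "e > 0" "loc_int k" "\<And>y. norm (x - y) < e \<Longrightarrow> k y = c"
  shows "conv e k x = c"
  using conv_const_diff[OF assms(1,2), of x 0] assms(3)[of x] assms(3) assms(1) by simp

lemma conv_L2lim_continuous:
  fixes k :: "real^3 \<Rightarrow> real"
  assumes k: "continuous_on UNIV k" "\<And>x. norm x > R \<Longrightarrow> k x = 0" and e: "\<And>n. e n > 0" "e \<longlonglongrightarrow> 0"
  shows "L2lim (\<lambda>n. conv (e n) k) k"
proof -
  have L: "L2 k" by (rule L2_continuous_support[OF k])
  have li: "loc_int k" by (rule L2_loc_int[OF L])
  define V where "V = n2 (indicat_real (cball (0::real^3) (R + 1)))"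
  have lim: "(\<lambda>n. n2 (\<lambda>x. conv (e n) k x - k x)) \<longlonglongrightarrow> 0"
  proof (rule LIMSEQ_I)
    fix r :: real assume r: "r > 0"
    \<comment> \<open>The cap \<open>1\<close> allows \<open>c\<^sup>2 \<le> c\<close> below, so the
      squared error is still linear in \<open>c\<close>.\<close>
    define c where "c = min 1 (r / (2 * (V + 1)))"
    have V0: "V \<ge> 0" by (simp add: V_def)
    have c: "c > 0" using r V0 by (simp add: c_def)
    obtain d where d: "d > 0" "\<And>x y. norm (x - y) < d \<Longrightarrow> norm (k x - k y) < c"
      using uniform_continuous_support[OF k c] by blast
    have "\<forall>\<^sub>F n in sequentially. e n < min d 1"
      by (rule order_tendstoD(2)[OF e(2)]) (use d in simp)
    then obtain N where N: "\<And>n. n \<ge> N \<Longrightarrow> e n < min d 1" by (auto simp: eventually_sequentially)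
    have "norm (n2 (\<lambda>x. conv (e n) k x - k x) - 0) < r" if n: "n \<ge> N" for n
    proof -
      have b: "\<bar>conv (e n) k x - k x\<bar> \<le> \<bar>c * indicat_real (cball 0 (R + 1)) x\<bar>" for x
      proof (cases "norm x \<le> R + 1")
        case True
        have "\<bar>conv (e n) k x - k x\<bar> \<le> c"
        proof (rule conv_const_diff[OF e(1) li])
          fix y assume "norm (x - y) < e n"
          then have "norm (y - x) < d" using N[OF n] by (simp add: norm_minus_commute)
          from d(2)[OF this] show "\<bar>k y - k x\<bar> \<le> c" by simp
        qed
        then show ?thesis using True c by simp
      next
        case False
        have "conv (e n) k x = 0"
        proof (rule conv_eq_const[OF e(1) li])
          fix y assume y: "norm (x - y) < e n"
          then have "norm y > R" using False N[OF n] norm_triangle_ineq2[of x y] by simp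
          then show "k y = 0" by (rule k(2))
        qed
        then show ?thesis using k(2)[of x] False by simp
      qed
      have "n2 (\<lambda>x. conv (e n) k x - k x) \<le> n2 (\<lambda>x. c * indicat_real (cball 0 (R + 1)) x)"
        by (rule n2_mono) (use b in \<open>auto intro!: L2_cmult L2_indicator_cball L2_meas L2_diff L conv_n2_le e\<close>)
      also have "\<dots> = c\<^sup>2 * V" by (simp add: n2_cmult V_def)
      also have "\<dots> \<le> c * V"
      proof (rule mult_right_mono[OF _ V0])
        show "c\<^sup>2 \<le> c" using c power_decreasing[of 1 2 c] by (simp add: c_def)
      qed
      also have "\<dots> \<le> r / (2 * (V + 1)) * V" by (rule mult_right_mono) (use V0 in \<open>auto simp: c_def\<close>)
      also have "\<dots> < r" using r V0 by (simp add: field_simps) (smt (verit) mult_nonneg_nonneg)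
      finally show ?thesis by simp
    qed
    then show "\<exists>no. \<forall>n\<ge>no. norm (n2 (\<lambda>x. conv (e n) k x - k x) - 0) < r" by blast
  qed
  show ?thesis unfolding L2lim_def using lim L conv_n2_le(1)[OF e(1) L] by blast
qed

text \<open>Mollification is a contraction, so the convergence for continuous functions of bounded
  support passes to their limits.\<close>

lemma conv_L2lim:
  assumes u: "L2 u" and e: "\<And>n. e n > 0" "e \<longlonglongrightarrow> 0"
  shows "L2lim (\<lambda>n. conv (e n) u) u"
proof -
  have "(\<lambda>n. n2 (\<lambda>x. conv (e n) u x - u x)) \<longlonglongrightarrow> 0"
  proof (rule LIMSEQ_I)
    fix r :: real assume r: "r > 0"
    \<comment> \<open>Two uses of \<open>n2_triangle\<close> put the weights \<open>2\<close>,
      \<open>4\<close> and \<open>4\<close> on three errors below \<open>r / 12\<close>, in total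
      less than \<open>r\<close>.\<close>
    obtain k R where k: "continuous_on UNIV k" "\<And>x. norm x > R \<Longrightarrow> k x = 0" "n2 (\<lambda>x. k x - u x) < r / 12"
      using L2_approx_continuous[OF u, of "r/12"] r by auto
    have L: "L2 k" by (rule L2_continuous_support[OF k(1,2)])
    have "\<forall>\<^sub>F n in sequentially. n2 (\<lambda>x. conv (e n) k x - k x) < r / 12"
      by (rule order_tendstoD(2)[OF L2limD(3)[OF conv_L2lim_continuous[OF k(1,2) e]]]) (use r in auto)
    then obtain N where N: "\<And>n. n \<ge> N \<Longrightarrow> n2 (\<lambda>x. conv (e n) k x - k x) < r / 12"
      by (auto simp: eventually_sequentially)
    have "n2 (\<lambda>x. conv (e n) u x - u x) < r" if "n \<ge> N" for n
    proof -
      have "(\<lambda>x. conv (e n) u x - conv (e n) k x) = conv (e n) (\<lambda>x. u x - k x)"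
        by (rule ext) (simp add: conv_diff[OF e(1) L2_loc_int[OF u] L2_loc_int[OF L]])
      then have "n2 (\<lambda>x. conv (e n) u x - conv (e n) k x) = n2 (conv (e n) (\<lambda>x. u x - k x))" by simp
      also have "\<dots> \<le> n2 (\<lambda>x. u x - k x)" by (rule conv_n2_le(2)[OF e(1) L2_diff[OF u L]])
      also have "\<dots> < r / 12" using k(3) n2_commute[of u k] by simp
      finally have "n2 (\<lambda>x. conv (e n) u x - conv (e n) k x) < r / 12" .
      then show ?thesis
        using n2_triangle[OF conv_n2_le(1)[OF e(1) u] conv_n2_le(1)[OF e(1) L] u, of n n]
          n2_triangle[OF conv_n2_le(1)[OF e(1) L] L u, of n] N[OF that] k(3) r by linarith
    qed
    then show "\<exists>no. \<forall>n\<ge>no. norm (n2 (\<lambda>x. conv (e n) u x - u x) - 0) < r" by auto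
  qed
  then show ?thesis unfolding L2lim_def using u conv_n2_le(1)[OF e(1) u] by blast
qed

section \<open>Weak gradients\<close>

lemma test_funI:
  assumes "smooth_on UNIV \<phi>" "compact K" "K \<subseteq> U" "\<And>x. x \<notin> K \<Longrightarrow> \<phi> x = 0"
  shows "test_fun U \<phi>"
proof -
  have s: "tsupp \<phi> \<subseteq> K" unfolding tsupp_def
    by (rule closure_minimal) (use assms in \<open>auto intro: compact_imp_closed\<close>)
  have "compact (tsupp \<phi>)"
    using compact_Int_closed[OF assms(2), of "tsupp \<phi>"] Int_absorb1[OF s] by (simp add: tsupp_def)
  with s assms show ?thesis by (auto simp: test_fun_def)
qed

lemma test_fun_outside: "x \<notin> tsupp \<phi> \<Longrightarrow> \<phi> x = 0"
  unfolding tsupp_def using closure_subset[of "{x. \<phi> x \<noteq> 0}"] by blast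

lemma test_fun_C1c:
  assumes "test_fun U \<phi>" shows "C1c \<phi> (gr \<phi>)"
proof -
  have "bounded (tsupp \<phi>)" using assms by (simp add: test_fun_def compact_imp_bounded)
  then obtain R where R: "\<And>x. x \<in> tsupp \<phi> \<Longrightarrow> norm x \<le> R"
    by (auto simp: bounded_iff)
  have "\<phi> x = 0" if "norm x > R" for x
    using R[of x] that test_fun_outside[of x \<phi>] not_le by blast
  moreover have "C1 \<phi> (gr \<phi>)" using assms by (auto simp: test_fun_def intro: smooth_on_C1)
  ultimately show ?thesis by (auto simp: C1c_def)
qed

lemma C1_mult:
  assumes "C1 a A" "C1 b B" shows "C1 (\<lambda>x. a x * b x) (\<lambda>x. a x *\<^sub>R B x + b x *\<^sub>R A x)"
  unfolding C1_def
proof (intro conjI allI)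
  show "((\<lambda>x. a x * b x) has_derivative (\<bullet>) (a x *\<^sub>R B x + b x *\<^sub>R A x)) (at x)" for x
    by (rule has_derivative_eq_rhs[OF has_derivative_mult[of a "\<lambda>h. A x \<bullet> h" x UNIV b "\<lambda>h. B x \<bullet> h"]])
      (use assms in \<open>auto simp: C1_def inner_add_left algebra_simps\<close>)
  show "continuous_on UNIV (\<lambda>x. a x *\<^sub>R B x + b x *\<^sub>R A x)"
    using C1_continuous[OF assms(1)] C1_continuous[OF assms(2)] by (intro continuous_intros)
qed

lemma C1c_mult: assumes "C1 a A" "C1c b B" shows "C1c (\<lambda>x. a x * b x) (\<lambda>x. a x *\<^sub>R B x + b x *\<^sub>R A x)"
  using C1_mult[OF assms(1) C1c_imp_C1[OF assms(2)]] assms(2) by (auto simp: C1c_def)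

lemma C1_affine:
  assumes "C1 k D" shows "C1 (\<lambda>y. k (t + s *\<^sub>R y)) (\<lambda>y. s *\<^sub>R D (t + s *\<^sub>R y))"
  unfolding C1_def
proof (intro conjI allI)
  fix x
  have "((\<lambda>y. t + s *\<^sub>R y) has_derivative (\<lambda>h. s *\<^sub>R h)) (at x)"
    by (auto intro!: derivative_eq_intros)
  note h = has_derivative_compose[OF this, of k "\<lambda>h. D (t + s *\<^sub>R x) \<bullet> h"]
  have e: "(\<lambda>h. D (t + s *\<^sub>R x) \<bullet> (s *\<^sub>R h)) = (\<bullet>) (s *\<^sub>R D (t + s *\<^sub>R x))"
    by (rule ext) simp
  show "((\<lambda>y. k (t + s *\<^sub>R y)) has_derivative (\<bullet>) (s *\<^sub>R D (t + s *\<^sub>R x))) (at x)"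
  proof -
    have "(k has_derivative (\<bullet>) (D (t + s *\<^sub>R x))) (at (t + s *\<^sub>R x))" using assms by (simp add: C1_def)
    from h[OF this] show ?thesis unfolding e .
  qed
next
  show "continuous_on UNIV (\<lambda>y. s *\<^sub>R D (t + s *\<^sub>R y))"
  proof (rule continuous_on_scaleR[OF continuous_on_const])
    show "continuous_on UNIV (\<lambda>y. D (t + s *\<^sub>R y))"
      by (rule continuous_on_compose2[OF C1_continuous(2)[OF assms]]) (auto intro!: continuous_intros)
  qed
qed

lemma C1c_affine:
  assumes "C1c k D" "s \<noteq> 0" shows "C1c (\<lambda>y. k (t + s *\<^sub>R y)) (\<lambda>y. s *\<^sub>R D (t + s *\<^sub>R y))"
proof -
  obtain R where R: "R > 0" "\<And>x. norm x > R \<Longrightarrow> k x = 0" "\<And>x. norm x > R \<Longrightarrow> D x = 0"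
    using C1c_obtain[OF assms(1)] by blast
  have "k (t + s *\<^sub>R y) = 0" if "norm y > (R + norm t) / \<bar>s\<bar>" for y
  proof (rule R(2))
    have "R + norm t < \<bar>s\<bar> * norm y" using that assms(2) by (simp add: field_simps)
    then show "R < norm (t + s *\<^sub>R y)" using norm_diff_ineq[of "s *\<^sub>R y" t] by (simp add: add.commute)
  qed
  then show ?thesis using C1_affine[OF C1c_imp_C1[OF assms(1)]] by (auto simp: C1c_def)
qed

lemma C1c_integrable:
  fixes z :: "real^'n::finite \<Rightarrow> real"
  assumes "C1c z D" shows "integrable lebesgue (\<lambda>x. D x $ i)" "integrable lebesgue z"
proof -
  obtain R where R: "R > 0" "\<And>x. norm x > R \<Longrightarrow> z x = 0" "\<And>x. norm x > R \<Longrightarrow> D x = 0"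
    using C1c_obtain[OF assms] by blast
  note c = C1_continuous[OF C1c_imp_C1[OF assms]]
  have "integrable lebesgue (\<lambda>x::real^'n. 1 * z x)" by (rule loc_int_mult_integrable[OF loc_int_1 c(1) R(2)])
  then show "integrable lebesgue z" by simp
  have "integrable lebesgue (\<lambda>x::real^'n. 1 * D x $ i)"
    by (rule loc_int_mult_integrable[OF loc_int_1, of _ R]) (use R(3) c(2) in \<open>auto intro!: continuous_intros\<close>)
  then show "integrable lebesgue (\<lambda>x. D x $ i)" by simp
qed

lemma C1c_parts:
  fixes z \<phi> :: "real^3 \<Rightarrow> real"
  assumes "C1c z D" "C1c \<phi> E"
  shows "(\<integral>x. z x * E x $ i \<partial>lebesgue) = - (\<integral>x. D x $ i * \<phi> x \<partial>lebesgue)"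
proof -
  have "(\<integral>x. z x * E x $ i + D x $ i * \<phi> x \<partial>lebesgue) = 0"
    using integral_C1c_partial[OF C1c_mult[OF C1c_imp_C1[OF assms(1)] assms(2)], of i]
    by (simp add: mult.commute)
  then show ?thesis
    using L2_mult_integrable[OF C1c_L2(1)[OF assms(1)] C1c_L2(2)[OF assms(2), of i]]
      L2_mult_integrable[OF C1c_L2(2)[OF assms(1), of i] C1c_L2(1)[OF assms(2)]]
    by simp
qed

text \<open>\<open>grad\<close> is an arbitrary choice among almost everywhere equal gradients.
  Proofs carry an explicit weak gradient instead and return to \<open>grad\<close> through
  \<open>wg_grad_AE\<close> and \<open>D12_Dsq\<close>.\<close>

definition wg :: "(real^3 \<Rightarrow> real) \<Rightarrow> (real^3 \<Rightarrow> real^3) \<Rightarrow> bool" where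
  "wg u g \<longleftrightarrow> L2 u \<and> (\<forall>i. L2 (\<lambda>x. g x $ i)) \<and> weak_grad u g"

lemma wgD: assumes "wg u g" shows "L2 u" "L2 (\<lambda>x. g x $ i)" "weak_grad u g"
  using assms by (auto simp: wg_def)

lemma wgI:
  assumes "L2 u" "\<And>i. L2 (\<lambda>x. g x $ i)"
    "\<And>\<phi> i. test_fun UNIV \<phi> \<Longrightarrow> (\<integral>x. u x * gr \<phi> x $ i \<partial>lebesgue) = - (\<integral>x. g x $ i * \<phi> x \<partial>lebesgue)"
  shows "wg u g"
proof -
  have "partial i \<phi> x = gr \<phi> x $ i" for i x and \<phi> :: "real^3 \<Rightarrow> real" by (simp add: gr_def)
  then show ?thesis
    unfolding wg_def weak_grad_def using assms
    by (auto intro!: L2_mult_integrable dest: test_fun_C1c C1c_L2)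
qed

lemma wg_H1: "wg u g \<Longrightarrow> H1 u" by (auto simp: wg_def H1_def)

lemma H1_wg: assumes "H1 u" shows "wg u (grad u)"
  unfolding wg_def using assms someI_ex[of "\<lambda>g. (\<forall>i. L2 (\<lambda>x. g x $ i)) \<and> weak_grad u g"]
  by (auto simp: H1_def grad_def)

lemma wg_test:
  assumes "wg u g" "test_fun UNIV \<phi>"
  shows "(\<integral>x. u x * gr \<phi> x $ i \<partial>lebesgue) = - (\<integral>x. g x $ i * \<phi> x \<partial>lebesgue)"
  using assms by (auto simp: wg_def weak_grad_def gr_def)

lemma C1c_wg: "C1c z D \<Longrightarrow> wg z D"
  by (rule wgI) (auto intro: C1c_L2 C1c_parts dest: test_fun_C1c)

lemma rho_shift_test_fun:
  assumes "e > 0" shows "test_fun UNIV (\<lambda>y. rho e (x - y))" "gr (\<lambda>y. rho e (x - y)) y = - gr (rho e) (x - y)"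
proof -
  have "smooth_on UNIV (\<lambda>y. rho e (y - x))" by (rule balg_smooth[OF balg_shift[OF rho_balg]])
  then have s: "smooth_on UNIV (\<lambda>y. rho e (x - y))" by (simp add: rho_reflect)
  show "test_fun UNIV (\<lambda>y. rho e (x - y))"
    by (rule test_funI[OF s compact_cball[of x e]]) (use assms in \<open>auto simp: dist_norm rho_eq_0\<close>)
  have "C1 (\<lambda>y. rho e (x + (-1) *\<^sub>R y)) (\<lambda>y. (-1) *\<^sub>R gr (rho e) (x + (-1) *\<^sub>R y))"
    by (rule C1_affine[OF smooth_on_C1[OF rho_smooth]])
  then show "gr (\<lambda>y. rho e (x - y)) y = - gr (rho e) (x - y)" by (simp add: gr_C1)
qed

text \<open>The shifted mollifiers are test functions, so all mollifications of \<open>w\<close>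
  vanish identically, and \<open>w\<close> is their mean square limit.\<close>

lemma L2_eq_0_weak:
  assumes w: "L2 w" and t: "\<And>\<phi>. test_fun UNIV \<phi> \<Longrightarrow> (\<integral>x. w x * \<phi> x \<partial>lebesgue) = 0"
  shows "AE x in lebesgue. w x = 0"
proof -
  have "conv e w = (\<lambda>x. 0)" if "e > 0" for e
    by (rule ext) (simp add: ck_def t rho_shift_test_fun[OF that])
  moreover have "L2lim (\<lambda>n. conv (inverse (real (Suc n))) w) w"
    by (rule conv_L2lim[OF w _ LIMSEQ_inverse_real_of_nat]) simp
  ultimately have "L2lim (\<lambda>n x. 0) w" by simp
  then have "(\<lambda>n::nat. n2 (\<lambda>x. - w x)) \<longlonglongrightarrow> 0" by (simp add: L2lim_def)
  then have "n2 w = 0" by (simp add: n2_def LIMSEQ_const_iff)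
  then show ?thesis using n2_eq_0[OF w] by simp
qed

lemma wg_unique:
  assumes "wg u g" "wg u h" shows "AE x in lebesgue. g x = h x"
proof -
  have "AE x in lebesgue. g x $ i - h x $ i = 0" for i
  proof (rule L2_eq_0_weak)
    show "L2 (\<lambda>x. g x $ i - h x $ i)" using assms by (auto intro: L2_diff wgD)
    fix \<phi> assume t: "test_fun UNIV \<phi>"
    have "(\<integral>x. g x $ i * \<phi> x \<partial>lebesgue) = (\<integral>x. h x $ i * \<phi> x \<partial>lebesgue)"
      using wg_test[OF assms(1) t, of i] wg_test[OF assms(2) t, of i] by simp
    then show "(\<integral>x. (g x $ i - h x $ i) * \<phi> x \<partial>lebesgue) = 0"
      using L2_mult_integrable[OF wgD(2)[OF assms(1), of i] C1c_L2(1)[OF test_fun_C1c[OF t]]]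
        L2_mult_integrable[OF wgD(2)[OF assms(2), of i] C1c_L2(1)[OF test_fun_C1c[OF t]]]
      by (simp add: left_diff_distrib)
  qed
  then have "AE x in lebesgue. \<forall>i. g x $ i - h x $ i = 0" by (simp add: AE_all_countable)
  then show ?thesis by eventually_elim (simp add: vec_eq_iff)
qed

lemma wg_grad_AE: "wg u g \<Longrightarrow> AE x in lebesgue. grad u x = g x"
  using wg_unique H1_wg wg_H1 by blast

definition Dsq :: "(real^3 \<Rightarrow> real^3) \<Rightarrow> real" where
  "Dsq g = (\<Sum>i\<in>UNIV. n2 (\<lambda>x. g x $ i))"

lemma Dsq_nonneg [simp]: "Dsq g \<ge> 0"
  by (simp add: Dsq_def sum_nonneg)

lemma norm_sq_sum: "(norm (v::real^'n::finite))\<^sup>2 = (\<Sum>i\<in>UNIV. (v $ i)\<^sup>2)"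
  by (simp only: power2_norm_eq_inner inner_vec_def) (simp add: power2_eq_square)

lemma Dsq_integral:
  assumes "\<And>i. L2 (\<lambda>x. g x $ i)"
  shows "integrable lebesgue (\<lambda>x. (norm (g x))\<^sup>2)" "(\<integral>x. (norm (g x))\<^sup>2 \<partial>lebesgue) = Dsq g"
  unfolding norm_sq_sum Dsq_def n2_def using assms
  by (auto simp: L2_int intro!: Bochner_Integration.integrable_sum Bochner_Integration.integral_sum)

lemma L2_vec_cong_AE:
  assumes "AE x in lebesgue. g x = h x" shows "AE x in lebesgue. g x $ i = h x $ i"
  using assms by eventually_elim simp

lemma Dsq_cong_AE:
  assumes "\<And>i. L2 (\<lambda>x. g x $ i)" "\<And>i. L2 (\<lambda>x. h x $ i)" "AE x in lebesgue. g x = h x"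
  shows "Dsq g = Dsq h"
  unfolding Dsq_def using assms(3)
  by (intro sum.cong refl n2_cong_AE L2_meas assms(1,2)) (rule L2_vec_cong_AE)

lemma D12_Dsq: assumes "wg u g" shows "D12_sq u = Dsq g"
proof -
  have w: "wg u (grad u)" using H1_wg wg_H1 assms by blast
  have "D12_sq u = Dsq (grad u)" unfolding D12_sq_def by (rule Dsq_integral(2)[OF wgD(2)[OF w]])
  also have "\<dots> = Dsq g" by (rule Dsq_cong_AE[OF wgD(2)[OF w] wgD(2)[OF assms] wg_grad_AE[OF assms]])
  finally show ?thesis .
qed

lemma wg_add:
  assumes "wg u g" "wg v h" shows "wg (\<lambda>x. u x + v x) (\<lambda>x. g x + h x)"
proof (rule wgI)
  show "L2 (\<lambda>x. u x + v x)" by (rule L2_add[OF wgD(1)[OF assms(1)] wgD(1)[OF assms(2)]])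
  show "L2 (\<lambda>x. (g x + h x) $ i)" for i
    using L2_add[OF wgD(2)[OF assms(1), of i] wgD(2)[OF assms(2), of i]] by simp
  fix \<phi> i assume t: "test_fun UNIV \<phi>"
  note C = test_fun_C1c[OF t]
  show "(\<integral>x. (u x + v x) * gr \<phi> x $ i \<partial>lebesgue) = - (\<integral>x. (g x + h x) $ i * \<phi> x \<partial>lebesgue)"
    using wg_test[OF assms(1) t, of i] wg_test[OF assms(2) t, of i]
      L2_mult_integrable[OF wgD(1)[OF assms(1)] C1c_L2(2)[OF C, of i]]
      L2_mult_integrable[OF wgD(1)[OF assms(2)] C1c_L2(2)[OF C, of i]]
      L2_mult_integrable[OF wgD(2)[OF assms(1), of i] C1c_L2(1)[OF C]]
      L2_mult_integrable[OF wgD(2)[OF assms(2), of i] C1c_L2(1)[OF C]]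
    by (simp add: distrib_right)
qed

lemma wg_cmult:
  assumes "wg u g" shows "wg (\<lambda>x. c * u x) (\<lambda>x. c *\<^sub>R g x)"
proof (rule wgI)
  show "L2 (\<lambda>x. c * u x)" "L2 (\<lambda>x. (c *\<^sub>R g x) $ i)" for i
    using wgD[OF assms] by (auto intro!: L2_cmult)
  fix \<phi> i assume t: "test_fun UNIV \<phi>"
  show "(\<integral>x. c * u x * gr \<phi> x $ i \<partial>lebesgue) = - (\<integral>x. (c *\<^sub>R g x) $ i * \<phi> x \<partial>lebesgue)"
    using wg_test[OF assms(1) t, of i] by (simp add: mult.assoc)
qed

lemma wg_diff:
  assumes "wg u g" "wg v h" shows "wg (\<lambda>x. u x - v x) (\<lambda>x. g x - h x)"
  using wg_add[OF assms(1) wg_cmult[OF assms(2), of "-1"]] by simp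

lemma wg_closed:
  assumes "\<And>n. wg (us n) (gs n)" "L2lim us u" "\<And>i. L2lim (\<lambda>n x. gs n x $ i) (\<lambda>x. g x $ i)"
  shows "wg u g"
proof (rule wgI)
  show "L2 u" "L2 (\<lambda>x. g x $ i)" for i using assms by (auto dest: L2limD)
  fix \<phi> i assume t: "test_fun UNIV \<phi>"
  note C = test_fun_C1c[OF t]
  have "(\<lambda>n. \<integral>x. us n x * gr \<phi> x $ i \<partial>lebesgue) \<longlonglongrightarrow> (\<integral>x. u x * gr \<phi> x $ i \<partial>lebesgue)"
    by (rule L2lim_inner[OF assms(2) L2lim_const[OF C1c_L2(2)[OF C]]])
  moreover have "(\<lambda>n. - (\<integral>x. gs n x $ i * \<phi> x \<partial>lebesgue)) \<longlonglongrightarrow> - (\<integral>x. g x $ i * \<phi> x \<partial>lebesgue)"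
    by (rule tendsto_minus[OF L2lim_inner[OF assms(3) L2lim_const[OF C1c_L2(1)[OF C]]]])
  ultimately show "(\<integral>x. u x * gr \<phi> x $ i \<partial>lebesgue) = - (\<integral>x. g x $ i * \<phi> x \<partial>lebesgue)"
    unfolding wg_test[OF assms(1) t] by (rule LIMSEQ_unique)
qed

text \<open>Testing the weak gradient with \<open>\<lambda>y. rho e (x - y)\<close> moves the
  derivative from the kernel to \<open>u\<close>: the gradient of the mollification is the
  mollification of the gradient.\<close>

lemma conv_C1:
  assumes u: "wg u g" and e: "e > 0"
  shows "C1 (conv e u) (\<lambda>x. \<chi> i. conv e (\<lambda>y. g y $ i) x)"
proof -
  have "ck (\<lambda>x. gr (rho e) x $ i) u x = conv e (\<lambda>y. g y $ i) x" for i x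
    using wg_test[OF u rho_shift_test_fun(1)[OF e], of x i]
    by (simp add: rho_shift_test_fun(2)[OF e] ck_def)
  then have "(conv e u has_derivative (\<lambda>h. (\<chi> i. conv e (\<lambda>y. g y $ i) x) \<bullet> h)) (at x)" for x
    using ck_has_derivative[OF L2_loc_int[OF wgD(1)[OF u]] rho_C1c[OF e], of x] by simp
  moreover have "continuous_on UNIV (\<lambda>x. \<chi> i. conv e (\<lambda>y. g y $ i) x)"
    by (rule continuous_on_vec_lambda) (rule conv_continuous[OF e L2_loc_int[OF wgD(2)[OF u]]])
  ultimately show ?thesis by (simp add: C1_def)
qed

lemma ck_eq_0_AE:
  assumes "\<And>x. norm x \<ge> e \<Longrightarrow> k x = 0" "AE y in lebesgue. norm (x - y) < e \<longrightarrow> u y = 0" shows "ck k u x = 0"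
  unfolding ck_def
proof (rule integral_eq_zero_AE)
  show "AE y in lebesgue. u y * k (x - y) = 0"
    using assms(2) by eventually_elim (use assms(1) in \<open>auto simp: not_le[symmetric]\<close>)
qed

lemma conv_test_fun:
  assumes e: "e > 0" and u: "loc_int u" "AE x in lebesgue. x \<notin> K \<longrightarrow> u x = 0"
    and K: "compact K" "\<And>x. x \<in> K \<Longrightarrow> cball x e \<subseteq> U"
  shows "test_fun U (conv e u)"
proof (rule test_funI[OF conv_smooth[OF e u(1)] compact_sums[OF K(1) compact_cball[of 0 e]]])
  show "{x + y |x y. x \<in> K \<and> y \<in> cball 0 e} \<subseteq> U" using K(2) by (auto simp: dist_norm subset_iff)
  fix x assume x: "x \<notin> {x + y |x y. x \<in> K \<and> y \<in> cball 0 e}"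
  have "y \<notin> K" if "norm (x - y) < e" for y
  proof
    assume "y \<in> K"
    then have "x \<in> {x + y |x y. x \<in> K \<and> y \<in> cball 0 e}"
    proof -
      have "x = y + (x - y) \<and> y \<in> K \<and> x - y \<in> cball 0 e" using that \<open>y \<in> K\<close> by simp
      then show ?thesis by blast
    qed
    with x show False by blast
  qed
  then show "conv e u x = 0"
    by (intro ck_eq_0_AE[of e] rho_eq_0 e) (use u(2) in \<open>auto elim: AE_mp\<close>)
qed

lemma C1c_AE_outside: "C1c z D \<Longrightarrow> \<exists>R. AE x in lebesgue. x \<notin> cball 0 R \<longrightarrow> z x = 0"
  by (auto simp: C1c_def not_le)

text \<open>Mollifying the test function extends integration by parts from smooth to merely
  \<open>C1c\<close> functions. Products such as \<open>\<eta> * \<phi>\<close> with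
  \<open>\<eta>\<close> of class \<open>C1\<close> thereby become admissible.\<close>

lemma wg_C1c_test:
  assumes u: "wg u g" and z: "C1c z D"
  shows "(\<integral>x. u x * D x $ i \<partial>lebesgue) = - (\<integral>x. g x $ i * z x \<partial>lebesgue)"
proof -
  define e where "e n = inverse (real (Suc n))" for n
  have e: "e n > 0" "e \<longlonglongrightarrow> 0" for n
    using LIMSEQ_inverse_real_of_nat by (auto simp: e_def[abs_def] simp del: of_nat_Suc)
  obtain R where R: "AE x in lebesgue. x \<notin> cball 0 R \<longrightarrow> z x = 0" using C1c_AE_outside[OF z] by blast
  have t: "test_fun UNIV (conv (e n) z)" for n
    by (rule conv_test_fun[OF e(1) L2_loc_int[OF C1c_L2(1)[OF z]] R]) auto
  have gr: "gr (conv (e n) z) x $ i = conv (e n) (\<lambda>y. D y $ i) x" for n x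
    by (simp add: gr_C1[OF conv_C1[OF C1c_wg[OF z] e(1)]])
  have "(\<lambda>n. \<integral>x. u x * conv (e n) (\<lambda>y. D y $ i) x \<partial>lebesgue) \<longlonglongrightarrow> (\<integral>x. u x * D x $ i \<partial>lebesgue)"
    by (rule L2lim_inner[OF L2lim_const[OF wgD(1)[OF u]] conv_L2lim[OF C1c_L2(2)[OF z] e]])
  moreover have "(\<lambda>n. - (\<integral>x. g x $ i * conv (e n) z x \<partial>lebesgue)) \<longlonglongrightarrow> - (\<integral>x. g x $ i * z x \<partial>lebesgue)"
    by (rule tendsto_minus[OF L2lim_inner[OF L2lim_const[OF wgD(2)[OF u]] conv_L2lim[OF C1c_L2(1)[OF z] e]]])
  ultimately show ?thesis
    using wg_test[OF u t, of _ i] by (simp add: gr LIMSEQ_unique)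
qed

lemma wg_mult:
  assumes u: "wg u g" and n: "C1 \<eta> E" "\<And>x. \<bar>\<eta> x\<bar> \<le> C" "\<And>x i. \<bar>E x $ i\<bar> \<le> C"
  shows "wg (\<lambda>x. \<eta> x * u x) (\<lambda>x. \<eta> x *\<^sub>R g x + u x *\<^sub>R E x)"
proof (rule wgI)
  note c = C1_continuous[OF n(1)]
  have m: "\<eta> \<in> borel_measurable lebesgue" "(\<lambda>x. E x $ i) \<in> borel_measurable lebesgue" for i
    using c by (auto intro!: continuous_measurable_lebesgue continuous_intros)
  have L: "L2 (\<lambda>x. \<eta> x * g x $ i)" "L2 (\<lambda>x. E x $ i * u x)" for i
    by (rule L2_bdd_mult[OF wgD(2)[OF u] m(1) n(2)], rule L2_bdd_mult[OF wgD(1)[OF u] m(2) n(3)])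
  show "L2 (\<lambda>x. \<eta> x * u x)" by (rule L2_bdd_mult[OF wgD(1)[OF u] m(1) n(2)])
  show "L2 (\<lambda>x. (\<eta> x *\<^sub>R g x + u x *\<^sub>R E x) $ i)" for i
    using L2_add[OF L(1)[of i] L(2)[of i]] by (simp add: mult.commute)
  fix \<phi> i assume t: "test_fun UNIV \<phi>"
  note C = test_fun_C1c[OF t]
  have a: "(\<lambda>x. u x * (\<eta> x *\<^sub>R gr \<phi> x + \<phi> x *\<^sub>R E x) $ i) = (\<lambda>x. \<eta> x * u x * gr \<phi> x $ i + E x $ i * u x * \<phi> x)"
    by (auto simp: algebra_simps)
  have b: "(\<lambda>x. (\<eta> x *\<^sub>R g x + u x *\<^sub>R E x) $ i * \<phi> x) = (\<lambda>x. \<eta> x * g x $ i * \<phi> x + E x $ i * u x * \<phi> x)"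
    by (auto simp: algebra_simps)
  have d: "(\<lambda>x. g x $ i * (\<eta> x * \<phi> x)) = (\<lambda>x. \<eta> x * g x $ i * \<phi> x)" by (auto simp: algebra_simps)
  have i: "integrable lebesgue (\<lambda>x. \<eta> x * u x * gr \<phi> x $ i)"
    "integrable lebesgue (\<lambda>x. E x $ i * u x * \<phi> x)" "integrable lebesgue (\<lambda>x. \<eta> x * g x $ i * \<phi> x)"
    by (intro L2_mult_integrable C1c_L2[OF C] L L2_bdd_mult[OF wgD(1)[OF u] m(1) n(2)])+
  show "(\<integral>x. \<eta> x * u x * gr \<phi> x $ i \<partial>lebesgue) = - (\<integral>x. (\<eta> x *\<^sub>R g x + u x *\<^sub>R E x) $ i * \<phi> x \<partial>lebesgue)"
    using wg_C1c_test[OF u C1c_mult[OF n(1) C], of i] i unfolding a b d by simp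
qed

lemma wg_shift: assumes "wg u g" shows "wg (\<lambda>x. u (x + t)) (\<lambda>x. g (x + t))"
proof (rule wgI)
  have L: "L2 v \<Longrightarrow> L2 (\<lambda>x. v (x + t))" for v
    using lebesgue_shift(1)[of v t] lebesgue_shift(3)[of "\<lambda>x. (v x)\<^sup>2" t] by (auto simp: L2_def)
  show "L2 (\<lambda>x. u (x + t))" "L2 (\<lambda>x. g (x + t) $ i)" for i
    using L[OF wgD(1)[OF assms]] L[OF wgD(2)[OF assms]] by auto
  fix \<phi> i assume "test_fun UNIV \<phi>"
  note C = test_fun_C1c[OF this]
  have C': "C1c (\<lambda>y. \<phi> (y - t)) (\<lambda>y. gr \<phi> (y - t))" using C1c_affine[OF C, of 1 "- t"] by simp
  have 1: "(\<integral>x. u (x + t) * gr \<phi> x $ i \<partial>lebesgue) = (\<integral>x. u x * gr \<phi> (x - t) $ i \<partial>lebesgue)"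
    using lebesgue_shift(5)[of "\<lambda>x. u x * gr \<phi> (x - t) $ i" t] L2_meas[OF wgD(1)[OF assms]] L2_meas[OF C1c_L2(2)[OF C']]
    by simp
  have 2: "(\<integral>x. g (x + t) $ i * \<phi> x \<partial>lebesgue) = (\<integral>x. g x $ i * \<phi> (x - t) \<partial>lebesgue)"
    using lebesgue_shift(5)[of "\<lambda>x. g x $ i * \<phi> (x - t)" t] L2_meas[OF wgD(2)[OF assms]] L2_meas[OF C1c_L2(1)[OF C']]
    by simp
  show "(\<integral>x. u (x + t) * gr \<phi> x $ i \<partial>lebesgue) = - (\<integral>x. g (x + t) $ i * \<phi> x \<partial>lebesgue)"
    unfolding 1 2 by (rule wg_C1c_test[OF assms C'])
qed

section \<open>Cutoff functions and density\<close>

lemma conv_mono_bounds: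
  fixes u :: "real^'n::finite \<Rightarrow> real"
  assumes e: "e > 0" and u: "loc_int u" "\<And>x. 0 \<le> u x" "\<And>x. u x \<le> 1"
  shows "0 \<le> conv e u x" "conv e u x \<le> 1"
proof -
  have m: "rho e \<in> borel_measurable (lebesgue :: (real^'n) measure)"
    by (rule continuous_measurable_lebesgue[OF rho_continuous])
  have r: "integrable lebesgue (\<lambda>y. rho e (x - y))" "(\<integral>y. rho e (x - y) \<partial>lebesgue) = 1"
    using lebesgue_shift(4)[OF m, of x] lebesgue_shift(6)[OF m, of x] rho_integrable[OF e] rho_integral[OF e] by auto
  show "0 \<le> conv e u x" unfolding ck_def
    by (intro Bochner_Integration.integral_nonneg mult_nonneg_nonneg u rho_nonneg e)
  have "conv e u x \<le> (\<integral>y. rho e (x - y) \<partial>lebesgue)" unfolding ck_def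
    by (rule integral_mono[OF rho_conv_integrable[OF e u(1)] r(1)])
      (use u rho_nonneg[OF e] in \<open>auto intro: mult_left_le_one_le\<close>)
  with r show "conv e u x \<le> 1" by simp
qed

text \<open>The gradient of a mollified indicator is bounded by the integral of the kernel's
  gradient. Hence \<open>C\<close> depends on the transition width \<open>s\<close> only, and one
  constant serves for all centres and radii.\<close>

lemma cutoff_exists:
  assumes s: "s > 0"
  obtains C where "C \<ge> 1" "\<And>(a::real^3) R. \<exists>\<xi>. test_fun UNIV \<xi> \<and> (\<forall>x. 0 \<le> \<xi> x \<and> \<xi> x \<le> 1) \<and>
    (\<forall>x i. \<bar>gr \<xi> x $ i\<bar> \<le> C) \<and> (\<forall>x. norm (x - a) \<le> R \<longrightarrow> \<xi> x = 1) \<and>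
    (\<forall>x. norm (x - a) \<ge> R + 2 * s \<longrightarrow> \<xi> x = 0)"
proof -
  define B where "B i = (\<integral>y. \<bar>gr (rho s) (y::real^3) $ i\<bar> \<partial>lebesgue)" for i
  define C where "C = 1 + (\<Sum>i\<in>UNIV. B i)"
  have B0: "B i \<ge> 0" for i unfolding B_def by (intro Bochner_Integration.integral_nonneg) simp
  have BC: "B i \<le> C" for i using member_le_sum[of i UNIV B] B0 by (simp add: C_def)
  have gr0: "gr (rho s) x = 0" if "norm x > s" for x :: "real^3"
    by (rule C1_support_norm[OF C1c_imp_C1[OF rho_C1c[OF s]] _ that]) (use s in \<open>simp add: rho_eq_0\<close>)
  have Dm: "(\<lambda>y. gr (rho s) y $ i) \<in> borel_measurable lebesgue" for i :: 3
    by (intro continuous_measurable_lebesgue continuous_intros C1_continuous(2)[OF C1c_imp_C1[OF rho_C1c[OF s]]])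
  have "\<exists>\<xi>. test_fun UNIV \<xi> \<and> (\<forall>x. 0 \<le> \<xi> x \<and> \<xi> x \<le> 1) \<and>
    (\<forall>x i. \<bar>gr \<xi> x $ i\<bar> \<le> C) \<and> (\<forall>x. norm (x - a) \<le> R \<longrightarrow> \<xi> x = 1) \<and>
    (\<forall>x. norm (x - a) \<ge> R + 2 * s \<longrightarrow> \<xi> x = 0)" for a :: "real^3" and R
  proof -
    \<comment> \<open>Mollification at scale \<open>s\<close> erodes the ball by \<open>s\<close> on
      the inside and enlarges it by \<open>s\<close> on the outside, hence the radii
      \<open>R\<close> and \<open>R + 2 * s\<close> for the plateau and the support.\<close>
    define u where "u = indicat_real (cball a (R + s))"
    define \<xi> where "\<xi> = conv s u"
    have li: "loc_int u" unfolding u_def by (rule L2_loc_int[OF L2_indicator_cball])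
    have "test_fun UNIV \<xi>" unfolding \<xi>_def
      by (rule conv_test_fun[OF s li _ compact_cball[of a "R + s"]]) (auto simp: u_def)
    moreover have "0 \<le> \<xi> x \<and> \<xi> x \<le> 1" for x
      unfolding \<xi>_def using conv_mono_bounds[OF s li] by (auto simp: u_def)
    moreover have "\<bar>gr \<xi> x $ i\<bar> \<le> C" for x i
    proof -
      have i: "integrable lebesgue (\<lambda>y. \<bar>gr (rho s) (x - y) $ i\<bar>)"
        using lebesgue_shift(4)[OF borel_measurable_abs[OF Dm[of i]], of x] C1c_integrable(1)[OF rho_C1c[OF s], of i]
        by (simp add: integrable_abs)
      have "gr \<xi> x $ i = (\<integral>y. u y * gr (rho s) (x - y) $ i \<partial>lebesgue)"
        unfolding \<xi>_def gr_def[of "conv s u"] by (simp add: ck_partial[OF li rho_C1c[OF s]] ck_def)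
      also have "\<bar>\<dots>\<bar> \<le> (\<integral>y. \<bar>gr (rho s) (x - y) $ i\<bar> \<partial>lebesgue)"
      proof (rule integral_abs_bound_integral[OF _ i])
        show "integrable lebesgue (\<lambda>y. u y * gr (rho s) (x - y) $ i)"
          by (rule ck_integrable[OF li, of "\<lambda>x. gr (rho s) x $ i" s x])
            (use gr0 in \<open>auto intro!: continuous_intros C1_continuous(2)[OF C1c_imp_C1[OF rho_C1c[OF s]]]\<close>)
      qed (auto simp: u_def indicator_def)
      also have "\<dots> = B i" unfolding B_def by (rule lebesgue_shift(6)[OF borel_measurable_abs[OF Dm]])
      finally show ?thesis using BC[of i] by linarith
    qed
    moreover have "\<xi> x = 1" if "norm (x - a) \<le> R" for x
      unfolding \<xi>_def
    proof (rule conv_eq_const[OF s li])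
      fix y assume "norm (x - y) < s"
      then have "norm (a - y) \<le> R + s"
        using that norm_triangle_ineq[of "a - x" "x - y"] by (simp add: norm_minus_commute)
      then show "u y = 1" by (simp add: u_def dist_norm)
    qed
    moreover have "\<xi> x = 0" if "norm (x - a) \<ge> R + 2 * s" for x
      unfolding \<xi>_def
    proof (rule conv_eq_const[OF s li])
      fix y assume "norm (x - y) < s"
      then have "norm (a - y) > R + s"
        using that norm_triangle_ineq[of "x - y" "y - a"] by (simp add: norm_minus_commute)
      then show "u y = 0" by (simp add: u_def dist_norm)
    qed
    ultimately show ?thesis by blast
  qed
  moreover have "C \<ge> 1" using B0 by (simp add: C_def sum_nonneg)
  ultimately show thesis using that by blast
qed

text \<open>Mollify, then cut off at radius \<open>n\<close>. The gradients of the cutoffs are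
  uniformly bounded and vanish eventually at each point, so the extra term of the product rule tends
  to \<open>0\<close> in the mean.\<close>

lemma wg_approx:
  assumes u: "wg u g"
  obtains z D where "\<And>n. C1c (z n) (D n)" "L2lim z u" "\<And>i. L2lim (\<lambda>n x. D n x $ i) (\<lambda>x. g x $ i)"
proof -
  obtain C where C: "C \<ge> 1" "\<And>(a::real^3) R. \<exists>\<xi>. test_fun UNIV \<xi> \<and> (\<forall>x. 0 \<le> \<xi> x \<and> \<xi> x \<le> 1) \<and>
    (\<forall>x i. \<bar>gr \<xi> x $ i\<bar> \<le> C) \<and> (\<forall>x. norm (x - a) \<le> R \<longrightarrow> \<xi> x = 1) \<and>
    (\<forall>x. norm (x - a) \<ge> R + 2 * 1 \<longrightarrow> \<xi> x = 0)"
    using cutoff_exists[of 1] by auto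
  have "\<forall>n. \<exists>\<xi>. test_fun UNIV \<xi> \<and> (\<forall>x. 0 \<le> \<xi> x \<and> \<xi> x \<le> 1) \<and>
    (\<forall>x i. \<bar>gr \<xi> x $ i\<bar> \<le> C) \<and> (\<forall>x. norm (x - 0) \<le> real n \<longrightarrow> \<xi> x = 1)"
    using C(2)[of 0] by blast
  from choice[OF this] obtain \<xi> where xx: "\<forall>n. test_fun UNIV (\<xi> n) \<and> (\<forall>x. 0 \<le> \<xi> n x \<and> \<xi> n x \<le> 1) \<and>
    (\<forall>x i. \<bar>gr (\<xi> n) x $ i\<bar> \<le> C) \<and> (\<forall>x. norm (x - 0) \<le> real n \<longrightarrow> \<xi> n x = 1)" by blast
  have x: "\<And>n. test_fun UNIV (\<xi> n)" "\<And>n x. 0 \<le> \<xi> n x" "\<And>n x. \<xi> n x \<le> 1"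
    "\<And>n x i. \<bar>gr (\<xi> n) x $ i\<bar> \<le> C" "\<And>n x. norm x \<le> real n \<Longrightarrow> \<xi> n x = 1"
    using xx by auto
  note xC = test_fun_C1c[OF x(1)]
  define e where "e n = inverse (real (Suc n))" for n
  have e: "e n > 0" "e \<longlonglongrightarrow> 0" for n
    using LIMSEQ_inverse_real_of_nat by (auto simp: e_def[abs_def] simp del: of_nat_Suc)
  define z where "z n x = conv (e n) u x * \<xi> n x" for n x
  define D where "D n x = conv (e n) u x *\<^sub>R gr (\<xi> n) x + \<xi> n x *\<^sub>R (\<chi> i. conv (e n) (\<lambda>y. g y $ i) x)" for n x
  have g0: "gr (\<xi> n) x = 0" if "norm x < real n" for n x
    by (rule C1_support[OF C1c_imp_C1[OF xC], of "ball 0 (real n)" _ _ 1]) (use that x(5) in auto)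
  have ev: "\<forall>\<^sub>F n in sequentially. norm x < real n" for x :: "real^3"
  proof -
    obtain N where "norm x < real N" using reals_Archimedean2 by blast
    then show ?thesis
      by (intro eventually_mono[OF eventually_ge_at_top[of N]]) (meson less_le_trans of_nat_mono)
  qed
  have l1: "(\<lambda>n. \<xi> n x) \<longlonglongrightarrow> 1" for x
    by (rule tendsto_eventually, rule eventually_mono[OF ev[of x]]) (simp add: x(5))
  have l0: "(\<lambda>n. gr (\<xi> n) x $ i) \<longlonglongrightarrow> 0" for x i
    by (rule tendsto_eventually, rule eventually_mono[OF ev[of x]]) (simp add: g0)
  have m: "\<xi> n \<in> borel_measurable lebesgue" "(\<lambda>x. gr (\<xi> n) x $ i) \<in> borel_measurable lebesgue" for n i
    using L2_meas[OF C1c_L2(1)[OF xC]] L2_meas[OF C1c_L2(2)[OF xC]] by auto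
  have mult1: "L2lim (\<lambda>n x. \<xi> n x * conv (e n) v x) (\<lambda>x. 1 * v x)" if "L2 v" for v
    by (rule L2lim_bdd_mult[OF conv_L2lim[OF that e] m(1), where C = 1]) (use x l1 in \<open>auto simp: abs_le_iff intro: order_trans[OF _ x(2)]\<close>)
  have mult0: "L2lim (\<lambda>n x. gr (\<xi> n) x $ i * conv (e n) v x) (\<lambda>x. 0 * v x)" if "L2 v" for v i
    by (rule L2lim_bdd_mult[OF conv_L2lim[OF that e] m(2), where C = C]) (use x l0 in auto)
  have "C1c (z n) (D n)" for n
    using C1c_mult[OF conv_C1[OF u e(1)] xC, of n n] by (simp add: z_def[abs_def] D_def[abs_def])
  moreover have "L2lim z u" using mult1[OF wgD(1)[OF u]] by (simp add: z_def[abs_def] mult.commute)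
  moreover have "L2lim (\<lambda>n x. D n x $ i) (\<lambda>x. g x $ i)" for i
    using L2lim_add[OF mult0[OF wgD(1)[OF u], of i] mult1[OF wgD(2)[OF u, of i]]]
    by (simp add: D_def mult.commute)
  ultimately show thesis using that by blast
qed

section \<open>The Sobolev inequality\<close>

definition v3 :: "real \<Rightarrow> real \<Rightarrow> real \<Rightarrow> real^3" where
  "v3 a b c = a *\<^sub>R axis 1 1 + b *\<^sub>R axis 2 1 + c *\<^sub>R axis 3 1"

lemma v3_nth: "v3 a b c $ 1 = a" "v3 a b c $ 2 = b" "v3 a b c $ 3 = c"
  by (simp_all add: v3_def axis_def)

lemma Basis_vec3: "(Basis :: (real^3) set) = {axis 1 1, axis 2 1, axis 3 1}"
  by (auto simp: Basis_vec_def UNIV_3)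

lemma v3_measurable [measurable (raw)]:
  assumes "f \<in> borel_measurable M" "g \<in> borel_measurable M" "h \<in> borel_measurable M"
  shows "(\<lambda>x. v3 (f x) (g x) (h x)) \<in> borel_measurable M"
  unfolding v3_def using assms by (intro borel_measurable_add borel_measurable_scaleR) auto

text \<open>Lebesgue measure is determined by its values on boxes. This identification is what
  allows iterated integrals along coordinate lines.\<close>

lemma distr_v3:
  "distr (lborel :: (real \<times> real \<times> real) measure) borel (\<lambda>(a, b, c). v3 a b c) = lborel"
proof (rule lborel_eqI[symmetric])
  have m: "(\<lambda>(a, b, c). v3 a b c) \<in> borel_measurable (lborel :: (real \<times> real \<times> real) measure)"
    unfolding v3_def case_prod_beta' by (auto intro!: borel_measurable_continuous_onI continuous_intros)
  fix l u :: "real^3" assume lu': "\<And>b. b \<in> Basis \<Longrightarrow> l \<bullet> b \<le> u \<bullet> b"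
  then have lu: "l $ 1 \<le> u $ 1" "l $ 2 \<le> u $ 2" "l $ 3 \<le> u $ 3"
    using lu'[of "axis 1 1"] lu'[of "axis 2 1"] lu'[of "axis 3 1"] by (auto simp: Basis_vec3 inner_axis)
  have "(\<lambda>(a, b, c). v3 a b c) -` box l u = {l $ 1<..<u $ 1} \<times> {l $ 2<..<u $ 2} \<times> {l $ 3<..<u $ 3}"
    by (auto simp: box_def Basis_vec3 inner_axis v3_nth)
  then have "emeasure (distr lborel borel (\<lambda>(a, b, c). v3 a b c)) (box l u) =
      emeasure lborel ({l $ 1<..<u $ 1} \<times> {l $ 2<..<u $ 2} \<times> {l $ 3<..<u $ 3})"
    by (subst emeasure_distr[OF m]) auto
  also have "\<dots> = ennreal (u $ 1 - l $ 1) * (ennreal (u $ 2 - l $ 2) * ennreal (u $ 3 - l $ 3))"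
  proof -
    have "emeasure lborel ({l $ 1<..<u $ 1} \<times> {l $ 2<..<u $ 2} \<times> {l $ 3<..<u $ 3}) =
        emeasure lborel {l $ 1<..<u $ 1} * emeasure lborel ({l $ 2<..<u $ 2} \<times> {l $ 3<..<u $ 3})"
      unfolding lborel_prod[symmetric, where 'b = "real \<times> real"]
      by (rule lborel.emeasure_pair_measure_Times) (auto intro!: borel_open open_Times)
    also have "emeasure lborel ({l $ 2<..<u $ 2} \<times> {l $ 3<..<u $ 3}) =
        emeasure lborel {l $ 2<..<u $ 2} * emeasure lborel {l $ 3<..<u $ 3}"
      unfolding lborel_prod[symmetric, where 'b = real]
      by (rule lborel.emeasure_pair_measure_Times) auto
    finally show ?thesis using lu by simp
  qed
  also have "\<dots> = ennreal (prod ((\<bullet>) (u - l)) Basis)"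
    using lu by (simp add: Basis_vec3 inner_axis ennreal_mult axis_eq_axis)
  finally show "emeasure (distr lborel borel (\<lambda>(a, b, c). v3 a b c)) (box l u) = ennreal (prod ((\<bullet>) (u - l)) Basis)" .
qed simp

lemma nn_integral_v3:
  assumes f: "f \<in> borel_measurable (borel :: (real^3) measure)"
  shows "(\<integral>\<^sup>+x. f x \<partial>lborel) = (\<integral>\<^sup>+a. \<integral>\<^sup>+b. \<integral>\<^sup>+c. f (v3 a b c) \<partial>lborel \<partial>lborel \<partial>lborel)"
proof -
  have m: "(\<lambda>(a, b, c). v3 a b c) \<in> borel_measurable (lborel :: (real \<times> real \<times> real) measure)"
    unfolding v3_def case_prod_beta' by (auto intro!: borel_measurable_continuous_onI continuous_intros)
  have fm: "(\<lambda>(a, b, c). f (v3 a b c)) \<in> borel_measurable (lborel \<Otimes>\<^sub>M lborel \<Otimes>\<^sub>M lborel)"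
    using measurable_compose[OF m f] by (simp add: case_prod_beta' lborel_prod)
  have "(\<integral>\<^sup>+x. f x \<partial>lborel) = (\<integral>\<^sup>+p. f (case p of (a, b, c) \<Rightarrow> v3 a b c) \<partial>lborel)"
    by (subst distr_v3[symmetric], subst nn_integral_distr[OF m]) (use f in auto)
  also have "\<dots> = (\<integral>\<^sup>+p. (case p of (a, b, c) \<Rightarrow> f (v3 a b c)) \<partial>(lborel \<Otimes>\<^sub>M lborel \<Otimes>\<^sub>M lborel))"
    by (simp add: case_prod_beta' lborel_prod)
  also have "\<dots> = (\<integral>\<^sup>+a. \<integral>\<^sup>+p. (case p of (b, c) \<Rightarrow> f (v3 a b c)) \<partial>(lborel \<Otimes>\<^sub>M lborel) \<partial>lborel)"
    using lborel.nn_integral_fst[OF fm[unfolded lborel_prod[where 'a = real and 'b = real]]]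
    by (simp add: lborel_prod)
  also have "\<dots> = (\<integral>\<^sup>+a. \<integral>\<^sup>+b. \<integral>\<^sup>+c. f (v3 a b c) \<partial>lborel \<partial>lborel \<partial>lborel)"
  proof (rule nn_integral_cong)
    fix a :: real
    have "(\<lambda>(b, c). f (v3 a b c)) \<in> borel_measurable (lborel \<Otimes>\<^sub>M lborel)"
      using f by measurable
    from lborel.nn_integral_fst[OF this]
    show "(\<integral>\<^sup>+p. (case p of (b, c) \<Rightarrow> f (v3 a b c)) \<partial>(lborel \<Otimes>\<^sub>M lborel)) = (\<integral>\<^sup>+b. \<integral>\<^sup>+c. f (v3 a b c) \<partial>lborel \<partial>lborel)"
      by simp
  qed
  finally show ?thesis .
qed

text \<open>The square root on \<open>[0, \<infinity>]\<close>; \<open>enn2real\<close> alone would send \<open>\<infinity>\<close> to \<open>0\<close>.\<close>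
definition esq :: "ennreal \<Rightarrow> ennreal" where
  "esq x = (if x = top then top else ennreal (sqrt (enn2real x)))"

lemma esq_power2: "(esq x)\<^sup>2 = x"
proof (cases x)
  case (real r)
  then show ?thesis by (simp add: esq_def ennreal_power)
qed (simp add: esq_def power2_eq_square)

lemma ennreal_power2_le_iff: "(a::ennreal)\<^sup>2 \<le> b\<^sup>2 \<longleftrightarrow> a \<le> b"
proof
  assume "a \<le> b" then show "a\<^sup>2 \<le> b\<^sup>2" by (rule power_mono) simp
next
  assume l: "a\<^sup>2 \<le> b\<^sup>2"
  show "a \<le> b"
  proof (cases a; cases b)
    fix r s assume rs: "a = ennreal r" "0 \<le> r" "b = ennreal s" "0 \<le> s"
    have "ennreal (r\<^sup>2) \<le> ennreal (s\<^sup>2)"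
      using l unfolding rs(1,3) ennreal_power[OF rs(2)] ennreal_power[OF rs(4)] .
    then have "r\<^sup>2 \<le> s\<^sup>2" by (subst (asm) ennreal_le_iff) auto
    then have "r \<le> s" by (rule power2_le_imp_le[OF _ rs(4)])
    then show ?thesis using rs by simp
  next
    fix s assume "a = top" "b = ennreal s" "0 \<le> s"
    with l show ?thesis by (simp add: ennreal_power) (simp add: power2_eq_square top_unique)
  qed auto
qed

lemma esq_le: "a\<^sup>2 \<le> x \<Longrightarrow> a \<le> esq x"
  using ennreal_power2_le_iff[of a "esq x"] by (simp add: esq_power2)

lemma esq_mult: "esq (x * y) = esq x * esq y"
proof (rule antisym)
  show "esq (x * y) \<le> esq x * esq y" "esq x * esq y \<le> esq (x * y)"
    by (simp_all add: ennreal_power2_le_iff[symmetric] power_mult_distrib esq_power2)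
qed

lemma esq_measurable [measurable]: "esq \<in> borel_measurable borel"
  unfolding esq_def by measurable

lemma esq_Cauchy_Schwarz:
  assumes [measurable]: "f \<in> borel_measurable M" "g \<in> borel_measurable M"
  shows "(\<integral>\<^sup>+x. esq (f x) * esq (g x) \<partial>M) \<le> esq (\<integral>\<^sup>+x. f x \<partial>M) * esq (\<integral>\<^sup>+x. g x \<partial>M)"
proof -
  have "(\<integral>\<^sup>+x. esq (f x) * esq (g x) \<partial>M)\<^sup>2 \<le> (\<integral>\<^sup>+x. f x \<partial>M) * (\<integral>\<^sup>+x. g x \<partial>M)"
    using Cauchy_Schwarz_nn_integral[of "\<lambda>x. esq (f x)" M "\<lambda>x. esq (g x)"] by (simp add: esq_power2)
  then show ?thesis unfolding esq_mult[symmetric, of "integral\<^sup>N M f"] by (rule esq_le)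
qed

text \<open>Cauchy-Schwarz in one variable at a time. Each line integral is constant in one
  coordinate: in \<open>c\<close> the factor \<open>F3\<close> comes out and \<open>F1\<close>,
  \<open>F2\<close> are paired, in \<open>b\<close> the result of the first is paired with
  \<open>F3\<close>, and in \<open>a\<close> the two remaining factors are paired. Every integration
  ends in a root of the full integral.\<close>

lemma Loomis_Whitney:
  assumes [measurable]: "H \<in> borel_measurable (borel :: (real^3) measure)"
  shows "(\<integral>\<^sup>+a. \<integral>\<^sup>+b. \<integral>\<^sup>+c. esq (\<integral>\<^sup>+t. H (v3 t b c) \<partial>lborel) * esq (\<integral>\<^sup>+t. H (v3 a t c) \<partial>lborel) *
      esq (\<integral>\<^sup>+t. H (v3 a b t) \<partial>lborel) \<partial>lborel \<partial>lborel \<partial>lborel)\<^sup>2 \<le> (\<integral>\<^sup>+x. H x \<partial>lborel) ^ 3"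
proof -
  define I where "I = (\<integral>\<^sup>+x. H x \<partial>lborel)"
  define F1 where "F1 b c = (\<integral>\<^sup>+t. H (v3 t b c) \<partial>lborel)" for b c
  define F2 where "F2 a c = (\<integral>\<^sup>+t. H (v3 a t c) \<partial>lborel)" for a c
  define F3 where "F3 a b = (\<integral>\<^sup>+t. H (v3 a b t) \<partial>lborel)" for a b
  have [measurable]: "(\<lambda>(b, c). F1 b c) \<in> borel_measurable (lborel \<Otimes>\<^sub>M lborel)"
    "(\<lambda>(b, c). F2 b c) \<in> borel_measurable (lborel \<Otimes>\<^sub>M lborel)"
    "(\<lambda>(b, c). F3 b c) \<in> borel_measurable (lborel \<Otimes>\<^sub>M lborel)"
    unfolding F1_def F2_def F3_def by measurable
  have [measurable]: "F1 b \<in> borel_measurable lborel" "F2 b \<in> borel_measurable lborel" "F3 b \<in> borel_measurable lborel" for b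
    unfolding F1_def F2_def F3_def by measurable
  define P where "P b = (\<integral>\<^sup>+c. F1 b c \<partial>lborel)" for b
  define R where "R a = (\<integral>\<^sup>+c. F2 a c \<partial>lborel)" for a
  define S where "S a = (\<integral>\<^sup>+b. F3 a b \<partial>lborel)" for a
  have [measurable]: "P \<in> borel_measurable lborel" "R \<in> borel_measurable lborel" "S \<in> borel_measurable lborel"
    unfolding P_def R_def S_def by measurable
  have IS: "(\<integral>\<^sup>+a. S a \<partial>lborel) = I"
    unfolding S_def F3_def I_def by (rule nn_integral_v3[symmetric]) simp
  have "R a = S a" for a
    unfolding R_def S_def F2_def F3_def
    by (rule lborel_pair.Fubini') measurable
  then have IR: "(\<integral>\<^sup>+a. R a \<partial>lborel) = I" using IS by simp
  have IP: "(\<integral>\<^sup>+b. P b \<partial>lborel) = I"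
  proof -
    have "P b = (\<integral>\<^sup>+a. F3 a b \<partial>lborel)" for b
      unfolding P_def F1_def F3_def by (rule lborel_pair.Fubini') measurable
    then have "(\<integral>\<^sup>+b. P b \<partial>lborel) = (\<integral>\<^sup>+b. \<integral>\<^sup>+a. F3 a b \<partial>lborel \<partial>lborel)" by simp
    also have "\<dots> = (\<integral>\<^sup>+a. \<integral>\<^sup>+b. F3 a b \<partial>lborel \<partial>lborel)"
      by (rule lborel_pair.Fubini') measurable
    finally show ?thesis using IS by (simp add: S_def)
  qed
  have "(\<integral>\<^sup>+a. \<integral>\<^sup>+b. \<integral>\<^sup>+c. esq (F1 b c) * esq (F2 a c) * esq (F3 a b) \<partial>lborel \<partial>lborel \<partial>lborel)
     = (\<integral>\<^sup>+a. \<integral>\<^sup>+b. (\<integral>\<^sup>+c. esq (F1 b c) * esq (F2 a c) \<partial>lborel) * esq (F3 a b) \<partial>lborel \<partial>lborel)"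
    by (intro nn_integral_cong nn_integral_multc) measurable
  also have "\<dots> \<le> (\<integral>\<^sup>+a. \<integral>\<^sup>+b. (esq (P b) * esq (R a)) * esq (F3 a b) \<partial>lborel \<partial>lborel)"
    unfolding P_def R_def by (intro nn_integral_mono mult_right_mono esq_Cauchy_Schwarz) auto
  also have "\<dots> = (\<integral>\<^sup>+a. esq (R a) * (\<integral>\<^sup>+b. esq (P b) * esq (F3 a b) \<partial>lborel) \<partial>lborel)"
    by (subst nn_integral_cmult[symmetric]) (auto intro!: nn_integral_cong simp: mult_ac)
  also have "\<dots> \<le> (\<integral>\<^sup>+a. esq (R a) * (esq I * esq (S a)) \<partial>lborel)"
    unfolding S_def IP[symmetric] by (intro nn_integral_mono mult_left_mono esq_Cauchy_Schwarz) auto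
  also have "\<dots> = esq I * (\<integral>\<^sup>+a. esq (R a) * esq (S a) \<partial>lborel)"
    by (subst nn_integral_cmult[symmetric]) (auto intro!: nn_integral_cong simp: mult_ac)
  also have "\<dots> \<le> esq I * (esq I * esq I)"
    using esq_Cauchy_Schwarz[of R lborel S] unfolding IR IS by (intro mult_left_mono) auto
  finally have "(\<integral>\<^sup>+a. \<integral>\<^sup>+b. \<integral>\<^sup>+c. esq (F1 b c) * esq (F2 a c) * esq (F3 a b) \<partial>lborel \<partial>lborel \<partial>lborel)\<^sup>2
     \<le> (esq I * (esq I * esq I))\<^sup>2" by (rule power_mono) simp
  also have "\<dots> = I ^ 3" by (simp add: power_mult_distrib esq_power2 power3_eq_cube mult.assoc)
  finally show ?thesis unfolding F1_def F2_def F3_def I_def .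
qed

text \<open>Fundamental theorem of calculus for \<open>g ^ 4\<close>, started where \<open>g\<close>
  vanishes. The exponent is chosen so that the bounds along three coordinate lines multiply to
  \<open>z ^ 12\<close>, the square of the \<open>z ^ 6\<close> wanted in the Sobolev
  inequality.\<close>

lemma power4_le_line_integral:
  fixes g g' :: "real \<Rightarrow> real"
  assumes d: "\<And>s. (g has_real_derivative g' s) (at s)" and c: "continuous_on UNIV g'"
    and z: "\<And>s. s < r \<Longrightarrow> g s = 0"
  shows "ennreal (g t ^ 4) \<le> (\<integral>\<^sup>+s. ennreal (4 * \<bar>g s\<bar> ^ 3 * \<bar>g' s\<bar>) \<partial>lborel)"
proof -
  define a where "a = min (r - 1) t"
  have cg: "continuous_on UNIV g" using d by (auto intro!: continuous_at_imp_continuous_on DERIV_isCont)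
  have D4: "((\<lambda>s. g s ^ 4) has_real_derivative 4 * g s ^ 3 * g' s) (at s)" for s
    by (rule DERIV_cong[OF DERIV_power[OF d]]) simp
  have cD: "continuous_on UNIV (\<lambda>s. 4 * g s ^ 3 * g' s)" by (intro continuous_intros cg c)
  have "(\<integral>s. (4 * g s ^ 3 * g' s) * indicator {a..t} s \<partial>lborel) = g t ^ 4 - g a ^ 4"
    by (rule integral_FTC_Icc_real) (use D4 cD in \<open>auto simp: a_def continuous_on_eq_continuous_at\<close>)
  moreover have "g a = 0" by (rule z) (simp add: a_def)
  ultimately have "g t ^ 4 = (\<integral>s. (4 * g s ^ 3 * g' s) * indicator {a..t} s \<partial>lborel)" by simp
  then have "ennreal (g t ^ 4) \<le> ennreal (norm (\<integral>s. (4 * g s ^ 3 * g' s) * indicator {a..t} s \<partial>lborel))"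
    by (intro ennreal_leI) simp
  also have "\<dots> \<le> (\<integral>\<^sup>+s. norm ((4 * g s ^ 3 * g' s) * indicator {a..t} s) \<partial>lborel)"
    by (rule integral_norm_bound_ennreal)
      (use borel_integrable_compact[of "{a..t}" "\<lambda>s. 4 * g s ^ 3 * g' s"] cD in
        \<open>auto simp: mult.commute intro: continuous_on_subset\<close>)
  also have "\<dots> \<le> (\<integral>\<^sup>+s. ennreal (4 * \<bar>g s\<bar> ^ 3 * \<bar>g' s\<bar>) \<partial>lborel)"
    by (intro nn_integral_mono ennreal_leI) (auto simp: abs_mult power_abs indicator_def)
  finally show ?thesis .
qed

lemma power6_integrable_continuous:
  fixes z :: "real^3 \<Rightarrow> real"
  assumes "continuous_on UNIV z" "\<And>x. norm x > R \<Longrightarrow> z x = 0"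
  shows "integrable lebesgue (\<lambda>x. z x ^ 6)"
proof -
  have "integrable lebesgue (\<lambda>x::real^3. 1 * z x ^ 6)"
    by (rule loc_int_mult_integrable[OF loc_int_1, of _ R]) (use assms in \<open>auto intro!: continuous_intros\<close>)
  then show ?thesis by simp
qed

text \<open>All three line bounds use the same integrand \<open>H\<close>, so
  \<open>Loomis_Whitney\<close> gives \<open>i\<^sup>2 \<le> K ^ 3\<close>, while Cauchy-Schwarz
  gives \<open>K\<^sup>2 \<le> 16 * i * Dsq D\<close>. Hence
  \<open>i ^ 4 \<le> (16 * i * Dsq D) ^ 3\<close>, and since \<open>i\<close> is finite a factor
  \<open>i ^ 3\<close> cancels. This is the origin of \<open>4096 = 16 ^ 3\<close>.\<close>

lemma Sobolev_C1c:
  assumes z: "C1c z D"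
  shows "(\<integral>x. z x ^ 6 \<partial>lebesgue) \<le> 4096 * Dsq D ^ 3"
proof -
  obtain r where r: "r > 0" "\<And>x. norm x > r \<Longrightarrow> z x = 0" "\<And>x. norm x > r \<Longrightarrow> D x = 0"
    using C1c_obtain[OF z] by blast
  note c = C1_continuous[OF C1c_imp_C1[OF z]]
  have [measurable]: "z \<in> borel_measurable borel" "D \<in> borel_measurable borel"
    using c by (auto intro: borel_measurable_continuous_onI)
  define H where "H x = ennreal (4 * \<bar>z x\<bar> ^ 3 * norm (D x))" for x
  have Hm [measurable]: "H \<in> borel_measurable borel" unfolding H_def by measurable
  define i where "i = (\<integral>x. z x ^ 6 \<partial>lebesgue)"
  have i6: "integrable lebesgue (\<lambda>x. z x ^ 6)" by (rule power6_integrable_continuous[OF c(1) r(2)])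
  have ii: "(\<integral>\<^sup>+x. ennreal (z x ^ 6) \<partial>lborel) = ennreal i"
    using nn_integral_eq_integral[OF i6] by (simp add: i_def nn_integral_completion)
  have i0: "i \<ge> 0" unfolding i_def by (intro Bochner_Integration.integral_nonneg) simp
  have dd: "(\<integral>\<^sup>+x. ennreal ((norm (D x))\<^sup>2) \<partial>lborel) = ennreal (Dsq D)"
    using nn_integral_eq_integral[OF Dsq_integral(1)[OF C1c_L2(2)[OF z]]] Dsq_integral(2)[OF C1c_L2(2)[OF z]]
    by (simp add: nn_integral_completion)
  define K where "K = (\<integral>\<^sup>+x. H x \<partial>lborel)"
  have nb: "norm (v3 t b c) > r" if "t < - r \<or> b < - r \<or> c < - r" for t b c
    using component_le_norm_cart[of "v3 t b c" 1] component_le_norm_cart[of "v3 t b c" 2]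
      component_le_norm_cart[of "v3 t b c" 3] that by (auto simp: v3_nth)
  have line: "ennreal (z (v3 a b c) ^ 4) \<le> (\<integral>\<^sup>+t. H (v3 t b c) \<partial>lborel)"
    "ennreal (z (v3 a b c) ^ 4) \<le> (\<integral>\<^sup>+t. H (v3 a t c) \<partial>lborel)"
    "ennreal (z (v3 a b c) ^ 4) \<le> (\<integral>\<^sup>+t. H (v3 a b t) \<partial>lborel)" for a b c
  proof -
    have gen: "ennreal (z (p t) ^ 4) \<le> (\<integral>\<^sup>+s. H (p s) \<partial>lborel)"
      if p: "\<And>s. (p has_vector_derivative axis k 1) (at s)" "\<And>s. s < - r \<Longrightarrow> norm (p s) > r" for p k t
    proof -
      have pc: "continuous_on UNIV p" using p(1)
        by (auto intro!: continuous_at_imp_continuous_on has_vector_derivative_continuous)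
      have "ennreal (z (p t) ^ 4) \<le> (\<integral>\<^sup>+s. ennreal (4 * \<bar>z (p s)\<bar> ^ 3 * \<bar>D (p s) $ k\<bar>) \<partial>lborel)"
      proof (rule power4_le_line_integral[where r = "- r"])
        fix s
        have "(z has_derivative (\<lambda>h. D (p s) \<bullet> h)) (at (p s))" using z by (simp add: C1c_def C1_def)
        from has_derivative_compose[OF p(1)[of s, unfolded has_vector_derivative_def] this]
        show "((\<lambda>s. z (p s)) has_real_derivative D (p s) $ k) (at s)"
          unfolding has_field_derivative_def
          by (rule has_derivative_eq_rhs) (auto simp: inner_axis mult.commute)
      next
        show "continuous_on UNIV (\<lambda>s. D (p s) $ k)"
          by (intro continuous_intros continuous_on_compose2[OF c(2) pc]) auto
      qed (use r p in auto)
      also have "\<dots> \<le> (\<integral>\<^sup>+s. H (p s) \<partial>lborel)"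
        unfolding H_def by (intro nn_integral_mono ennreal_leI mult_left_mono component_le_norm_cart) auto
      finally show ?thesis .
    qed
    have ders: "((\<lambda>t. v3 t b c) has_vector_derivative axis 1 1) (at s)"
      "((\<lambda>t. v3 a t c) has_vector_derivative axis 2 1) (at s)"
      "((\<lambda>t. v3 a b t) has_vector_derivative axis 3 1) (at s)" for s
      unfolding v3_def by (auto intro!: derivative_eq_intros)
    show "ennreal (z (v3 a b c) ^ 4) \<le> (\<integral>\<^sup>+t. H (v3 t b c) \<partial>lborel)"
      by (rule gen[OF ders(1)]) (rule nb, simp)
    show "ennreal (z (v3 a b c) ^ 4) \<le> (\<integral>\<^sup>+t. H (v3 a t c) \<partial>lborel)"
      by (rule gen[OF ders(2)]) (rule nb, simp)
    show "ennreal (z (v3 a b c) ^ 4) \<le> (\<integral>\<^sup>+t. H (v3 a b t) \<partial>lborel)"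
      by (rule gen[OF ders(3)]) (rule nb, simp)
  qed
  have pt: "ennreal (z (v3 a b c) ^ 6) \<le> esq (\<integral>\<^sup>+t. H (v3 t b c) \<partial>lborel) * esq (\<integral>\<^sup>+t. H (v3 a t c) \<partial>lborel) *
      esq (\<integral>\<^sup>+t. H (v3 a b t) \<partial>lborel)" for a b c
  proof -
    have "(ennreal (z (v3 a b c) ^ 6))\<^sup>2 = ennreal (z (v3 a b c) ^ 4) * ennreal (z (v3 a b c) ^ 4) * ennreal (z (v3 a b c) ^ 4)"
      by (simp add: ennreal_power flip: ennreal_mult power_add power_mult)
    also have "\<dots> \<le> (\<integral>\<^sup>+t. H (v3 t b c) \<partial>lborel) * (\<integral>\<^sup>+t. H (v3 a t c) \<partial>lborel) * (\<integral>\<^sup>+t. H (v3 a b t) \<partial>lborel)"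
      by (intro mult_mono line) auto
    finally show ?thesis unfolding esq_mult[symmetric] by (rule esq_le)
  qed
  have "ennreal i = (\<integral>\<^sup>+a. \<integral>\<^sup>+b. \<integral>\<^sup>+c. ennreal (z (v3 a b c) ^ 6) \<partial>lborel \<partial>lborel \<partial>lborel)"
    unfolding ii[symmetric] by (rule nn_integral_v3) measurable
  also have "\<dots> \<le> (\<integral>\<^sup>+a. \<integral>\<^sup>+b. \<integral>\<^sup>+c. esq (\<integral>\<^sup>+t. H (v3 t b c) \<partial>lborel) * esq (\<integral>\<^sup>+t. H (v3 a t c) \<partial>lborel) *
      esq (\<integral>\<^sup>+t. H (v3 a b t) \<partial>lborel) \<partial>lborel \<partial>lborel \<partial>lborel)"
    by (intro nn_integral_mono pt)
  finally have "(ennreal i)\<^sup>2 \<le> (\<integral>\<^sup>+a. \<integral>\<^sup>+b. \<integral>\<^sup>+c. esq (\<integral>\<^sup>+t. H (v3 t b c) \<partial>lborel) * esq (\<integral>\<^sup>+t. H (v3 a t c) \<partial>lborel) *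
      esq (\<integral>\<^sup>+t. H (v3 a b t) \<partial>lborel) \<partial>lborel \<partial>lborel \<partial>lborel)\<^sup>2" by (rule power_mono) simp
  also have "\<dots> \<le> K ^ 3" unfolding K_def by (rule Loomis_Whitney[OF Hm])
  finally have iK: "(ennreal i)\<^sup>2 \<le> K ^ 3" .
  have "K\<^sup>2 = (\<integral>\<^sup>+x. ennreal (4 * \<bar>z x\<bar> ^ 3) * ennreal (norm (D x)) \<partial>lborel)\<^sup>2"
    unfolding K_def H_def by (simp add: ennreal_mult)
  also have "\<dots> \<le> (\<integral>\<^sup>+x. (ennreal (4 * \<bar>z x\<bar> ^ 3))\<^sup>2 \<partial>lborel) * (\<integral>\<^sup>+x. (ennreal (norm (D x)))\<^sup>2 \<partial>lborel)"
    by (rule Cauchy_Schwarz_nn_integral) measurable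
  also have "(\<integral>\<^sup>+x. (ennreal (4 * \<bar>z x\<bar> ^ 3))\<^sup>2 \<partial>lborel) = (\<integral>\<^sup>+x. ennreal 16 * ennreal (z x ^ 6) \<partial>lborel)"
  proof (rule nn_integral_cong)
    fix x
    have "(4 * \<bar>z x\<bar> ^ 3)\<^sup>2 = 16 * z x ^ 6"
      by (simp add: power_mult_distrib flip: power_mult)
    then show "(ennreal (4 * \<bar>z x\<bar> ^ 3))\<^sup>2 = ennreal 16 * ennreal (z x ^ 6)"
      by (simp add: ennreal_power ennreal_mult'')
  qed
  also have "\<dots> = ennreal (16 * i)"
    by (subst nn_integral_cmult) (use i0 in \<open>auto simp: ii ennreal_mult\<close>)
  also have "(\<integral>\<^sup>+x. (ennreal (norm (D x)))\<^sup>2 \<partial>lborel) = ennreal (Dsq D)"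
    using dd by (simp add: ennreal_power)
  finally have K2: "K\<^sup>2 \<le> ennreal (16 * i * Dsq D)" using i0 by (simp add: ennreal_mult)
  then have "K \<noteq> top" by (auto simp: power2_eq_square top_unique)
  then obtain k where k: "K = ennreal k" "k \<ge> 0" by (cases K) auto
  have k2: "k\<^sup>2 \<le> 16 * i * Dsq D" using K2 k i0 by (simp add: ennreal_power)
  have ik: "i\<^sup>2 \<le> k ^ 3" using iK k i0 by (simp add: ennreal_power)
  have "i ^ 4 = (i\<^sup>2)\<^sup>2" by (simp flip: power_mult)
  also have "\<dots> \<le> (k ^ 3)\<^sup>2" by (rule power_mono[OF ik]) simp
  also have "\<dots> = (k\<^sup>2) ^ 3" by (simp flip: power_mult)
  also have "\<dots> \<le> (16 * i * Dsq D) ^ 3" by (rule power_mono[OF k2]) simp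
  also have "\<dots> = i ^ 3 * (4096 * Dsq D ^ 3)" by (simp add: power_mult_distrib)
  finally have f: "i ^ 3 * i \<le> i ^ 3 * (4096 * Dsq D ^ 3)" by (simp add: power4_eq_xxxx power3_eq_cube mult.assoc)
  have "i \<le> 4096 * Dsq D ^ 3"
  proof (cases "i = 0")
    case False
    then have "i ^ 3 > 0" using i0 by simp
    then show ?thesis using f by (simp add: mult_le_cancel_left_pos)
  qed simp
  then show ?thesis by (simp add: i_def)
qed

text \<open>Only the upper bounds \<open>c n\<close> have to converge, not the integrals themselves.
  This fits the applications, where an energy bounds the integral.\<close>

lemma Fatou_bound:
  fixes us :: "nat \<Rightarrow> 'a \<Rightarrow> real"
  assumes i: "\<And>n. integrable M (us n)" and nn: "\<And>n. AE x in M. 0 \<le> us n x"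
    and u: "u \<in> borel_measurable M" "AE x in M. (\<lambda>n. us n x) \<longlonglongrightarrow> u x"
    and b: "\<And>n. (\<integral>x. us n x \<partial>M) \<le> c n" "c \<longlonglongrightarrow> C"
  shows "integrable M u" "(\<integral>x. u x \<partial>M) \<le> C" "AE x in M. 0 \<le> u x"
proof -
  have all: "AE x in M. \<forall>n. 0 \<le> us n x" using nn by (simp add: AE_all_countable)
  show pos: "AE x in M. 0 \<le> u x" using u(2) all
    by eventually_elim (auto intro: LIMSEQ_le_const)
  have c0: "c n \<ge> 0" for n using order_trans[OF integral_nonneg_AE[OF nn] b(1)] .
  have C0: "C \<ge> 0" by (rule LIMSEQ_le_const[OF b(2)]) (use c0 in auto)
  have "(\<integral>\<^sup>+x. ennreal (u x) \<partial>M) = (\<integral>\<^sup>+x. liminf (\<lambda>n. ennreal (us n x)) \<partial>M)"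
  proof (rule nn_integral_cong_AE)
    show "AE x in M. ennreal (u x) = liminf (\<lambda>n. ennreal (us n x))" using u(2)
    proof eventually_elim
      case (elim x)
      have "(\<lambda>n. ennreal (us n x)) \<longlonglongrightarrow> ennreal (u x)" using elim by (rule tendsto_ennrealI)
      then show ?case by (simp add: lim_imp_Liminf)
    qed
  qed
  also have "\<dots> \<le> liminf (\<lambda>n. \<integral>\<^sup>+x. ennreal (us n x) \<partial>M)"
    by (rule nn_integral_liminf) (use i in auto)
  also have "\<dots> \<le> liminf (\<lambda>n. ennreal (c n))"
  proof (rule Liminf_mono, rule always_eventually, rule allI)
    fix n
    show "(\<integral>\<^sup>+x. ennreal (us n x) \<partial>M) \<le> ennreal (c n)"
      unfolding nn_integral_eq_integral[OF i nn] by (rule ennreal_leI[OF b(1)])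
  qed
  also have "\<dots> = ennreal C" by (rule lim_imp_Liminf) (auto intro: tendsto_ennrealI b(2))
  finally have le: "(\<integral>\<^sup>+x. ennreal (u x) \<partial>M) \<le> ennreal C" .
  show iu: "integrable M u"
    by (rule integrableI_nonneg[OF u(1) pos]) (use le in \<open>auto intro: le_less_trans\<close>)
  show "(\<integral>x. u x \<partial>M) \<le> C" using le C0 unfolding nn_integral_eq_integral[OF iu pos] by simp
qed

lemma L2lim_Dsq:
  assumes "\<And>i. L2lim (\<lambda>n x. D n x $ i) (\<lambda>x. g x $ i)"
  shows "(\<lambda>n. Dsq (D n)) \<longlonglongrightarrow> Dsq g"
  unfolding Dsq_def by (intro tendsto_sum L2lim_norm[OF assms])

lemma Sobolev:
  assumes u: "wg u g"
  shows "integrable lebesgue (\<lambda>x. u x ^ 6)" "(\<integral>x. u x ^ 6 \<partial>lebesgue) \<le> 4096 * Dsq g ^ 3"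
proof -
  obtain z D where z: "\<And>n. C1c (z n) (D n)" "L2lim z u" "\<And>i. L2lim (\<lambda>n x. D n x $ i) (\<lambda>x. g x $ i)"
    using wg_approx[OF u] by metis
  obtain r where r: "strict_mono r" "AE x in lebesgue. (\<lambda>n. z (r n) x) \<longlonglongrightarrow> u x"
    using L2lim_AE_subseq[OF z(2)] by blast
  have i: "integrable lebesgue (\<lambda>x. z n x ^ 6)" for n
  proof -
    obtain R where R: "R > 0" "\<And>x. norm x > R \<Longrightarrow> z n x = 0" "\<And>x. norm x > R \<Longrightarrow> D n x = 0"
      using C1c_obtain[OF z(1)] by blast
    show ?thesis by (rule power6_integrable_continuous[OF C1_continuous(1)[OF C1c_imp_C1[OF z(1)]] R(2)])
  qed
  have um: "(\<lambda>x. u x ^ 6) \<in> borel_measurable lebesgue" using L2_meas[OF wgD(1)[OF u]] by simp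
  have c: "(\<lambda>n. 4096 * Dsq (D (r n)) ^ 3) \<longlonglongrightarrow> 4096 * Dsq g ^ 3"
    using LIMSEQ_subseq_LIMSEQ[OF L2lim_Dsq[of D g, OF z(3)] r(1)] by (intro tendsto_intros) (simp add: o_def)
  have l: "AE x in lebesgue. (\<lambda>n. z (r n) x ^ 6) \<longlonglongrightarrow> u x ^ 6"
    using r(2) by eventually_elim (rule tendsto_power)
  show "integrable lebesgue (\<lambda>x. u x ^ 6)" "(\<integral>x. u x ^ 6 \<partial>lebesgue) \<le> 4096 * Dsq g ^ 3"
    using Fatou_bound[OF i[of "r _"] _ um l Sobolev_C1c[OF z(1)] c] by auto
qed

section \<open>Compactness\<close>

lemma le_add_square_div:
  fixes d s :: real assumes "s > 0" shows "\<bar>d\<bar> \<le> s + d\<^sup>2 / s"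
proof (cases "\<bar>d\<bar> \<le> s")
  case True
  then show ?thesis using assms by (simp add: add_increasing2)
next
  case False
  then have "\<bar>d\<bar> * s \<le> \<bar>d\<bar> * \<bar>d\<bar>" by (intro mult_left_mono) auto
  then have "\<bar>d\<bar> \<le> d\<^sup>2 / s" using assms by (simp add: pos_le_divide_eq power2_eq_square)
  then show ?thesis using assms by linarith
qed

text \<open>Riesz-Fischer. The square of a difference controls the difference itself through
  \<open>\<bar>d\<bar> \<le> s + d\<^sup>2 / s\<close> with \<open>s = (1/2) ^ k\<close>. The rate
  \<open>(1/8) ^ k\<close> leaves \<open>(1/4) ^ k\<close> after multiplication by
  \<open>2 ^ k\<close>, so both series converge almost everywhere although the space has infinite
  measure.\<close>

lemma L2_complete:
  assumes L: "\<And>n. L2 (ws n)"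
    and C: "\<And>\<epsilon>. \<epsilon> > 0 \<Longrightarrow> \<exists>N. \<forall>m\<ge>N. \<forall>n\<ge>N. n2 (\<lambda>x. ws m x - ws n x) \<le> \<epsilon>"
  obtains w where "L2lim ws w"
proof -
  have "\<forall>k. \<exists>N. \<forall>m\<ge>N. \<forall>n\<ge>N. n2 (\<lambda>x. ws m x - ws n x) \<le> (1/8) ^ k"
    by (intro allI C) simp
  from choice[OF this] obtain N where N: "\<And>k m n. m \<ge> N k \<Longrightarrow> n \<ge> N k \<Longrightarrow> n2 (\<lambda>x. ws m x - ws n x) \<le> (1/8) ^ k"
    by blast
  \<comment> \<open>The sum of all thresholds up to \<open>k\<close> makes \<open>r\<close> strictly
    increasing and keeps both \<open>r k\<close> and \<open>r (Suc k)\<close> beyond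
    \<open>N k\<close>.\<close>
  define r where "r k = k + (\<Sum>j\<le>k. N j)" for k
  have rN: "r k \<ge> N k" "r (Suc k) \<ge> N k" "r k \<ge> k" for k
    using member_le_sum[of k "{..k}" N] by (auto simp: r_def)
  have sr: "strict_mono r" by (rule strict_monoI_Suc) (simp add: r_def)
  define d where "d k x = ws (r (Suc k)) x - ws (r k) x" for k x
  have dL: "L2 (d k)" for k unfolding d_def[abs_def] by (intro L2_diff L)
  have dn: "n2 (d k) \<le> (1/8) ^ k" for k unfolding d_def[abs_def] by (rule N) (rule rN)+
  define S where "S k x = 2 ^ k * (d k x)\<^sup>2" for k x
  have Si: "integrable lebesgue (S k)" for k unfolding S_def using L2_int[OF dL] by simp
  have Sle: "(\<integral>x. S k x \<partial>lebesgue) \<le> (1/4) ^ k" for k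
  proof -
    have "(\<integral>x. S k x \<partial>lebesgue) = 2 ^ k * n2 (d k)" by (simp add: S_def n2_def)
    also have "\<dots> \<le> 2 ^ k * (1/8) ^ k" by (rule mult_left_mono[OF dn]) simp
    also have "\<dots> = (1/4) ^ k" by (simp flip: power_mult_distrib)
    finally show ?thesis .
  qed
  have "(\<integral>\<^sup>+x. (\<Sum>k. ennreal (S k x)) \<partial>lebesgue) = (\<Sum>k. \<integral>\<^sup>+x. ennreal (S k x) \<partial>lebesgue)"
    by (rule nn_integral_suminf) (use borel_measurable_integrable[OF Si] in auto)
  also have "\<dots> = (\<Sum>k. ennreal (\<integral>x. S k x \<partial>lebesgue))"
    by (intro suminf_cong nn_integral_eq_integral Si) (auto simp: S_def)
  also have "\<dots> \<le> (\<Sum>k. ennreal ((1/4) ^ k))"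
    by (intro suminf_le ennreal_leI Sle) auto
  also have "\<dots> = ennreal (\<Sum>k. (1/4) ^ k)"
    by (rule suminf_ennreal2) (auto intro: summable_geometric)
  also have "\<dots> < \<infinity>" by simp
  finally have fin: "(\<integral>\<^sup>+x. (\<Sum>k. ennreal (S k x)) \<partial>lebesgue) \<noteq> \<infinity>" by simp
  have "AE x in lebesgue. (\<Sum>k. ennreal (S k x)) \<noteq> \<infinity>"
    by (rule nn_integral_PInf_AE[OF _ fin]) (use borel_measurable_integrable[OF Si] in auto)
  then have conv: "AE x in lebesgue. convergent (\<lambda>k. ws (r k) x)"
  proof eventually_elim
    case (elim x)
    have sS: "summable (\<lambda>k. S k x)" by (rule summable_suminf_not_top) (use elim in \<open>auto simp: S_def\<close>)
    have "summable (\<lambda>k. d k x)"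
    proof (rule summable_comparison_test[OF _ summable_add[OF summable_geometric[of "1/2::real"] sS]])
      have "norm (d k x) \<le> (1/2) ^ k + S k x" for k
        using le_add_square_div[of "(1/2)^k" "d k x"] by (simp add: S_def power_divide mult.commute)
      then show "\<exists>N. \<forall>n\<ge>N. norm (d n x) \<le> (1/2) ^ n + S n x" by blast
    qed simp
    then have "convergent (\<lambda>n. \<Sum>k<n. d k x)" by (simp add: summable_iff_convergent)
    then have "convergent (\<lambda>n. ws (r 0) x + (\<Sum>k<n. d k x))" by (intro convergent_add convergent_const)
    moreover have "ws (r 0) x + (\<Sum>k<n. d k x) = ws (r n) x" for n
      unfolding d_def by (induction n) auto
    ultimately show ?case by simp
  qed
  define w where "w x = lim (\<lambda>k. ws (r k) x)" for x
  have wm: "w \<in> borel_measurable lebesgue" unfolding w_def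
    by (rule borel_measurable_lim_metric) (rule L2_meas[OF L])
  have wl: "AE x in lebesgue. (\<lambda>k. ws (r k) x) \<longlonglongrightarrow> w x"
    using conv by eventually_elim (simp add: w_def convergent_LIMSEQ_iff)
  \<comment> \<open>Fatou in the second index only: the Cauchy bound survives when one member is
    replaced by the almost everywhere limit. The shift by \<open>K\<close> puts the subsequence into
    the range of that bound.\<close>
  have key: "L2 (\<lambda>x. ws n x - w x) \<and> n2 (\<lambda>x. ws n x - w x) \<le> \<epsilon>"
    if n: "n \<ge> K" and K: "\<forall>m\<ge>K. \<forall>n\<ge>K. n2 (\<lambda>x. ws m x - ws n x) \<le> \<epsilon>" for n K \<epsilon>
  proof -
    have i: "integrable lebesgue (\<lambda>x. (ws n x - ws (r (k + K)) x)\<^sup>2)" for k by (rule L2_int[OF L2_diff[OF L L]])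
    have m: "(\<lambda>x. (ws n x - w x)\<^sup>2) \<in> borel_measurable lebesgue" using wm L2_meas[OF L[of n]] by simp
    have l: "AE x in lebesgue. (\<lambda>k. (ws n x - ws (r (k + K)) x)\<^sup>2) \<longlonglongrightarrow> (ws n x - w x)\<^sup>2"
      using wl
    proof eventually_elim
      case (elim x)
      then have "(\<lambda>k. ws (r (k + K)) x) \<longlonglongrightarrow> w x" by (rule LIMSEQ_ignore_initial_segment)
      then show ?case by (intro tendsto_intros)
    qed
    have b: "(\<integral>x. (ws n x - ws (r (k + K)) x)\<^sup>2 \<partial>lebesgue) \<le> \<epsilon>" for k
      using K n rN(3)[of "k + K"] unfolding n2_def by auto
    have f: "integrable lebesgue (\<lambda>x. (ws n x - w x)\<^sup>2)" "(\<integral>x. (ws n x - w x)\<^sup>2 \<partial>lebesgue) \<le> \<epsilon>"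
      using Fatou_bound(1,2)[OF i _ m l b tendsto_const] by auto
    then show ?thesis using wm L2_meas[OF L[of n]] by (auto simp: L2_def n2_def)
  qed
  obtain K where K: "\<forall>m\<ge>K. \<forall>n\<ge>K. n2 (\<lambda>x. ws m x - ws n x) \<le> 1" using C[of 1] by auto
  have wL: "L2 w" using L2_diff[OF L[of K] conjunct1[OF key[OF order_refl K]]] by simp
  have "(\<lambda>n. n2 (\<lambda>x. ws n x - w x)) \<longlonglongrightarrow> 0"
  proof (rule LIMSEQ_I)
    fix \<epsilon> :: real assume e: "\<epsilon> > 0"
    obtain K where K: "\<forall>m\<ge>K. \<forall>n\<ge>K. n2 (\<lambda>x. ws m x - ws n x) \<le> \<epsilon> / 2" using C[of "\<epsilon>/2"] e by auto
    have "norm (n2 (\<lambda>x. ws n x - w x) - 0) < \<epsilon>" if "n \<ge> K" for n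
      using conjunct2[OF key[OF that K]] e by simp
    then show "\<exists>no. \<forall>n\<ge>no. norm (n2 (\<lambda>x. ws n x - w x) - 0) < \<epsilon>" by blast
  qed
  then have "L2lim ws w" using L wL by (simp add: L2lim_def)
  then show thesis using that by blast
qed

section \<open>The mollification error\<close>

lemma integral_unit_square_le:
  fixes f :: "real \<Rightarrow> real"
  assumes "continuous_on UNIV f"
  shows "(\<integral>t. indicator {0..1} t * f t \<partial>lborel)\<^sup>2 \<le> (\<integral>t. indicator {0..1} t * (f t)\<^sup>2 \<partial>lborel)"
proof -
  define I where "I = (\<integral>t. indicator {0..1} t * f t \<partial>lborel)"
  have i: "integrable lborel (\<lambda>t. indicator {0..1::real} t * h t)" if "continuous_on UNIV h" for h :: "real \<Rightarrow> real"
    using borel_integrable_compact[of "{0..1::real}" h] continuous_on_subset[OF that] by auto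
  have eq: "indicator {0..1} t * (f t - I)\<^sup>2 = indicator {0..1} t * (f t)\<^sup>2 - 2 * I * (indicator {0..1} t * f t) + I\<^sup>2 * (indicator {0..1::real} t * 1)" for t
    by (simp add: power2_eq_square algebra_simps)
  have "0 \<le> (\<integral>t. indicator {0..1} t * (f t - I)\<^sup>2 \<partial>lborel)"
    by (intro Bochner_Integration.integral_nonneg) simp
  also have "\<dots> = (\<integral>t. indicator {0..1} t * (f t)\<^sup>2 \<partial>lborel) - 2 * I * I + I\<^sup>2 * 1"
    unfolding eq using i[OF assms] i[OF continuous_on_power[OF assms, of 2]] i[OF continuous_on_const, of 1]
    by (simp add: I_def)
  finally show ?thesis by (simp add: I_def power2_eq_square)
qed

lemma segment_square_le:
  fixes z :: "real^'n::finite \<Rightarrow> real"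
  assumes z: "C1 z D"
  shows "(z x - z (x - y))\<^sup>2 \<le> (norm y)\<^sup>2 * (\<integral>t. indicator {0..1} t * (norm (D (x - t *\<^sub>R y)))\<^sup>2 \<partial>lborel)"
proof -
  note c = C1_continuous[OF z]
  have pc: "continuous_on UNIV (\<lambda>t::real. D (x - t *\<^sub>R y))"
    by (rule continuous_on_compose2[OF c(2)]) (auto intro!: continuous_intros)
  have d: "((\<lambda>t. z (x - t *\<^sub>R y)) has_real_derivative - (D (x - t *\<^sub>R y) \<bullet> y)) (at t)" for t
  proof -
    have "((\<lambda>t. x - t *\<^sub>R y) has_derivative (\<lambda>h. - (h *\<^sub>R y))) (at t)"
      by (auto intro!: derivative_eq_intros)
    then have "((\<lambda>t. z (x - t *\<^sub>R y)) has_derivative (\<lambda>h. D (x - t *\<^sub>R y) \<bullet> (- (h *\<^sub>R y)))) (at t)"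
      by (rule has_derivative_compose) (use z in \<open>simp add: C1_def\<close>)
    moreover have "(\<lambda>h. D (x - t *\<^sub>R y) \<bullet> (- (h *\<^sub>R y))) = (*) (- (D (x - t *\<^sub>R y) \<bullet> y))"
      by (rule ext) simp
    ultimately show ?thesis unfolding has_field_derivative_def by (simp only:)
  qed
  define f where "f t = D (x - t *\<^sub>R y) \<bullet> y" for t
  have fc: "continuous_on UNIV f" unfolding f_def by (intro continuous_intros pc)
  have "(\<integral>t. (- f t) * indicator {0..1} t \<partial>lborel) = z (x - 1 *\<^sub>R y) - z (x - 0 *\<^sub>R y)"
    by (rule integral_FTC_Icc_real)
      (use d fc in \<open>auto simp: f_def continuous_on_eq_continuous_at\<close>)
  then have e: "z x - z (x - y) = (\<integral>t. indicator {0..1} t * f t \<partial>lborel)"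
    by (simp add: mult.commute)
  have i: "integrable lborel (\<lambda>t. indicator {0..1::real} t * h t)" if "continuous_on UNIV h" for h :: "real \<Rightarrow> real"
    using borel_integrable_compact[of "{0..1::real}" h] continuous_on_subset[OF that] by auto
  have "(z x - z (x - y))\<^sup>2 \<le> (\<integral>t. indicator {0..1} t * (f t)\<^sup>2 \<partial>lborel)"
    unfolding e by (rule integral_unit_square_le[OF fc])
  also have "\<dots> \<le> (\<integral>t. (norm y)\<^sup>2 * (indicator {0..1} t * (norm (D (x - t *\<^sub>R y)))\<^sup>2) \<partial>lborel)"
  proof (rule integral_mono)
    show "integrable lborel (\<lambda>t. indicator {0..1} t * (f t)\<^sup>2)" by (rule i) (intro continuous_intros fc)
    show "integrable lborel (\<lambda>t. (norm y)\<^sup>2 * (indicator {0..1} t * (norm (D (x - t *\<^sub>R y)))\<^sup>2))"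
      by (intro integrable_mult_right i continuous_intros pc)
    fix t :: real
    have "\<bar>f t\<bar>\<^sup>2 \<le> (norm (D (x - t *\<^sub>R y)) * norm y)\<^sup>2"
      unfolding f_def by (intro power_mono Cauchy_Schwarz_ineq2) simp
    then show "indicator {0..1} t * (f t)\<^sup>2 \<le> (norm y)\<^sup>2 * (indicator {0..1} t * (norm (D (x - t *\<^sub>R y)))\<^sup>2)"
      by (auto simp: indicator_def power_mult_distrib mult.commute)
  qed
  finally show ?thesis by simp
qed

text \<open>Jensen turns the error into an average of \<open>(z x - z (x - y))\<^sup>2\<close> over
  \<open>norm y < e\<close>, and each of these is bounded along the segment by
  \<open>segment_square_le\<close>. By translation invariance the integral over \<open>x\<close> of
  the squared gradient at \<open>x - t *\<^sub>R y\<close> is \<open>Dsq D\<close> for all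
  \<open>t\<close> and \<open>y\<close>.\<close>

lemma mollify_error_C1c:
  assumes z: "C1c z D" and e: "e > 0"
  shows "n2 (\<lambda>x. z x - conv e z x) \<le> e\<^sup>2 * Dsq D"
proof -
  note z1 = C1c_imp_C1[OF z]
  note c = C1_continuous[OF z1]
  have L: "L2 z" by (rule C1c_L2[OF z])
  have [measurable]: "z \<in> borel_measurable borel" "D \<in> borel_measurable borel" "rho e \<in> borel_measurable (borel :: (real^3) measure)"
    using c rho_continuous by (auto intro: borel_measurable_continuous_onI)
  have rm: "rho e \<in> borel_measurable (lebesgue :: (real^3) measure)"
    by (rule continuous_measurable_lebesgue[OF rho_continuous])
  have rs: "integrable lebesgue (\<lambda>y. rho e (x - y))" "(\<integral>y. rho e (x - y) \<partial>lebesgue) = 1" for x :: "real^3"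
    using lebesgue_shift(4)[OF rm, of x] lebesgue_shift(6)[OF rm, of x] rho_integrable[OF e] rho_integral[OF e] by auto
  have r1: "(\<integral>\<^sup>+y. ennreal (rho e (y::real^3)) \<partial>lborel) = 1"
    using nn_integral_eq_integral[OF rho_integrable[OF e, where 'n=3]] rho_integral[OF e, where 'n=3]
    by (simp add: nn_integral_completion rho_nonneg[OF e])
  define \<Psi> where "\<Psi> x y t = ennreal (rho e y * e\<^sup>2 * indicator {0..1::real} t) * ennreal ((norm (D (x - t *\<^sub>R y)))\<^sup>2)"
    for x y :: "real^3" and t
  have [measurable (raw)]: "(\<lambda>w. \<Psi> (f w) (g w) (h w)) \<in> borel_measurable M"
    if "f \<in> borel_measurable M" "g \<in> borel_measurable M" "h \<in> borel_measurable M" for f g h and M :: "'m measure"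
    using that unfolding \<Psi>_def by measurable
  have pt: "ennreal ((z x - conv e z x)\<^sup>2) \<le> (\<integral>\<^sup>+y. \<integral>\<^sup>+t. \<Psi> x y t \<partial>lborel \<partial>lborel)" for x
  proof -
    have kc: "continuous_on UNIV (\<lambda>y. z x - z y)" by (intro continuous_intros c)
    have li: "loc_int (\<lambda>y. z x - z y)" "loc_int (\<lambda>y. (z x - z y)\<^sup>2)"
    proof -
      have "loc_int h" if "continuous_on UNIV h" for h :: "real^3 \<Rightarrow> real"
        unfolding loc_int_def
      proof (intro conjI allI continuous_measurable_lebesgue[OF that])
        fix R
        have "integrable lborel (\<lambda>x. indicator (cball 0 R) x *\<^sub>R h x)"
          by (rule borel_integrable_compact) (auto intro: continuous_on_subset[OF that])
        then have "integrable lebesgue (\<lambda>x. indicator (cball 0 R) x *\<^sub>R h x)"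
          by (subst integrable_completion) (auto dest: borel_measurable_integrable)
        then show "integrable lebesgue (\<lambda>x. indicat_real (cball 0 R) x * h x)" by simp
      qed
      then show "loc_int (\<lambda>y. z x - z y)" "loc_int (\<lambda>y. (z x - z y)\<^sup>2)"
        using kc continuous_on_power[OF kc, of 2] by blast+
    qed
    have "z x - conv e z x = (\<integral>y. (z x - z y) * rho e (x - y) \<partial>lebesgue)"
      using rs[of x] rho_conv_integrable[OF e L2_loc_int[OF L], of x] by (simp add: ck_def left_diff_distrib)
    then have "(z x - conv e z x)\<^sup>2 \<le> (\<integral>y. (z x - z y)\<^sup>2 * rho e (x - y) \<partial>lebesgue)"
      using rho_Jensen[OF e rho_conv_integrable[OF e li(1)] rho_conv_integrable[OF e li(2)], of x] by simp
    also have "\<dots> = (\<integral>y. (z x - z (x - y))\<^sup>2 * rho e y \<partial>lebesgue)"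
    proof -
      have "(\<lambda>y. (z x - z y)\<^sup>2 * rho e (x - y)) \<in> borel_measurable lebesgue"
        using rho_conv_integrable[OF e li(2)] by (rule borel_measurable_integrable)
      from lebesgue_shift(6)[OF this, of x] show ?thesis by simp
    qed
    finally have 1: "ennreal ((z x - conv e z x)\<^sup>2) \<le> ennreal (\<integral>y. (z x - z (x - y))\<^sup>2 * rho e y \<partial>lebesgue)"
      by (rule ennreal_leI)
    have i: "integrable lebesgue (\<lambda>y. (z x - z (x - y))\<^sup>2 * rho e y)"
      using lebesgue_shift(4)[OF borel_measurable_integrable[OF rho_conv_integrable[OF e li(2), of x]], of x]
        rho_conv_integrable[OF e li(2), of x] by simp
    note 1
    also have "ennreal (\<integral>y. (z x - z (x - y))\<^sup>2 * rho e y \<partial>lebesgue) = (\<integral>\<^sup>+y. ennreal ((z x - z (x - y))\<^sup>2 * rho e y) \<partial>lborel)"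
      using nn_integral_eq_integral[OF i] by (simp add: nn_integral_completion rho_nonneg[OF e])
    also have "\<dots> \<le> (\<integral>\<^sup>+y. \<integral>\<^sup>+t. \<Psi> x y t \<partial>lborel \<partial>lborel)"
    proof (rule nn_integral_mono)
      fix y :: "real^3"
      have pc: "continuous_on UNIV (\<lambda>t::real. D (x - t *\<^sub>R y))"
        by (rule continuous_on_compose2[OF c(2)]) (auto intro!: continuous_intros)
      have it: "integrable lborel (\<lambda>t. indicator {0..1::real} t * (norm (D (x - t *\<^sub>R y)))\<^sup>2)"
        using borel_integrable_compact[of "{0..1::real}" "\<lambda>t. (norm (D (x - t *\<^sub>R y)))\<^sup>2"]
          continuous_on_subset[OF continuous_on_power[OF continuous_on_norm[OF pc], of 2]] by auto
      define T where "T = (\<integral>t. indicator {0..1::real} t * (norm (D (x - t *\<^sub>R y)))\<^sup>2 \<partial>lborel)"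
      have T0: "T \<ge> 0" unfolding T_def by (intro Bochner_Integration.integral_nonneg) simp
      have "(z x - z (x - y))\<^sup>2 * rho e y \<le> rho e y * e\<^sup>2 * T"
      proof (cases "norm y < e")
        case True
        have "(z x - z (x - y))\<^sup>2 \<le> (norm y)\<^sup>2 * T" unfolding T_def by (rule segment_square_le[OF z1])
        also have "\<dots> \<le> e\<^sup>2 * T" using True T0 by (intro mult_right_mono power_mono) auto
        finally have "rho e y * (z x - z (x - y))\<^sup>2 \<le> rho e y * (e\<^sup>2 * T)"
          by (intro mult_left_mono rho_nonneg e)
        then show ?thesis by (simp add: mult_ac)
      next
        case False
        then show ?thesis using rho_eq_0[OF e, of y] by simp
      qed
      then have "ennreal ((z x - z (x - y))\<^sup>2 * rho e y) \<le> ennreal (rho e y * e\<^sup>2) * ennreal T"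
        using T0 rho_nonneg[OF e, of y] by (simp add: ennreal_leI flip: ennreal_mult)
      also have "ennreal T = (\<integral>\<^sup>+t. ennreal (indicator {0..1::real} t * (norm (D (x - t *\<^sub>R y)))\<^sup>2) \<partial>lborel)"
        unfolding T_def by (rule nn_integral_eq_integral[OF it, symmetric]) simp
      also have "ennreal (rho e y * e\<^sup>2) * \<dots> = (\<integral>\<^sup>+t. ennreal (rho e y * e\<^sup>2) * ennreal (indicator {0..1::real} t * (norm (D (x - t *\<^sub>R y)))\<^sup>2) \<partial>lborel)"
        by (rule nn_integral_cmult[symmetric]) (use it in \<open>auto dest: borel_measurable_integrable\<close>)
      also have "\<dots> = (\<integral>\<^sup>+t. \<Psi> x y t \<partial>lborel)"
        using rho_nonneg[OF e, of y] unfolding \<Psi>_def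
        by (intro nn_integral_cong) (auto simp: indicator_def)
      finally show "ennreal ((z x - z (x - y))\<^sup>2 * rho e y) \<le> (\<integral>\<^sup>+t. \<Psi> x y t \<partial>lborel)" .
    qed
    finally show ?thesis .
  qed
  have Dm: "(\<lambda>x. (norm (D x))\<^sup>2) \<in> borel_measurable lebesgue"
    by (intro continuous_measurable_lebesgue continuous_intros c)
  have sh: "(\<integral>\<^sup>+x. ennreal ((norm (D (x - t)))\<^sup>2) \<partial>lborel) = ennreal (Dsq D)" for t
  proof -
    have i: "integrable lebesgue (\<lambda>x. (norm (D (x + (- t))))\<^sup>2)"
      using lebesgue_shift(3)[OF Dm, of "- t"] Dsq_integral(1)[OF C1c_L2(2)[OF z]] by simp
    have "(\<integral>\<^sup>+x. ennreal ((norm (D (x + (- t))))\<^sup>2) \<partial>lebesgue) = ennreal (Dsq D)"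
      using nn_integral_eq_integral[OF i] lebesgue_shift(5)[OF Dm, of "- t"] Dsq_integral(2)[OF C1c_L2(2)[OF z]] by simp
    then show ?thesis by (simp add: nn_integral_completion)
  qed
  have "(\<integral>\<^sup>+x. ennreal ((z x - conv e z x)\<^sup>2) \<partial>lborel) \<le> (\<integral>\<^sup>+x. \<integral>\<^sup>+y. \<integral>\<^sup>+t. \<Psi> x y t \<partial>lborel \<partial>lborel \<partial>lborel)"
    by (intro nn_integral_mono pt)
  also have "\<dots> = (\<integral>\<^sup>+y. \<integral>\<^sup>+x. \<integral>\<^sup>+t. \<Psi> x y t \<partial>lborel \<partial>lborel \<partial>lborel)"
    by (rule lborel_pair.Fubini'[symmetric]) measurable
  also have "\<dots> = (\<integral>\<^sup>+y. \<integral>\<^sup>+t. \<integral>\<^sup>+x. \<Psi> x y t \<partial>lborel \<partial>lborel \<partial>lborel)"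
  proof (rule nn_integral_cong)
    fix y :: "real^3"
    show "(\<integral>\<^sup>+x. \<integral>\<^sup>+t. \<Psi> x y t \<partial>lborel \<partial>lborel) = (\<integral>\<^sup>+t. \<integral>\<^sup>+x. \<Psi> x y t \<partial>lborel \<partial>lborel)"
      by (rule lborel_pair.Fubini'[symmetric]) (unfold \<Psi>_def, measurable)
  qed
  also have "\<dots> = (\<integral>\<^sup>+y. \<integral>\<^sup>+t. ennreal (rho e (y::real^3) * e\<^sup>2 * indicator {0..1::real} t) * ennreal (Dsq D) \<partial>lborel \<partial>lborel)"
    unfolding \<Psi>_def by (intro nn_integral_cong) (subst nn_integral_cmult, measurable, simp add: sh)
  also have "\<dots> = (\<integral>\<^sup>+y. ennreal (rho e (y::real^3)) * (ennreal (e\<^sup>2) * ennreal (Dsq D)) \<partial>lborel)"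
  proof (rule nn_integral_cong)
    fix y :: "real^3"
    have "(\<integral>\<^sup>+t. ennreal (rho e y * e\<^sup>2 * indicator {0..1::real} t) * ennreal (Dsq D) \<partial>lborel) =
        (\<integral>\<^sup>+t. (ennreal (rho e y) * (ennreal (e\<^sup>2) * ennreal (Dsq D))) * indicator {0..1::real} t \<partial>lborel)"
      using rho_nonneg[OF e, of y]
      by (intro nn_integral_cong) (auto simp: indicator_def ennreal_mult mult.assoc)
    also have "\<dots> = ennreal (rho e y) * (ennreal (e\<^sup>2) * ennreal (Dsq D))"
      by (subst nn_integral_cmult_indicator) auto
    finally show "(\<integral>\<^sup>+t. ennreal (rho e y * e\<^sup>2 * indicator {0..1::real} t) * ennreal (Dsq D) \<partial>lborel) =
        ennreal (rho e y) * (ennreal (e\<^sup>2) * ennreal (Dsq D))" .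
  qed
  also have "\<dots> = ennreal (e\<^sup>2) * ennreal (Dsq D)"
    by (subst nn_integral_multc) (auto simp: r1)
  also have "\<dots> = ennreal (e\<^sup>2 * Dsq D)" by (simp add: ennreal_mult)
  finally have le: "(\<integral>\<^sup>+x. ennreal ((z x - conv e z x)\<^sup>2) \<partial>lborel) \<le> ennreal (e\<^sup>2 * Dsq D)" .
  have i: "integrable lebesgue (\<lambda>x. (z x - conv e z x)\<^sup>2)"
    by (rule L2_int[OF L2_diff[OF L conv_n2_le(1)[OF e L]]])
  show ?thesis
    using le nn_integral_eq_integral[OF i] by (simp add: n2_def nn_integral_completion)
qed

lemma mollify_error:
  assumes u: "wg u g" and e: "e > 0"
  shows "n2 (\<lambda>x. u x - conv e u x) \<le> e\<^sup>2 * Dsq g"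
proof -
  obtain z D where z: "\<And>n. C1c (z n) (D n)" "L2lim z u" "\<And>i. L2lim (\<lambda>n x. D n x $ i) (\<lambda>x. g x $ i)"
    using wg_approx[OF u] by metis
  note D = L2limD[OF z(2)]
  have lc: "L2lim (\<lambda>n. conv e (z n)) (conv e u)"
  proof (rule L2lim_bound)
    show "L2 (conv e (z n))" "L2 (conv e u)" for n using conv_n2_le(1)[OF e] D by auto
    show "n2 (\<lambda>x. conv e (z n) x - conv e u x) \<le> n2 (\<lambda>x. z n x - u x)" for n
    proof -
      have "(\<lambda>x. conv e (z n) x - conv e u x) = conv e (\<lambda>x. z n x - u x)"
        by (rule ext) (simp add: conv_diff[OF e L2_loc_int[OF D(1)] L2_loc_int[OF D(2)]])
      then show ?thesis using conv_n2_le(2)[OF e L2_diff[OF D(1)[of n] D(2)]] by simp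
    qed
  qed (rule D(3))
  have "(\<lambda>n. n2 (\<lambda>x. z n x - conv e (z n) x)) \<longlonglongrightarrow> n2 (\<lambda>x. u x - conv e u x)"
    by (rule L2lim_norm[OF L2lim_diff[OF z(2) lc]])
  moreover have "(\<lambda>n. e\<^sup>2 * Dsq (D n)) \<longlonglongrightarrow> e\<^sup>2 * Dsq g"
    by (intro tendsto_intros L2lim_Dsq z)
  ultimately show ?thesis
    by (rule LIMSEQ_le) (use mollify_error_C1c[OF z(1) e] in auto)
qed

text \<open>At a fixed scale the bound involves only \<open>n2 u\<close>, hence it is uniform along
  bounded sequences. The estimate is \<open>2 * a * b \<le> a\<^sup>2 + b\<^sup>2\<close> under the
  integral.\<close>

lemma conv_abs_bound:
  assumes u: "L2 u" and e: "e > 0" shows "\<bar>conv e u x\<bar> \<le> n2 u + n2 (rho e)"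
proof -
  have c: "continuous_on UNIV (\<lambda>y. rho e (x - y))"
    by (rule continuous_on_compose2[OF rho_continuous]) (auto intro!: continuous_intros)
  have L: "L2 (rho e)" by (rule L2_continuous_support[OF rho_continuous, of e]) (simp add: rho_eq_0[OF e])
  have rL: "L2 (\<lambda>y. rho e (x - y))"
    using lebesgue_shift(2)[OF L2_meas[OF L], of x] lebesgue_shift(4)[of "\<lambda>y. (rho e y)\<^sup>2" x] L by (auto simp: L2_def)
  have n: "n2 (\<lambda>y. rho e (x - y)) = n2 (rho e)"
    unfolding n2_def by (rule lebesgue_shift(6)) (use L in \<open>auto simp: L2_def\<close>)
  have "\<bar>conv e u x\<bar> \<le> (\<integral>y. (u y)\<^sup>2 + (rho e (x - y))\<^sup>2 \<partial>lebesgue)"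
    unfolding ck_def
  proof (rule integral_abs_bound_integral)
    show "integrable lebesgue (\<lambda>y. u y * rho e (x - y))" by (rule L2_mult_integrable[OF u rL])
    show "integrable lebesgue (\<lambda>y. (u y)\<^sup>2 + (rho e (x - y))\<^sup>2)" using L2_int[OF u] L2_int[OF rL] by simp
    fix y
    have "2 * (\<bar>u y\<bar> * \<bar>rho e (x - y)\<bar>) \<le> (u y)\<^sup>2 + (rho e (x - y))\<^sup>2"
      using sum_squares_bound[of "\<bar>u y\<bar>" "\<bar>rho e (x - y)\<bar>"] by (simp add: mult.assoc)
    moreover have "0 \<le> \<bar>u y\<bar> * \<bar>rho e (x - y)\<bar>" by simp
    ultimately show "\<bar>u y * rho e (x - y)\<bar> \<le> (u y)\<^sup>2 + (rho e (x - y))\<^sup>2" unfolding abs_mult by linarith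
  qed
  also have "\<dots> = n2 u + n2 (rho e)" unfolding n[symmetric] unfolding n2_def
    by (rule Bochner_Integration.integral_add[OF L2_int[OF u] L2_int[OF rL]])
  finally show ?thesis .
qed

text \<open>\<open>conv_abs_bound\<close> applied to the three components of the gradient, one
  factor \<open>3\<close> for their sum. A sequence bounded in energy is thus equicontinuous after
  mollification at a fixed scale.\<close>

lemma conv_Lipschitz:
  assumes u: "wg u g" and e: "e > 0" and M: "Dsq g \<le> M"
  shows "\<bar>conv e u x - conv e u y\<bar> \<le> 3 * (M + n2 (rho e)) * norm (x - y)"
proof -
  define B where "B = M + n2 (rho e)"
  have gi: "\<bar>conv e (\<lambda>y. g y $ i) x\<bar> \<le> B" for i x
  proof -
    have "n2 (\<lambda>y. g y $ i) \<le> Dsq g" unfolding Dsq_def by (rule member_le_sum) auto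
    then show ?thesis using conv_abs_bound[OF wgD(2)[OF u] e, of i x] M by (simp add: B_def)
  qed
  have "norm (conv e u x - conv e u y) \<le> (3 * B) * norm (x - y)"
  proof (rule differentiable_bound[where S = UNIV and f' = "\<lambda>x h. (\<chi> i. conv e (\<lambda>y. g y $ i) x) \<bullet> h"])
    fix x
    show "(conv e u has_derivative (\<bullet>) (\<chi> i. conv e (\<lambda>y. g y $ i) x)) (at x within UNIV)"
      using conv_C1[OF u e] by (simp add: C1_def)
    have "norm (\<chi> i. conv e (\<lambda>y. g y $ i) x) \<le> (\<Sum>i\<in>UNIV. \<bar>(\<chi> i. conv e (\<lambda>y. g y $ i) x) $ i\<bar>)"
      by (rule norm_le_l1_cart)
    also have "\<dots> \<le> (\<Sum>i\<in>(UNIV::3 set). B)" using gi by (intro sum_mono) simp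
    finally have n: "norm (\<chi> i. conv e (\<lambda>y. g y $ i) x) \<le> 3 * B" by simp
    show "onorm ((\<bullet>) (\<chi> i. conv e (\<lambda>y. g y $ i) x)) \<le> 3 * B"
    proof (rule onorm_bound)
      show "0 \<le> 3 * B" using n norm_ge_zero order_trans by blast
      fix h
      show "norm ((\<chi> i. conv e (\<lambda>y. g y $ i) x) \<bullet> h) \<le> 3 * B * norm h"
        using Cauchy_Schwarz_ineq2[of "\<chi> i. conv e (\<lambda>y. g y $ i) x" h] mult_right_mono[OF n norm_ge_zero[of h]]
        by simp
    qed
  qed auto
  then show ?thesis by (simp add: B_def)
qed

section \<open>Almost everywhere convergent subsequences\<close>

lemma diagonal_subsequence:
  fixes f :: "nat \<Rightarrow> nat \<Rightarrow> real"
  assumes b: "\<And>i n. \<bar>f i n\<bar> \<le> B i"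
  obtains r where "strict_mono r" "\<And>i. convergent (\<lambda>n. f i (r n))"
proof -
  interpret subseqs "\<lambda>i s. convergent (\<lambda>n. f i (s n))"
  proof
    fix i :: nat and s :: "nat \<Rightarrow> nat" assume "strict_mono s"
    have "\<forall>n. f i (s n) \<in> {- B i..B i}" using b by (auto simp: abs_le_iff minus_le_iff)
    moreover have "seq_compact {- B i..B i}" using compact_Icc compact_eq_seq_compact_metric by blast
    ultimately obtain l r where "strict_mono r" "((\<lambda>n. f i (s n)) \<circ> r) \<longlonglongrightarrow> l"
      using seq_compactE[of "{- B i..B i}" "\<lambda>n. f i (s n)"] by blast
    then show "\<exists>r. strict_mono r \<and> convergent (\<lambda>n. f i ((s \<circ> r) n))"
      by (auto simp: o_def convergent_def)
  qed
  have "convergent (\<lambda>n. f i (diagseq n))" for i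
  proof -
    \<comment> \<open>The diagonal sequence is controlled for index \<open>i\<close> only after its
      first \<open>Suc i\<close> terms, which do not affect convergence.\<close>
    have "convergent (\<lambda>n. f i ((diagseq \<circ> ((+) (Suc i))) n))"
    proof (rule diagseq_holds)
      fix r s :: "nat \<Rightarrow> nat" and n
      assume "strict_mono r" "convergent (\<lambda>k. f n (s k))"
      then show "convergent (\<lambda>k. f n ((s \<circ> r) k))"
        using convergent_subseq_convergent[of "\<lambda>k. f n (s k)" r] by (simp add: o_def)
    qed
    then have "convergent (\<lambda>n. f i (diagseq (n + Suc i)))" by (simp add: add.commute)
    then show ?thesis by (rule convergent_ignore_initial_segment[THEN iffD1])
  qed
  with subseq_diagseq that show thesis by blast
qed

text \<open>The common Lipschitz constant transfers the Cauchy property from a nearby point of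
  \<open>D\<close> to \<open>x\<close>.\<close>

lemma Lipschitz_dense_convergent:
  fixes f :: "nat \<Rightarrow> 'a::real_normed_vector \<Rightarrow> real"
  assumes lip: "\<And>n x y. \<bar>f n x - f n y\<bar> \<le> L * norm (x - y)"
    and dense: "\<And>X. open X \<Longrightarrow> X \<noteq> {} \<Longrightarrow> \<exists>d\<in>D. d \<in> X"
    and conv: "\<And>q. q \<in> D \<Longrightarrow> convergent (\<lambda>n. f n q)"
  shows "convergent (\<lambda>n. f n x)"
proof -
  have "Cauchy (\<lambda>n. f n x)"
  proof (rule metric_CauchyI)
    fix e :: real assume e: "e > 0"
    define d where "d = e / (3 * (\<bar>L\<bar> + 1))"
    have d: "d > 0" using e by (simp add: d_def)
    obtain q where q: "q \<in> D" "q \<in> ball x d" using dense[of "ball x d"] d by auto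
    obtain N where N: "\<And>m n. m \<ge> N \<Longrightarrow> n \<ge> N \<Longrightarrow> dist (f m q) (f n q) < e / 3"
      using convergent_Cauchy[OF conv[OF q(1)]] e unfolding Cauchy_def by (metis divide_pos_pos zero_less_numeral)
    have c: "\<bar>f n x - f n q\<bar> < e / 3" for n
    proof -
      have "\<bar>f n x - f n q\<bar> \<le> \<bar>L\<bar> * norm (x - q)"
        using lip[of n x q] mult_right_mono[OF abs_ge_self[of L] norm_ge_zero[of "x - q"]] by linarith
      also have "\<dots> \<le> \<bar>L\<bar> * d" using q by (intro mult_left_mono) (auto simp: dist_norm)
      also have "\<dots> < (\<bar>L\<bar> + 1) * d" using d by simp
      also have "\<dots> = e / 3" by (simp add: d_def field_simps)
      finally show ?thesis .
    qed
    have "dist (f m x) (f n x) < e" if "m \<ge> N" "n \<ge> N" for m n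
      using c[of m] c[of n] N[OF that] unfolding dist_real_def by linarith
    then show "\<exists>M. \<forall>m\<ge>M. \<forall>n\<ge>M. dist (f m x) (f n x) < e" by blast
  qed
  then show ?thesis by (simp add: Cauchy_convergent_iff)
qed

lemma positive_L2_weight:
  obtains \<kappa> :: "real^3 \<Rightarrow> real" where "L2 \<kappa>" "\<And>x. 0 < \<kappa> x" "\<And>x. \<kappa> x \<le> 1"
proof -
  obtain f :: "real^3 \<Rightarrow> real" where f: "f \<in> borel_measurable lborel" "\<And>x. 0 < f x" "\<And>x. f x \<le> 1" "integrable lborel f"
    using sigma_finite_measure.obtain_positive_integrable_function[OF sigma_finite_lborel] by blast
  show thesis
  proof (rule that[of "\<lambda>x. sqrt (f x)"])
    have "f \<in> borel_measurable lebesgue" using f(1) by (rule measurable_completion)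
    then show "L2 (\<lambda>x. sqrt (f x))"
      using f(4) f(2) integrable_completion[of f lborel] f(1) by (simp add: L2_def less_imp_le)
  qed (use f in auto)
qed

text \<open>Mollifications at each scale converge pointwise along a diagonal subsequence, and the
  mollification error is uniformly small. The weight makes the whole space have finite measure.\<close>
lemma Rellich_AE:
  fixes us :: "nat \<Rightarrow> real^3 \<Rightarrow> real"
  assumes u: "\<And>n. wg (us n) (gs n)" and n: "\<And>n. n2 (us n) \<le> M" and d: "\<And>n. Dsq (gs n) \<le> M"
  obtains r :: "nat \<Rightarrow> nat" and u where "strict_mono r" "u \<in> borel_measurable lebesgue" "AE x in lebesgue. (\<lambda>n. us (r n) x) \<longlonglongrightarrow> u x"
proof -
  obtain \<kappa> :: "real^3 \<Rightarrow> real" where k: "L2 \<kappa>" "\<And>x. 0 < \<kappa> x" "\<And>x. \<kappa> x \<le> 1"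
    using positive_L2_weight by blast
  note km = L2_meas[OF k(1)]
  have kb: "\<bar>\<kappa> x\<bar> \<le> 1" for x using k(2)[of x] k(3)[of x] by simp
  define e where "e j = inverse (real (Suc j))" for j
  have e: "e j > 0" for j by (simp add: e_def)
  define B where "B j = M + n2 (rho (e j))" for j
  have vb: "\<bar>conv (e j) (us n) x\<bar> \<le> B j" for j n x
    using conv_abs_bound[OF wgD(1)[OF u[of n]] e[of j], of x] n[of n] by (simp add: B_def)
  obtain D :: "(real^3) set" where D: "countable D" "\<And>X. open X \<Longrightarrow> X \<noteq> {} \<Longrightarrow> \<exists>d\<in>D. d \<in> X"
    using countable_dense_setE by blast
  define T where "T = (UNIV :: nat set) \<times> D"
  have Tc: "countable T" unfolding T_def using D(1) by simp
  have "D \<noteq> {}" using D(2)[of UNIV] by auto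
  then have Tn: "T \<noteq> {}" by (simp add: T_def)
  define f where "f i n = conv (e (fst (from_nat_into T i))) (us n) (snd (from_nat_into T i))" for i n
  obtain r where r: "strict_mono r" "\<And>i. convergent (\<lambda>n. f i (r n))"
    by (rule diagonal_subsequence[of f "\<lambda>i. B (fst (from_nat_into T i))"]) (auto simp: f_def vb)
  have "convergent (\<lambda>n. conv (e j) (us (r n)) q)" if "q \<in> D" for j q
  proof -
    have "(j, q) \<in> T" using that by (simp add: T_def)
    then obtain i where "from_nat_into T i = (j, q)" using from_nat_into_surj[OF Tc] by blast
    then show ?thesis using r(2)[of i] by (simp add: f_def)
  qed
  note qc = this
  have pc: "convergent (\<lambda>n. conv (e j) (us (r n)) x)" for j x
    by (rule Lipschitz_dense_convergent[where f = "\<lambda>n. conv (e j) (us (r n))", OF conv_Lipschitz[OF u e d] D(2) qc])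
  define w where "w j x = lim (\<lambda>n. conv (e j) (us (r n)) x)" for j x
  have wl: "(\<lambda>n. conv (e j) (us (r n)) x) \<longlonglongrightarrow> w j x" for j x
    using pc by (simp add: w_def convergent_LIMSEQ_iff)
  have vL: "L2 (conv (e j) (us n))" for j n by (rule conv_n2_le(1)[OF e wgD(1)[OF u]])
  have wm: "w j \<in> borel_measurable lebesgue" for j
    unfolding w_def by (rule borel_measurable_lim_metric) (rule L2_meas[OF vL])
  have lim: "L2lim (\<lambda>n x. \<kappa> x * conv (e j) (us (r n)) x) (\<lambda>x. \<kappa> x * w j x)" for j
  proof (rule L2lim_dominated)
    show "(\<lambda>x. \<kappa> x * conv (e j) (us (r n)) x) \<in> borel_measurable lebesgue" for n using km L2_meas[OF vL] by simp
    show "(\<lambda>x. \<kappa> x * w j x) \<in> borel_measurable lebesgue" using km wm by simp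
    show "L2 (\<lambda>x. B j * \<kappa> x)" by (rule L2_cmult[OF k(1)])
    have "\<bar>\<kappa> x * conv (e j) (us (r n)) x\<bar> \<le> \<bar>B j * \<kappa> x\<bar>" for n x
      using vb[of j "r n" x] mult_left_mono[OF order_trans[OF vb[of j "r n" x] abs_ge_self[of "B j"]], of "\<bar>\<kappa> x\<bar>"]
      by (simp add: abs_mult mult.commute)
    then show "AE x in lebesgue. \<bar>\<kappa> x * conv (e j) (us (r n)) x\<bar> \<le> \<bar>B j * \<kappa> x\<bar>" for n by simp
    show "AE x in lebesgue. (\<lambda>n. \<kappa> x * conv (e j) (us (r n)) x) \<longlonglongrightarrow> \<kappa> x * w j x"
      by (intro AE_I2 tendsto_intros wl)
  qed
  have uL: "L2 (\<lambda>x. \<kappa> x * us n x)" for n by (rule L2_bdd_mult[OF wgD(1)[OF u] km kb])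
  have M0: "M \<ge> 0" using n[of 0] n2_nonneg[of "us 0"] by linarith
  have err: "n2 (\<lambda>x. \<kappa> x * us n x - \<kappa> x * conv (e j) (us n) x) \<le> (e j)\<^sup>2 * M" for j n
  proof -
    have L: "L2 (\<lambda>x. us n x - conv (e j) (us n) x)" by (rule L2_diff[OF wgD(1)[OF u] vL])
    have "n2 (\<lambda>x. \<kappa> x * us n x - \<kappa> x * conv (e j) (us n) x) \<le> n2 (\<lambda>x. us n x - conv (e j) (us n) x)"
    proof (rule n2_mono[OF L])
      show "(\<lambda>x. \<kappa> x * us n x - \<kappa> x * conv (e j) (us n) x) \<in> borel_measurable lebesgue"
        using km L2_meas[OF vL] L2_meas[OF wgD(1)[OF u]] by simp
      have "\<bar>\<kappa> x * us n x - \<kappa> x * conv (e j) (us n) x\<bar> \<le> 1 * \<bar>us n x - conv (e j) (us n) x\<bar>" for x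
        unfolding right_diff_distrib[symmetric] abs_mult by (rule mult_right_mono[OF kb]) simp
      then show "AE x in lebesgue. \<bar>\<kappa> x * us n x - \<kappa> x * conv (e j) (us n) x\<bar> \<le> \<bar>us n x - conv (e j) (us n) x\<bar>" by simp
    qed
    also have "\<dots> \<le> (e j)\<^sup>2 * Dsq (gs n)" by (rule mollify_error[OF u e])
    also have "\<dots> \<le> (e j)\<^sup>2 * M" by (rule mult_left_mono[OF d]) simp
    finally show ?thesis .
  qed
  have ex: "\<exists>N. \<forall>m\<ge>N. \<forall>n\<ge>N. n2 (\<lambda>x. \<kappa> x * us (r m) x - \<kappa> x * us (r n) x) \<le> \<epsilon>" if \<epsilon>: "\<epsilon> > 0" for \<epsilon>
  proof -
    have "(\<lambda>j. (e j)\<^sup>2 * M) \<longlonglongrightarrow> 0\<^sup>2 * M"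
      unfolding e_def by (intro tendsto_intros LIMSEQ_inverse_real_of_nat)
    then have "\<forall>\<^sub>F j in sequentially. (e j)\<^sup>2 * M < \<epsilon> / 16" using \<epsilon> by (intro order_tendstoD(2)) auto
    \<comment> \<open>Two errors below \<open>\<epsilon> / 16\<close> add up to less than
      \<open>\<epsilon> / 4\<close> by \<open>n2_triangle\<close>, and two of these to less than
      \<open>\<epsilon>\<close>. The scale \<open>j\<close> is fixed before the index
      \<open>N\<close>, as the mollification error is uniform in \<open>n\<close>.\<close>
    then obtain j where j: "(e j)\<^sup>2 * M < \<epsilon> / 16" by (auto dest: eventually_happens)
    have "\<forall>\<^sub>F n in sequentially. n2 (\<lambda>x. \<kappa> x * conv (e j) (us (r n)) x - \<kappa> x * w j x) < \<epsilon> / 16"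
      by (rule order_tendstoD(2)[OF L2limD(3)[OF lim]]) (use \<epsilon> in simp)
    then obtain N where N: "\<And>n. n \<ge> N \<Longrightarrow> n2 (\<lambda>x. \<kappa> x * conv (e j) (us (r n)) x - \<kappa> x * w j x) < \<epsilon> / 16"
      by (auto simp: eventually_sequentially)
    note wL = L2limD(2)[OF lim, of j] and cL = L2limD(1)[OF lim, of j]
    have a: "n2 (\<lambda>x. \<kappa> x * us (r n) x - \<kappa> x * w j x) < \<epsilon> / 4" if "n \<ge> N" for n
      using n2_triangle[OF uL[of "r n"] cL[of n] wL] err[of "r n" j] N[OF that] j by linarith
    have "n2 (\<lambda>x. \<kappa> x * us (r m) x - \<kappa> x * us (r n) x) \<le> \<epsilon>" if "m \<ge> N" "n \<ge> N" for m n
      using n2_triangle[OF uL[of "r m"] wL uL[of "r n"]] a[OF that(1)] a[OF that(2)]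
        n2_commute[of "\<lambda>x. \<kappa> x * w j x" "\<lambda>x. \<kappa> x * us (r n) x"] by linarith
    then show ?thesis by blast
  qed
  obtain W where W: "L2lim (\<lambda>n x. \<kappa> x * us (r n) x) W"
    by (rule L2_complete[of "\<lambda>n x. \<kappa> x * us (r n) x", OF uL ex])
  obtain s where s: "strict_mono s" "AE x in lebesgue. (\<lambda>n. \<kappa> x * us (r (s n)) x) \<longlonglongrightarrow> W x"
    using L2lim_AE_subseq[OF W] by blast
  show thesis
  proof (rule that[of "r \<circ> s" "\<lambda>x. W x / \<kappa> x"])
    show "strict_mono (r \<circ> s)" by (rule strict_mono_o[OF r(1) s(1)])
    show "(\<lambda>x. W x / \<kappa> x) \<in> borel_measurable lebesgue" using km L2_meas[OF L2limD(2)[OF W]] by simp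
    show "AE x in lebesgue. (\<lambda>n. us ((r \<circ> s) n) x) \<longlonglongrightarrow> W x / \<kappa> x"
      using s(2)
    proof eventually_elim
      case (elim x)
      have "(\<lambda>n. \<kappa> x * us (r (s n)) x / \<kappa> x) \<longlonglongrightarrow> W x / \<kappa> x"
        by (intro tendsto_divide elim tendsto_const) (use k(2)[of x] in simp)
      then show ?case using k(2)[of x] by simp
    qed
  qed
qed

text \<open>The truncation argument of Brezis and Lieb: \<open>max 0 (w - \<tau> q)\<close> is dominated.\<close>
lemma Brezis_Lieb_limit:
  fixes w q :: "nat \<Rightarrow> 'a \<Rightarrow> real"
  assumes w: "\<And>n. w n \<in> borel_measurable M" "\<And>n x. 0 \<le> w n x" "AE x in M. (\<lambda>n. w n x) \<longlonglongrightarrow> 0"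
    and q: "\<And>n. integrable M (q n)" "\<And>n x. 0 \<le> q n x" "\<And>n. (\<integral>x. q n x \<partial>M) \<le> C"
    and B: "\<And>\<tau>. \<tau> > 0 \<Longrightarrow> \<exists>B. integrable M B \<and> (\<forall>n x. w n x \<le> \<tau> * q n x + B x)"
  shows "integrable M (w n)" "(\<lambda>n. \<integral>x. w n x \<partial>M) \<longlonglongrightarrow> 0"
proof -
  have wi: "integrable M (w n)" for n
  proof -
    obtain B1 where B1: "integrable M B1" "\<forall>n x. w n x \<le> 1 * q n x + B1 x" using B[of 1] by auto
    show ?thesis
    proof (rule Bochner_Integration.integrable_bound)
      show "integrable M (\<lambda>x. q n x + B1 x)" using q(1) B1(1) by simp
      have "norm (w n x) \<le> norm (q n x + B1 x)" for x
        using B1(2)[rule_format, of n x] w(2)[of n x] by simp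
      then show "AE x in M. norm (w n x) \<le> norm (q n x + B1 x)" by simp
    qed (rule w(1))
  qed
  then show "integrable M (w n)" .
  have C0: "C \<ge> 0" using order_trans[OF Bochner_Integration.integral_nonneg q(3)[of 0]] q(2) by blast
  show "(\<lambda>n. \<integral>x. w n x \<partial>M) \<longlonglongrightarrow> 0"
  proof (rule LIMSEQ_I)
    fix \<epsilon> :: real assume \<epsilon>: "\<epsilon> > 0"
    define \<tau> where "\<tau> = \<epsilon> / (2 * (C + 1))"
    have \<tau>: "\<tau> > 0" using \<epsilon> C0 by (simp add: \<tau>_def)
    obtain Bt where Bt: "integrable M Bt" "\<And>n x. w n x \<le> \<tau> * q n x + Bt x" using B[OF \<tau>] by blast
    define m where "m n x = max 0 (w n x - \<tau> * q n x)" for n x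
    have mm: "m n \<in> borel_measurable M" for n
      unfolding m_def using w(1)[of n] borel_measurable_integrable[OF q(1)[of n]] by measurable
    have mb: "norm (m n x) \<le> \<bar>Bt x\<bar>" for n x using Bt(2)[of n x] by (auto simp: m_def)
    have ml: "AE x in M. (\<lambda>n. m n x) \<longlonglongrightarrow> 0" using w(3)
    proof eventually_elim
      case (elim x)
      show ?case
      proof (rule tendsto_sandwich[OF _ _ tendsto_const elim])
        show "\<forall>\<^sub>F n in sequentially. m n x \<le> w n x"
        proof (rule always_eventually, rule allI)
          fix n show "m n x \<le> w n x"
            using w(2)[of n x] mult_nonneg_nonneg[OF less_imp_le[OF \<tau>] q(2)[of n x]] by (simp add: m_def)
        qed
      qed (simp add: m_def)
    qed
    have mi: "integrable M (m n)" for n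
      by (rule Bochner_Integration.integrable_bound[OF integrable_abs[OF Bt(1)] mm]) (use mb in auto)
    have "(\<lambda>n. \<integral>x. m n x \<partial>M) \<longlonglongrightarrow> (\<integral>x. 0 \<partial>M)"
      by (rule integral_dominated_convergence[OF _ mm integrable_abs[OF Bt(1)] ml]) (use mb in auto)
    then have "\<forall>\<^sub>F n in sequentially. (\<integral>x. m n x \<partial>M) < \<epsilon> / 2" using \<epsilon> by (intro order_tendstoD(2)) auto
    then obtain N where N: "\<And>n. n \<ge> N \<Longrightarrow> (\<integral>x. m n x \<partial>M) < \<epsilon> / 2" by (auto simp: eventually_sequentially)
    have "norm ((\<integral>x. w n x \<partial>M) - 0) < \<epsilon>" if "n \<ge> N" for n
    proof -
      have "(\<integral>x. w n x \<partial>M) \<le> (\<integral>x. m n x + \<tau> * q n x \<partial>M)"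
      proof (rule integral_mono[OF wi])
        show "integrable M (\<lambda>x. m n x + \<tau> * q n x)" using mi q(1) by simp
        show "w n x \<le> m n x + \<tau> * q n x" for x by (simp add: m_def)
      qed
      also have "\<dots> = (\<integral>x. m n x \<partial>M) + \<tau> * (\<integral>x. q n x \<partial>M)" using mi q(1) by simp
      also have "\<dots> \<le> (\<integral>x. m n x \<partial>M) + \<tau> * C" using q(3)[of n] \<tau> by simp
      also have "\<tau> * C \<le> \<epsilon> / 2" using \<epsilon> C0 by (simp add: \<tau>_def field_simps)
      finally have "(\<integral>x. w n x \<partial>M) < \<epsilon>" using N[OF that] by simp
      moreover have "(\<integral>x. w n x \<partial>M) \<ge> 0" by (intro Bochner_Integration.integral_nonneg w(2))
      ultimately show ?thesis by simp
    qed
    then show "\<exists>no. \<forall>n\<ge>no. norm ((\<integral>x. w n x \<partial>M) - 0) < \<epsilon>" by blast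
  qed
qed

text \<open>Dyadic convex combinations of the tail from \<open>N\<close> on. Closure under midpoints
  is exactly what the parallelogram law uses, while bounds on \<open>n2\<close> and pointwise limits
  are inherited because balls and intervals are convex.\<close>

inductive_set mid :: "(nat \<Rightarrow> real^3 \<Rightarrow> real) \<Rightarrow> nat \<Rightarrow> (real^3 \<Rightarrow> real) set"
  for us :: "nat \<Rightarrow> real^3 \<Rightarrow> real" and N :: nat where
  base: "n \<ge> N \<Longrightarrow> us n \<in> mid us N"
| avg: "u \<in> mid us N \<Longrightarrow> v \<in> mid us N \<Longrightarrow> (\<lambda>x. (u x + v x) / 2) \<in> mid us N"

lemma mid_mono: "h \<in> mid us N \<Longrightarrow> M \<le> N \<Longrightarrow> h \<in> mid us M"
  by (induction rule: mid.induct) (auto intro: mid.intros)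

lemma wg_avg: "wg u g \<Longrightarrow> wg v h \<Longrightarrow> wg (\<lambda>x. (u x + v x) / 2) (\<lambda>x. (1/2) *\<^sub>R (g x + h x))"
  using wg_cmult[OF wg_add, of u g v h "1/2"] by simp

lemma mid_H1: "h \<in> mid us N \<Longrightarrow> (\<And>n. H1 (us n)) \<Longrightarrow> H1 h"
  by (induction rule: mid.induct) (auto intro: wg_H1[OF wg_avg[OF H1_wg H1_wg]])

lemma n2_avg_le: "L2 u \<Longrightarrow> L2 v \<Longrightarrow> n2 (\<lambda>x. (u x + v x) / 2) \<le> (n2 u + n2 v) / 2"
  using n2_add_le[of u v] n2_cmult[of "1/2" "\<lambda>x. u x + v x"] by (simp add: power2_eq_square)

lemma mid_n2:
  assumes "h \<in> mid us N" "\<And>n. L2 (us n)" "\<And>n. n2 (us n) \<le> M" shows "L2 h \<and> n2 h \<le> M"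
  using assms(1)
proof (induction rule: mid.induct)
  case (avg u v)
  then show ?case
    using n2_avg_le[of u v] L2_cmult[OF L2_add[of u v], of "1/2"] by auto
qed (use assms in auto)

lemma mid_AE_lim:
  assumes h: "\<And>N. h N \<in> mid us N" and l: "(\<lambda>n. us n x) \<longlonglongrightarrow> l"
  shows "(\<lambda>n. h n x) \<longlonglongrightarrow> l"
proof (rule LIMSEQ_I)
  fix e :: real assume e: "e > 0"
  obtain K where K: "\<And>n. n \<ge> K \<Longrightarrow> \<bar>us n x - l\<bar> \<le> e / 2"
    using LIMSEQ_D[OF l, of "e / 2"] e by (force simp: less_imp_le)
  have "\<bar>w x - l\<bar> \<le> e / 2" if "w \<in> mid us N" "N \<ge> K" for w N
    using that(1)
  proof (induction rule: mid.induct)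
    case (avg u v)
    show ?case using avg.IH unfolding abs_le_iff by (simp add: field_simps)
  qed (use K that(2) in auto)
  then have "norm (h n x - l) < e" if "n \<ge> K" for n using h[of n] that e by fastforce
  then show "\<exists>no. \<forall>n\<ge>no. norm (h n x - l) < e" by blast
qed

lemma Dsq_parallelogram:
  assumes "wg u g" "wg v h"
  shows "D12_sq (\<lambda>x. u x - v x) = 2 * D12_sq u + 2 * D12_sq v - 4 * D12_sq (\<lambda>x. (u x + v x) / 2)"
proof -
  have "Dsq (\<lambda>x. g x - h x) + 4 * Dsq (\<lambda>x. (1/2) *\<^sub>R (g x + h x)) = 2 * Dsq g + 2 * Dsq h"
  proof -
    have "n2 (\<lambda>x. (g x - h x) $ i) + 4 * n2 (\<lambda>x. ((1/2) *\<^sub>R (g x + h x)) $ i) = 2 * n2 (\<lambda>x. g x $ i) + 2 * n2 (\<lambda>x. h x $ i)" for i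
      using n2_parallelogram[OF wgD(2)[OF assms(1), of i] wgD(2)[OF assms(2), of i]]
        n2_cmult[of "1/2" "\<lambda>x. g x $ i + h x $ i"] by (simp add: power2_eq_square)
    then show ?thesis unfolding Dsq_def sum_distrib_left sum.distrib[symmetric] by simp
  qed
  then show ?thesis
    using D12_Dsq[OF assms(1)] D12_Dsq[OF assms(2)] D12_Dsq[OF wg_diff[OF assms]] D12_Dsq[OF wg_avg[OF assms]] by simp
qed

text \<open>A substitute for weak compactness: averages of minimal Dirichlet energy of the tails
  form a Cauchy sequence, by the parallelogram law.\<close>
lemma energy_averages:
  assumes u: "\<And>n. H1 (us n)" and d: "\<And>n. D12_sq (us n) \<le> d n" "d \<longlonglongrightarrow> d0"
  obtains h G where "\<And>N. h N \<in> mid us N" "\<And>i. L2lim (\<lambda>n x. grad (h n) x $ i) (\<lambda>x. G x $ i)" "Dsq G \<le> d0"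
proof -
  have nn: "D12_sq h \<ge> 0" for h unfolding D12_sq_def by (intro Bochner_Integration.integral_nonneg) simp
  define ep where "ep N = inverse (real (Suc N))" for N
  have ep: "ep \<longlonglongrightarrow> 0" "ep N > 0" "M \<ge> N \<Longrightarrow> ep M \<le> ep N" for M N
    using LIMSEQ_inverse_real_of_nat by (auto simp: ep_def[abs_def] intro: le_imp_inverse_le)
  define m where "m N = Inf (D12_sq ` mid us N)" for N
  have bdd: "bdd_below (D12_sq ` mid us N)" for N using nn by (auto intro!: bdd_belowI[of _ 0])
  have m_le: "m N \<le> D12_sq h" if "h \<in> mid us N" for N h
    unfolding m_def by (rule cInf_lower[OF _ bdd]) (use that in auto)
  have mne: "D12_sq ` mid us N \<noteq> {}" for N using mid.base[of N N us] by auto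
  \<comment> \<open>The tails shrink as \<open>N\<close> grows, so their infima increase; being
    bounded by \<open>d0\<close>, they converge.\<close>
  have m_mono: "m M \<le> m N" if "M \<le> N" for M N
    unfolding m_def[of N] by (rule cInf_greatest[OF mne]) (use m_le mid_mono that in blast)
  have m_d: "m N \<le> d0" for N
  proof (rule LIMSEQ_le_const[OF d(2)])
    show "\<exists>K. \<forall>n\<ge>K. m N \<le> d n"
      using order_trans[OF m_le[OF mid.base] d(1)] by blast
  qed
  obtain ms where ms: "m \<longlonglongrightarrow> ms" and m_ms: "\<And>N. m N \<le> ms"
    using incseq_convergent[of m d0] m_mono m_d by (auto simp: incseq_def)
  have "\<forall>N. \<exists>h. h \<in> mid us N \<and> D12_sq h < m N + ep N"
  proof
    fix N
    have "Inf (D12_sq ` mid us N) < m N + ep N" using ep(2)[of N] by (simp add: m_def)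
    then show "\<exists>h. h \<in> mid us N \<and> D12_sq h < m N + ep N"
      unfolding cInf_less_iff[OF mne bdd] by blast
  qed
  from choice[OF this] obtain h where h: "\<And>N. h N \<in> mid us N" "\<And>N. D12_sq (h N) < m N + ep N"
    by blast
  have hw: "wg (h N) (grad (h N))" for N by (rule H1_wg[OF mid_H1[OF h(1) u]])
  \<comment> \<open>The midpoint of two near-minimizers is again an average of the tail from
    \<open>K\<close> on, hence its energy is at least \<open>m K\<close>. In the parallelogram
    identity this leaves only the small excess for the difference.\<close>
  have dist: "D12_sq (\<lambda>x. h M x - h N x) \<le> 4 * (ms - m K) + 4 * ep K"
    if "M \<ge> K" "N \<ge> K" for K M N
  proof -
    have "(\<lambda>x. (h M x + h N x) / 2) \<in> mid us K"
      by (rule mid.avg) (use h(1) mid_mono that in blast)+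
    then have "m K \<le> D12_sq (\<lambda>x. (h M x + h N x) / 2)" by (rule m_le)
    moreover have "ep M \<le> ep K" "ep N \<le> ep K"
      using that by (auto intro: ep(3))
    ultimately show ?thesis
      using Dsq_parallelogram[OF hw hw, of M N] h(2)[of M] h(2)[of N] m_ms[of M] m_ms[of N] by argo
  qed
  have gdist: "n2 (\<lambda>x. grad (h M) x $ i - grad (h N) x $ i) \<le> D12_sq (\<lambda>x. h M x - h N x)" for M N i
    unfolding D12_Dsq[OF wg_diff[OF hw hw]] Dsq_def
    using member_le_sum[of i UNIV "\<lambda>i. n2 (\<lambda>x. (grad (h M) x - grad (h N) x) $ i)"] by simp
  have lim0: "(\<lambda>K. 4 * (ms - m K) + 4 * ep K) \<longlonglongrightarrow> 4 * (ms - ms) + 4 * 0"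
    by (intro tendsto_intros ms ep(1))
  have "\<exists>G. L2lim (\<lambda>n x. grad (h n) x $ i) G" for i
  proof -
    have "\<exists>N. \<forall>m\<ge>N. \<forall>n\<ge>N. n2 (\<lambda>x. grad (h m) x $ i - grad (h n) x $ i) \<le> \<epsilon>" if "\<epsilon> > 0" for \<epsilon>
    proof -
      have "\<forall>\<^sub>F K in sequentially. 4 * (ms - m K) + 4 * ep K < \<epsilon>"
        by (rule order_tendstoD(2)[OF lim0]) (use that in simp)
      then obtain K where "4 * (ms - m K) + 4 * ep K < \<epsilon>" by (auto dest: eventually_happens)
      then show ?thesis using gdist dist[of K] by (meson less_imp_le order_trans)
    qed
    then obtain w where "L2lim (\<lambda>n x. grad (h n) x $ i) w"
      by (rule L2_complete[of "\<lambda>n x. grad (h n) x $ i", OF wgD(2)[OF hw]])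
    then show ?thesis by blast
  qed
  then obtain Gi where Gi: "\<And>i. L2lim (\<lambda>n x. grad (h n) x $ i) (Gi i)" by metis
  define G where "G x = (\<chi> i. Gi i x)" for x
  have GL: "L2lim (\<lambda>n x. grad (h n) x $ i) (\<lambda>x. G x $ i)" for i using Gi[of i] by (simp add: G_def)
  have "Dsq G \<le> d0 + 0"
  proof (rule LIMSEQ_le[OF L2lim_Dsq[of "\<lambda>n. grad (h n)", OF GL] tendsto_add[OF tendsto_const ep(1)]])
    show "\<exists>N. \<forall>n\<ge>N. Dsq (grad (h n)) \<le> d0 + ep n"
    proof (intro exI[of _ 0] allI impI)
      fix n
      show "Dsq (grad (h n)) \<le> d0 + ep n"
        using D12_Dsq[OF hw, of n] h(2)[of n] m_d[of n] by linarith
    qed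
  qed
  then show thesis using that[OF h(1) GL] by simp
qed

text \<open>A bounded sequence with an almost everywhere limit converges weakly to it. The
  inequality \<open>\<bar>a\<bar> * \<bar>b\<bar> \<le> \<tau> * a\<^sup>2 + b\<^sup>2 /
  \<tau>\<close> provides the domination required by \<open>Brezis_Lieb_limit\<close>.\<close>

lemma weak_limit_L2:
  assumes h: "\<And>n. L2 (h n)" "\<And>n. n2 (h n) \<le> M" and u: "L2 u" "AE x in lebesgue. (\<lambda>n. h n x) \<longlonglongrightarrow> u x"
    and \<psi>: "L2 \<psi>"
  shows "(\<lambda>n. \<integral>x. h n x * \<psi> x \<partial>lebesgue) \<longlonglongrightarrow> (\<integral>x. u x * \<psi> x \<partial>lebesgue)"
proof -
  define w where "w n x = \<bar>h n x - u x\<bar> * \<bar>\<psi> x\<bar>" for n x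
  have w: "(\<lambda>n. \<integral>x. w n x \<partial>lebesgue) \<longlonglongrightarrow> 0" "integrable lebesgue (w n)" for n
  proof -
    have 1: "w n \<in> borel_measurable lebesgue" "0 \<le> w n x" for n x
      unfolding w_def using L2_meas[OF h(1)[of n]] L2_meas[OF u(1)] L2_meas[OF \<psi>] by auto
    have 2: "AE x in lebesgue. (\<lambda>n. w n x) \<longlonglongrightarrow> 0" using u(2)
    proof eventually_elim
      case (elim x)
      have "(\<lambda>n. \<bar>h n x - u x\<bar> * \<bar>\<psi> x\<bar>) \<longlonglongrightarrow> \<bar>u x - u x\<bar> * \<bar>\<psi> x\<bar>" by (intro tendsto_intros elim)
      then show ?case by (simp add: w_def)
    qed
    have 3: "integrable lebesgue (\<lambda>x. (h n x - u x)\<^sup>2)" for n by (rule L2_int[OF L2_diff[OF h(1) u(1)]])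
    have 4: "(\<integral>x. (h n x - u x)\<^sup>2 \<partial>lebesgue) \<le> 2 * M + 2 * n2 u" for n
      using n2_diff_le[OF h(1)[of n] u(1)] h(2)[of n] by (simp add: n2_def)
    have 5: "\<exists>B. integrable lebesgue B \<and> (\<forall>n x. w n x \<le> \<tau> * (h n x - u x)\<^sup>2 + B x)" if "\<tau> > 0" for \<tau>
    proof (intro exI conjI allI)
      show "integrable lebesgue (\<lambda>x. (\<psi> x)\<^sup>2 / \<tau>)" using L2_int[OF \<psi>] by simp
      fix n x
      have "\<bar>a\<bar> * \<bar>b\<bar> \<le> \<tau> * a\<^sup>2 + b\<^sup>2 / \<tau>" for a b :: real
      proof -
        have "2 * ((\<tau> * \<bar>a\<bar>) * \<bar>b\<bar>) \<le> (\<tau> * a)\<^sup>2 + b\<^sup>2"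
          using sum_squares_bound[of "\<tau> * \<bar>a\<bar>" "\<bar>b\<bar>"] by (simp add: power_mult_distrib mult.assoc)
        moreover have "0 \<le> (\<tau> * \<bar>a\<bar>) * \<bar>b\<bar>" using that by simp
        ultimately have "(\<tau> * \<bar>a\<bar>) * \<bar>b\<bar> \<le> (\<tau> * a)\<^sup>2 + b\<^sup>2" by linarith
        then show ?thesis using that by (simp add: field_simps power2_eq_square)
      qed
      then show "w n x \<le> \<tau> * (h n x - u x)\<^sup>2 + (\<psi> x)\<^sup>2 / \<tau>" by (simp add: w_def)
    qed
    show "(\<lambda>n. \<integral>x. w n x \<partial>lebesgue) \<longlonglongrightarrow> 0" "integrable lebesgue (w n)"
      using Brezis_Lieb_limit[OF 1 2 3 _ 4 5] by auto
  qed
  have "(\<lambda>n. (\<integral>x. h n x * \<psi> x \<partial>lebesgue) - (\<integral>x. u x * \<psi> x \<partial>lebesgue)) \<longlonglongrightarrow> 0"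
  proof (rule Lim_null_comparison[OF _ w(1)], rule always_eventually, rule allI)
    fix n
    have "(\<integral>x. h n x * \<psi> x \<partial>lebesgue) - (\<integral>x. u x * \<psi> x \<partial>lebesgue) = (\<integral>x. (h n x - u x) * \<psi> x \<partial>lebesgue)"
      using L2_mult_integrable[OF h(1)[of n] \<psi>] L2_mult_integrable[OF u(1) \<psi>] by (simp add: left_diff_distrib)
    then show "norm ((\<integral>x. h n x * \<psi> x \<partial>lebesgue) - (\<integral>x. u x * \<psi> x \<partial>lebesgue)) \<le> (\<integral>x. w n x \<partial>lebesgue)"
      using integral_abs_bound_integral[OF L2_mult_integrable[OF L2_diff[OF h(1)[of n] u(1)] \<psi>] w(2)[of n]]
      by (simp add: w_def abs_mult)
  qed
  then show ?thesis by (rule LIM_zero_cancel)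
qed

text \<open>The averages have the same almost everywhere limit as the sequence and strongly
  convergent gradients, so integration by parts passes to the limit and identifies \<open>G\<close>
  as a weak gradient of \<open>v\<close>.\<close>

lemma H1_lsc:
  assumes u: "\<And>n. H1 (us n)" and n: "\<And>n. n2 (us n) \<le> M" and d: "\<And>n. D12_sq (us n) \<le> d n" "d \<longlonglongrightarrow> d0"
    and l: "v \<in> borel_measurable lebesgue" "AE x in lebesgue. (\<lambda>n. us n x) \<longlonglongrightarrow> v x"
  obtains h G where "\<And>N. h N \<in> mid us N" "wg v G" "Dsq G \<le> d0" "\<And>i. L2lim (\<lambda>n x. grad (h n) x $ i) (\<lambda>x. G x $ i)"
    "AE x in lebesgue. (\<lambda>n. h n x) \<longlonglongrightarrow> v x"
proof -
  obtain h G where h: "\<And>N. h N \<in> mid us N" "\<And>i. L2lim (\<lambda>n x. grad (h n) x $ i) (\<lambda>x. G x $ i)" "Dsq G \<le> d0"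
    using energy_averages[of us d d0, OF u d] by metis
  have hw: "wg (h N) (grad (h N))" for N by (rule H1_wg[OF mid_H1[OF h(1) u]])
  have hl: "AE x in lebesgue. (\<lambda>n. h n x) \<longlonglongrightarrow> v x"
    using l(2) by eventually_elim (rule mid_AE_lim[OF h(1)])
  have uL: "L2 (us n)" for n using H1_wg[OF u] by (rule wgD)
  have hn: "L2 (h N)" "n2 (h N) \<le> M" for N using mid_n2[OF h(1) uL n] by auto
  have vL: "L2 v"
  proof -
    have l2: "AE x in lebesgue. (\<lambda>n. (us n x)\<^sup>2) \<longlonglongrightarrow> (v x)\<^sup>2"
      using l(2) by eventually_elim (rule tendsto_power)
    have "integrable lebesgue (\<lambda>x. (v x)\<^sup>2)"
      using Fatou_bound(1)[OF L2_int[OF uL] _ _ l2 n[unfolded n2_def] tendsto_const] l(1) by auto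
    then show ?thesis using l(1) by (simp add: L2_def)
  qed
  have "wg v G"
  proof (rule wgI[OF vL])
    show "L2 (\<lambda>x. G x $ i)" for i by (rule L2limD(2)[OF h(2)])
    fix \<phi> i assume t: "test_fun UNIV \<phi>"
    note C = test_fun_C1c[OF t]
    have "(\<lambda>n. \<integral>x. h n x * gr \<phi> x $ i \<partial>lebesgue) \<longlonglongrightarrow> (\<integral>x. v x * gr \<phi> x $ i \<partial>lebesgue)"
      by (rule weak_limit_L2[OF hn vL hl C1c_L2(2)[OF C]])
    moreover have "(\<lambda>n. - (\<integral>x. grad (h n) x $ i * \<phi> x \<partial>lebesgue)) \<longlonglongrightarrow> - (\<integral>x. G x $ i * \<phi> x \<partial>lebesgue)"
      by (rule tendsto_minus[OF L2lim_inner[OF h(2) L2lim_const[OF C1c_L2(1)[OF C]]]])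
    ultimately show "(\<integral>x. v x * gr \<phi> x $ i \<partial>lebesgue) = - (\<integral>x. G x $ i * \<phi> x \<partial>lebesgue)"
      unfolding wg_test[OF hw t] by (rule LIMSEQ_unique)
  qed
  then show thesis using that h hl by blast
qed

section \<open>Functions vanishing outside a smooth domain\<close>

lemma smooth_on_add:
  fixes f g :: "real^'n::finite \<Rightarrow> real"
  assumes "smooth_on UNIV f" "smooth_on UNIV g" shows "smooth_on UNIV (\<lambda>x. f x + g x)"
proof (rule smooth_on_coinduct[where F = "{\<lambda>x. f x + g x |f g. smooth_on UNIV f \<and> smooth_on UNIV g}"])
  show "(\<lambda>x. f x + g x) \<in> {\<lambda>x. f x + g x |f g. smooth_on UNIV f \<and> smooth_on UNIV g}"
    using assms by blast
  fix h :: "real^'n \<Rightarrow> real" and x i assume "h \<in> {\<lambda>x. f x + g x |f g. smooth_on UNIV f \<and> smooth_on UNIV g}"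
  then obtain f g where h: "h = (\<lambda>x. f x + g x)" and fg: "smooth_on UNIV f" "smooth_on UNIV g" by blast
  show "h differentiable (at x)" unfolding h
    using smooth_on_differentiable[OF fg(1)] smooth_on_differentiable[OF fg(2)] by (rule differentiable_add)
  have "partial i h = (\<lambda>x. partial i f x + partial i g x)"
  proof
    fix x
    have "(h has_derivative (\<lambda>t. gr f x \<bullet> t + gr g x \<bullet> t)) (at x)" unfolding h
      using smooth_on_C1[OF fg(1)] smooth_on_C1[OF fg(2)] by (intro has_derivative_add) (auto simp: C1_def)
    from partial_eq[OF this, of i] show "partial i h x = partial i f x + partial i g x"
      by (simp add: inner_axis gr_def)
  qed
  then show "partial i h \<in> {\<lambda>x. f x + g x |f g. smooth_on UNIV f \<and> smooth_on UNIV g}"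
    using smooth_on_partial[OF fg(1)] smooth_on_partial[OF fg(2)] by blast
qed

lemma C1_add: "C1 a A \<Longrightarrow> C1 b B \<Longrightarrow> C1 (\<lambda>x. a x + b x) (\<lambda>x. A x + B x)"
  unfolding C1_def
proof (intro conjI allI)
  assume *: "(\<forall>x. (a has_derivative (\<bullet>) (A x)) (at x)) \<and> continuous_on UNIV A"
    "(\<forall>x. (b has_derivative (\<bullet>) (B x)) (at x)) \<and> continuous_on UNIV B"
  show "((\<lambda>x. a x + b x) has_derivative (\<bullet>) (A x + B x)) (at x)" for x
    by (rule has_derivative_eq_rhs[OF has_derivative_add[of a "\<lambda>h. A x \<bullet> h" _ b "\<lambda>h. B x \<bullet> h"]])
      (use * in \<open>auto simp: inner_add_left\<close>)
  show "continuous_on UNIV (\<lambda>x. A x + B x)" using * by (intro continuous_intros) auto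
qed

lemma test_fun_add:
  assumes "test_fun U \<phi>" "test_fun U \<psi>"
  shows "test_fun U (\<lambda>x. \<phi> x + \<psi> x)" "gr (\<lambda>x. \<phi> x + \<psi> x) = (\<lambda>x. gr \<phi> x + gr \<psi> x)"
proof -
  show "test_fun U (\<lambda>x. \<phi> x + \<psi> x)"
    by (rule test_funI[of _ "tsupp \<phi> \<union> tsupp \<psi>"])
      (use assms in \<open>auto simp: test_fun_def test_fun_outside intro: smooth_on_add\<close>)
  show "gr (\<lambda>x. \<phi> x + \<psi> x) = (\<lambda>x. gr \<phi> x + gr \<psi> x)"
    by (rule gr_C1, rule C1_add) (use assms in \<open>auto simp: test_fun_def smooth_on_C1\<close>)
qed

section \<open>Zero boundary values\<close>

lemma D12_diff_sum:
  assumes "wg u g" "wg v h" shows "D12_sq (\<lambda>x. u x - v x) = (\<Sum>i\<in>UNIV. n2 (\<lambda>x. g x $ i - h x $ i))"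
  using D12_Dsq[OF wg_diff[OF assms]] by (simp add: Dsq_def)

lemma H10I:
  assumes w: "wg u g" and t: "\<And>n. test_fun \<Omega> (\<phi> n)"
    and l: "L2lim \<phi> u" "\<And>i. L2lim (\<lambda>n x. gr (\<phi> n) x $ i) (\<lambda>x. g x $ i)"
  shows "H10 \<Omega> u"
proof -
  have "(\<lambda>n. n2 (\<lambda>x. \<phi> n x - u x) + (\<Sum>i\<in>UNIV. n2 (\<lambda>x. gr (\<phi> n) x $ i - g x $ i))) \<longlonglongrightarrow> 0 + (\<Sum>i\<in>(UNIV::3 set). 0)"
    by (intro tendsto_add tendsto_sum L2limD(3) l)
  then have "(\<lambda>n. (\<integral>x. (\<phi> n x - u x)\<^sup>2 \<partial>lebesgue) + D12_sq (\<lambda>x. \<phi> n x - u x)) \<longlonglongrightarrow> 0"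
    by (simp add: D12_diff_sum[OF C1c_wg[OF test_fun_C1c[OF t]] w] n2_def)
  then show ?thesis unfolding H10_def using wg_H1[OF w] t by blast
qed

lemma H10_obtain:
  assumes "H10 \<Omega> u" "wg u g"
  obtains \<phi> where "\<And>n. test_fun \<Omega> (\<phi> n)" "L2lim \<phi> u" "\<And>i. L2lim (\<lambda>n x. gr (\<phi> n) x $ i) (\<lambda>x. g x $ i)"
proof -
  obtain \<phi> where p: "\<And>n. test_fun \<Omega> (\<phi> n)"
    "(\<lambda>n. (\<integral>x. (\<phi> n x - u x)\<^sup>2 \<partial>lebesgue) + D12_sq (\<lambda>x. \<phi> n x - u x)) \<longlonglongrightarrow> 0"
    using assms(1) unfolding H10_def by blast
  note C = test_fun_C1c[OF p(1)]
  define c where "c n = (\<integral>x. (\<phi> n x - u x)\<^sup>2 \<partial>lebesgue) + D12_sq (\<lambda>x. \<phi> n x - u x)" for n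
  have ceq: "c n = n2 (\<lambda>x. \<phi> n x - u x) + (\<Sum>i\<in>UNIV. n2 (\<lambda>x. gr (\<phi> n) x $ i - g x $ i))" for n
    unfolding c_def D12_diff_sum[OF C1c_wg[OF C] assms(2)] n2_def by simp
  have c0: "c \<longlonglongrightarrow> 0" using p(2) by (simp add: c_def[abs_def])
  have "n2 (\<lambda>x. gr (\<phi> n) x $ i - g x $ i) \<le> c n" for n i
    unfolding ceq using member_le_sum[of i UNIV "\<lambda>i. n2 (\<lambda>x. gr (\<phi> n) x $ i - g x $ i)"]
    by (intro add_increasing) auto
  then have "L2lim (\<lambda>n x. gr (\<phi> n) x $ i) (\<lambda>x. g x $ i)" for i
    by (intro L2lim_bound[where c = c] C1c_L2[OF C] wgD[OF assms(2)] c0)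
  moreover have "L2lim \<phi> u"
    by (rule L2lim_bound[where c = c]) (use C1c_L2[OF C] wgD[OF assms(2)] c0 in \<open>auto simp: ceq sum_nonneg\<close>)
  ultimately show thesis using that p(1) by blast
qed

lemma H10_H1: "H10 \<Omega> u \<Longrightarrow> H1 u" by (simp add: H10_def)

text \<open>For each \<open>n\<close> a test function within \<open>inverse (real (Suc n))\<close>
  of \<open>us n\<close>, in values and in all gradient components, is chosen; these test functions
  converge to the same limit.\<close>

lemma H10_closed:
  assumes H: "\<And>n. H10 \<Omega> (us n)" and w: "\<And>n. wg (us n) (gs n)"
    and l: "L2lim us u" "\<And>i. L2lim (\<lambda>n x. gs n x $ i) (\<lambda>x. g x $ i)"
  shows "H10 \<Omega> u"
proof -
  have wu: "wg u g" by (rule wg_closed[OF w l])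
  have "\<forall>n. \<exists>\<phi>. test_fun \<Omega> \<phi> \<and> n2 (\<lambda>x. \<phi> x - us n x) < inverse (real (Suc n)) \<and>
      (\<forall>i. n2 (\<lambda>x. gr \<phi> x $ i - gs n x $ i) < inverse (real (Suc n)))"
  proof
    fix n
    obtain \<phi> where p: "\<And>k. test_fun \<Omega> (\<phi> k)" "L2lim \<phi> (us n)" "\<And>i. L2lim (\<lambda>k x. gr (\<phi> k) x $ i) (\<lambda>x. gs n x $ i)"
      using H10_obtain[OF H w] by metis
    have pos: "inverse (real (Suc n)) > 0" by simp
    have "\<forall>\<^sub>F k in sequentially. n2 (\<lambda>x. \<phi> k x - us n x) < inverse (real (Suc n)) \<and>
      (\<forall>i. n2 (\<lambda>x. gr (\<phi> k) x $ i - gs n x $ i) < inverse (real (Suc n)))"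
      by (intro eventually_conj eventually_all_finite order_tendstoD(2)[OF L2limD(3)[OF p(2)] pos] order_tendstoD(2)[OF L2limD(3)[OF p(3)] pos])
    then obtain k where "n2 (\<lambda>x. \<phi> k x - us n x) < inverse (real (Suc n)) \<and>
      (\<forall>i. n2 (\<lambda>x. gr (\<phi> k) x $ i - gs n x $ i) < inverse (real (Suc n)))"
      by (auto dest: eventually_happens)
    then show "\<exists>\<phi>. test_fun \<Omega> \<phi> \<and> n2 (\<lambda>x. \<phi> x - us n x) < inverse (real (Suc n)) \<and>
      (\<forall>i. n2 (\<lambda>x. gr \<phi> x $ i - gs n x $ i) < inverse (real (Suc n)))" using p(1) by blast
  qed
  from choice[OF this] obtain \<phi> where p: "\<And>n. test_fun \<Omega> (\<phi> n)"
    "\<And>n. n2 (\<lambda>x. \<phi> n x - us n x) < inverse (real (Suc n))"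
    "\<And>n i. n2 (\<lambda>x. gr (\<phi> n) x $ i - gs n x $ i) < inverse (real (Suc n))" by blast
  note C = test_fun_C1c[OF p(1)]
  have lim: "L2lim a v"
    if a: "\<And>n. L2 (a n)" "\<And>n. n2 (\<lambda>x. a n x - b n x) < inverse (real (Suc n))" and b: "L2lim b v" for a b v
  proof (rule L2lim_bound[OF a(1) L2limD(2)[OF b]])
    show "n2 (\<lambda>x. a n x - v x) \<le> 2 * inverse (real (Suc n)) + 2 * n2 (\<lambda>x. b n x - v x)" for n
      using n2_triangle[OF a(1)[of n] L2limD(1)[OF b, of n] L2limD(2)[OF b]] a(2)[of n] by linarith
    have "(\<lambda>n. 2 * inverse (real (Suc n)) + 2 * n2 (\<lambda>x. b n x - v x)) \<longlonglongrightarrow> 2 * 0 + 2 * 0"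
      by (intro tendsto_intros LIMSEQ_inverse_real_of_nat L2limD(3)[OF b])
    then show "(\<lambda>n. 2 * inverse (real (Suc n)) + 2 * n2 (\<lambda>x. b n x - v x)) \<longlonglongrightarrow> 0" by simp
  qed
  show ?thesis
    by (rule H10I[OF wu p(1) lim[OF C1c_L2(1)[OF C] p(2) l(1)] lim[OF C1c_L2(2)[OF C] p(3) l(2)]])
qed

lemma H10_add:
  assumes "H10 \<Omega> u" "H10 \<Omega> v" shows "H10 \<Omega> (\<lambda>x. u x + v x)"
proof -
  note w = H1_wg[OF H10_H1[OF assms(1)]] H1_wg[OF H10_H1[OF assms(2)]]
  obtain \<phi> where p: "\<And>n. test_fun \<Omega> (\<phi> n)" "L2lim \<phi> u" "\<And>i. L2lim (\<lambda>n x. gr (\<phi> n) x $ i) (\<lambda>x. grad u x $ i)"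
    using H10_obtain[OF assms(1) w(1)] by metis
  obtain \<psi> where q: "\<And>n. test_fun \<Omega> (\<psi> n)" "L2lim \<psi> v" "\<And>i. L2lim (\<lambda>n x. gr (\<psi> n) x $ i) (\<lambda>x. grad v x $ i)"
    using H10_obtain[OF assms(2) w(2)] by metis
  show ?thesis
    by (rule H10I[OF wg_add[OF w] test_fun_add(1)[OF p(1) q(1)] L2lim_add[OF p(2) q(2)]])
      (use L2lim_add[OF p(3) q(3)] in \<open>simp add: test_fun_add(2)[OF p(1) q(1)]\<close>)
qed

text \<open>Mollification at scales below the distance \<open>d\<close> from \<open>K\<close> to the
  complement stays inside \<open>\<Omega>\<close>.\<close>

lemma H10_compact_support:
  assumes w: "wg w g" and K: "compact K" "K \<subseteq> \<Omega>" "open \<Omega>" "AE x in lebesgue. x \<notin> K \<longrightarrow> w x = 0"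
  shows "H10 \<Omega> w"
proof -
  obtain d where d: "d > 0" "(\<Union>x\<in>K. cball x d) \<subseteq> \<Omega>"
    using compact_subset_open_imp_cball_epsilon_subset[OF K(1,3,2)] by blast
  define e where "e n = d * inverse (real (Suc n))" for n
  have e0: "e n > 0" for n using d by (simp add: e_def)
  have ed: "e n \<le> d" for n using d by (simp add: e_def field_simps)
  have el: "e \<longlonglongrightarrow> 0" unfolding e_def using tendsto_mult[OF tendsto_const LIMSEQ_inverse_real_of_nat, of d] by simp
  have t: "test_fun \<Omega> (conv (e n) w)" for n
  proof (rule conv_test_fun[OF e0 L2_loc_int[OF wgD(1)[OF w]] K(4,1)])
    fix x assume "x \<in> K"
    then show "cball x (e n) \<subseteq> \<Omega>" using d(2) ed[of n] by (force simp: subset_iff)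
  qed
  show ?thesis
    by (rule H10I[OF w t conv_L2lim[OF wgD(1)[OF w] e0 el]])
      (use conv_L2lim[OF wgD(2)[OF w] e0 el] in \<open>simp add: gr_C1[OF conv_C1[OF w e0]]\<close>)
qed

section \<open>Translations at the boundary and vanishing functions\<close>

lemma L2_shift: "L2 v \<Longrightarrow> L2 (\<lambda>x. v (x + t))"
  using lebesgue_shift(1)[of v t] lebesgue_shift(3)[of "\<lambda>x. (v x)\<^sup>2" t] by (auto simp: L2_def)

lemma n2_shift: "L2 v \<Longrightarrow> n2 (\<lambda>x. v (x + t)) = n2 v"
  unfolding n2_def by (rule lebesgue_shift(5)) (auto simp: L2_def)

lemma L2_shift_lim:
  assumes v: "L2 v" and t: "t \<longlonglongrightarrow> 0" shows "L2lim (\<lambda>n x. v (x + t n)) v"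
proof -
  have "(\<lambda>n. n2 (\<lambda>x. v (x + t n) - v x)) \<longlonglongrightarrow> 0"
  proof (rule LIMSEQ_I)
    fix r :: real assume r: "r > 0"
    obtain k R where k: "continuous_on UNIV k" "\<And>x. norm x > R \<Longrightarrow> k x = 0" "n2 (\<lambda>x. k x - v x) < r / 12"
      using L2_approx_continuous[OF v, of "r/12"] r by auto
    have L: "L2 k" by (rule L2_continuous_support[OF k(1,2)])
    have "L2lim (\<lambda>n x. k (x + t n)) k"
    proof -
      obtain B where B: "B > 0" "\<And>x. norm (k x) \<le> B" using bounded_continuous_support[OF k(1,2)] by blast
      have "Bseq t" using t by (intro convergent_imp_Bseq) (auto simp: convergent_def)
      then obtain T where T: "\<And>n. norm (t n) \<le> T" by (auto simp: Bseq_def)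
      show ?thesis
      proof (rule L2lim_dominated)
        show "(\<lambda>x. k (x + t n)) \<in> borel_measurable lebesgue" for n by (rule L2_meas[OF L2_shift[OF L]])
        show "k \<in> borel_measurable lebesgue" by (rule L2_meas[OF L])
        show "L2 (\<lambda>x. B * indicat_real (cball 0 (R + T)) x)" by (rule L2_cmult[OF L2_indicator_cball])
        have "\<bar>k (x + t n)\<bar> \<le> \<bar>B * indicat_real (cball 0 (R + T)) x\<bar>" for n x
        proof (cases "norm x \<le> R + T")
          case True then show ?thesis using B(1) B(2)[of "x + t n"] by simp
        next
          case False
          then have "norm (x + t n) > R" using T[of n] norm_diff_ineq[of x "t n"] by linarith
          then show ?thesis using k(2) by simp
        qed
        then show "AE x in lebesgue. \<bar>k (x + t n)\<bar> \<le> \<bar>B * indicat_real (cball 0 (R + T)) x\<bar>" for n by simp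
        have "(\<lambda>n. k (x + t n)) \<longlonglongrightarrow> k (x + 0)" for x
          by (rule continuous_on_tendsto_compose[OF k(1) tendsto_add[OF tendsto_const t]]) auto
        then show "AE x in lebesgue. (\<lambda>n. k (x + t n)) \<longlonglongrightarrow> k x" by simp
      qed
    qed
    then have "\<forall>\<^sub>F n in sequentially. n2 (\<lambda>x. k (x + t n) - k x) < r / 12"
      by (intro order_tendstoD(2)[OF L2limD(3)]) (use r in auto)
    then obtain N where N: "\<And>n. n \<ge> N \<Longrightarrow> n2 (\<lambda>x. k (x + t n) - k x) < r / 12"
      by (auto simp: eventually_sequentially)
    have "n2 (\<lambda>x. v (x + t n) - v x) < r" if "n \<ge> N" for n
    proof -
      have "n2 (\<lambda>x. v (x + t n) - k (x + t n)) = n2 (\<lambda>x. v x - k x)" by (rule n2_shift[OF L2_diff[OF v L]])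
      then have "n2 (\<lambda>x. v (x + t n) - k (x + t n)) < r / 12" using k(3) n2_commute[of v k] by simp
      then show ?thesis
        using n2_triangle[OF L2_shift[OF v] L2_shift[OF L] v, of "t n" "t n"]
          n2_triangle[OF L2_shift[OF L] L v, of "t n"] N[OF that] k(3) r by argo
    qed
    then show "\<exists>no. \<forall>n\<ge>no. norm (n2 (\<lambda>x. v (x + t n) - v x) - 0) < r" by auto
  qed
  then show ?thesis unfolding L2lim_def using v L2_shift[OF v] by blast
qed

lemma smooth_bounded_domainD:
  assumes "smooth_bounded_domain \<Omega>" shows "open \<Omega>" "connected \<Omega>" "bounded \<Omega>"
  using assms unfolding smooth_bounded_domain_def by blast+

lemma vector2_eq: "(vector [a, b] :: real^2) = a *\<^sub>R axis 1 1 + b *\<^sub>R axis 2 1"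
  by (simp add: vec_eq_iff forall_2 axis_def)

text \<open>Near a boundary point the domain lies below a graph, so a function vanishing off its closure
  is shifted into the domain by a small downward translation.\<close>
lemma H10_boundary_piece:
  assumes dom: "smooth_bounded_domain \<Omega>" and x0: "x0 \<in> frontier \<Omega>"
  obtains r where "r > 0" "\<And>w g. wg w g \<Longrightarrow> AE x in lebesgue. x \<notin> closure \<Omega> \<inter> cball x0 r \<longrightarrow> w x = 0 \<Longrightarrow> H10 \<Omega> w"
proof -
  note op = smooth_bounded_domainD(1)[OF dom] and bd = smooth_bounded_domainD(3)[OF dom]
  obtain r and T :: "real^3 \<Rightarrow> real^3" and \<gamma> where r: "r > 0" and T: "orthogonal_transformation T" and sm: "smooth_on UNIV (\<gamma> :: real^2 \<Rightarrow> real)"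
    and g: "\<Omega> \<inter> ball x0 r = {x \<in> ball x0 r. T (x - x0) $ 3 < \<gamma> (vector [T (x - x0) $ 1, T (x - x0) $ 2])}"
    using dom x0 unfolding smooth_bounded_domain_def by blast
  note lin = orthogonal_transformation_linear[OF T]
  have Tc: "continuous_on UNIV (\<lambda>x. T (x - x0))"
    by (rule continuous_on_compose2[OF linear_continuous_on[OF linear_conv_bounded_linear[THEN iffD1, OF lin], of UNIV]])
      (auto intro!: continuous_intros)
  have gc: "continuous_on UNIV \<gamma>" by (rule C1_continuous(1)[OF smooth_on_C1[OF sm]])
  have gTc: "continuous_on UNIV (\<lambda>x. \<gamma> (vector [T (x - x0) $ 1, T (x - x0) $ 2]))"
    unfolding vector2_eq
    by (rule continuous_on_compose2[OF gc]) (auto intro!: continuous_intros Tc)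
  have cl: "T (y - x0) $ 3 \<le> \<gamma> (vector [T (y - x0) $ 1, T (y - x0) $ 2])" if "y \<in> closure \<Omega>" "y \<in> ball x0 r" for y
  proof -
    have "closed {x. T (x - x0) $ 3 \<le> \<gamma> (vector [T (x - x0) $ 1, T (x - x0) $ 2])}"
      by (rule closed_Collect_le) (auto intro!: continuous_intros Tc gTc)
    moreover have "ball x0 r \<inter> \<Omega> \<subseteq> {x. T (x - x0) $ 3 \<le> \<gamma> (vector [T (x - x0) $ 1, T (x - x0) $ 2])}"
      using g by (auto simp: Int_commute)
    ultimately have "closure (ball x0 r \<inter> \<Omega>) \<subseteq> {x. T (x - x0) $ 3 \<le> \<gamma> (vector [T (x - x0) $ 1, T (x - x0) $ 2])}"
      by (rule closure_minimal[rotated])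
    moreover have "y \<in> closure (ball x0 r \<inter> \<Omega>)"
      using open_Int_closure_subset[OF open_ball, of x0 r \<Omega>] that by blast
    ultimately show ?thesis by blast
  qed
  \<comment> \<open>Moving by \<open>- s *\<^sub>R e\<close> lowers the third graph coordinate and
    keeps the other two. The weak inequality \<open>cl\<close> on the closure becomes the strict one
    that describes \<open>\<Omega>\<close>.\<close>
  obtain e where e: "T e = axis 3 1" using orthogonal_transformation_surj[OF T] by (metis surjD)
  have ne: "norm e = 1" using orthogonal_transformation_norm[OF T, of e] e by simp
  have "H10 \<Omega> w" if w: "wg w gw" and z: "AE x in lebesgue. x \<notin> closure \<Omega> \<inter> cball x0 (r / 2) \<longrightarrow> w x = 0" for w gw
  proof -
    \<comment> \<open>All shifts are shorter than \<open>r / 2\<close>, so points of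
      \<open>cball x0 (r / 2)\<close> remain in \<open>ball x0 r\<close>, where the graph
      description is valid.\<close>
    define s where "s n = (r / 4) * inverse (real (Suc n))" for n
    have s0: "s n > 0" for n using r by (simp add: s_def)
    have sr: "s n < r / 2" for n using r by (simp add: s_def field_simps) (simp add: add_pos_nonneg)
    have "(\<lambda>n. s n *\<^sub>R e) \<longlonglongrightarrow> ((r / 4) * 0) *\<^sub>R e" unfolding s_def
      by (intro tendsto_intros LIMSEQ_inverse_real_of_nat)
    then have tl: "(\<lambda>n. s n *\<^sub>R e) \<longlonglongrightarrow> 0" by simp
    have "H10 \<Omega> (\<lambda>x. w (x + s n *\<^sub>R e))" for n
    proof (rule H10_compact_support[OF wg_shift[OF w]])
      show "compact ((\<lambda>y. y - s n *\<^sub>R e) ` (closure \<Omega> \<inter> cball x0 (r / 2)))"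
        by (intro compact_continuous_image continuous_intros compact_Int_closed) (use bd in \<open>auto simp: compact_closure\<close>)
      show "(\<lambda>y. y - s n *\<^sub>R e) ` (closure \<Omega> \<inter> cball x0 (r / 2)) \<subseteq> \<Omega>"
      proof (clarify)
        fix y assume y: "y \<in> closure \<Omega>" "y \<in> cball x0 (r / 2)"
        have yb: "y \<in> ball x0 r" using y r by auto
        have xb: "y - s n *\<^sub>R e \<in> ball x0 r"
        proof -
          have "norm (x0 - (y - s n *\<^sub>R e)) \<le> norm (x0 - y) + norm (s n *\<^sub>R e)"
            using norm_triangle_ineq[of "x0 - y" "s n *\<^sub>R e"] by (simp add: algebra_simps)
          also have "\<dots> < r" using y sr[of n] s0[of n] ne by (simp add: dist_norm)
          finally show ?thesis by (simp add: dist_norm)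
        qed
        have Te: "T (y - s n *\<^sub>R e - x0) = T (y - x0) - s n *\<^sub>R axis 3 1"
        proof -
          have "y - s n *\<^sub>R e - x0 = (y - x0) - s n *\<^sub>R e" by simp
          then show ?thesis by (simp only: linear_diff[OF lin] linear_cmul[OF lin] e)
        qed
        have "T (y - s n *\<^sub>R e - x0) $ 3 < \<gamma> (vector [T (y - s n *\<^sub>R e - x0) $ 1, T (y - s n *\<^sub>R e - x0) $ 2])"
          unfolding Te using cl[OF y(1) yb] s0[of n] by (simp add: axis_def)
        then show "y - s n *\<^sub>R e \<in> \<Omega>" using g xb by blast
      qed
      show "AE x in lebesgue. x \<notin> (\<lambda>y. y - s n *\<^sub>R e) ` (closure \<Omega> \<inter> cball x0 (r / 2)) \<longrightarrow> w (x + s n *\<^sub>R e) = 0"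
        using AE_lebesgue_shift(1)[OF z, of "s n *\<^sub>R e"]
      proof eventually_elim
        case (elim x)
        have "x = (x + s n *\<^sub>R e) - s n *\<^sub>R e" by simp
        then show ?case using elim by blast
      qed
    qed (rule op)
    then show ?thesis
      by (rule H10_closed[OF _ wg_shift[OF w] L2_shift_lim[OF wgD(1)[OF w] tl] L2_shift_lim[OF wgD(2)[OF w] tl]])
  qed
  then show thesis using that[of "r / 2"] r by auto
qed

lemma H10_piece:
  assumes dom: "smooth_bounded_domain \<Omega>" and x0: "x0 \<in> closure \<Omega>"
  obtains r where "r > 0" "\<And>w g. wg w g \<Longrightarrow> AE x in lebesgue. x \<notin> closure \<Omega> \<inter> cball x0 r \<longrightarrow> w x = 0 \<Longrightarrow> H10 \<Omega> w"
proof (cases "x0 \<in> \<Omega>")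
  case False
  then have "x0 \<in> frontier \<Omega>" using x0 smooth_bounded_domainD(1)[OF dom] by (simp add: frontier_def interior_open)
  then show ?thesis using H10_boundary_piece[OF dom] that by blast
next
  case True
  note op = smooth_bounded_domainD(1)[OF dom]
  obtain r where r: "r > 0" "cball x0 r \<subseteq> \<Omega>" using op True open_contains_cball by blast
  show ?thesis
  proof (rule that[OF r(1)])
    fix w g assume "wg w g" and z: "AE x in lebesgue. x \<notin> closure \<Omega> \<inter> cball x0 r \<longrightarrow> w x = 0"
    then show "H10 \<Omega> w"
      by (intro H10_compact_support[OF _ compact_cball r(2) op]) (auto elim: AE_mp)
  qed
qed

text \<open>The cutoffs of a finite cover are peeled off one after the other instead of being
  normalized to a partition of unity. What remains of \<open>u\<close> is
  \<open>(\<Prod>c\<in>F. 1 - \<Xi> c x) * u x\<close>, and this vanishes almost everywhere: on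
  \<open>closure \<Omega>\<close> some factor is \<open>0\<close>, outside \<open>u\<close>
  is.\<close>

lemma H10_of_vanishing:
  assumes dom: "smooth_bounded_domain \<Omega>" and u: "H1 u" and z: "AE x in lebesgue. x \<notin> closure \<Omega> \<longrightarrow> u x = 0"
  shows "H10 \<Omega> u"
proof -
  note op = smooth_bounded_domainD(1)[OF dom]
  have bd: "compact (closure \<Omega>)" by (rule compact_closure[THEN iffD2, OF smooth_bounded_domainD(3)[OF dom]])
  define good where "good \<xi> \<longleftrightarrow> (\<exists>C. test_fun UNIV \<xi> \<and> (\<forall>x. 0 \<le> \<xi> x \<and> \<xi> x \<le> 1) \<and> (\<forall>x i. \<bar>gr \<xi> x $ i\<bar> \<le> C) \<and>
    (\<forall>w g. wg w g \<longrightarrow> (AE x in lebesgue. x \<notin> closure \<Omega> \<longrightarrow> w x = 0) \<longrightarrow> H10 \<Omega> (\<lambda>x. \<xi> x * w x)))" for \<xi>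
  have "\<exists>U \<xi>. open U \<and> x0 \<in> U \<and> good \<xi> \<and> (\<forall>x\<in>U. \<xi> x = 1)" if x0: "x0 \<in> closure \<Omega>" for x0
  proof -
    obtain r where r: "r > 0" "\<And>w g. wg w g \<Longrightarrow> AE x in lebesgue. x \<notin> closure \<Omega> \<inter> cball x0 r \<longrightarrow> w x = 0 \<Longrightarrow> H10 \<Omega> w"
      using H10_piece[OF dom x0] by blast
    obtain C where C: "C \<ge> 1" "\<And>(a::real^3) R. \<exists>\<xi>. test_fun UNIV \<xi> \<and> (\<forall>x. 0 \<le> \<xi> x \<and> \<xi> x \<le> 1) \<and>
      (\<forall>x i. \<bar>gr \<xi> x $ i\<bar> \<le> C) \<and> (\<forall>x. norm (x - a) \<le> R \<longrightarrow> \<xi> x = 1) \<and>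
      (\<forall>x. norm (x - a) \<ge> R + 2 * (r / 4) \<longrightarrow> \<xi> x = 0)"
      using cutoff_exists[of "r / 4"] r(1) by auto
    obtain \<xi> where x: "test_fun UNIV \<xi>" "\<And>x. 0 \<le> \<xi> x \<and> \<xi> x \<le> 1" "\<And>x i. \<bar>gr \<xi> x $ i\<bar> \<le> C"
      "\<And>x. norm (x - x0) \<le> r / 4 \<Longrightarrow> \<xi> x = 1" "\<And>x. norm (x - x0) \<ge> r / 4 + 2 * (r / 4) \<Longrightarrow> \<xi> x = 0"
      using C(2)[of x0 "r / 4"] by blast
    have "H10 \<Omega> (\<lambda>x. \<xi> x * w x)" if w: "wg w g" "AE x in lebesgue. x \<notin> closure \<Omega> \<longrightarrow> w x = 0" for w g
    proof (rule r(2)[OF wg_mult[OF w(1) C1c_imp_C1[OF test_fun_C1c[OF x(1)]], of C]])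
      show "\<bar>\<xi> y\<bar> \<le> C" for y using x(2)[of y] C(1) by auto
      show "AE y in lebesgue. y \<notin> closure \<Omega> \<inter> cball x0 r \<longrightarrow> \<xi> y * w y = 0"
        using w(2)
      proof eventually_elim
        case (elim y)
        show ?case
        proof (cases "y \<in> cball x0 r")
          case False
          then have "norm (y - x0) \<ge> r / 4 + 2 * (r / 4)" using r(1) by (simp add: dist_norm norm_minus_commute)
          then show ?thesis using x(5) by simp
        qed (use elim in auto)
      qed
    qed (rule x(3))
    then have "good \<xi>" unfolding good_def using x by blast
    moreover have "open (ball x0 (r / 4))" "x0 \<in> ball x0 (r / 4)" "\<forall>y\<in>ball x0 (r / 4). \<xi> y = 1"
      using x(4) r(1) by (auto simp: dist_norm norm_minus_commute)
    ultimately show ?thesis by blast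
  qed
  then obtain U \<Xi> where U: "\<And>x0. x0 \<in> closure \<Omega> \<Longrightarrow> open (U x0) \<and> x0 \<in> U x0 \<and> good (\<Xi> x0) \<and> (\<forall>x\<in>U x0. \<Xi> x0 x = 1)"
    by metis
  obtain F where F: "F \<subseteq> closure \<Omega>" "finite F" "closure \<Omega> \<subseteq> (\<Union>c\<in>F. U c)"
    using compactE_image[OF bd, of "closure \<Omega>" U] U by blast
  \<comment> \<open>The invariant of the peeling: the remainder \<open>w\<close> is still in
    \<open>H1\<close>, still vanishes wherever \<open>u\<close> does, and the part
    \<open>u - w\<close> removed so far has zero boundary values.\<close>
  have "\<exists>w. H1 w \<and> (AE x in lebesgue. w x = (\<Prod>c\<in>G. 1 - \<Xi> c x) * u x) \<and> H10 \<Omega> (\<lambda>x. u x - w x) \<and>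
      (\<forall>x. u x = 0 \<longrightarrow> w x = 0) \<and> (\<forall>x. w x = (\<Prod>c\<in>G. 1 - \<Xi> c x) * u x)"
    if "G \<subseteq> F" for G
    using finite_subset[OF that F(2)] that
  proof (induction G rule: finite_induct)
    case empty
    have "H10 \<Omega> (\<lambda>x. u x - u x)"
      by (rule H10_compact_support[OF wg_diff[OF H1_wg[OF u] H1_wg[OF u]], of "{}"])
        (use op in auto)
    then show ?case using u by (intro exI[of _ u]) auto
  next
    case (insert c G)
    then obtain w where w: "H1 w" "H10 \<Omega> (\<lambda>x. u x - w x)" "\<forall>x. u x = 0 \<longrightarrow> w x = 0" "\<forall>x. w x = (\<Prod>c\<in>G. 1 - \<Xi> c x) * u x"
      by auto
    have "good (\<Xi> c)" using U F(1) insert.prems by auto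
    then obtain C where c: "test_fun UNIV (\<Xi> c)" "\<And>x. 0 \<le> \<Xi> c x \<and> \<Xi> c x \<le> 1" "\<And>x i. \<bar>gr (\<Xi> c) x $ i\<bar> \<le> C"
      "\<And>w g. wg w g \<Longrightarrow> (AE x in lebesgue. x \<notin> closure \<Omega> \<longrightarrow> w x = 0) \<Longrightarrow> H10 \<Omega> (\<lambda>x. \<Xi> c x * w x)"
      unfolding good_def by blast
    have wz: "AE x in lebesgue. x \<notin> closure \<Omega> \<longrightarrow> w x = 0"
      using z by eventually_elim (use w(3) in auto)
    have h: "H10 \<Omega> (\<lambda>x. \<Xi> c x * w x)" by (rule c(4)[OF H1_wg[OF w(1)] wz])
    let ?w = "\<lambda>x. w x - \<Xi> c x * w x"
    have "H1 ?w" by (rule wg_H1[OF wg_diff[OF H1_wg[OF w(1)] H1_wg[OF H10_H1[OF h]]]])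
    moreover have "H10 \<Omega> (\<lambda>x. u x - ?w x)" using H10_add[OF w(2) h] by (simp add: algebra_simps)
    moreover have "?w x = (\<Prod>c\<in>insert c G. 1 - \<Xi> c x) * u x" for x
      using w(4)[rule_format, of x] insert.hyps by (simp add: algebra_simps)
    ultimately show ?case using w(3) by (intro exI[of _ ?w]) auto
  qed
  from this[of F] obtain w where w: "H1 w" "H10 \<Omega> (\<lambda>x. u x - w x)" "\<forall>x. w x = (\<Prod>c\<in>F. 1 - \<Xi> c x) * u x" by auto
  have w0: "AE x in lebesgue. x \<notin> {} \<longrightarrow> w x = 0" using z
  proof eventually_elim
    case (elim x)
    show ?case
    proof (cases "x \<in> closure \<Omega>")
      case True
      then obtain c where c: "c \<in> F" "x \<in> U c" using F(3) by blast
      then have "\<Xi> c x = 1" using U F(1) by blast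
      then have "(\<Prod>c\<in>F. 1 - \<Xi> c x) = 0" using c(1) F(2) by (auto intro!: prod_zero)
      then show ?thesis using w(3) by simp
    qed (use elim w(3) in simp)
  qed
  have "H10 \<Omega> w" by (rule H10_compact_support[OF H1_wg[OF w(1)] compact_empty _ _ w0])
      (use op in auto)
  from H10_add[OF w(2) this] show ?thesis by simp
qed

text \<open>The approximating test functions and their gradients vanish at every point outside
  \<open>\<Omega>\<close>, the frontier included, and a subsequence converges almost
  everywhere.\<close>

lemma H10_vanishes:
  assumes "H10 \<Omega> u" "wg u g" shows "AE x in lebesgue. x \<notin> \<Omega> \<longrightarrow> u x = 0 \<and> g x = 0"
proof -
  obtain \<phi> where p: "\<And>n. test_fun \<Omega> (\<phi> n)" "L2lim \<phi> u" "\<And>i. L2lim (\<lambda>n x. gr (\<phi> n) x $ i) (\<lambda>x. g x $ i)"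
    using H10_obtain[OF assms] by metis
  have z: "\<phi> n x = 0" "gr (\<phi> n) x = 0" if "x \<notin> \<Omega>" for n x
  proof -
    have o: "x \<notin> tsupp (\<phi> n)" using p(1)[of n] that by (auto simp: test_fun_def)
    show "\<phi> n x = 0" by (rule test_fun_outside[OF o])
    show "gr (\<phi> n) x = 0"
    proof (rule C1_support[OF C1c_imp_C1[OF test_fun_C1c[OF p(1)]], of "- tsupp (\<phi> n)" x n 0])
      show "open (- tsupp (\<phi> n))" by (simp add: tsupp_def open_Compl)
      show "x \<in> - tsupp (\<phi> n)" using o by simp
      show "\<phi> n y = 0" if "y \<in> - tsupp (\<phi> n)" for y
        by (rule test_fun_outside) (use that in simp)
    qed
  qed
  have gen: "AE x in lebesgue. x \<notin> \<Omega> \<longrightarrow> v x = 0" if l: "L2lim a v" and a: "\<And>n x. x \<notin> \<Omega> \<Longrightarrow> a n x = 0" for a v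
  proof -
    obtain r where r: "AE x in lebesgue. (\<lambda>n. a (r n) x) \<longlonglongrightarrow> v x" using L2lim_AE_subseq[OF l] by blast
    then show ?thesis
    proof eventually_elim
      case (elim x)
      show ?case
      proof
        assume "x \<notin> \<Omega>"
        then show "v x = 0" using elim a by (simp add: LIMSEQ_const_iff)
      qed
    qed
  qed
  have "AE x in lebesgue. \<forall>i. x \<notin> \<Omega> \<longrightarrow> g x $ i = 0"
    unfolding AE_all_countable by (intro allI gen[OF p(3)]) (simp add: z)
  moreover have "AE x in lebesgue. x \<notin> \<Omega> \<longrightarrow> u x = 0"
    by (rule gen[OF p(2)]) (rule z(1))
  ultimately show ?thesis by eventually_elim (auto simp: vec_eq_iff)
qed

section \<open>Quadratic forms with a weight whose power \<open>3/2\<close> is integrable\<close>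

lemma Young_three_halves:
  fixes F a \<tau> :: real
  assumes "F \<ge> 0" "\<tau> > 0" shows "F * a\<^sup>2 \<le> \<tau> * a ^ 6 + F powr (3/2) / sqrt \<tau>"
proof -
  have p: "F powr (3/2) = F * sqrt F"
  proof (cases "F = 0")
    case False
    have "F powr (3/2) = F powr (1 + 1/2)" by simp
    also have "\<dots> = F powr 1 * F powr (1/2)" by (rule powr_add)
    finally show ?thesis using assms by (simp add: powr_half_sqrt)
  qed simp
  show ?thesis
  proof (cases "F \<le> \<tau> * a ^ 4")
    case True
    have "F * a\<^sup>2 \<le> (\<tau> * a ^ 4) * a\<^sup>2" by (rule mult_right_mono[OF True]) simp
    also have "\<dots> = \<tau> * a ^ 6" by (simp flip: power_add)
    finally show ?thesis using assms by (simp add: p add_increasing2)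
  next
    case False
    have "a\<^sup>2 = sqrt (a ^ 4)" using real_sqrt_abs[of "a\<^sup>2"] by (simp flip: power_mult)
    also have "\<dots> \<le> sqrt (F / \<tau>)" using False assms by (simp add: field_simps)
    finally have "F * a\<^sup>2 \<le> F * sqrt (F / \<tau>)" using assms by (intro mult_left_mono)
    also have "\<dots> = F powr (3/2) / sqrt \<tau>" by (simp add: p real_sqrt_divide)
    finally show ?thesis using assms by (simp add: add_increasing)
  qed
qed

definition L6b :: "(real^3 \<Rightarrow> real) \<Rightarrow> real \<Rightarrow> bool" where
  "L6b u C \<longleftrightarrow> u \<in> borel_measurable lebesgue \<and> integrable lebesgue (\<lambda>x. u x ^ 6) \<and> (\<integral>x. u x ^ 6 \<partial>lebesgue) \<le> C"

lemma wg_L6b: assumes "wg u g" "Dsq g \<le> M" shows "L6b u (4096 * M ^ 3)"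
proof -
  have "Dsq g ^ 3 \<le> M ^ 3" by (rule power_mono[OF assms(2)]) simp
  then show ?thesis using Sobolev[OF assms(1)] L2_meas[OF wgD(1)[OF assms(1)]] by (auto simp: L6b_def)
qed

lemma weighted_integrable:
  assumes f: "f \<in> borel_measurable lebesgue" "integrable lebesgue (\<lambda>x. \<bar>f x\<bar> powr (3/2))" and u: "L6b u C"
  shows "integrable lebesgue (\<lambda>x. f x * (u x)\<^sup>2)"
proof (rule Bochner_Integration.integrable_bound)
  show "integrable lebesgue (\<lambda>x. u x ^ 6 + \<bar>f x\<bar> powr (3/2))" using f u by (simp add: L6b_def)
  show "(\<lambda>x. f x * (u x)\<^sup>2) \<in> borel_measurable lebesgue"
    by (intro borel_measurable_times borel_measurable_power f(1)) (use u in \<open>simp add: L6b_def\<close>)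
  have "norm (f x * (u x)\<^sup>2) \<le> norm (u x ^ 6 + \<bar>f x\<bar> powr (3/2))" for x
    using Young_three_halves[of "\<bar>f x\<bar>" 1 "u x"] by (simp add: abs_mult)
  then show "AE x in lebesgue. norm (f x * (u x)\<^sup>2) \<le> norm (u x ^ 6 + \<bar>f x\<bar> powr (3/2))" by simp
qed

text \<open>The weight and the Sobolev exponent are dual: by \<open>Young_three_halves\<close> the
  integrand is at most \<open>\<tau>\<close> times sixth powers plus a fixed integrable function,
  which is the hypothesis of \<open>Brezis_Lieb_limit\<close>. Bounded sixth powers and almost
  everywhere convergence therefore suffice; strong convergence is not assumed.\<close>

lemma weighted_limit:
  assumes f: "f \<in> borel_measurable lebesgue" "integrable lebesgue (\<lambda>x. \<bar>f x\<bar> powr (3/2))"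
    and us: "\<And>n. L6b (us n) C" and u: "L6b u C" and l: "AE x in lebesgue. (\<lambda>n. us n x) \<longlonglongrightarrow> u x"
  shows "(\<lambda>n. \<integral>x. f x * (us n x)\<^sup>2 \<partial>lebesgue) \<longlonglongrightarrow> (\<integral>x. f x * (u x)\<^sup>2 \<partial>lebesgue)"
proof -
  define w where "w n x = \<bar>f x\<bar> * \<bar>(us n x)\<^sup>2 - (u x)\<^sup>2\<bar>" for n x
  note I = weighted_integrable[OF f us] weighted_integrable[OF f u]
  have w: "(\<lambda>n. \<integral>x. w n x \<partial>lebesgue) \<longlonglongrightarrow> 0" "integrable lebesgue (w n)" for n
  proof -
    have 1: "w n \<in> borel_measurable lebesgue" "0 \<le> w n x" for n x
      unfolding w_def using f us[of n] u by (auto simp: L6b_def)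
    have 2: "AE x in lebesgue. (\<lambda>n. w n x) \<longlonglongrightarrow> 0" using l
    proof eventually_elim
      case (elim x)
      have "(\<lambda>n. \<bar>f x\<bar> * \<bar>(us n x)\<^sup>2 - (u x)\<^sup>2\<bar>) \<longlonglongrightarrow> \<bar>f x\<bar> * \<bar>(u x)\<^sup>2 - (u x)\<^sup>2\<bar>" by (intro tendsto_intros elim)
      then show ?case by (simp add: w_def)
    qed
    have 3: "integrable lebesgue (\<lambda>x. us n x ^ 6 + u x ^ 6)" for n using us[of n] u by (simp add: L6b_def)
    have 4: "(\<integral>x. us n x ^ 6 + u x ^ 6 \<partial>lebesgue) \<le> C + C" for n using us[of n] u by (simp add: L6b_def)
    have 5: "\<exists>B. integrable lebesgue B \<and> (\<forall>n x. w n x \<le> \<tau> * (us n x ^ 6 + u x ^ 6) + B x)" if "\<tau> > 0" for \<tau>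
    proof (intro exI conjI allI)
      show "integrable lebesgue (\<lambda>x. 2 * (\<bar>f x\<bar> powr (3/2) / sqrt \<tau>))" using f by simp
      fix n x
      have "\<bar>(us n x)\<^sup>2 - (u x)\<^sup>2\<bar> \<le> (us n x)\<^sup>2 + (u x)\<^sup>2" by (simp add: abs_le_iff)
      then have "w n x \<le> \<bar>f x\<bar> * ((us n x)\<^sup>2 + (u x)\<^sup>2)" unfolding w_def by (rule mult_left_mono) simp
      then show "w n x \<le> \<tau> * (us n x ^ 6 + u x ^ 6) + 2 * (\<bar>f x\<bar> powr (3/2) / sqrt \<tau>)"
        using Young_three_halves[of "\<bar>f x\<bar>" \<tau> "us n x"] Young_three_halves[of "\<bar>f x\<bar>" \<tau> "u x"] that
        by (simp add: distrib_left)
    qed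
    show "(\<lambda>n. \<integral>x. w n x \<partial>lebesgue) \<longlonglongrightarrow> 0" "integrable lebesgue (w n)"
      using Brezis_Lieb_limit[OF 1 2 3 _ 4 5] by auto
  qed
  have "(\<lambda>n. (\<integral>x. f x * (us n x)\<^sup>2 \<partial>lebesgue) - (\<integral>x. f x * (u x)\<^sup>2 \<partial>lebesgue)) \<longlonglongrightarrow> 0"
  proof (rule Lim_null_comparison[OF _ w(1)], rule always_eventually, rule allI)
    fix n
    have i: "integrable lebesgue (\<lambda>x. f x * ((us n x)\<^sup>2 - (u x)\<^sup>2))"
      using I(1)[of n] I(2) by (simp add: right_diff_distrib)
    have "(\<integral>x. f x * (us n x)\<^sup>2 \<partial>lebesgue) - (\<integral>x. f x * (u x)\<^sup>2 \<partial>lebesgue) = (\<integral>x. f x * ((us n x)\<^sup>2 - (u x)\<^sup>2) \<partial>lebesgue)"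
      using I(1)[of n] I(2) by (simp add: right_diff_distrib)
    then show "norm ((\<integral>x. f x * (us n x)\<^sup>2 \<partial>lebesgue) - (\<integral>x. f x * (u x)\<^sup>2 \<partial>lebesgue)) \<le> (\<integral>x. w n x \<partial>lebesgue)"
      using integral_abs_bound_integral[OF i w(2)[of n]] by (simp add: w_def abs_mult)
  qed
  then show ?thesis by (rule LIM_zero_cancel)
qed

section \<open>The principal eigenvalue\<close>

lemma ip_integral:
  assumes "\<And>i. L2 (\<lambda>x. g x $ i)" "\<And>i. L2 (\<lambda>x. h x $ i)"
  shows "(\<integral>x. g x \<bullet> h x \<partial>lebesgue) = (\<Sum>i\<in>UNIV. \<integral>x. g x $ i * h x $ i \<partial>lebesgue)"
    "integrable lebesgue (\<lambda>x. g x \<bullet> h x)"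
  unfolding inner_vec_def using L2_mult_integrable[OF assms]
  by (auto intro!: Bochner_Integration.integral_sum Bochner_Integration.integrable_sum)

text \<open>Adding up the squared errors of the values and of the three gradient components gives
  one sequence \<open>q\<close> tending to \<open>0\<close> in mean, so one subsequence works for
  all of them.\<close>

lemma H10_AE_subseq:
  assumes l: "L2lim us u" "\<And>i::3. L2lim (\<lambda>n x. D n x $ i) (\<lambda>x. g x $ i)"
  obtains r where "strict_mono (r :: nat \<Rightarrow> nat)" "AE x in lebesgue. (\<lambda>n. us (r n) x) \<longlonglongrightarrow> u x \<and> (\<lambda>n. D (r n) x) \<longlonglongrightarrow> g x"
proof -
  define q where "q n x = (us n x - u x)\<^sup>2 + (\<Sum>i\<in>UNIV. (D n x $ i - g x $ i)\<^sup>2)" for n x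
  have i: "integrable lebesgue (\<lambda>x. (us n x - u x)\<^sup>2)" "integrable lebesgue (\<lambda>x. (D n x $ i - g x $ i)\<^sup>2)" for n i
    by (intro L2_int L2_diff L2limD[OF l(1)] L2limD[OF l(2)])+
  have qi: "integrable lebesgue (q n)" for n
    unfolding q_def using i by (intro Bochner_Integration.integrable_add Bochner_Integration.integrable_sum) auto
  have q0: "q n x \<ge> 0" for n x by (simp add: q_def sum_nonneg)
  have "(\<lambda>n. \<integral>x. norm (q n x) \<partial>lebesgue) \<longlonglongrightarrow> 0"
  proof -
    have "(\<integral>x. norm (q n x) \<partial>lebesgue) = n2 (\<lambda>x. us n x - u x) + (\<Sum>i\<in>UNIV. n2 (\<lambda>x. D n x $ i - g x $ i))" for n
      using q0 i unfolding n2_def by (simp add: q_def)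
    moreover have "(\<lambda>n. n2 (\<lambda>x. us n x - u x) + (\<Sum>i\<in>UNIV. n2 (\<lambda>x. D n x $ i - g x $ i))) \<longlonglongrightarrow> 0 + (\<Sum>i\<in>(UNIV::3 set). 0)"
      by (intro tendsto_add tendsto_sum L2limD(3) l)
    ultimately show ?thesis by simp
  qed
  from tendsto_L1_AE_subseq[OF qi this] obtain r where r: "strict_mono r" "AE x in lebesgue. (\<lambda>n. q (r n) x) \<longlonglongrightarrow> 0" by blast
  have "AE x in lebesgue. (\<lambda>n. us (r n) x) \<longlonglongrightarrow> u x \<and> (\<lambda>n. D (r n) x) \<longlonglongrightarrow> g x" using r(2)
  proof eventually_elim
    case (elim x)
    have "(\<lambda>n. (us (r n) x - u x)\<^sup>2) \<longlonglongrightarrow> 0"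
      by (rule tendsto_sandwich[OF _ _ tendsto_const elim]) (auto simp: q_def sum_nonneg)
    then have 1: "(\<lambda>n. us (r n) x) \<longlonglongrightarrow> u x" by (simp add: LIM_zero_cancel)
    have "(\<lambda>n. D (r n) x $ i) \<longlonglongrightarrow> g x $ i" for i
    proof -
      have "(\<lambda>n. (D (r n) x $ i - g x $ i)\<^sup>2) \<longlonglongrightarrow> 0"
      proof (rule tendsto_sandwich[OF _ _ tendsto_const elim])
        have "(D n x $ i - g x $ i)\<^sup>2 \<le> q n x" for n
          unfolding q_def using member_le_sum[of i UNIV "\<lambda>i. (D n x $ i - g x $ i)\<^sup>2"] by (simp add: add_increasing)
        then show "\<forall>\<^sub>F n in sequentially. (D (r n) x $ i - g x $ i)\<^sup>2 \<le> q (r n) x" by simp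
      qed simp
      then show ?thesis by (simp add: LIM_zero_cancel)
    qed
    then have "(\<lambda>n. D (r n) x) \<longlonglongrightarrow> g x" by (rule vec_tendstoI)
    with 1 show ?case by blast
  qed
  with r(1) that show thesis by blast
qed

lemma L6b_add: assumes "L6b u C" "L6b v D" shows "L6b (\<lambda>x. u x + v x) (64 * (C + D))"
proof -
  have p: "(a + b) ^ 6 \<le> 64 * (a ^ 6 + b ^ 6)" for a b :: real
  proof -
    define m where "m = max \<bar>a\<bar> \<bar>b\<bar>"
    have "\<bar>a + b\<bar> ^ 6 \<le> (2 * m) ^ 6" by (rule power_mono) (auto simp: m_def)
    also have "\<dots> = 64 * m ^ 6" by (simp add: power_mult_distrib)
    also have "m ^ 6 \<le> \<bar>a\<bar> ^ 6 + \<bar>b\<bar> ^ 6" by (auto simp: m_def max_def)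
    finally show ?thesis by (simp add: power_even_abs)
  qed
  have m: "(\<lambda>x. u x + v x) \<in> borel_measurable lebesgue" using assms by (auto simp: L6b_def)
  have d: "integrable lebesgue (\<lambda>x. 64 * (u x ^ 6 + v x ^ 6))" using assms by (simp add: L6b_def)
  have i: "integrable lebesgue (\<lambda>x. (u x + v x) ^ 6)"
    by (rule Bochner_Integration.integrable_bound[OF d]) (use m p in auto)
  have "(\<integral>x. (u x + v x) ^ 6 \<partial>lebesgue) \<le> (\<integral>x. 64 * (u x ^ 6 + v x ^ 6) \<partial>lebesgue)"
    by (rule integral_mono[OF i d p])
  also have "\<dots> \<le> 64 * (C + D)" using assms by (simp add: L6b_def)
  finally show ?thesis using m i by (simp add: L6b_def)
qed

lemma weighted_bilinear_integrable:
  assumes f: "f \<in> borel_measurable lebesgue" "integrable lebesgue (\<lambda>x. \<bar>f x\<bar> powr (3/2))" and u: "L6b u C" "L6b v D"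
  shows "integrable lebesgue (\<lambda>x. f x * (u x * v x))"
proof -
  have e: "(\<lambda>x. f x * (u x * v x)) = (\<lambda>x. (f x * (u x + v x)\<^sup>2 - f x * (u x)\<^sup>2 - f x * (v x)\<^sup>2) / 2)"
    by (auto simp: power2_eq_square algebra_simps)
  show ?thesis unfolding e
    using weighted_integrable[OF f u(1)] weighted_integrable[OF f u(2)] weighted_integrable[OF f L6b_add[OF u]] by simp
qed

lemma weighted_bilinear_limit:
  assumes f: "f \<in> borel_measurable lebesgue" "integrable lebesgue (\<lambda>x. \<bar>f x\<bar> powr (3/2))"
    and us: "\<And>n. L6b (us n) C" and u: "L6b u C" and l: "AE x in lebesgue. (\<lambda>n. us n x) \<longlonglongrightarrow> u x" and v: "L6b v D"
  shows "(\<lambda>n. \<integral>x. f x * (v x * us n x) \<partial>lebesgue) \<longlonglongrightarrow> (\<integral>x. f x * (v x * u x) \<partial>lebesgue)"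
proof -
  have e: "(\<integral>x. f x * (v x * w x) \<partial>lebesgue) =
      ((\<integral>x. f x * (v x + w x)\<^sup>2 \<partial>lebesgue) - (\<integral>x. f x * (v x)\<^sup>2 \<partial>lebesgue) - (\<integral>x. f x * (w x)\<^sup>2 \<partial>lebesgue)) / 2"
    if w: "L6b w C" for w
  proof -
    have e: "f x * (v x * w x) = (f x * (v x + w x)\<^sup>2 - f x * (v x)\<^sup>2 - f x * (w x)\<^sup>2) / 2" for x
      by (auto simp: power2_eq_square algebra_simps)
    show ?thesis unfolding e
      using weighted_integrable[OF f w] weighted_integrable[OF f v] weighted_integrable[OF f L6b_add[OF v w]] by simp
  qed
  have "AE x in lebesgue. (\<lambda>n. v x + us n x) \<longlonglongrightarrow> v x + u x" using l by eventually_elim (intro tendsto_intros)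
  note l' = weighted_limit[OF f L6b_add[OF v us] L6b_add[OF v u] this]
  show ?thesis unfolding e[OF us] e[OF u] by (intro tendsto_intros l' weighted_limit[OF f us u l]) simp
qed

definition G :: "real \<Rightarrow> real \<Rightarrow> real" where "G e t = (1 / e) * (1 - t / (e + \<bar>t\<bar>))"
definition dG :: "real \<Rightarrow> real \<Rightarrow> real" where "dG e t = - (1 / (e + \<bar>t\<bar>)\<^sup>2)"

text \<open>\<open>G e\<close> is a bounded \<open>C\<^sup>1\<close> extension to the whole line of \<open>t \<mapsto> 1 / (t + e)\<close>, \<open>t \<ge> 0\<close>.\<close>
lemma G_nonneg_arg: "e > 0 \<Longrightarrow> t \<ge> 0 \<Longrightarrow> G e t = 1 / (e + t)"
  by (simp add: G_def field_simps)

lemma G_neg_arg: "e > 0 \<Longrightarrow> t \<le> 0 \<Longrightarrow> G e t = (1 / e) * (1 - t / (e - t))"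
  by (simp add: G_def)

lemma G_deriv: assumes e: "e > 0" shows "(G e has_real_derivative dG e t) (at t)"
proof -
  consider "t > 0" | "t < 0" | "t = 0" by linarith
  then show ?thesis
  proof cases
    case 1
    have "((\<lambda>t. 1 / (e + t)) has_real_derivative dG e t) (at t)"
      using 1 e by (auto intro!: derivative_eq_intros simp: dG_def power2_eq_square)
    then show ?thesis
      by (rule has_field_derivative_transform_within_open[of _ _ _ "{0<..}"]) (use 1 e in \<open>auto simp: G_nonneg_arg\<close>)
  next
    case 2
    have "((\<lambda>t. (1 / e) * (1 - t / (e - t))) has_real_derivative dG e t) (at t)"
      by (rule derivative_eq_intros refl | use 2 e in force)+ (use 2 e in \<open>simp add: dG_def power2_eq_square field_simps\<close>)
    then show ?thesis
      by (rule has_field_derivative_transform_within_open[of _ _ _ "{..<0}"]) (use 2 e in \<open>auto simp: G_neg_arg\<close>)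
  next
    case 3
    have "G e z - G e 0 = - (1 / (e * (e + \<bar>z\<bar>))) * (z - 0)" for z
      by (simp add: G_def right_diff_distrib)
    moreover have "isCont (\<lambda>z. - (1 / (e * (e + \<bar>z\<bar>)))) 0" using e by (intro continuous_intros) auto
    moreover have "- (1 / (e * (e + \<bar>0\<bar>))) = dG e 0" by (simp add: dG_def power2_eq_square)
    ultimately show ?thesis unfolding CARAT_DERIV 3 by (intro exI[of _ "\<lambda>z. - (1 / (e * (e + \<bar>z\<bar>)))"]) blast
  qed
qed

text \<open>The first three bounds keep \<open>v\<^sup>2 * G e (\<phi>)\<close> and its gradient
  coefficients bounded for a test function \<open>v\<close>. The last one handles an unbounded
  \<open>v\<close>: it lets \<open>arctan\<close> absorb the product of \<open>v\<close> with
  \<open>dG e\<close>.\<close>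

lemma G_bounds:
  assumes e: "e > 0"
  shows "0 < G e t" "\<bar>G e t\<bar> \<le> 2 / e" "\<bar>dG e t\<bar> \<le> 1 / e\<^sup>2" "\<bar>dG e t\<bar> \<le> G e t / e"
proof -
  have a: "\<bar>t / (e + \<bar>t\<bar>)\<bar> < 1" using e by (simp add: abs_divide)
  show p: "0 < G e t" using a e by (simp add: G_def abs_less_iff)
  have "1 - t / (e + \<bar>t\<bar>) \<le> 2" using a by linarith
  then have "G e t \<le> (1 / e) * 2" unfolding G_def using e by (intro mult_left_mono) auto
  with p show "\<bar>G e t\<bar> \<le> 2 / e" by simp
  have "e\<^sup>2 \<le> (e + \<bar>t\<bar>)\<^sup>2" using e by (intro power_mono) auto
  then show d: "\<bar>dG e t\<bar> \<le> 1 / e\<^sup>2" using e by (simp add: dG_def frac_le)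
  show "\<bar>dG e t\<bar> \<le> G e t / e"
  proof (cases "t \<ge> 0")
    case True
    have "(e + t) * e \<le> (e + t) * (e + t)" using True e by (intro mult_left_mono) auto
    then have "1 / (e + t)\<^sup>2 \<le> 1 / ((e + t) * e)" using True e by (intro frac_le) (auto simp: power2_eq_square)
    then show ?thesis using True e by (simp add: dG_def G_nonneg_arg)
  next
    case False
    have "t / (e + \<bar>t\<bar>) \<le> 0" using False e by (intro divide_nonpos_pos) auto
    then have "(1 / e) * 1 \<le> G e t" unfolding G_def using e by (intro mult_left_mono) auto
    then have "1 / e \<le> G e t" by simp
    then have "1 / e / e \<le> G e t / e" using e by (intro divide_right_mono) auto
    then show ?thesis using d by (simp add: power2_eq_square)
  qed
qed

lemma G_continuous: assumes "e > 0" shows "continuous_on UNIV (G e)" "continuous_on UNIV (dG e)"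
proof -
  have "e + \<bar>t\<bar> \<noteq> 0" for t using assms by (smt (verit))
  then show "continuous_on UNIV (G e)" "continuous_on UNIV (dG e)"
    unfolding G_def[abs_def] dG_def[abs_def] by (auto intro!: continuous_intros)
qed

lemma C1_comp:
  assumes F: "\<And>t. (F has_real_derivative F' t) (at t)" "continuous_on UNIV F'" and y: "C1 y E"
  shows "C1 (\<lambda>x. F (y x)) (\<lambda>x. F' (y x) *\<^sub>R E x)"
  unfolding C1_def
proof (intro conjI allI)
  fix x
  have "((\<lambda>x. F (y x)) has_derivative (\<lambda>h. (E x \<bullet> h) * F' (y x))) (at x)"
    by (rule DERIV_compose_FDERIV[OF F(1)]) (use y in \<open>simp add: C1_def\<close>)
  then show "((\<lambda>x. F (y x)) has_derivative (\<bullet>) (F' (y x) *\<^sub>R E x)) (at x)"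
    by (rule has_derivative_eq_rhs) (auto simp: mult.commute)
next
  show "continuous_on UNIV (\<lambda>x. F' (y x) *\<^sub>R E x)"
    using C1_continuous[OF y] by (intro continuous_intros continuous_on_compose2[OF F(2)]) auto
qed

lemma C1_uminus_mult_bound: "C1c z D \<Longrightarrow> \<exists>B>0. (\<forall>x. \<bar>z x\<bar> \<le> B) \<and> (\<forall>x i. \<bar>D x $ i\<bar> \<le> B)"
proof -
  assume z: "C1c z D"
  obtain R where R: "R > 0" "\<And>x. norm x > R \<Longrightarrow> z x = 0" "\<And>x. norm x > R \<Longrightarrow> D x = 0"
    using C1c_obtain[OF z] by blast
  note c = C1_continuous[OF C1c_imp_C1[OF z]]
  obtain B1 where B1: "B1 > 0" "\<And>x. norm (z x) \<le> B1" using bounded_continuous_support[OF c(1) R(2)] by blast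
  obtain B2 where B2: "B2 > 0" "\<And>x. norm (D x) \<le> B2" using bounded_continuous_support[OF c(2) R(3)] by blast
  have "\<bar>D x $ i\<bar> \<le> B2" for x i using component_le_norm_cart[of "D x" i] B2(2)[of x] by linarith
  then show ?thesis using B1 B2 by (intro exI[of _ "max B1 B2"]) (auto simp: le_max_iff_disj)
qed

text \<open>The eigenvalue enters through a positive weak solution; that it bounds the Rayleigh
  quotient from below is a consequence of \<open>Picone\<close>.\<close>

locale eigen_setting =
  fixes \<Omega> :: "(real^3) set" and f :: "real^3 \<Rightarrow> real" and lam1 :: real and \<phi> :: "real^3 \<Rightarrow> real"
  assumes op: "open \<Omega>" and con: "connected \<Omega>" and bd: "bounded \<Omega>"
    and fm: "f \<in> borel_measurable lebesgue" and fi: "integrable lebesgue (\<lambda>x. \<bar>f x\<bar> powr (3/2))"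
    and eig: "dirichlet_eigenpair \<Omega> f lam1 \<phi>"
    and pos: "AE x in lebesgue. x \<in> \<Omega> \<longrightarrow> \<phi> x > 0"
begin

definition fO :: "real^3 \<Rightarrow> real" where "fO x = indicator \<Omega> x * f x"

abbreviation g :: "real^3 \<Rightarrow> real^3" where "g \<equiv> grad \<phi>"

lemma phi_H10: "H10 \<Omega> \<phi>" using eig by (simp add: dirichlet_eigenpair_def)

lemma phi_wg: "wg \<phi> g" by (rule H1_wg[OF H10_H1[OF phi_H10]])

lemma Om_meas: "\<Omega> \<in> sets lebesgue" using op by auto

lemma fO_m: "fO \<in> borel_measurable lebesgue"
  unfolding fO_def[abs_def] using fm Om_meas by (intro borel_measurable_times borel_measurable_indicator)

lemma fO_mult:
  assumes "b \<in> borel_measurable lebesgue" "\<And>x. \<bar>b x\<bar> \<le> 1"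
  shows "(\<lambda>x. fO x * b x) \<in> borel_measurable lebesgue" "integrable lebesgue (\<lambda>x. \<bar>fO x * b x\<bar> powr (3/2))"
proof -
  show m: "(\<lambda>x. fO x * b x) \<in> borel_measurable lebesgue" using fO_m assms(1) by (rule borel_measurable_times)
  show "integrable lebesgue (\<lambda>x. \<bar>fO x * b x\<bar> powr (3/2))"
  proof (rule Bochner_Integration.integrable_bound[OF fi])
    show "(\<lambda>x. \<bar>fO x * b x\<bar> powr (3/2)) \<in> borel_measurable lebesgue" using m by measurable
    have "\<bar>fO x * b x\<bar> \<le> \<bar>f x\<bar>" for x
      using assms(2)[of x] by (auto simp: fO_def indicator_def abs_mult mult_left_le)
    then have "norm (\<bar>fO x * b x\<bar> powr (3/2)) \<le> norm (\<bar>f x\<bar> powr (3/2))" for x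
      by (simp add: powr_mono2)
    then show "AE x in lebesgue. norm (\<bar>fO x * b x\<bar> powr (3/2)) \<le> norm (\<bar>f x\<bar> powr (3/2))" by simp
  qed
qed

lemma fO_i: "integrable lebesgue (\<lambda>x. \<bar>fO x\<bar> powr (3/2))"
  using fO_mult(2)[of "\<lambda>x. 1"] by simp

lemma phi_L6: "L6b \<phi> (4096 * Dsq g ^ 3)" by (rule wg_L6b[OF phi_wg order_refl])

lemma phi_sign: "AE x in lebesgue. (x \<in> \<Omega> \<longrightarrow> \<phi> x > 0) \<and> (x \<notin> \<Omega> \<longrightarrow> \<phi> x = 0 \<and> g x = 0)"
  using pos H10_vanishes[OF phi_H10 phi_wg] by eventually_elim auto

lemma eq_test:
  assumes v: "test_fun \<Omega> v"
  shows "(\<Sum>i\<in>UNIV. \<integral>x. g x $ i * gr v x $ i \<partial>lebesgue) = lam1 * (\<integral>x. fO x * (\<phi> x * v x) \<partial>lebesgue)"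
proof -
  have w: "wg v (gr v)" by (rule C1c_wg[OF test_fun_C1c[OF v]])
  have w': "wg v (grad v)" by (rule H1_wg[OF wg_H1[OF w]])
  have "(\<Sum>i\<in>UNIV. \<integral>x. g x $ i * gr v x $ i \<partial>lebesgue) = (\<Sum>i\<in>UNIV. \<integral>x. g x $ i * grad v x $ i \<partial>lebesgue)"
  proof (rule sum.cong[OF refl], rule integral_cong_AE)
    fix i
    show "(\<lambda>x. g x $ i * gr v x $ i) \<in> borel_measurable lebesgue" "(\<lambda>x. g x $ i * grad v x $ i) \<in> borel_measurable lebesgue"
      by (intro borel_measurable_times L2_meas wgD(2)[OF phi_wg] wgD(2)[OF w] wgD(2)[OF w'])+
    show "AE x in lebesgue. g x $ i * gr v x $ i = g x $ i * grad v x $ i"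
      using wg_grad_AE[OF w] by eventually_elim simp
  qed
  also have "\<dots> = (\<integral>x. g x \<bullet> grad v x \<partial>lebesgue)" by (rule ip_integral(1)[symmetric, OF wgD(2)[OF phi_wg] wgD(2)[OF w']])
  also have "\<dots> = lam1 * (\<integral>x\<in>\<Omega>. f x * \<phi> x * v x \<partial>lebesgue)" using eig v by (auto simp: dirichlet_eigenpair_def)
  also have "(\<integral>x\<in>\<Omega>. f x * \<phi> x * v x \<partial>lebesgue) = (\<integral>x. fO x * (\<phi> x * v x) \<partial>lebesgue)"
    unfolding set_lebesgue_integral_def by (simp add: fO_def mult_ac)
  finally show ?thesis .
qed

lemma L2lim_Dsq_bounded:
  assumes "\<And>i. L2lim (\<lambda>n x. D n x $ i) (\<lambda>x. h x $ i)"
  obtains M where "\<And>n. Dsq (D n) \<le> M" "Dsq h \<le> M"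
proof -
  have "Bseq (\<lambda>n. Dsq (D n))" using L2lim_Dsq[of D h, OF assms] by (intro convergent_imp_Bseq) (auto simp: convergent_def)
  then obtain K where K: "\<And>n. \<bar>Dsq (D n)\<bar> \<le> K" by (auto simp: Bseq_def)
  show thesis
  proof (rule that[of "max K (Dsq h)"])
    show "Dsq (D n) \<le> max K (Dsq h)" for n using K[of n] by simp
  qed simp
qed

text \<open>Density of test functions; the right-hand side passes to the limit by
  \<open>weighted_bilinear_limit\<close>, as \<open>f\<close> need not be bounded.\<close>

lemma eq_H10:
  assumes w: "H10 \<Omega> w" "wg w h"
  shows "(\<Sum>i\<in>UNIV. \<integral>x. g x $ i * h x $ i \<partial>lebesgue) = lam1 * (\<integral>x. fO x * (\<phi> x * w x) \<partial>lebesgue)"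
proof -
  obtain ps where p: "\<And>n. test_fun \<Omega> (ps n)" "L2lim ps w" "\<And>i. L2lim (\<lambda>n x. gr (ps n) x $ i) (\<lambda>x. h x $ i)"
    using H10_obtain[OF w] by metis
  obtain M where M: "\<And>n. Dsq (gr (ps n)) \<le> M" "Dsq h \<le> M" using L2lim_Dsq_bounded[of "\<lambda>n. gr (ps n)" h, OF p(3)] by blast
  obtain r where r: "strict_mono r" "AE x in lebesgue. (\<lambda>n. ps (r n) x) \<longlonglongrightarrow> w x" using L2lim_AE_subseq[OF p(2)] by blast
  have "(\<lambda>n. \<Sum>i\<in>UNIV. \<integral>x. g x $ i * gr (ps (r n)) x $ i \<partial>lebesgue) \<longlonglongrightarrow> (\<Sum>i\<in>UNIV. \<integral>x. g x $ i * h x $ i \<partial>lebesgue)"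
    by (intro tendsto_sum L2lim_inner[OF L2lim_const[OF wgD(2)[OF phi_wg]] L2lim_subseq[OF p(3) r(1)]])
  moreover have "(\<lambda>n. lam1 * (\<integral>x. fO x * (\<phi> x * ps (r n) x) \<partial>lebesgue)) \<longlonglongrightarrow> lam1 * (\<integral>x. fO x * (\<phi> x * w x) \<partial>lebesgue)"
    by (intro tendsto_mult tendsto_const weighted_bilinear_limit[OF fO_m fO_i _ wg_L6b[OF w(2) M(2)] r(2) phi_L6])
      (rule wg_L6b[OF C1c_wg[OF test_fun_C1c[OF p(1)]] M(1)])
  ultimately show ?thesis unfolding eq_test[OF p(1)] by (rule LIMSEQ_unique)
qed

text \<open>The equation is tested with \<open>(v x)\<^sup>2 * G e (\<phi> x)\<close>, a regularized
  \<open>v\<^sup>2 / \<phi>\<close>. For \<open>\<phi> \<ge> 0\<close> one has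
  \<open>dG e = - (G e)\<^sup>2\<close>, which completes the square on the left-hand side.\<close>

lemma picone_test:
  assumes v: "test_fun \<Omega> v" and e: "e > 0"
  shows "(\<integral>x. (norm (gr v x - (v x * G e (\<phi> x)) *\<^sub>R g x))\<^sup>2 \<partial>lebesgue) =
    Dsq (gr v) - lam1 * (\<integral>x. (fO x * (\<phi> x * G e (\<phi> x))) * (v x)\<^sup>2 \<partial>lebesgue)"
proof -
  note C = test_fun_C1c[OF v]
  obtain B where B: "B > 0" "\<And>x. \<bar>v x\<bar> \<le> B" "\<And>x i. \<bar>gr v x $ i\<bar> \<le> B" using C1_uminus_mult_bound[OF C] by blast
  \<comment> \<open>\<open>\<phi>\<close> is only weakly differentiable, so inside
    \<open>G e\<close> it is replaced by test functions. The factors \<open>G e\<close> and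
    \<open>dG e\<close> are bounded and continuous, hence the gradients converge by
    \<open>L2lim_bdd_mult\<close>.\<close>
  obtain qs where q: "\<And>n. test_fun \<Omega> (qs n)" "L2lim qs \<phi>" "\<And>i. L2lim (\<lambda>n x. gr (qs n) x $ i) (\<lambda>x. g x $ i)"
    using H10_obtain[OF phi_H10 phi_wg] by metis
  obtain r where r: "strict_mono r" "AE x in lebesgue. (\<lambda>n. qs (r n) x) \<longlonglongrightarrow> \<phi> x" using L2lim_AE_subseq[OF q(2)] by blast
  define ps where "ps n = qs (r n)" for n
  have p: "\<And>n. test_fun \<Omega> (ps n)" "L2lim ps \<phi>" "\<And>i. L2lim (\<lambda>n x. gr (ps n) x $ i) (\<lambda>x. g x $ i)"
    "AE x in lebesgue. (\<lambda>n. ps n x) \<longlonglongrightarrow> \<phi> x"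
    unfolding ps_def using q(1) L2lim_subseq[OF q(2) r(1)] L2lim_subseq[OF q(3) r(1)] r(2) by auto
  note Cp = test_fun_C1c[OF p(1)]
  have vm: "v \<in> borel_measurable lebesgue" by (rule L2_meas[OF C1c_L2(1)[OF C]])
  have pm: "ps n \<in> borel_measurable lebesgue" for n by (rule L2_meas[OF C1c_L2(1)[OF Cp]])
  have fm': "\<phi> \<in> borel_measurable lebesgue" by (rule L2_meas[OF wgD(1)[OF phi_wg]])
  have Gm: "(\<lambda>x. G e (y x)) \<in> borel_measurable lebesgue" "(\<lambda>x. dG e (y x)) \<in> borel_measurable lebesgue"
    if "y \<in> borel_measurable lebesgue" for y :: "real^3 \<Rightarrow> real"
    using borel_measurable_continuous_on[OF G_continuous(1)[OF e] that] borel_measurable_continuous_on[OF G_continuous(2)[OF e] that] by auto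
  have Gl: "(\<lambda>n. G e (y n)) \<longlonglongrightarrow> G e l" "(\<lambda>n. dG e (y n)) \<longlonglongrightarrow> dG e l" if "y \<longlonglongrightarrow> l" for y l
    using continuous_on_tendsto_compose[OF G_continuous(1)[OF e] that] continuous_on_tendsto_compose[OF G_continuous(2)[OF e] that] by auto
  define w where "w n x = (v x * v x) * G e (ps n x)" for n x
  define W where "W n x = (v x * v x) *\<^sub>R (dG e (ps n x) *\<^sub>R gr (ps n) x) + G e (ps n x) *\<^sub>R (v x *\<^sub>R gr v x + v x *\<^sub>R gr v x)" for n x
  have Cw: "C1c (w n) (W n)" for n
  proof -
    have "C1 (w n) (W n)" unfolding w_def W_def
      by (rule C1_mult[OF C1_mult[OF C1c_imp_C1[OF C] C1c_imp_C1[OF C]] C1_comp[OF G_deriv[OF e] G_continuous(2)[OF e] C1c_imp_C1[OF Cp]]])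
    then show ?thesis using C by (auto simp: C1c_def w_def)
  qed
  have Hw: "H10 \<Omega> (w n)" for n
    by (rule H10_compact_support[OF C1c_wg[OF Cw], of "tsupp v"]) (use v op in \<open>auto simp: test_fun_def w_def test_fun_outside\<close>)
  have eqn: "(\<Sum>i\<in>UNIV. \<integral>x. g x $ i * W n x $ i \<partial>lebesgue) = lam1 * (\<integral>x. fO x * (\<phi> x * w n x) \<partial>lebesgue)" for n
    by (rule eq_H10[OF Hw C1c_wg[OF Cw]])
  define Wl where "Wl x = ((v x)\<^sup>2 * dG e (\<phi> x)) *\<^sub>R g x + (2 * v x * G e (\<phi> x)) *\<^sub>R gr v x" for x
  have lW: "L2lim (\<lambda>n x. W n x $ i) (\<lambda>x. Wl x $ i)" for i
  proof -
    have 1: "L2lim (\<lambda>n x. ((v x)\<^sup>2 * dG e (ps n x)) * gr (ps n) x $ i) (\<lambda>x. ((v x)\<^sup>2 * dG e (\<phi> x)) * g x $ i)"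
    proof (rule L2lim_bdd_mult[OF p(3), where C = "B\<^sup>2 * (1 / e\<^sup>2)"])
      show "(\<lambda>x. (v x)\<^sup>2 * dG e (ps n x)) \<in> borel_measurable lebesgue" "(\<lambda>x. (v x)\<^sup>2 * dG e (\<phi> x)) \<in> borel_measurable lebesgue" for n
        by (intro borel_measurable_times borel_measurable_power vm Gm pm fm')+
      show "\<bar>(v x)\<^sup>2 * dG e (ps n x)\<bar> \<le> B\<^sup>2 * (1 / e\<^sup>2)" for n x
        unfolding abs_mult by (rule mult_mono) (use B(1) B(2)[of x] G_bounds(3)[OF e] power_mono[OF B(2)[of x], of 2] in auto)
      show "AE x in lebesgue. (\<lambda>n. (v x)\<^sup>2 * dG e (ps n x)) \<longlonglongrightarrow> (v x)\<^sup>2 * dG e (\<phi> x)"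
        using p(4) by eventually_elim (intro tendsto_intros Gl)
    qed
    have 2: "L2lim (\<lambda>n x. (2 * v x * G e (ps n x)) * gr v x $ i) (\<lambda>x. (2 * v x * G e (\<phi> x)) * gr v x $ i)"
    proof (rule L2lim_bdd_mult[OF L2lim_const[OF C1c_L2(2)[OF C]], where C = "(2 * B) * (2 / e)"])
      show "(\<lambda>x. 2 * v x * G e (ps n x)) \<in> borel_measurable lebesgue" "(\<lambda>x. 2 * v x * G e (\<phi> x)) \<in> borel_measurable lebesgue" for n
        by (intro borel_measurable_times borel_measurable_const vm Gm pm fm')+
      show "\<bar>2 * v x * G e (ps n x)\<bar> \<le> (2 * B) * (2 / e)" for n x
        unfolding abs_mult[of "2 * v x"] by (rule mult_mono) (use B(1) B(2)[of x] G_bounds(2)[OF e] in auto)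
      show "AE x in lebesgue. (\<lambda>n. 2 * v x * G e (ps n x)) \<longlonglongrightarrow> 2 * v x * G e (\<phi> x)"
        using p(4) by eventually_elim (intro tendsto_intros Gl)
    qed
    show ?thesis using L2lim_add[OF 1 2] by (simp add: W_def Wl_def power2_eq_square algebra_simps)
  qed
  have lim1: "(\<lambda>n. \<Sum>i\<in>UNIV. \<integral>x. g x $ i * W n x $ i \<partial>lebesgue) \<longlonglongrightarrow> (\<Sum>i\<in>UNIV. \<integral>x. g x $ i * Wl x $ i \<partial>lebesgue)"
    by (intro tendsto_sum L2lim_inner[OF L2lim_const[OF wgD(2)[OF phi_wg]] lW])
  have vL6: "L6b v (4096 * Dsq (gr v) ^ 3)" by (rule wg_L6b[OF C1c_wg[OF C] order_refl])
  have lim2: "(\<lambda>n. \<integral>x. fO x * (\<phi> x * w n x) \<partial>lebesgue) \<longlonglongrightarrow> (\<integral>x. (fO x * (\<phi> x * G e (\<phi> x))) * (v x)\<^sup>2 \<partial>lebesgue)"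
  proof (rule integral_dominated_convergence[where w = "\<lambda>x. (B * (2 / e)) * \<bar>fO x * (\<phi> x * v x)\<bar>"])
    show "(\<lambda>x. fO x * (\<phi> x * G e (\<phi> x)) * (v x)\<^sup>2) \<in> borel_measurable lebesgue"
      by (intro borel_measurable_times borel_measurable_power fO_m fm' vm Gm)
    show "(\<lambda>x. fO x * (\<phi> x * w n x)) \<in> borel_measurable lebesgue" for n
      unfolding w_def by (intro borel_measurable_times fO_m fm' vm Gm pm)
    show "integrable lebesgue (\<lambda>x. (B * (2 / e)) * \<bar>fO x * (\<phi> x * v x)\<bar>)"
      by (intro integrable_mult_right integrable_abs weighted_bilinear_integrable[OF fO_m fO_i phi_L6 vL6])
    show "AE x in lebesgue. (\<lambda>n. fO x * (\<phi> x * w n x)) \<longlonglongrightarrow> fO x * (\<phi> x * G e (\<phi> x)) * (v x)\<^sup>2"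
      using p(4)
    proof eventually_elim
      case (elim x)
      have "(\<lambda>n. fO x * (\<phi> x * w n x)) \<longlonglongrightarrow> fO x * (\<phi> x * ((v x * v x) * G e (\<phi> x)))"
        unfolding w_def by (intro tendsto_intros Gl elim)
      then show ?case by (simp add: power2_eq_square mult_ac)
    qed
    have "\<bar>fO x * (\<phi> x * w n x)\<bar> \<le> (B * (2 / e)) * \<bar>fO x * (\<phi> x * v x)\<bar>" for n x
    proof -
      have "fO x * (\<phi> x * w n x) = (v x * G e (ps n x)) * (fO x * (\<phi> x * v x))" by (simp add: w_def mult_ac)
      also have "\<bar>\<dots>\<bar> \<le> (B * (2 / e)) * \<bar>fO x * (\<phi> x * v x)\<bar>"
        unfolding abs_mult[of "v x * G e (ps n x)"] abs_mult[of "v x" "G e (ps n x)"]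
        by (intro mult_right_mono mult_mono) (use B(1,2) G_bounds(2)[OF e] in auto)
      finally show ?thesis .
    qed
    then show "AE x in lebesgue. norm (fO x * (\<phi> x * w n x)) \<le> (B * (2 / e)) * \<bar>fO x * (\<phi> x * v x)\<bar>" for n by simp
  qed
  have key: "(\<Sum>i\<in>UNIV. \<integral>x. g x $ i * Wl x $ i \<partial>lebesgue) = lam1 * (\<integral>x. (fO x * (\<phi> x * G e (\<phi> x))) * (v x)\<^sup>2 \<partial>lebesgue)"
    using lim1 tendsto_mult[OF tendsto_const[of lam1] lim2] unfolding eqn by (rule LIMSEQ_unique)
  have LW: "L2 (\<lambda>x. Wl x $ i)" for i by (rule L2limD(2)[OF lW])
  have bm: "(\<lambda>x. v x * G e (\<phi> x)) \<in> borel_measurable lebesgue" by (intro borel_measurable_times vm Gm fm')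
  have bb: "\<bar>v x * G e (\<phi> x)\<bar> \<le> B * (2 / e)" for x
    unfolding abs_mult by (rule mult_mono) (use B(1) B(2)[of x] G_bounds(2)[OF e] in auto)
  have Lb: "L2 (\<lambda>x. (gr v x - (v x * G e (\<phi> x)) *\<^sub>R g x) $ i)" for i
    using L2_diff[OF C1c_L2(2)[OF C, of i] L2_bdd_mult[OF wgD(2)[OF phi_wg, of i] bm bb]] by simp
  have "(\<integral>x. (norm (gr v x - (v x * G e (\<phi> x)) *\<^sub>R g x))\<^sup>2 \<partial>lebesgue) = (\<integral>x. (norm (gr v x))\<^sup>2 - g x \<bullet> Wl x \<partial>lebesgue)"
  proof (rule integral_cong_AE)
    show "(\<lambda>x. (norm (gr v x - (v x * G e (\<phi> x)) *\<^sub>R g x))\<^sup>2) \<in> borel_measurable lebesgue"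
      by (rule borel_measurable_integrable[OF Dsq_integral(1)[OF Lb]])
    show "(\<lambda>x. (norm (gr v x))\<^sup>2 - g x \<bullet> Wl x) \<in> borel_measurable lebesgue"
      by (intro borel_measurable_diff borel_measurable_integrable[OF Dsq_integral(1)[OF C1c_L2(2)[OF C]]]
          borel_measurable_integrable[OF ip_integral(2)[OF wgD(2)[OF phi_wg] LW]])
    show "AE x in lebesgue. (norm (gr v x - (v x * G e (\<phi> x)) *\<^sub>R g x))\<^sup>2 = (norm (gr v x))\<^sup>2 - g x \<bullet> Wl x"
      using phi_sign
    proof eventually_elim
      case (elim x)
      have "\<phi> x \<ge> 0" using elim by (cases "x \<in> \<Omega>") auto
      then have d: "dG e (\<phi> x) = - (G e (\<phi> x))\<^sup>2" using e by (simp add: dG_def G_nonneg_arg power_divide)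
      show ?case unfolding Wl_def d power2_norm_eq_inner
        by (simp add: inner_diff_left inner_diff_right inner_add_right inner_commute power2_eq_square algebra_simps)
    qed
  qed
  also have "\<dots> = Dsq (gr v) - (\<Sum>i\<in>UNIV. \<integral>x. g x $ i * Wl x $ i \<partial>lebesgue)"
    using Dsq_integral[OF C1c_L2(2)[OF C]] ip_integral[OF wgD(2)[OF phi_wg] LW] by simp
  finally show ?thesis by (simp add: key)
qed

end

text \<open>Near \<open>x0\<close> the mollifications at small scales have derivative
  \<open>0\<close> and are constant on a ball. Their pointwise limit is therefore locally constant
  on \<open>\<Omega>\<close>, and connectedness makes it constant.\<close>

lemma zero_gradient_const:
  assumes op: "open \<Omega>" and con: "connected \<Omega>" and F: "L2 F"
    and z: "\<And>\<psi> i. test_fun \<Omega> \<psi> \<Longrightarrow> (\<integral>x. F x * gr \<psi> x $ i \<partial>lebesgue) = 0"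
  shows "\<exists>c. AE x in lebesgue. x \<in> \<Omega> \<longrightarrow> F x = c"
proof -
  define e where "e n = inverse (real (Suc n))" for n
  have e: "e n > 0" "e \<longlonglongrightarrow> 0" for n
    using LIMSEQ_inverse_real_of_nat by (auto simp: e_def[abs_def] simp del: of_nat_Suc)
  obtain r where r: "strict_mono r" "AE x in lebesgue. (\<lambda>n. conv (e (r n)) F x) \<longlonglongrightarrow> F x"
    using L2lim_AE_subseq[OF conv_L2lim[OF F e]] by blast
  define c where "c x = lim (\<lambda>n. conv (e (r n)) F x)" for x
  have Fc: "AE x in lebesgue. F x = c x" using r(2) by eventually_elim (simp add: c_def limI)
  have "\<exists>T. openin (top_of_set \<Omega>) T \<and> x0 \<in> T \<and> (\<forall>x\<in>T. c x = c x0)" if x0: "x0 \<in> \<Omega>" for x0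
  proof -
    obtain d where d: "d > 0" "cball x0 d \<subseteq> \<Omega>" using op x0 open_contains_cball by blast
    have loc: "conv (e n) F x = conv (e n) F x0" if n: "e n < d / 2" and x: "x \<in> ball x0 (d / 2)" for n x
    proof -
      have "\<exists>k. \<forall>y\<in>ball x0 (d / 2). conv (e n) F y = k"
      proof (rule has_derivative_zero_constant[OF convex_ball])
        fix y assume y: "y \<in> ball x0 (d / 2)"
        have t: "test_fun \<Omega> (\<lambda>t. rho (e n) (y - t))"
        proof (rule test_funI[OF _ compact_cball[of y "e n"]])
          show "smooth_on UNIV (\<lambda>t. rho (e n) (y - t))"
            using rho_shift_test_fun(1)[OF e(1), of n y] by (simp add: test_fun_def)
          show "cball y (e n) \<subseteq> \<Omega>"
          proof
            fix t assume "t \<in> cball y (e n)"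
            then have "dist x0 t \<le> d" using y n dist_triangle[of x0 t y] by simp
            then show "t \<in> \<Omega>" using d(2) by auto
          qed
          show "rho (e n) (y - t) = 0" if "t \<notin> cball y (e n)" for t
            using that e(1)[of n] by (intro rho_eq_0) (auto simp: dist_norm)
        qed
        have "ck (\<lambda>x. gr (rho (e n)) x $ i) F y = 0" for i
          using z[OF t, of i] by (simp add: ck_def rho_shift_test_fun(2)[OF e(1)])
        then have "(conv (e n) F has_derivative (\<lambda>h. 0)) (at y)"
          using ck_has_derivative[OF L2_loc_int[OF F] rho_C1c[OF e(1)], of n y]
          by (simp add: inner_vec_def)
        then show "(conv (e n) F has_derivative (\<lambda>h. 0)) (at y within ball x0 (d / 2))"
          by (rule has_derivative_at_withinI)
      qed
      then show ?thesis using x d(1) by (metis centre_in_ball half_gt_zero)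
    qed
    have ev: "\<forall>\<^sub>F n in sequentially. e (r n) < d / 2"
      using LIMSEQ_subseq_LIMSEQ[OF e(2) r(1)] d(1) by (intro order_tendstoD(2)) (auto simp: o_def)
    have "c x = c x0" if x: "x \<in> ball x0 (d / 2)" for x
    proof -
      \<comment> \<open>The two sequences agree eventually, so they have the same limits
        \<open>l\<close>, possibly none. Hence \<open>lim\<close> takes the same value for both even
        where they diverge, and \<open>c\<close> is locally constant at every point.\<close>
      have "((\<lambda>n. conv (e (r n)) F x) \<longlonglongrightarrow> l) = ((\<lambda>n. conv (e (r n)) F x0) \<longlonglongrightarrow> l)" for l
        by (rule tendsto_cong) (use ev in eventually_elim, rule loc[OF _ x])
      then show ?thesis by (simp add: c_def lim_def)
    qed
    moreover have "openin (top_of_set \<Omega>) (ball x0 (d / 2))"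
    proof (rule open_subset[OF subset_trans[OF _ d(2)] open_ball])
      show "ball x0 (d / 2) \<subseteq> cball x0 d"
        using subset_trans[OF subset_ball[of "d / 2" d x0] ball_subset_cball] d(1) by simp
    qed
    moreover have "x0 \<in> ball x0 (d / 2)" using d(1) by simp
    ultimately show ?thesis by blast
  qed
  then have "c constant_on \<Omega>" by (rule locally_constant_imp_constant[OF con])
  then obtain k where "\<forall>x\<in>\<Omega>. c x = k" by (auto simp: constant_on_def)
  then have "AE x in lebesgue. x \<in> \<Omega> \<longrightarrow> F x = k" using Fc by (auto elim: AE_mp)
  then show ?thesis by blast
qed

lemma test_fun_zero_outside:
  assumes "test_fun U \<psi>" "x \<notin> U" shows "\<psi> x = 0" "gr \<psi> x = 0"
proof -
  have o: "x \<notin> tsupp \<psi>" using assms by (auto simp: test_fun_def)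
  show "\<psi> x = 0" by (rule test_fun_outside[OF o])
  show "gr \<psi> x = 0"
  proof (rule C1_support[OF C1c_imp_C1[OF test_fun_C1c[OF assms(1)]], of "- tsupp \<psi>" x 0])
    show "open (- tsupp \<psi>)" by (simp add: tsupp_def open_Compl)
    show "x \<in> - tsupp \<psi>" using o by simp
    show "\<psi> y = 0" if "y \<in> - tsupp \<psi>" for y by (rule test_fun_outside) (use that in simp)
  qed
qed

lemma arctan_deriv_bounds:
  fixes z :: real
  shows "0 < inverse (1 + z\<^sup>2)" "inverse (1 + z\<^sup>2) \<le> 1" "inverse (1 + z\<^sup>2) * \<bar>z\<bar> \<le> 1"
proof -
  have p: "1 + z\<^sup>2 > 0" using zero_le_power2[of z] by linarith
  then show "0 < inverse (1 + z\<^sup>2)" by simp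
  show "inverse (1 + z\<^sup>2) \<le> 1" using p by (simp add: inverse_le_1_iff)
  have "\<bar>z\<bar> \<le> 1 + z\<^sup>2" using le_add_square_div[of 1 z] by simp
  then show "inverse (1 + z\<^sup>2) * \<bar>z\<bar> \<le> 1" using p by (simp add: divide_inverse[symmetric] mult.commute)
qed

lemma arctan_abs_le: "\<bar>arctan x\<bar> \<le> pi / 2"
  using arctan_bounded[of x] by linarith

context eigen_setting
begin

lemma phi_m: "\<phi> \<in> borel_measurable lebesgue" by (rule L2_meas[OF wgD(1)[OF phi_wg]])

lemma G_meas:
  assumes "e > 0" "y \<in> borel_measurable lebesgue"
  shows "(\<lambda>x. G e (y x)) \<in> borel_measurable lebesgue" "(\<lambda>x. dG e (y x)) \<in> borel_measurable lebesgue"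
  using borel_measurable_continuous_on[OF G_continuous(1)[OF assms(1)] assms(2)]
    borel_measurable_continuous_on[OF G_continuous(2)[OF assms(1)] assms(2)] by auto

lemma G_lim:
  assumes "e > 0" "y \<longlonglongrightarrow> l" shows "(\<lambda>n. G e (y n)) \<longlonglongrightarrow> G e l" "(\<lambda>n. dG e (y n)) \<longlonglongrightarrow> dG e l"
  using continuous_on_tendsto_compose[OF G_continuous(1)[OF assms(1)] assms(2)]
    continuous_on_tendsto_compose[OF G_continuous(2)[OF assms(1)] assms(2)] by auto

text \<open>The quotient \<open>\<phi> / (\<phi> + e)\<close>. The truncation \<open>max 0\<close>
  makes its modulus at most \<open>1\<close> everywhere, while \<open>\<phi>\<close> is nonnegative
  only almost everywhere; \<open>fO_mult\<close> asks for a pointwise bound.\<close>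

definition bt :: "real \<Rightarrow> real^3 \<Rightarrow> real" where "bt e x = max 0 (\<phi> x) * G e (\<phi> x)"

lemma bt: assumes "e > 0" shows "bt e \<in> borel_measurable lebesgue" "\<bar>bt e x\<bar> \<le> 1"
proof -
  show "bt e \<in> borel_measurable lebesgue" unfolding bt_def[abs_def]
    using phi_m G_meas(1)[OF assms phi_m] by measurable
  show "\<bar>bt e x\<bar> \<le> 1"
  proof (cases "\<phi> x \<ge> 0")
    case True
    then show ?thesis using assms by (simp add: bt_def G_nonneg_arg field_simps)
  qed (simp add: bt_def)
qed

lemma picone_test_L2:
  assumes v: "test_fun \<Omega> v" and e: "e > 0"
  shows "L2 (\<lambda>x. (gr v x - (v x * G e (\<phi> x)) *\<^sub>R g x) $ i)"
proof -
  note C = test_fun_C1c[OF v]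
  obtain B where B: "B > 0" "\<And>x. \<bar>v x\<bar> \<le> B" "\<And>x i. \<bar>gr v x $ i\<bar> \<le> B" using C1_uminus_mult_bound[OF C] by blast
  have bm: "(\<lambda>x. v x * G e (\<phi> x)) \<in> borel_measurable lebesgue"
    by (intro borel_measurable_times L2_meas[OF C1c_L2(1)[OF C]] G_meas e phi_m)
  have bb: "\<bar>v x * G e (\<phi> x)\<bar> \<le> B * (2 / e)" for x
    unfolding abs_mult by (rule mult_mono) (use B(1) B(2)[of x] G_bounds(2)[OF e] in auto)
  show ?thesis
    using L2_diff[OF C1c_L2(2)[OF C, of i] L2_bdd_mult[OF wgD(2)[OF phi_wg, of i] bm bb]] by simp
qed

lemma fO_bt_eq:
  assumes "v \<in> borel_measurable lebesgue" "e > 0"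
  shows "(\<integral>x. (fO x * (\<phi> x * G e (\<phi> x))) * (v x)\<^sup>2 \<partial>lebesgue) = (\<integral>x. (fO x * bt e x) * (v x)\<^sup>2 \<partial>lebesgue)"
proof (rule integral_cong_AE)
  show "(\<lambda>x. (fO x * (\<phi> x * G e (\<phi> x))) * (v x)\<^sup>2) \<in> borel_measurable lebesgue"
    "(\<lambda>x. (fO x * bt e x) * (v x)\<^sup>2) \<in> borel_measurable lebesgue"
    by (intro borel_measurable_times borel_measurable_power fO_m phi_m G_meas bt assms)+
  show "AE x in lebesgue. (fO x * (\<phi> x * G e (\<phi> x))) * (v x)\<^sup>2 = (fO x * bt e x) * (v x)\<^sup>2"
    using phi_sign
  proof eventually_elim
    case (elim x)
    then have "\<phi> x \<ge> 0" by (cases "x \<in> \<Omega>") auto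
    then show ?case by (simp add: bt_def)
  qed
qed

lemma vec_diff_sq_meas:
  assumes "\<And>i. (\<lambda>x. h x $ i) \<in> borel_measurable lebesgue" "b \<in> borel_measurable lebesgue"
  shows "(\<lambda>x. (norm (h x - b x *\<^sub>R g x))\<^sup>2) \<in> borel_measurable lebesgue"
proof -
  have "(\<lambda>x. h x $ i - b x * g x $ i) \<in> borel_measurable lebesgue" for i
    by (intro borel_measurable_diff borel_measurable_times assms L2_meas[OF wgD(2)[OF phi_wg]])
  then have "(\<lambda>x. \<Sum>i\<in>UNIV. (h x $ i - b x * g x $ i)\<^sup>2) \<in> borel_measurable lebesgue"
    by (intro borel_measurable_sum borel_measurable_power)
  then show ?thesis by (simp add: norm_sq_sum)
qed

text \<open>Approximation by test functions: the square passes to the limit by Fatou, which keeps an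
  inequality, and the right-hand side converges by \<open>weighted_limit\<close>.\<close>

lemma picone_H10_approx:
  assumes v: "H10 \<Omega> v" "wg v h" and e: "e > 0"
  shows "integrable lebesgue (\<lambda>x. (norm (h x - (v x * G e (\<phi> x)) *\<^sub>R g x))\<^sup>2)"
    "(\<integral>x. (norm (h x - (v x * G e (\<phi> x)) *\<^sub>R g x))\<^sup>2 \<partial>lebesgue) \<le> Dsq h - lam1 * (\<integral>x. (fO x * bt e x) * (v x)\<^sup>2 \<partial>lebesgue)"
proof -
  obtain ps where p: "\<And>n. test_fun \<Omega> (ps n)" "L2lim ps v" "\<And>i. L2lim (\<lambda>n x. gr (ps n) x $ i) (\<lambda>x. h x $ i)"
    using H10_obtain[OF v] by metis
  obtain r where r: "strict_mono r" "AE x in lebesgue. (\<lambda>n. ps (r n) x) \<longlonglongrightarrow> v x \<and> (\<lambda>n. gr (ps (r n)) x) \<longlonglongrightarrow> h x"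
    using H10_AE_subseq[of ps v "\<lambda>n. gr (ps n)" h, OF p(2,3)] by blast
  obtain M where M: "\<And>n. Dsq (gr (ps n)) \<le> M" "Dsq h \<le> M" using L2lim_Dsq_bounded[of "\<lambda>n. gr (ps n)" h, OF p(3)] by blast
  have vm: "v \<in> borel_measurable lebesgue" by (rule L2_meas[OF wgD(1)[OF v(2)]])
  have i: "integrable lebesgue (\<lambda>x. (norm (gr (ps (r n)) x - (ps (r n) x * G e (\<phi> x)) *\<^sub>R g x))\<^sup>2)" for n
    by (rule Dsq_integral(1)[OF picone_test_L2[OF p(1) e]])
  have m: "(\<lambda>x. (norm (h x - (v x * G e (\<phi> x)) *\<^sub>R g x))\<^sup>2) \<in> borel_measurable lebesgue"
    by (intro vec_diff_sq_meas L2_meas[OF wgD(2)[OF v(2)]] borel_measurable_times vm G_meas e phi_m)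
  have l: "AE x in lebesgue. (\<lambda>n. (norm (gr (ps (r n)) x - (ps (r n) x * G e (\<phi> x)) *\<^sub>R g x))\<^sup>2) \<longlonglongrightarrow>
      (norm (h x - (v x * G e (\<phi> x)) *\<^sub>R g x))\<^sup>2"
    using r(2) by eventually_elim (auto intro!: tendsto_intros)
  have b: "(\<integral>x. (norm (gr (ps (r n)) x - (ps (r n) x * G e (\<phi> x)) *\<^sub>R g x))\<^sup>2 \<partial>lebesgue) \<le>
      Dsq (gr (ps (r n))) - lam1 * (\<integral>x. (fO x * bt e x) * (ps (r n) x)\<^sup>2 \<partial>lebesgue)" for n
    unfolding picone_test[OF p(1) e] fO_bt_eq[OF L2_meas[OF C1c_L2(1)[OF test_fun_C1c[OF p(1)]]] e] by simp
  have D: "(\<lambda>n. Dsq (gr (ps (r n)))) \<longlonglongrightarrow> Dsq h"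
    using LIMSEQ_subseq_LIMSEQ[OF L2lim_Dsq[of "\<lambda>n. gr (ps n)" h, OF p(3)] r(1)] by (simp add: o_def)
  have c: "(\<lambda>n. Dsq (gr (ps (r n))) - lam1 * (\<integral>x. (fO x * bt e x) * (ps (r n) x)\<^sup>2 \<partial>lebesgue)) \<longlonglongrightarrow>
      Dsq h - lam1 * (\<integral>x. (fO x * bt e x) * (v x)\<^sup>2 \<partial>lebesgue)"
  proof (intro tendsto_diff D tendsto_mult tendsto_const)
    show "(\<lambda>n. \<integral>x. (fO x * bt e x) * (ps (r n) x)\<^sup>2 \<partial>lebesgue) \<longlonglongrightarrow> (\<integral>x. (fO x * bt e x) * (v x)\<^sup>2 \<partial>lebesgue)"
      by (rule weighted_limit[OF fO_mult[OF bt[OF e]] wg_L6b[OF C1c_wg[OF test_fun_C1c[OF p(1)]] M(1)] wg_L6b[OF v(2) M(2)]])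
        (use r(2) in \<open>auto elim: AE_mp\<close>)
  qed
  show "integrable lebesgue (\<lambda>x. (norm (h x - (v x * G e (\<phi> x)) *\<^sub>R g x))\<^sup>2)"
    "(\<integral>x. (norm (h x - (v x * G e (\<phi> x)) *\<^sub>R g x))\<^sup>2 \<partial>lebesgue) \<le> Dsq h - lam1 * (\<integral>x. (fO x * bt e x) * (v x)\<^sup>2 \<partial>lebesgue)"
    using Fatou_bound(1,2)[OF i _ m l b c] by auto
qed

text \<open>The regularization is removed by Fatou once more, with \<open>bt (e n)\<close> tending
  to \<open>1\<close> on \<open>\<Omega>\<close>. Off \<open>\<Omega>\<close> both gradients and
  \<open>v\<close> vanish almost everywhere, so the value of \<open>v x / \<phi> x\<close> there is
  harmless.\<close>

lemma Picone:
  assumes v: "H10 \<Omega> v" "wg v h"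
  shows "integrable lebesgue (\<lambda>x. (norm (h x - (v x / \<phi> x) *\<^sub>R g x))\<^sup>2)"
    "(\<integral>x. (norm (h x - (v x / \<phi> x) *\<^sub>R g x))\<^sup>2 \<partial>lebesgue) \<le> Dsq h - lam1 * (\<integral>x. fO x * (v x)\<^sup>2 \<partial>lebesgue)"
proof -
  define e where "e n = inverse (real (Suc n))" for n
  have e: "e n > 0" "e \<longlonglongrightarrow> 0" for n
    using LIMSEQ_inverse_real_of_nat by (auto simp: e_def[abs_def] simp del: of_nat_Suc)
  have vm: "v \<in> borel_measurable lebesgue" by (rule L2_meas[OF wgD(1)[OF v(2)]])
  note vL6 = wg_L6b[OF v(2) order_refl]
  have Gl: "(\<lambda>n. G (e n) t) \<longlonglongrightarrow> 1 / t" if "t > 0" for t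
  proof -
    have "(\<lambda>n. 1 / (e n + t)) \<longlonglongrightarrow> 1 / (0 + t)" by (intro tendsto_intros e) (use that in simp)
    then show ?thesis using that e(1) by (simp add: G_nonneg_arg)
  qed
  have m: "(\<lambda>x. (norm (h x - (v x / \<phi> x) *\<^sub>R g x))\<^sup>2) \<in> borel_measurable lebesgue"
    by (intro vec_diff_sq_meas L2_meas[OF wgD(2)[OF v(2)]] borel_measurable_divide vm phi_m)
  have l: "AE x in lebesgue. (\<lambda>n. (norm (h x - (v x * G (e n) (\<phi> x)) *\<^sub>R g x))\<^sup>2) \<longlonglongrightarrow> (norm (h x - (v x / \<phi> x) *\<^sub>R g x))\<^sup>2"
    using phi_sign H10_vanishes[OF v]
  proof eventually_elim
    case (elim x)
    show ?case
    proof (cases "x \<in> \<Omega>")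
      case True
      then have "\<phi> x > 0" using elim by simp
      then have "(\<lambda>n. (norm (h x - (v x * G (e n) (\<phi> x)) *\<^sub>R g x))\<^sup>2) \<longlonglongrightarrow> (norm (h x - (v x * (1 / \<phi> x)) *\<^sub>R g x))\<^sup>2"
        by (intro tendsto_intros Gl)
      then show ?thesis by simp
    qed (use elim in simp)
  qed
  have c: "(\<lambda>n. Dsq h - lam1 * (\<integral>x. (fO x * bt (e n) x) * (v x)\<^sup>2 \<partial>lebesgue)) \<longlonglongrightarrow>
      Dsq h - lam1 * (\<integral>x. fO x * (v x)\<^sup>2 \<partial>lebesgue)"
  proof (intro tendsto_diff tendsto_mult tendsto_const)
    show "(\<lambda>n. \<integral>x. (fO x * bt (e n) x) * (v x)\<^sup>2 \<partial>lebesgue) \<longlonglongrightarrow> (\<integral>x. fO x * (v x)\<^sup>2 \<partial>lebesgue)"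
    proof (rule integral_dominated_convergence[where w = "\<lambda>x. \<bar>fO x * (v x)\<^sup>2\<bar>"])
      show "(\<lambda>x. fO x * (v x)\<^sup>2) \<in> borel_measurable lebesgue" "(\<lambda>x. (fO x * bt (e n) x) * (v x)\<^sup>2) \<in> borel_measurable lebesgue" for n
        by (intro borel_measurable_times borel_measurable_power fO_m bt vm e)+
      show "integrable lebesgue (\<lambda>x. \<bar>fO x * (v x)\<^sup>2\<bar>)" by (rule integrable_abs[OF weighted_integrable[OF fO_m fO_i vL6]])
      show "AE x in lebesgue. (\<lambda>n. (fO x * bt (e n) x) * (v x)\<^sup>2) \<longlonglongrightarrow> fO x * (v x)\<^sup>2"
        using phi_sign
      proof eventually_elim
        case (elim x)
        show ?case
        proof (cases "x \<in> \<Omega>")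
          case True
          then have p: "\<phi> x > 0" using elim by simp
          then have "(\<lambda>n. (fO x * (\<phi> x * G (e n) (\<phi> x))) * (v x)\<^sup>2) \<longlonglongrightarrow> (fO x * (\<phi> x * (1 / \<phi> x))) * (v x)\<^sup>2"
            by (intro tendsto_intros Gl)
          then show ?thesis using p by (simp add: bt_def max_def)
        qed (simp add: fO_def)
      qed
      have "\<bar>(fO x * bt (e n) x) * (v x)\<^sup>2\<bar> \<le> \<bar>fO x * (v x)\<^sup>2\<bar>" for n x
      proof -
        have "\<bar>(fO x * bt (e n) x) * (v x)\<^sup>2\<bar> = \<bar>bt (e n) x\<bar> * \<bar>fO x * (v x)\<^sup>2\<bar>" by (simp add: abs_mult)
        also have "\<dots> \<le> 1 * \<bar>fO x * (v x)\<^sup>2\<bar>" by (rule mult_right_mono[OF bt(2)[OF e(1)]]) simp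
        finally show ?thesis by simp
      qed
      then show "AE x in lebesgue. norm ((fO x * bt (e n) x) * (v x)\<^sup>2) \<le> \<bar>fO x * (v x)\<^sup>2\<bar>" for n by simp
    qed
  qed
  show "integrable lebesgue (\<lambda>x. (norm (h x - (v x / \<phi> x) *\<^sub>R g x))\<^sup>2)"
    "(\<integral>x. (norm (h x - (v x / \<phi> x) *\<^sub>R g x))\<^sup>2 \<partial>lebesgue) \<le> Dsq h - lam1 * (\<integral>x. fO x * (v x)\<^sup>2 \<partial>lebesgue)"
    using Fatou_bound(1,2)[OF picone_H10_approx(1)[OF v e(1)] _ m l picone_H10_approx(2)[OF v e(1)] c] by auto
qed

text \<open>The logarithmic gradient of \<open>\<phi>\<close>, localized by \<open>v\<close>. It is
  the difference of \<open>gr v\<close> and the vector field that \<open>Picone\<close> shows to be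
  square integrable, even if \<open>\<phi>\<close> comes close to \<open>0\<close> on the support of
  \<open>v\<close>.\<close>

lemma log_gradient_L2:
  assumes v: "test_fun \<Omega> v" shows "L2 (\<lambda>x. (v x / \<phi> x) * g x $ i)"
proof -
  note C = test_fun_C1c[OF v]
  have H: "H10 \<Omega> v"
    by (rule H10_compact_support[OF C1c_wg[OF C], of "tsupp v"]) (use v op in \<open>auto simp: test_fun_def test_fun_outside\<close>)
  let ?d = "\<lambda>x. gr v x - (v x / \<phi> x) *\<^sub>R g x"
  have m: "(\<lambda>x. ?d x $ i) \<in> borel_measurable lebesgue"
    using L2_meas[OF C1c_L2(2)[OF C, of i]] L2_meas[OF C1c_L2(1)[OF C]] phi_m L2_meas[OF wgD(2)[OF phi_wg, of i]]
    by simp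
  have "integrable lebesgue (\<lambda>x. (?d x $ i)\<^sup>2)"
  proof (rule Bochner_Integration.integrable_bound[OF Picone(1)[OF H C1c_wg[OF C]]])
    show "(\<lambda>x. (?d x $ i)\<^sup>2) \<in> borel_measurable lebesgue" by (rule borel_measurable_power[OF m])
    have "\<bar>?d x $ i\<bar>\<^sup>2 \<le> (norm (?d x))\<^sup>2" for x by (rule power_mono[OF component_le_norm_cart]) simp
    then show "AE x in lebesgue. norm ((?d x $ i)\<^sup>2) \<le> norm ((norm (?d x))\<^sup>2)" by simp
  qed
  then have "L2 (\<lambda>x. ?d x $ i)" using m by (simp add: L2_def)
  from L2_diff[OF C1c_L2(2)[OF C, of i] this] show ?thesis by simp
qed

text \<open>The product of \<open>v\<close> with \<open>dG e (\<phi>)\<close> is not a bounded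
  multiplier. The derivative of \<open>arctan\<close> repairs this since
  \<open>inverse (1 + z\<^sup>2) * \<bar>z\<bar> \<le> 1\<close>, and the chain rule passes from
  \<open>C1c\<close> approximations to the limit in the mean.\<close>

lemma arctan_chain:
  assumes v: "wg v h" and e: "e > 0" and \<psi>: "C1c \<psi> E"
  shows "(\<integral>x. arctan (v x * G e (\<phi> x)) * E x $ i \<partial>lebesgue) =
    - (\<integral>x. (inverse (1 + (v x * G e (\<phi> x))\<^sup>2) * (v x * dG e (\<phi> x)) * g x $ i +
        inverse (1 + (v x * G e (\<phi> x))\<^sup>2) * G e (\<phi> x) * h x $ i) * \<psi> x \<partial>lebesgue)"
proof -
  obtain p0 P0 where p0: "\<And>n. C1c (p0 n) (P0 n)" "L2lim p0 \<phi>" "\<And>i. L2lim (\<lambda>n x. P0 n x $ i) (\<lambda>x. g x $ i)"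
    using wg_approx[OF phi_wg] by metis
  obtain q0 Q0 where q0: "\<And>n. C1c (q0 n) (Q0 n)" "L2lim q0 v" "\<And>i. L2lim (\<lambda>n x. Q0 n x $ i) (\<lambda>x. h x $ i)"
    using wg_approx[OF v] by metis
  obtain r where r: "strict_mono r" "AE x in lebesgue. (\<lambda>n. p0 (r n) x) \<longlonglongrightarrow> \<phi> x" using L2lim_AE_subseq[OF p0(2)] by blast
  obtain s where s: "strict_mono s" "AE x in lebesgue. (\<lambda>n. q0 (r (s n)) x) \<longlonglongrightarrow> v x"
    using L2lim_AE_subseq[OF L2lim_subseq[OF q0(2) r(1)]] by blast
  have rs: "strict_mono (\<lambda>n. r (s n))" using strict_mono_o[OF r(1) s(1)] by (simp add: o_def)
  define p where "p n = p0 (r (s n))" for n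
  define P where "P n = P0 (r (s n))" for n
  define q where "q n = q0 (r (s n))" for n
  define Q where "Q n = Q0 (r (s n))" for n
  have pq: "\<And>n. C1c (p n) (P n)" "\<And>i. L2lim (\<lambda>n x. P n x $ i) (\<lambda>x. g x $ i)"
    "\<And>n. C1c (q n) (Q n)" "\<And>i. L2lim (\<lambda>n x. Q n x $ i) (\<lambda>x. h x $ i)"
    unfolding p_def P_def q_def Q_def using p0(1) q0(1) L2lim_subseq[OF p0(3) rs] L2lim_subseq[OF q0(3) rs] by auto
  have pl: "AE x in lebesgue. (\<lambda>n. p n x) \<longlonglongrightarrow> \<phi> x" using r(2)
    by eventually_elim (use LIMSEQ_subseq_LIMSEQ[OF _ s(1)] in \<open>force simp: p_def o_def\<close>)
  have ql: "AE x in lebesgue. (\<lambda>n. q n x) \<longlonglongrightarrow> v x" using s(2) by (simp add: q_def)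
  have pm: "p n \<in> borel_measurable lebesgue" "q n \<in> borel_measurable lebesgue" for n
    using L2_meas[OF C1c_L2(1)[OF pq(1)]] L2_meas[OF C1c_L2(1)[OF pq(3)]] by auto
  have vm: "v \<in> borel_measurable lebesgue" by (rule L2_meas[OF wgD(1)[OF v]])
  define T where "T z = inverse (1 + z\<^sup>2)" for z :: real
  have Tc: "continuous_on UNIV T" unfolding T_def[abs_def]
  proof (intro continuous_intros ballI)
    show "1 + z\<^sup>2 \<noteq> 0" for z :: real using zero_le_power2[of z] by linarith
  qed
  have Tm: "(\<lambda>x. T (y x)) \<in> borel_measurable lebesgue" if "y \<in> borel_measurable lebesgue" for y :: "real^3 \<Rightarrow> real"
    using borel_measurable_continuous_on[OF Tc that] .
  have Tl: "(\<lambda>n. T (y n)) \<longlonglongrightarrow> T l" if "y \<longlonglongrightarrow> l" for y l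
    by (rule continuous_on_tendsto_compose[OF Tc that]) auto
  note meas = borel_measurable_times borel_measurable_const Tm G_meas e pm vm phi_m
  have C: "C1c (\<lambda>x. arctan (q n x * G e (p n x))) (\<lambda>x. T (q n x * G e (p n x)) *\<^sub>R (q n x *\<^sub>R (dG e (p n x) *\<^sub>R P n x) + G e (p n x) *\<^sub>R Q n x))" for n
  proof -
    have "C1 (\<lambda>x. arctan (q n x * G e (p n x))) (\<lambda>x. T (q n x * G e (p n x)) *\<^sub>R (q n x *\<^sub>R (dG e (p n x) *\<^sub>R P n x) + G e (p n x) *\<^sub>R Q n x))"
      by (rule C1_comp[OF _ Tc C1_mult[OF C1c_imp_C1[OF pq(3)] C1_comp[OF G_deriv[OF e] G_continuous(2)[OF e] C1c_imp_C1[OF pq(1)]]]])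
        (auto simp: T_def intro: DERIV_arctan)
    then show ?thesis using pq(3)[of n] unfolding C1c_def by (metis arctan_zero_zero mult_zero_left)
  qed
  define b1 where "b1 n x = T (q n x * G e (p n x)) * (q n x * dG e (p n x))" for n x
  define b2 where "b2 n x = T (q n x * G e (p n x)) * G e (p n x)" for n x
  \<comment> \<open>\<open>\<bar>dG e\<bar> \<le> G e / e\<close> trades \<open>dG e\<close> for
    \<open>G e\<close>, after which the factor \<open>T z * \<bar>z\<bar>\<close> with
    \<open>z = q n x * G e (p n x)\<close> appears and is at most \<open>1\<close>.\<close>
  have bb1: "\<bar>b1 n x\<bar> \<le> 1 / e" for n x
  proof -
    have "\<bar>q n x * dG e (p n x)\<bar> \<le> \<bar>q n x\<bar> * (G e (p n x) / e)"
      unfolding abs_mult by (rule mult_left_mono[OF G_bounds(4)[OF e]]) simp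
    also have "\<dots> = \<bar>q n x * G e (p n x)\<bar> / e" using G_bounds(1)[OF e, of "p n x"] by (simp add: abs_mult)
    finally have le: "\<bar>q n x * dG e (p n x)\<bar> \<le> \<bar>q n x * G e (p n x)\<bar> / e" .
    have T0: "0 \<le> T (q n x * G e (p n x))"
      unfolding T_def by (rule less_imp_le[OF arctan_deriv_bounds(1)])
    have "\<bar>b1 n x\<bar> = T (q n x * G e (p n x)) * \<bar>q n x * dG e (p n x)\<bar>"
      unfolding b1_def abs_mult[of "T _"] abs_of_nonneg[OF T0] ..
    also have "\<dots> \<le> T (q n x * G e (p n x)) * (\<bar>q n x * G e (p n x)\<bar> / e)"
      by (rule mult_left_mono[OF le T0])
    also have "\<dots> = (T (q n x * G e (p n x)) * \<bar>q n x * G e (p n x)\<bar>) / e" by simp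
    also have "\<dots> \<le> 1 / e" unfolding T_def using e by (intro divide_right_mono arctan_deriv_bounds(3)) simp
    finally show ?thesis .
  qed
  have bb2: "\<bar>b2 n x\<bar> \<le> 1 * (2 / e)" for n x
    unfolding b2_def abs_mult T_def
    by (rule mult_mono) (use arctan_deriv_bounds(1,2)[of "q n x * G e (p n x)"] G_bounds(2)[OF e] in auto)
  have conv1: "L2lim (\<lambda>n x. b1 n x * P n x $ i) (\<lambda>x. (T (v x * G e (\<phi> x)) * (v x * dG e (\<phi> x))) * g x $ i)"
  proof (rule L2lim_bdd_mult[OF pq(2) _ _ bb1])
    show "b1 n \<in> borel_measurable lebesgue" "(\<lambda>x. T (v x * G e (\<phi> x)) * (v x * dG e (\<phi> x))) \<in> borel_measurable lebesgue" for n
      unfolding b1_def[abs_def] by (intro meas)+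
    show "AE x in lebesgue. (\<lambda>n. b1 n x) \<longlonglongrightarrow> T (v x * G e (\<phi> x)) * (v x * dG e (\<phi> x))"
      using pl ql unfolding b1_def by eventually_elim (intro tendsto_mult Tl G_lim e)
  qed
  have conv2: "L2lim (\<lambda>n x. b2 n x * Q n x $ i) (\<lambda>x. (T (v x * G e (\<phi> x)) * G e (\<phi> x)) * h x $ i)"
  proof (rule L2lim_bdd_mult[OF pq(4) _ _ bb2])
    show "b2 n \<in> borel_measurable lebesgue" "(\<lambda>x. T (v x * G e (\<phi> x)) * G e (\<phi> x)) \<in> borel_measurable lebesgue" for n
      unfolding b2_def[abs_def] by (intro meas)+
    show "AE x in lebesgue. (\<lambda>n. b2 n x) \<longlonglongrightarrow> T (v x * G e (\<phi> x)) * G e (\<phi> x)"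
      using pl ql unfolding b2_def by eventually_elim (intro tendsto_mult Tl G_lim e)
  qed
  have parts: "(\<integral>x. arctan (q n x * G e (p n x)) * E x $ i \<partial>lebesgue) = - (\<integral>x. (b1 n x * P n x $ i + b2 n x * Q n x $ i) * \<psi> x \<partial>lebesgue)" for n
    using C1c_parts[OF C \<psi>, of n i] by (simp add: b1_def b2_def algebra_simps)
  have lim1: "(\<lambda>n. \<integral>x. arctan (q n x * G e (p n x)) * E x $ i \<partial>lebesgue) \<longlonglongrightarrow> (\<integral>x. arctan (v x * G e (\<phi> x)) * E x $ i \<partial>lebesgue)"
  proof (rule integral_dominated_convergence[where w = "\<lambda>x. (pi / 2) * \<bar>E x $ i\<bar>"])
    have am: "(\<lambda>x. arctan (y x)) \<in> borel_measurable lebesgue" if "y \<in> borel_measurable lebesgue" for y :: "real^3 \<Rightarrow> real"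
      using borel_measurable_continuous_on[OF continuous_on_arctan[OF continuous_on_id] that] .
    show "(\<lambda>x. arctan (v x * G e (\<phi> x)) * E x $ i) \<in> borel_measurable lebesgue"
      "(\<lambda>x. arctan (q n x * G e (p n x)) * E x $ i) \<in> borel_measurable lebesgue" for n
      by (intro meas am L2_meas[OF C1c_L2(2)[OF \<psi>]])+
    show "integrable lebesgue (\<lambda>x. (pi / 2) * \<bar>E x $ i\<bar>)"
      by (intro integrable_mult_right integrable_abs C1c_integrable(1)[OF \<psi>])
    show "AE x in lebesgue. (\<lambda>n. arctan (q n x * G e (p n x)) * E x $ i) \<longlonglongrightarrow> arctan (v x * G e (\<phi> x)) * E x $ i"
      using pl ql by eventually_elim (intro tendsto_mult tendsto_arctan G_lim e tendsto_const)
    show "AE x in lebesgue. norm (arctan (q n x * G e (p n x)) * E x $ i) \<le> (pi / 2) * \<bar>E x $ i\<bar>" for n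
      unfolding real_norm_def abs_mult by (intro AE_I2 mult_right_mono arctan_abs_le) simp
  qed
  have lim2: "(\<lambda>n. - (\<integral>x. (b1 n x * P n x $ i + b2 n x * Q n x $ i) * \<psi> x \<partial>lebesgue)) \<longlonglongrightarrow>
      - (\<integral>x. ((T (v x * G e (\<phi> x)) * (v x * dG e (\<phi> x))) * g x $ i + (T (v x * G e (\<phi> x)) * G e (\<phi> x)) * h x $ i) * \<psi> x \<partial>lebesgue)"
    by (rule tendsto_minus[OF L2lim_inner[OF L2lim_add[OF conv1 conv2] L2lim_const[OF C1c_L2(1)[OF \<psi>]]]])
  show ?thesis using LIMSEQ_unique[OF lim1[unfolded parts] lim2] by (simp add: T_def)
qed

text \<open>Equality in \<open>Picone\<close> says that \<open>h = (v / \<phi>) *\<^sub>R g\<close>,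
  formally that \<open>v / \<phi>\<close> has gradient \<open>0\<close>. The quotient itself need
  not be integrable, so its \<open>arctan\<close> is differentiated weakly, and \<open>tan\<close>
  recovers the constant ratio.\<close>

theorem eigenfunction_simple:
  assumes v: "H10 \<Omega> v" "wg v h" and m: "Dsq h \<le> lam1 * (\<integral>x. fO x * (v x)\<^sup>2 \<partial>lebesgue)"
  shows "\<exists>k. AE x in lebesgue. v x = k * \<phi> x"
proof -
  have vm: "v \<in> borel_measurable lebesgue" by (rule L2_meas[OF wgD(1)[OF v(2)]])
  have "(\<integral>x. (norm (h x - (v x / \<phi> x) *\<^sub>R g x))\<^sup>2 \<partial>lebesgue) = 0"
    by (rule antisym) (use Picone(2)[OF v] m in \<open>auto intro: Bochner_Integration.integral_nonneg\<close>)
  then have hz: "AE x in lebesgue. h x = (v x / \<phi> x) *\<^sub>R g x"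
    using integral_nonneg_eq_0_iff_AE[OF Picone(1)[OF v]] by simp
  \<comment> \<open>\<open>arctan\<close> is bounded and \<open>\<Omega>\<close> is bounded, so the
    cutoff makes \<open>F\<close> square integrable, as \<open>zero_gradient_const\<close>
    requires.\<close>
  define F where "F x = indicat_real \<Omega> x * arctan (v x / \<phi> x)" for x
  have am: "(\<lambda>x. arctan (y x)) \<in> borel_measurable lebesgue" if "y \<in> borel_measurable lebesgue" for y :: "real^3 \<Rightarrow> real"
    using borel_measurable_continuous_on[OF continuous_on_arctan[OF continuous_on_id] that] .
  have Fm: "F \<in> borel_measurable lebesgue" unfolding F_def[abs_def]
    by (intro borel_measurable_times borel_measurable_indicator Om_meas am borel_measurable_divide vm phi_m)
  obtain R0 where R0: "\<Omega> \<subseteq> cball 0 R0" using bd by (auto simp: bounded_iff subset_iff)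
  have FL: "L2 F"
  proof (rule L2_bound[OF L2_indicator_cball Fm, where C = "pi / 2"])
    have "\<bar>F x\<bar> \<le> pi / 2 * \<bar>indicat_real (cball 0 R0) x\<bar>" for x
      using R0 arctan_abs_le[of "v x / \<phi> x"] by (auto simp: F_def indicator_def)
    then show "AE x in lebesgue. \<bar>F x\<bar> \<le> pi / 2 * \<bar>indicat_real (cball 0 R0) x\<bar>" by simp
  qed
  have zero: "(\<integral>x. F x * gr \<psi> x $ i \<partial>lebesgue) = 0" if \<psi>: "test_fun \<Omega> \<psi>" for \<psi> i
  proof -
    note C = test_fun_C1c[OF \<psi>]
    define e where "e n = inverse (real (Suc n))" for n
    have e: "e n > 0" "e \<longlonglongrightarrow> 0" for n
      using LIMSEQ_inverse_real_of_nat by (auto simp: e_def[abs_def] simp del: of_nat_Suc)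
    define K where "K n x = inverse (1 + (v x * G (e n) (\<phi> x))\<^sup>2) * (v x * dG (e n) (\<phi> x)) * g x $ i +
        inverse (1 + (v x * G (e n) (\<phi> x))\<^sup>2) * G (e n) (\<phi> x) * h x $ i" for n x
    have ch: "(\<integral>x. arctan (v x * G (e n) (\<phi> x)) * gr \<psi> x $ i \<partial>lebesgue) = - (\<integral>x. K n x * \<psi> x \<partial>lebesgue)" for n
      unfolding K_def by (rule arctan_chain[OF v(2) e(1) C])
    have Gl: "(\<lambda>n. G (e n) t) \<longlonglongrightarrow> 1 / t" if "t > 0" for t
    proof -
      have "(\<lambda>n. 1 / (e n + t)) \<longlonglongrightarrow> 1 / (0 + t)" by (intro tendsto_intros e) (use that in simp)
      then show ?thesis using that e(1) by (simp add: G_nonneg_arg)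
    qed
    have lim1: "(\<lambda>n. \<integral>x. arctan (v x * G (e n) (\<phi> x)) * gr \<psi> x $ i \<partial>lebesgue) \<longlonglongrightarrow> (\<integral>x. F x * gr \<psi> x $ i \<partial>lebesgue)"
    proof (rule integral_dominated_convergence[where w = "\<lambda>x. (pi / 2) * \<bar>gr \<psi> x $ i\<bar>"])
      show "(\<lambda>x. F x * gr \<psi> x $ i) \<in> borel_measurable lebesgue"
        "(\<lambda>x. arctan (v x * G (e n) (\<phi> x)) * gr \<psi> x $ i) \<in> borel_measurable lebesgue" for n
        by (intro borel_measurable_times Fm am vm G_meas e phi_m L2_meas[OF C1c_L2(2)[OF C]])+
      show "integrable lebesgue (\<lambda>x. (pi / 2) * \<bar>gr \<psi> x $ i\<bar>)"
        by (intro integrable_mult_right integrable_abs C1c_integrable(1)[OF C])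
      show "AE x in lebesgue. (\<lambda>n. arctan (v x * G (e n) (\<phi> x)) * gr \<psi> x $ i) \<longlonglongrightarrow> F x * gr \<psi> x $ i"
        using phi_sign
      proof eventually_elim
        case (elim x)
        show ?case
        proof (cases "x \<in> \<Omega>")
          case True
          then have "(\<lambda>n. arctan (v x * G (e n) (\<phi> x)) * gr \<psi> x $ i) \<longlonglongrightarrow> arctan (v x * (1 / \<phi> x)) * gr \<psi> x $ i"
            using elim by (intro tendsto_mult tendsto_arctan tendsto_const Gl) auto
          then show ?thesis using True by (simp add: F_def)
        next
          case False
          then show ?thesis using test_fun_zero_outside(2)[OF \<psi> False] by simp
        qed
      qed
      show "AE x in lebesgue. norm (arctan (v x * G (e n) (\<phi> x)) * gr \<psi> x $ i) \<le> (pi / 2) * \<bar>gr \<psi> x $ i\<bar>" for n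
        unfolding real_norm_def abs_mult by (intro AE_I2 mult_right_mono arctan_abs_le) simp
    qed
    \<comment> \<open>After inserting \<open>h\<close> the two terms of \<open>K n\<close> combine
      to \<open>(s / (1 + s\<^sup>2)) * (e n / (e n + \<phi> x))\<close> times the logarithmic
      gradient. The first factor is bounded, the second tends to \<open>0\<close> where
      \<open>\<phi> x > 0\<close>.\<close>
    have Kb: "AE x in lebesgue. (x \<in> \<Omega> \<longrightarrow> \<phi> x > 0) \<and> (\<forall>n. \<bar>K n x * \<psi> x\<bar> \<le> (if x \<in> \<Omega> then e n / (e n + \<phi> x) else 0) * \<bar>(\<psi> x / \<phi> x) * g x $ i\<bar>)"
      using phi_sign hz
    proof eventually_elim
      case (elim x)
      have "\<bar>K n x * \<psi> x\<bar> \<le> (if x \<in> \<Omega> then e n / (e n + \<phi> x) else 0) * \<bar>(\<psi> x / \<phi> x) * g x $ i\<bar>" for n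
      proof (cases "x \<in> \<Omega>")
        case False
        then show ?thesis using test_fun_zero_outside(1)[OF \<psi> False] by simp
      next
        case True
        then have p: "\<phi> x > 0" using elim by simp
        define s where "s = v x * G (e n) (\<phi> x)"
        have en: "e n > 0" by (rule e(1))
        have "h x = (v x / \<phi> x) *\<^sub>R g x" using elim by blast
        then have hx: "h x $ i = v x / \<phi> x * g x $ i" by simp
        have "K n x = inverse (1 + s\<^sup>2) * ((v x * dG (e n) (\<phi> x) + G (e n) (\<phi> x) * (v x / \<phi> x)) * g x $ i)"
          unfolding K_def hx s_def by (simp add: algebra_simps)
        also have "v x * dG (e n) (\<phi> x) + G (e n) (\<phi> x) * (v x / \<phi> x) = s * (e n / (e n + \<phi> x)) * (1 / \<phi> x)"
        proof -
          have ne: "e n + \<phi> x \<noteq> 0" "\<phi> x \<noteq> 0" using p en by auto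
          show ?thesis using p en unfolding s_def
            by (simp add: dG_def G_nonneg_arg divide_simps ne power2_eq_square) (simp add: algebra_simps)
        qed
        finally have Kx: "K n x * \<psi> x = (inverse (1 + s\<^sup>2) * s) * ((e n / (e n + \<phi> x)) * ((\<psi> x / \<phi> x) * g x $ i))"
          by (simp add: mult_ac)
        have "\<bar>K n x * \<psi> x\<bar> = (inverse (1 + s\<^sup>2) * \<bar>s\<bar>) * \<bar>(e n / (e n + \<phi> x)) * ((\<psi> x / \<phi> x) * g x $ i)\<bar>"
          unfolding Kx abs_mult[of "inverse (1 + s\<^sup>2) * s"] using arctan_deriv_bounds(1)[of s] by (simp add: abs_mult)
        also have "\<dots> \<le> 1 * \<bar>(e n / (e n + \<phi> x)) * ((\<psi> x / \<phi> x) * g x $ i)\<bar>"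
          by (rule mult_right_mono[OF arctan_deriv_bounds(3)]) simp
        also have "\<dots> = (e n / (e n + \<phi> x)) * \<bar>(\<psi> x / \<phi> x) * g x $ i\<bar>"
          using p en unfolding abs_mult[of "e n / (e n + \<phi> x)"] by simp
        finally show ?thesis using True by simp
      qed
      then show ?case using elim by blast
    qed
    \<comment> \<open>A square integrable function with bounded support is integrable; the support
      is that of \<open>\<psi>\<close>, inside \<open>\<Omega>\<close>.\<close>
    have Kint: "integrable lebesgue (\<lambda>x. \<bar>(\<psi> x / \<phi> x) * g x $ i\<bar>)"
    proof -
      have "integrable lebesgue (\<lambda>x. indicat_real (cball 0 R0) x * ((\<psi> x / \<phi> x) * g x $ i))"
        by (rule L2_mult_integrable[OF L2_indicator_cball log_gradient_L2[OF \<psi>]])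
      moreover have "(\<lambda>x. indicat_real (cball 0 R0) x * ((\<psi> x / \<phi> x) * g x $ i)) = (\<lambda>x. (\<psi> x / \<phi> x) * g x $ i)"
      proof
        fix x
        show "indicat_real (cball 0 R0) x * ((\<psi> x / \<phi> x) * g x $ i) = (\<psi> x / \<phi> x) * g x $ i"
          using R0 test_fun_zero_outside(1)[OF \<psi>, of x] by (cases "x \<in> \<Omega>") (auto simp: indicator_def)
      qed
      ultimately have "integrable lebesgue (\<lambda>x. (\<psi> x / \<phi> x) * g x $ i)" by (simp only:)
      then show ?thesis by (rule integrable_abs)
    qed
    have lim2: "(\<lambda>n. \<integral>x. K n x * \<psi> x \<partial>lebesgue) \<longlonglongrightarrow> (\<integral>x. 0 \<partial>(lebesgue :: (real^3) measure))"
    proof (rule integral_dominated_convergence[OF _ _ Kint])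
      show "(\<lambda>x. K n x * \<psi> x) \<in> borel_measurable lebesgue" for n
        unfolding K_def
        by (intro borel_measurable_times borel_measurable_add borel_measurable_inverse borel_measurable_power borel_measurable_const
            vm G_meas e phi_m L2_meas[OF wgD(2)[OF phi_wg]] L2_meas[OF wgD(2)[OF v(2)]] L2_meas[OF C1c_L2(1)[OF C]])
      show "AE x in lebesgue. (\<lambda>n. K n x * \<psi> x) \<longlonglongrightarrow> 0" using Kb
      proof eventually_elim
        case (elim x)
        show ?case
        proof (cases "x \<in> \<Omega>")
          case True
          then have p: "\<phi> x > 0" using elim by simp
          have "(\<lambda>n. (e n / (e n + \<phi> x)) * \<bar>(\<psi> x / \<phi> x) * g x $ i\<bar>) \<longlonglongrightarrow> (0 / (0 + \<phi> x)) * \<bar>(\<psi> x / \<phi> x) * g x $ i\<bar>"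
            by (intro tendsto_mult tendsto_divide tendsto_add tendsto_const e) (use p in simp)
          then have l: "(\<lambda>n. (e n / (e n + \<phi> x)) * \<bar>(\<psi> x / \<phi> x) * g x $ i\<bar>) \<longlonglongrightarrow> 0" by simp
          have "\<forall>n. norm (K n x * \<psi> x) \<le> (e n / (e n + \<phi> x)) * \<bar>(\<psi> x / \<phi> x) * g x $ i\<bar>"
            using conjunct2[OF elim] True by (simp only: if_True real_norm_def simp_thms)
          then show ?thesis by (intro Lim_null_comparison[OF _ l] always_eventually)
        next
          case False
          then show ?thesis using test_fun_zero_outside(1)[OF \<psi> False] by simp
        qed
      qed
      show "AE x in lebesgue. norm (K n x * \<psi> x) \<le> \<bar>(\<psi> x / \<phi> x) * g x $ i\<bar>" for n using Kb
      proof eventually_elim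
        case (elim x)
        have le1: "(if x \<in> \<Omega> then e n / (e n + \<phi> x) else 0) \<le> 1" using conjunct1[OF elim] e(1)[of n] by auto
        have "\<bar>K n x * \<psi> x\<bar> \<le> (if x \<in> \<Omega> then e n / (e n + \<phi> x) else 0) * \<bar>(\<psi> x / \<phi> x) * g x $ i\<bar>"
          using conjunct2[OF elim] by blast
        also have "\<dots> \<le> 1 * \<bar>(\<psi> x / \<phi> x) * g x $ i\<bar>" by (rule mult_right_mono[OF le1 abs_ge_zero])
        finally show ?case by (simp only: mult_1_left real_norm_def)
      qed
    qed simp
    have "(\<lambda>n. - (\<integral>x. K n x * \<psi> x \<partial>lebesgue)) \<longlonglongrightarrow> - 0" using tendsto_minus[OF lim2] by simp
    with lim1 show ?thesis unfolding ch using LIMSEQ_unique by fastforce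
  qed
  obtain c where c: "AE x in lebesgue. x \<in> \<Omega> \<longrightarrow> F x = c" using zero_gradient_const[OF op con FL zero] by blast
  have "AE x in lebesgue. v x = tan c * \<phi> x" using c phi_sign H10_vanishes[OF v]
  proof eventually_elim
    case (elim x)
    show ?case
    proof (cases "x \<in> \<Omega>")
      case True
      then have "arctan (v x / \<phi> x) = c" using elim by (simp add: F_def)
      then have "tan c = v x / \<phi> x" using tan_arctan[of "v x / \<phi> x"] by simp
      then show ?thesis using elim True by simp
    qed (use elim in simp)
  qed
  then show ?thesis by blast
qed

end

section \<open>The Kirchhoff functional\<close>

text \<open>Interpolation between exponents \<open>2\<close> and \<open>6\<close> by a threshold:
  below \<open>s\<close> the square dominates, above it the sixth power. As \<open>p < 6\<close>, a
  large \<open>s\<close> makes the sixth power's coefficient small, at the cost of the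
  square's.\<close>

lemma powr_split_le:
  fixes y s p :: real
  assumes "4 < p" "p < 6" "s > 0" "y \<ge> 0"
  shows "y powr p \<le> s powr (p - 2) * y\<^sup>2 + s powr (p - 6) * y ^ 6"
proof (cases "y = 0")
  case False
  then have y: "y > 0" using assms by simp
  show ?thesis
  proof (cases "y \<le> s")
    case True
    have "y powr p = y powr ((p - 2) + 2)" by simp
    also have "\<dots> = y powr (p - 2) * y\<^sup>2" unfolding powr_add using y by simp
    also have "\<dots> \<le> s powr (p - 2) * y\<^sup>2" using True assms y by (intro mult_right_mono powr_mono2) auto
    finally show ?thesis using assms by (simp add: add_increasing2)
  next
    case False
    have "y powr p = y powr ((p - 6) + 6)" by simp
    also have "\<dots> = y powr (p - 6) * y ^ 6" unfolding powr_add using y by simp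
    also have "\<dots> \<le> s powr (p - 6) * y ^ 6" using False assms by (intro mult_right_mono powr_mono2') auto
    finally show ?thesis by (simp add: add_increasing)
  qed
qed (use assms in simp)

lemma powr_triangle_le:
  fixes x y p :: real
  assumes "p > 0" shows "\<bar>x\<bar> powr p \<le> 2 powr p * (\<bar>x - y\<bar> powr p + \<bar>y\<bar> powr p)"
proof -
  define m where "m = max \<bar>x - y\<bar> \<bar>y\<bar>"
  have "\<bar>x - y\<bar> \<le> m" "\<bar>y\<bar> \<le> m" by (simp_all add: m_def)
  then have "\<bar>x\<bar> \<le> 2 * m" by linarith
  then have "\<bar>x\<bar> powr p \<le> (2 * m) powr p" using assms by (intro powr_mono2) auto
  also have "\<dots> = 2 powr p * m powr p" by (rule powr_mult)
  also have "m powr p \<le> \<bar>x - y\<bar> powr p + \<bar>y\<bar> powr p" by (auto simp: m_def max_def)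
  finally show ?thesis by simp
qed

lemma square_le_scaled:
  fixes u t :: real assumes "t > 0" shows "u\<^sup>2 \<le> t + u ^ 6 / t\<^sup>2"
proof (cases "u\<^sup>2 \<le> t")
  case True then show ?thesis using assms by (simp add: add_increasing2)
next
  case False
  have "t\<^sup>2 * u\<^sup>2 \<le> (u\<^sup>2)\<^sup>2 * u\<^sup>2" using False assms by (intro mult_right_mono power_mono) auto
  also have "\<dots> = u ^ 6" by (simp flip: power_mult power_add)
  finally have "u\<^sup>2 \<le> u ^ 6 / t\<^sup>2" using assms by (simp add: pos_le_divide_eq mult.commute)
  then show ?thesis using assms by simp
qed

locale kirchhoff = eigen_setting +
  fixes a p :: real and V Q :: "real^3 \<Rightarrow> real" and c CQ :: real
  assumes p4: "4 < p" and p6: "p < 6" and a0: "a > 0" and lam1: "lam1 > 0"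
    and Vc: "continuous_on UNIV V" and V0: "\<And>x. V x \<ge> 0"
    and c0: "c > 0" and Afin: "emeasure lebesgue {x. V x < c} < \<infinity>"
    and dom: "smooth_bounded_domain \<Omega>" and clO: "closure \<Omega> = {x. V x = 0}"
    and Qm: "Q \<in> borel_measurable lebesgue" and CQ0: "CQ > 0" and QC: "AE x in lebesgue. \<bar>Q x\<bar> \<le> CQ"
    and Qpos: "\<not> (AE x in lebesgue. x \<in> \<Omega> \<longrightarrow> Q x \<le> 0)"
    and Qneg: "(\<integral>x\<in>\<Omega>. Q x * \<phi> x powr p \<partial>lebesgue) < 0"
begin

definition Vn :: "(real^3 \<Rightarrow> real) \<Rightarrow> real" where "Vn u = (\<integral>x. V x * (u x)\<^sup>2 \<partial>lebesgue)"
definition Fn :: "(real^3 \<Rightarrow> real) \<Rightarrow> real" where "Fn u = (\<integral>x. f x * (u x)\<^sup>2 \<partial>lebesgue)"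
definition Bn :: "(real^3 \<Rightarrow> real) \<Rightarrow> real" where "Bn u = (\<integral>x. Q x * \<bar>u x\<bar> powr p \<partial>lebesgue)"
definition Pn :: "(real^3 \<Rightarrow> real) \<Rightarrow> real" where "Pn u = (\<integral>x. \<bar>u x\<bar> powr p \<partial>lebesgue)"

abbreviation X :: "(real^3 \<Rightarrow> real) set" where "X \<equiv> Xspace V"
abbreviation nm :: "real \<Rightarrow> (real^3 \<Rightarrow> real) \<Rightarrow> real" where "nm \<equiv> mu_norm_sq V"

lemma nm_def: "nm \<mu> u = D12_sq u + \<mu> * Vn u"
  by (simp add: mu_norm_sq_def Vn_def)

lemma Vm: "V \<in> borel_measurable lebesgue" by (rule continuous_measurable_lebesgue[OF Vc])

lemma XD: assumes "u \<in> X" shows "H1 u" "wg u (grad u)" "D12_sq u = Dsq (grad u)" "L2 u" "integrable lebesgue (\<lambda>x. V x * (u x)\<^sup>2)"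
  "u \<in> borel_measurable lebesgue"
proof -
  show h: "H1 u" and "integrable lebesgue (\<lambda>x. V x * (u x)\<^sup>2)" using assms by (auto simp: Xspace_def)
  show w: "wg u (grad u)" by (rule H1_wg[OF h])
  show "D12_sq u = Dsq (grad u)" by (rule D12_Dsq[OF w])
  show "L2 u" by (rule wgD(1)[OF w])
  then show "u \<in> borel_measurable lebesgue" by (rule L2_meas)
qed

lemma D0: "D12_sq u \<ge> 0" unfolding D12_sq_def by (intro Bochner_Integration.integral_nonneg) simp
lemma Vn0: "Vn u \<ge> 0" unfolding Vn_def by (intro Bochner_Integration.integral_nonneg) (simp add: V0)
lemma nm_ge: "\<mu> \<ge> 0 \<Longrightarrow> D12_sq u \<le> nm \<mu> u" "\<mu> > 0 \<Longrightarrow> Vn u \<le> nm \<mu> u / \<mu>" "\<mu> \<ge> 0 \<Longrightarrow> nm \<mu> u \<ge> 0"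
  using Vn0[of u] D0[of u] by (auto simp: nm_def field_simps)

lemma X_L6: "u \<in> X \<Longrightarrow> D12_sq u \<le> M \<Longrightarrow> L6b u (4096 * M ^ 3)"
  using wg_L6b[of u "grad u" M] XD(2,3)[of u] by simp

lemma X_cmult: assumes "u \<in> X" shows "(\<lambda>x. t * u x) \<in> X" "D12_sq (\<lambda>x. t * u x) = t\<^sup>2 * D12_sq u"
  "Vn (\<lambda>x. t * u x) = t\<^sup>2 * Vn u" "Fn (\<lambda>x. t * u x) = t\<^sup>2 * Fn u" "nm \<mu> (\<lambda>x. t * u x) = t\<^sup>2 * nm \<mu> u"
  "Bn (\<lambda>x. t * u x) = \<bar>t\<bar> powr p * Bn u"
proof -
  have w: "wg (\<lambda>x. t * u x) (\<lambda>x. t *\<^sub>R grad u x)" by (rule wg_cmult[OF XD(2)[OF assms]])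
  have e: "V x * (t * u x)\<^sup>2 = t\<^sup>2 * (V x * (u x)\<^sup>2)" "f x * (t * u x)\<^sup>2 = t\<^sup>2 * (f x * (u x)\<^sup>2)"
    "Q x * \<bar>t * u x\<bar> powr p = \<bar>t\<bar> powr p * (Q x * \<bar>u x\<bar> powr p)" for x
    by (simp_all add: power_mult_distrib abs_mult powr_mult)
  show "(\<lambda>x. t * u x) \<in> X" using wg_H1[OF w] XD(5)[OF assms] by (simp add: Xspace_def e)
  show D: "D12_sq (\<lambda>x. t * u x) = t\<^sup>2 * D12_sq u"
    unfolding D12_Dsq[OF w] XD(3)[OF assms] Dsq_def by (simp add: n2_cmult sum_distrib_left)
  show Vt: "Vn (\<lambda>x. t * u x) = t\<^sup>2 * Vn u" "Fn (\<lambda>x. t * u x) = t\<^sup>2 * Fn u" "Bn (\<lambda>x. t * u x) = \<bar>t\<bar> powr p * Bn u"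
    unfolding Vn_def Fn_def Bn_def e by simp_all
  show "nm \<mu> (\<lambda>x. t * u x) = t\<^sup>2 * nm \<mu> u" unfolding nm_def D Vt by (simp add: algebra_simps)
qed

lemma X_add_diff:
  assumes "u \<in> X" "v \<in> X"
  shows "(\<lambda>x. u x + v x) \<in> X" "(\<lambda>x. u x - v x) \<in> X"
proof -
  have i: "integrable lebesgue (\<lambda>x. 2 * (V x * (u x)\<^sup>2) + 2 * (V x * (v x)\<^sup>2))" using XD(5)[OF assms(1)] XD(5)[OF assms(2)] by simp
  have b: "V x * (u x + v x)\<^sup>2 \<le> 2 * (V x * (u x)\<^sup>2) + 2 * (V x * (v x)\<^sup>2)"
    "V x * (u x - v x)\<^sup>2 \<le> 2 * (V x * (u x)\<^sup>2) + 2 * (V x * (v x)\<^sup>2)" for x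
  proof -
    have "(u x + v x)\<^sup>2 \<le> 2 * (u x)\<^sup>2 + 2 * (v x)\<^sup>2" "(u x - v x)\<^sup>2 \<le> 2 * (u x)\<^sup>2 + 2 * (v x)\<^sup>2"
      using zero_le_power2[of "u x - v x"] zero_le_power2[of "u x + v x"] by (auto simp: power2_eq_square algebra_simps)
    from mult_left_mono[OF this(1) V0[of x]] mult_left_mono[OF this(2) V0[of x]]
    show "V x * (u x + v x)\<^sup>2 \<le> 2 * (V x * (u x)\<^sup>2) + 2 * (V x * (v x)\<^sup>2)"
      "V x * (u x - v x)\<^sup>2 \<le> 2 * (V x * (u x)\<^sup>2) + 2 * (V x * (v x)\<^sup>2)" by (simp_all add: algebra_simps)
  qed
  have m: "(\<lambda>x. V x * (u x + v x)\<^sup>2) \<in> borel_measurable lebesgue" "(\<lambda>x. V x * (u x - v x)\<^sup>2) \<in> borel_measurable lebesgue"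
    by (intro borel_measurable_times borel_measurable_power borel_measurable_add borel_measurable_diff Vm XD(6) assms)+
  have "integrable lebesgue (\<lambda>x. V x * (u x + v x)\<^sup>2)" "integrable lebesgue (\<lambda>x. V x * (u x - v x)\<^sup>2)"
    by (rule Bochner_Integration.integrable_bound[OF i m(1)], use b V0 in force,
        rule Bochner_Integration.integrable_bound[OF i m(2)], use b V0 in force)
  then show "(\<lambda>x. u x + v x) \<in> X" "(\<lambda>x. u x - v x) \<in> X"
    using wg_H1[OF wg_add[OF XD(2)[OF assms(1)] XD(2)[OF assms(2)]]] wg_H1[OF wg_diff[OF XD(2)[OF assms(1)] XD(2)[OF assms(2)]]]
    by (auto simp: Xspace_def)
qed

lemma X_avg: "u \<in> X \<Longrightarrow> v \<in> X \<Longrightarrow> (\<lambda>x. (u x + v x) / 2) \<in> X"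
  using X_cmult(1)[OF X_add_diff(1), of u v "1/2"] by simp

lemma parallelogram_X:
  assumes "u \<in> X" "v \<in> X"
  shows "D12_sq (\<lambda>x. u x - v x) = 2 * D12_sq u + 2 * D12_sq v - 4 * D12_sq (\<lambda>x. (u x + v x) / 2)"
    "Vn (\<lambda>x. u x - v x) = 2 * Vn u + 2 * Vn v - 4 * Vn (\<lambda>x. (u x + v x) / 2)"
proof -
  show "D12_sq (\<lambda>x. u x - v x) = 2 * D12_sq u + 2 * D12_sq v - 4 * D12_sq (\<lambda>x. (u x + v x) / 2)"
    by (rule Dsq_parallelogram[OF XD(2)[OF assms(1)] XD(2)[OF assms(2)]])
  have e: "V x * (u x - v x)\<^sup>2 = 2 * (V x * (u x)\<^sup>2) + 2 * (V x * (v x)\<^sup>2) - 4 * (V x * ((u x + v x) / 2)\<^sup>2)" for x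
    by (simp add: power2_eq_square field_simps)
  show "Vn (\<lambda>x. u x - v x) = 2 * Vn u + 2 * Vn v - 4 * Vn (\<lambda>x. (u x + v x) / 2)"
    unfolding Vn_def e using XD(5)[OF assms(1)] XD(5)[OF assms(2)] XD(5)[OF X_avg[OF assms]] by simp
qed

section \<open>Bounds uniform in \<open>\<mu>\<close>\<close>

definition VA :: real where "VA = measure lebesgue {x. V x < c}"
definition K :: real where "K = VA + 4096 + 1 / c"

lemma A_sets: "{x. V x < c} \<in> sets lebesgue"
proof -
  have "open {x. V x < c}" by (intro open_Collect_less continuous_on_const Vc)
  then show ?thesis by auto
qed

lemma A_int: "integrable lebesgue (indicat_real {x. V x < c})" "(\<integral>x. indicat_real {x. V x < c} x \<partial>lebesgue) = VA"
  "integrable lebesgue (\<lambda>x. \<bar>indicat_real {x. V x < c} x\<bar> powr (3/2))"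
proof -
  show i: "integrable lebesgue (indicat_real {x. V x < c})" using A_sets Afin by (simp add: integrable_indicator_iff)
  show "(\<integral>x. indicat_real {x. V x < c} x \<partial>lebesgue) = VA" by (simp add: VA_def)
  have "(\<lambda>x. \<bar>indicat_real {x. V x < c} x\<bar> powr (3/2)) = indicat_real {x. V x < c}" by (auto simp: indicator_def)
  then show "integrable lebesgue (\<lambda>x. \<bar>indicat_real {x. V x < c} x\<bar> powr (3/2))" using i by simp
qed

text \<open>The part of \<open>n2 u\<close> on the set of finite measure. The indicator of that set
  is an admissible weight, so this part is continuous along almost everywhere convergent sequences;
  only the rest has to be paid for by \<open>Vn\<close>.\<close>

definition An :: "(real^3 \<Rightarrow> real) \<Rightarrow> real" where "An u = (\<integral>x. indicat_real {x. V x < c} x * (u x)\<^sup>2 \<partial>lebesgue)"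

lemma n2_An: assumes "u \<in> X" shows "n2 u \<le> An u + Vn u / c"
proof -
  have iA: "integrable lebesgue (\<lambda>x. indicat_real {x. V x < c} x * (u x)\<^sup>2)"
    by (rule weighted_integrable[OF borel_measurable_integrable[OF A_int(1)] A_int(3) X_L6[OF assms order_refl]])
  have "n2 u \<le> (\<integral>x. indicat_real {x. V x < c} x * (u x)\<^sup>2 + V x * (u x)\<^sup>2 / c \<partial>lebesgue)"
    unfolding n2_def
  proof (rule integral_mono[OF L2_int[OF XD(4)[OF assms]]])
    show "integrable lebesgue (\<lambda>x. indicat_real {x. V x < c} x * (u x)\<^sup>2 + V x * (u x)\<^sup>2 / c)"
      using iA XD(5)[OF assms] by simp
    fix x
    show "(u x)\<^sup>2 \<le> indicat_real {x. V x < c} x * (u x)\<^sup>2 + V x * (u x)\<^sup>2 / c"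
    proof (cases "V x < c")
      case True
      then show ?thesis using V0[of x] c0 by simp
    next
      case False
      then have "c * (u x)\<^sup>2 \<le> V x * (u x)\<^sup>2" by (intro mult_right_mono) auto
      then show ?thesis using False c0 by (simp add: pos_le_divide_eq mult.commute)
    qed
  qed
  also have "\<dots> = An u + Vn u / c" unfolding An_def Vn_def using iA XD(5)[OF assms] by simp
  finally show ?thesis .
qed

text \<open>On \<open>{x. V x < c}\<close> the estimate \<open>square_le_scaled\<close> at level
  \<open>t\<close> costs \<open>t * VA\<close> plus \<open>4096 * t\<close> from the Sobolev
  inequality; elsewhere \<open>V \<ge> c\<close> costs \<open>t / c\<close>. These are the three
  summands of \<open>K\<close>. The bound \<open>t\<close> is separate from the norm so that it
  stays positive when the norm is \<open>0\<close>.\<close>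

lemma n2_bound:
  assumes u: "u \<in> X" and \<mu>: "\<mu> \<ge> 1" and t: "nm \<mu> u \<le> t" "t > 0"
  shows "n2 u \<le> K * t"
proof -
  have iA: "integrable lebesgue (\<lambda>x. indicat_real {x. V x < c} x * (u x)\<^sup>2)"
    by (rule weighted_integrable[OF borel_measurable_integrable[OF A_int(1)] A_int(3) X_L6[OF u order_refl]])
  have Dt: "D12_sq u \<le> t" using nm_ge(1)[of \<mu> u] \<mu> t by simp
  have L6: "L6b u (4096 * t ^ 3)" by (rule X_L6[OF u Dt])
  have "An u \<le> (\<integral>x. t * indicat_real {x. V x < c} x + u x ^ 6 / t\<^sup>2 \<partial>lebesgue)"
    unfolding An_def
  proof (rule integral_mono[OF iA])
    show "integrable lebesgue (\<lambda>x. t * indicat_real {x. V x < c} x + u x ^ 6 / t\<^sup>2)"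
      using A_int(1) L6 by (simp add: L6b_def)
    show "indicat_real {x. V x < c} x * (u x)\<^sup>2 \<le> t * indicat_real {x. V x < c} x + u x ^ 6 / t\<^sup>2" for x
      using square_le_scaled[OF t(2), of "u x"] by (auto simp: indicator_def)
  qed
  also have "\<dots> = t * VA + (\<integral>x. u x ^ 6 \<partial>lebesgue) / t\<^sup>2"
    using A_int L6 by (simp add: L6b_def)
  also have "\<dots> \<le> t * VA + (4096 * t ^ 3) / t\<^sup>2"
    using L6 t by (intro add_left_mono divide_right_mono) (auto simp: L6b_def)
  also have "(4096 * t ^ 3) / t\<^sup>2 = 4096 * t" using t by (simp add: power3_eq_cube power2_eq_square)
  finally have 1: "An u \<le> t * VA + 4096 * t" .
  have "Vn u \<le> \<mu> * Vn u" using \<mu> Vn0[of u] by (simp add: mult_le_cancel_right1)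
  then have "Vn u \<le> t" using t(1) D0[of u] by (simp add: nm_def)
  then have "Vn u / c \<le> t / c" using c0 by (intro divide_right_mono) auto
  then show ?thesis using 1 n2_An[OF u] by (simp add: K_def algebra_simps)
qed

lemma powr_m: "u \<in> borel_measurable lebesgue \<Longrightarrow> (\<lambda>x. \<bar>u x\<bar> powr p) \<in> borel_measurable (lebesgue :: (real^3) measure)"
  by measurable

lemma Pn_bound:
  assumes u: "L2 u" "L6b u M" and s: "s > 0"
  shows "integrable lebesgue (\<lambda>x. \<bar>u x\<bar> powr p)" "Pn u \<le> s powr (p - 2) * n2 u + s powr (p - 6) * M"
proof -
  have d: "integrable lebesgue (\<lambda>x. s powr (p - 2) * (u x)\<^sup>2 + s powr (p - 6) * u x ^ 6)" for s
    using u by (simp add: L2_def L6b_def)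
  have b: "\<bar>u x\<bar> powr p \<le> s powr (p - 2) * (u x)\<^sup>2 + s powr (p - 6) * u x ^ 6" for x
    using powr_split_le[OF p4 p6 s, of "\<bar>u x\<bar>"] by (simp add: power_even_abs)
  show i: "integrable lebesgue (\<lambda>x. \<bar>u x\<bar> powr p)"
    by (rule Bochner_Integration.integrable_bound[OF d[of s] powr_m[OF L2_meas[OF u(1)]]])
      (use b in \<open>auto intro: order_trans[OF _ abs_ge_self]\<close>)
  have "Pn u \<le> (\<integral>x. s powr (p - 2) * (u x)\<^sup>2 + s powr (p - 6) * u x ^ 6 \<partial>lebesgue)"
    unfolding Pn_def by (rule integral_mono[OF i d b])
  also have "\<dots> = s powr (p - 2) * n2 u + s powr (p - 6) * (\<integral>x. u x ^ 6 \<partial>lebesgue)"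
    using u by (simp add: L2_def L6b_def n2_def)
  also have "\<dots> \<le> s powr (p - 2) * n2 u + s powr (p - 6) * M"
    using u(2) by (intro add_left_mono mult_left_mono) (auto simp: L6b_def)
  finally show "Pn u \<le> s powr (p - 2) * n2 u + s powr (p - 6) * M" .
qed

lemma X_Pi: "u \<in> X \<Longrightarrow> integrable lebesgue (\<lambda>x. \<bar>u x\<bar> powr p)"
  by (rule Pn_bound(1)[OF XD(4) X_L6[OF _ order_refl], where s = 1]) auto

lemma Q_integrable:
  assumes "integrable lebesgue h" shows "integrable lebesgue (\<lambda>x. Q x * h x)"
proof (rule Bochner_Integration.integrable_bound)
  show "integrable lebesgue (\<lambda>x. CQ * h x)" using assms by simp
  show "(\<lambda>x. Q x * h x) \<in> borel_measurable lebesgue" using Qm assms by simp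
  show "AE x in lebesgue. norm (Q x * h x) \<le> norm (CQ * h x)" using QC
    by eventually_elim (use CQ0 in \<open>simp add: abs_mult mult_right_mono\<close>)
qed

lemma Q_integral_le:
  assumes "integrable lebesgue h" shows "\<bar>\<integral>x. Q x * h x \<partial>lebesgue\<bar> \<le> CQ * (\<integral>x. \<bar>h x\<bar> \<partial>lebesgue)"
proof -
  have "\<bar>\<integral>x. Q x * h x \<partial>lebesgue\<bar> \<le> (\<integral>x. \<bar>Q x * h x\<bar> \<partial>lebesgue)" by (rule integral_abs_bound)
  also have "\<dots> \<le> (\<integral>x. CQ * \<bar>h x\<bar> \<partial>lebesgue)"
  proof (rule integral_mono_AE)
    show "integrable lebesgue (\<lambda>x. \<bar>Q x * h x\<bar>)" by (rule integrable_abs[OF Q_integrable[OF assms]])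
    show "integrable lebesgue (\<lambda>x. CQ * \<bar>h x\<bar>)" using assms by simp
    show "AE x in lebesgue. \<bar>Q x * h x\<bar> \<le> CQ * \<bar>h x\<bar>" using QC
      by eventually_elim (simp add: abs_mult mult_right_mono)
  qed
  finally show ?thesis by simp
qed

lemma Bn_le_Pn: "u \<in> X \<Longrightarrow> \<bar>Bn u\<bar> \<le> CQ * Pn u"
  using Q_integral_le[OF X_Pi] by (simp add: Bn_def Pn_def)

text \<open>With threshold \<open>s = sqrt t\<close> both terms of \<open>Pn_bound\<close> scale
  like \<open>t powr (p / 2)\<close>, a power larger than \<open>1\<close>.\<close>

lemma Bn_le_nm:
  assumes u: "u \<in> X" and \<mu>: "\<mu> \<ge> 1" and t: "nm \<mu> u \<le> t" "t > 0"
  shows "Bn u \<le> CQ * (K + 4096) * (t * t powr ((p - 2) / 2))"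
proof -
  have Dt: "D12_sq u \<le> t" using nm_ge(1)[of \<mu> u] \<mu> t by simp
  have "Pn u \<le> sqrt t powr (p - 2) * n2 u + sqrt t powr (p - 6) * (4096 * t ^ 3)"
    by (rule Pn_bound(2)[OF XD(4)[OF u] X_L6[OF u Dt]]) (use t in simp)
  also have "\<dots> \<le> sqrt t powr (p - 2) * (K * t) + sqrt t powr (p - 6) * (4096 * t ^ 3)"
    by (intro add_right_mono mult_left_mono n2_bound[OF u \<mu> t]) simp
  also have "sqrt t powr (p - 2) = t powr ((p - 2) / 2)"
    using t by (simp add: powr_half_sqrt[symmetric] powr_powr)
  also have "sqrt t powr (p - 6) * (4096 * t ^ 3) = 4096 * (t * t powr ((p - 2) / 2))"
  proof -
    have "sqrt t powr (p - 6) = t powr ((p - 6) / 2)" using t by (simp add: powr_half_sqrt[symmetric] powr_powr)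
    moreover have "t powr ((p - 6) / 2) * t ^ 2 = t powr ((p - 6) / 2 + 2)" unfolding powr_add using t by simp
    moreover have "(p - 6) / 2 + 2 = (p - 2) / 2" by (simp add: field_simps)
    ultimately show ?thesis by (simp add: power3_eq_cube power2_eq_square mult_ac)
  qed
  finally have "Pn u \<le> (K + 4096) * (t * t powr ((p - 2) / 2))" by (simp add: algebra_simps)
  then have "CQ * Pn u \<le> CQ * ((K + 4096) * (t * t powr ((p - 2) / 2)))" using CQ0 by (intro mult_left_mono) auto
  then show ?thesis using Bn_le_Pn[OF u] by (simp add: mult.assoc)
qed

text \<open>A one-sided form of the Brezis-Lieb lemma: what exceeds \<open>2 powr p\<close> times
  the p-th power of the difference is dominated by a multiple of
  \<open>\<bar>u x\<bar> powr p\<close>, so it tends to \<open>0\<close> in mean. An inequality is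
  enough because the loss is later compared with a loss of norm.\<close>

lemma Bn_limit:
  assumes us: "\<And>n. us n \<in> X" and u: "u \<in> X" and l: "AE x in lebesgue. (\<lambda>n. us n x) \<longlonglongrightarrow> u x"
  obtains e where "e \<longlonglongrightarrow> 0" "\<And>n. \<bar>Bn (us n) - Bn u\<bar> \<le> e n + CQ * 2 powr p * Pn (\<lambda>x. us n x - u x)"
proof -
  define T where "T = (2::real) powr p"
  have T: "T > 0" by (simp add: T_def)
  define w where "w n x = max 0 (\<bar>\<bar>us n x\<bar> powr p - \<bar>u x\<bar> powr p\<bar> - T * \<bar>us n x - u x\<bar> powr p)" for n x
  have iu: "integrable lebesgue (\<lambda>x. \<bar>us n x\<bar> powr p)" "integrable lebesgue (\<lambda>x. \<bar>u x\<bar> powr p)"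
    "integrable lebesgue (\<lambda>x. \<bar>us n x - u x\<bar> powr p)" for n
    by (intro X_Pi us u X_add_diff)+
  have wm: "w n \<in> borel_measurable lebesgue" for n
    unfolding w_def using iu(1,3)[of n] iu(2) by (intro borel_measurable_max) auto
  have wb: "norm (w n x) \<le> (T + 1) * \<bar>u x\<bar> powr p" for n x
  proof -
    have aux: "norm (max 0 (\<bar>A - B\<bar> - C)) \<le> E + B" if "A \<le> C + E" "0 \<le> A" "0 \<le> B" "0 \<le> C" "0 \<le> E" for A B C E :: real
      using that by (auto simp: max_def abs_if)
    have "\<bar>us n x\<bar> powr p \<le> T * \<bar>us n x - u x\<bar> powr p + T * \<bar>u x\<bar> powr p"
      unfolding T_def distrib_left[symmetric] by (rule powr_triangle_le) (use p4 in simp)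
    then have "norm (w n x) \<le> T * \<bar>u x\<bar> powr p + \<bar>u x\<bar> powr p"
      unfolding w_def by (rule aux) (use T in auto)
    then show ?thesis by (simp add: distrib_right)
  qed
  have "(\<lambda>n. \<integral>x. w n x \<partial>lebesgue) \<longlonglongrightarrow> (\<integral>x. 0 \<partial>(lebesgue :: (real^3) measure))"
  proof (rule integral_dominated_convergence[where w = "\<lambda>x. (T + 1) * \<bar>u x\<bar> powr p"])
    show "AE x in lebesgue. (\<lambda>n. w n x) \<longlonglongrightarrow> 0" using l
    proof eventually_elim
      case (elim x)
      have c1: "(\<lambda>n. \<bar>us n x\<bar> powr p) \<longlonglongrightarrow> \<bar>u x\<bar> powr p"
        by (rule tendsto_powr'[OF tendsto_rabs[OF elim] tendsto_const]) (use p4 in auto)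
      have c2: "(\<lambda>n. \<bar>us n x - u x\<bar> powr p) \<longlonglongrightarrow> \<bar>u x - u x\<bar> powr p"
        by (rule tendsto_powr'[OF tendsto_rabs[OF tendsto_diff[OF elim tendsto_const]] tendsto_const]) (use p4 in auto)
      have "(\<lambda>n. w n x) \<longlonglongrightarrow> max 0 (\<bar>\<bar>u x\<bar> powr p - \<bar>u x\<bar> powr p\<bar> - T * \<bar>u x - u x\<bar> powr p)"
        unfolding w_def by (intro tendsto_max tendsto_const tendsto_diff tendsto_rabs tendsto_mult c1 c2)
      then show ?case by simp
    qed
  qed (use wm wb iu in auto)
  then have w0: "(\<lambda>n. \<integral>x. w n x \<partial>lebesgue) \<longlonglongrightarrow> 0" by simp
  have wi: "integrable lebesgue (w n)" for n
    by (rule Bochner_Integration.integrable_bound[OF integrable_mult_right[OF iu(2), of "T + 1"] wm])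
      (use wb T in \<open>auto intro: order_trans[OF _ abs_ge_self]\<close>)
  show thesis
  proof (rule that[of "\<lambda>n. CQ * (\<integral>x. w n x \<partial>lebesgue)"])
    show "(\<lambda>n. CQ * (\<integral>x. w n x \<partial>lebesgue)) \<longlonglongrightarrow> 0" using tendsto_mult[OF tendsto_const w0, of CQ] by simp
    fix n
    have i: "integrable lebesgue (\<lambda>x. \<bar>us n x\<bar> powr p - \<bar>u x\<bar> powr p)" using iu by simp
    have "Bn (us n) - Bn u = (\<integral>x. Q x * (\<bar>us n x\<bar> powr p - \<bar>u x\<bar> powr p) \<partial>lebesgue)"
      unfolding Bn_def using Q_integrable[OF iu(1)[of n]] Q_integrable[OF iu(2)] by (simp add: right_diff_distrib)
    then have "\<bar>Bn (us n) - Bn u\<bar> \<le> CQ * (\<integral>x. \<bar>\<bar>us n x\<bar> powr p - \<bar>u x\<bar> powr p\<bar> \<partial>lebesgue)"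
      using Q_integral_le[OF i] by simp
    also have "(\<integral>x. \<bar>\<bar>us n x\<bar> powr p - \<bar>u x\<bar> powr p\<bar> \<partial>lebesgue) \<le> (\<integral>x. w n x + T * \<bar>us n x - u x\<bar> powr p \<partial>lebesgue)"
      by (rule integral_mono[OF integrable_abs[OF i]]) (use wi iu in \<open>auto simp: w_def\<close>)
    also have "\<dots> = (\<integral>x. w n x \<partial>lebesgue) + T * Pn (\<lambda>x. us n x - u x)"
      unfolding Pn_def using wi iu by simp
    finally show "\<bar>Bn (us n) - Bn u\<bar> \<le> CQ * (\<integral>x. w n x \<partial>lebesgue) + CQ * 2 powr p * Pn (\<lambda>x. us n x - u x)"
      using CQ0 by (simp add: T_def algebra_simps)
  qed
qed

lemma An_limit:
  assumes us: "\<And>n. us n \<in> X" "\<And>n. D12_sq (us n) \<le> M" and l: "AE x in lebesgue. (\<lambda>n. us n x) \<longlonglongrightarrow> 0"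
  shows "(\<lambda>n. An (us n)) \<longlonglongrightarrow> 0"
proof -
  have "M \<ge> 0" using us(2)[of 0] D0[of "us 0"] by linarith
  then have "L6b (\<lambda>x. 0) (4096 * M ^ 3)" by (simp add: L6b_def)
  from weighted_limit[OF borel_measurable_integrable[OF A_int(1)] A_int(3) X_L6[OF us] this l]
  show ?thesis by (simp add: An_def)
qed

lemma X_lsc:
  assumes us: "\<And>n. us n \<in> X" and n: "\<And>n. n2 (us n) \<le> M" and d: "(\<lambda>n. D12_sq (us n)) \<longlonglongrightarrow> d" and w: "(\<lambda>n. Vn (us n)) \<longlonglongrightarrow> w"
    and u: "u \<in> borel_measurable lebesgue" "AE x in lebesgue. (\<lambda>n. us n x) \<longlonglongrightarrow> u x"
  shows "u \<in> X" "D12_sq u \<le> d" "Vn u \<le> w"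
proof -
  obtain G where G: "wg u G" "Dsq G \<le> d"
    using H1_lsc[of us M "\<lambda>n. D12_sq (us n)" d u, OF XD(1)[OF us] n order_refl d u] by metis
  have m: "(\<lambda>x. V x * (u x)\<^sup>2) \<in> borel_measurable lebesgue" by (intro borel_measurable_times borel_measurable_power Vm u)
  have l: "AE x in lebesgue. (\<lambda>n. V x * (us n x)\<^sup>2) \<longlonglongrightarrow> V x * (u x)\<^sup>2"
    using u(2) by eventually_elim (intro tendsto_intros)
  have F: "integrable lebesgue (\<lambda>x. V x * (u x)\<^sup>2)" "Vn u \<le> w"
    using Fatou_bound(1,2)[OF XD(5)[OF us] _ m l order_refl w[unfolded Vn_def]] V0 by (auto simp: Vn_def)
  show "u \<in> X" using wg_H1[OF G(1)] F(1) by (simp add: Xspace_def)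
  show "D12_sq u \<le> d" using G D12_Dsq[OF G(1)] by simp
  show "Vn u \<le> w" by (rule F(2))
qed

lemma Fn_limit:
  assumes us: "\<And>n. us n \<in> X" "\<And>n. D12_sq (us n) \<le> M" and u: "u \<in> X" "D12_sq u \<le> M"
    and l: "AE x in lebesgue. (\<lambda>n. us n x) \<longlonglongrightarrow> u x"
  shows "(\<lambda>n. Fn (us n)) \<longlonglongrightarrow> Fn u"
  unfolding Fn_def by (rule weighted_limit[OF fm fi X_L6[OF us] X_L6[OF u] l])

lemma X_zero: assumes u: "u \<in> X" and \<mu>: "\<mu> \<ge> 1" and z: "nm \<mu> u = 0" shows "AE x in lebesgue. u x = 0"
proof -
  have "n2 u \<le> 0 + t" if "t > 0" for t
  proof -
    have K: "K > 0" using c0 by (simp add: K_def VA_def add_nonneg_pos)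
    show ?thesis using n2_bound[OF u \<mu>, of "t / K"] z that K by simp
  qed
  then have "n2 u \<le> 0" by (rule field_le_epsilon)
  then have "n2 u = 0" using n2_nonneg[of u] by simp
  then show ?thesis using n2_eq_0[OF XD(4)[OF u]] by simp
qed

lemma zero_AE_functionals:
  assumes u: "u \<in> borel_measurable lebesgue" "AE x in lebesgue. u x = 0"
  shows "Bn u = 0" "Fn u = 0" "Vn u = 0"
  unfolding Bn_def Fn_def Vn_def
  by (rule integral_eq_zero_AE, use u(2) in eventually_elim, use p4 in simp)+

section \<open>Coercivity of the quadratic form near \<open>lam1\<close>\<close>

lemma Bn_phi: "Bn \<phi> < 0"
proof -
  have "Bn \<phi> = (\<integral>x\<in>\<Omega>. Q x * \<phi> x powr p \<partial>lebesgue)"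
    unfolding Bn_def set_lebesgue_integral_def
  proof (rule integral_cong_AE)
    show "(\<lambda>x. Q x * \<bar>\<phi> x\<bar> powr p) \<in> borel_measurable lebesgue" by (intro borel_measurable_times Qm powr_m phi_m)
    have "(\<lambda>x. \<phi> x powr p) \<in> borel_measurable lebesgue" using phi_m by measurable
    then show "(\<lambda>x. indicat_real \<Omega> x *\<^sub>R (Q x * \<phi> x powr p)) \<in> borel_measurable lebesgue"
      unfolding real_scaleR_def by (intro borel_measurable_times borel_measurable_indicator Om_meas Qm)
    show "AE x in lebesgue. Q x * \<bar>\<phi> x\<bar> powr p = indicat_real \<Omega> x *\<^sub>R (Q x * \<phi> x powr p)"
      using phi_sign
    proof eventually_elim
      case (elim x)
      then show ?case using p4 by (cases "x \<in> \<Omega>") auto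
    qed
  qed
  then show ?thesis using Qneg by simp
qed

text \<open>One \<open>\<delta>\<close> is both the length of the interval for \<open>lam\<close>
  and the coercivity constant. The negation at \<open>\<delta> = e n\<close>, with threshold
  \<open>real (Suc n)\<close> for \<open>\<mu>\<close>, then yields a single sequence along which
  \<open>lam\<close>, \<open>\<mu>\<close> and the form all degenerate together.\<close>

lemma spectral_gap:
  "\<exists>\<delta>>0. \<forall>lam. lam1 \<le> lam \<and> lam < lam1 + \<delta> \<longrightarrow>
    (\<exists>\<mu>s\<ge>1. \<forall>\<mu>>\<mu>s. \<forall>u\<in>X. Bn u > 0 \<longrightarrow> nm \<mu> u - lam * Fn u \<ge> \<delta> * nm \<mu> u)"
  (is ?gap)
proof (rule ccontr)
  assume neg: "\<not> ?gap"
  define e where "e n = inverse (real (Suc n))" for n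
  have e1: "e n > 0" for n by (simp add: e_def)
  have e2: "e \<longlonglongrightarrow> 0" unfolding e_def[abs_def] by (rule LIMSEQ_inverse_real_of_nat)
  have ex: "\<exists>lam \<mu> u. lam1 \<le> lam \<and> lam < lam1 + e n \<and> \<mu> > real (Suc n) \<and> u \<in> X \<and> Bn u > 0 \<and> nm \<mu> u = 1 \<and> 1 - lam * Fn u < e n" for n
  proof -
    have "\<not> (\<forall>lam. lam1 \<le> lam \<and> lam < lam1 + e n \<longrightarrow>
      (\<exists>\<mu>s\<ge>1. \<forall>\<mu>>\<mu>s. \<forall>u\<in>X. Bn u > 0 \<longrightarrow> nm \<mu> u - lam * Fn u \<ge> e n * nm \<mu> u))"
      (is "\<not> ?P")
    proof
      assume ?P
      then have ?gap by (intro exI[of _ "e n"] conjI e1)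
      with neg show False by contradiction
    qed
    then obtain lam where lam: "lam1 \<le> lam" "lam < lam1 + e n"
      and no: "\<not> (\<exists>\<mu>s\<ge>1. \<forall>\<mu>>\<mu>s. \<forall>u\<in>X. Bn u > 0 \<longrightarrow> nm \<mu> u - lam * Fn u \<ge> e n * nm \<mu> u)"
      by (elim not_all[THEN iffD1, THEN exE]) auto
    have "1 \<le> real (Suc n)" by simp
    with no have "\<not> (\<forall>\<mu>>real (Suc n). \<forall>u\<in>X. Bn u > 0 \<longrightarrow> nm \<mu> u - lam * Fn u \<ge> e n * nm \<mu> u)"
      by (metis (no_types, lifting))
    then obtain \<mu> u where u: "\<mu> > real (Suc n)" "u \<in> X" "Bn u > 0" "nm \<mu> u - lam * Fn u < e n * nm \<mu> u"
      by (auto simp: not_le simp del: of_nat_Suc)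
    have m1: "\<mu> \<ge> 1" using u(1) by simp
    have pos: "nm \<mu> u > 0"
    proof (rule ccontr)
      assume "\<not> nm \<mu> u > 0"
      then have "nm \<mu> u = 0" using nm_ge(3)[of \<mu> u] m1 by simp
      then have "Bn u = 0" using zero_AE_functionals(1)[OF XD(6)[OF u(2)] X_zero[OF u(2) m1]] by simp
      then show False using u(3) by simp
    qed
    \<comment> \<open>\<open>Bn u > 0\<close> excludes the zero function, so the norm can be
      normalized to \<open>1\<close>; the sign of \<open>Bn\<close> is kept.\<close>
    define t where "t = 1 / sqrt (nm \<mu> u)"
    have t: "t > 0" "t\<^sup>2 * nm \<mu> u = 1" using pos by (auto simp: t_def power_divide)
    have "t\<^sup>2 * (nm \<mu> u - lam * Fn u) < t\<^sup>2 * (e n * nm \<mu> u)" using u(4) t(1) by (intro mult_strict_left_mono) auto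
    then have "1 - lam * (t\<^sup>2 * Fn u) < e n" using t(2) by (simp add: algebra_simps)
    then show ?thesis
      using lam(1,2) u(1) X_cmult(1,4,6)[OF u(2), of t] X_cmult(5)[OF u(2), of \<mu> t] u(3) t
      by (rule_tac exI[of _ lam], rule_tac exI[of _ \<mu>], rule_tac exI[of _ "\<lambda>x. t * u x"]) auto
  qed
  then obtain L \<mu> us where us: "\<And>n. lam1 \<le> L n" "\<And>n. L n < lam1 + e n" "\<And>n. \<mu> n > real (Suc n)" "\<And>n. us n \<in> X" "\<And>n. Bn (us n) > 0"
    "\<And>n. nm (\<mu> n) (us n) = 1" "\<And>n. 1 - L n * Fn (us n) < e n"
    by metis
  have m1: "\<mu> n \<ge> 1" for n using us(3)[of n] by simp
  have Du: "D12_sq (us n) \<le> 1" for n using nm_ge(1)[of "\<mu> n" "us n"] m1[of n] us(6)[of n] by simp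
  have nu: "n2 (us n) \<le> K" for n using n2_bound[OF us(4)[of n] m1[of n], of 1] us(6)[of n] by simp
  \<comment> \<open>As \<open>\<mu> n\<close> grows the potential energy dies, which forces the
    limit to vanish where \<open>V > 0\<close>, that is off \<open>closure \<Omega>\<close>.\<close>
  have Vu: "Vn (us n) \<le> e n" for n
  proof -
    have "Vn (us n) \<le> 1 / \<mu> n" using nm_ge(2)[of "\<mu> n" "us n"] m1[of n] us(6)[of n] by simp
    also have "\<dots> \<le> e n" unfolding e_def using us(3)[of n] by (simp add: divide_inverse le_imp_inverse_le)
    finally show ?thesis .
  qed
  have bnd: "n2 (us n) \<le> max K 1" "Dsq (grad (us n)) \<le> max K 1" for n using nu[of n] Du[of n] XD(3)[OF us(4)[of n]] by auto
  obtain r w0 where r: "strict_mono r" "w0 \<in> borel_measurable lebesgue" "AE x in lebesgue. (\<lambda>n. us (r n) x) \<longlonglongrightarrow> w0 x"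
    by (rule Rellich_AE[OF XD(2)[OF us(4)] bnd])
  define ws where "ws n = us (r n)" for n
  have wsX: "ws n \<in> X" and Dw: "D12_sq (ws n) \<le> 1" and nw: "n2 (ws n) \<le> K" for n unfolding ws_def using us Du nu by auto
  have wl: "AE x in lebesgue. (\<lambda>n. ws n x) \<longlonglongrightarrow> w0 x" using r(3) by (simp add: ws_def)
  have er: "(\<lambda>n. e (r n)) \<longlonglongrightarrow> 0" using LIMSEQ_subseq_LIMSEQ[OF e2 r(1)] by (simp add: o_def)
  have Vw: "(\<lambda>n. Vn (ws n)) \<longlonglongrightarrow> 0"
    by (rule tendsto_sandwich[OF _ _ tendsto_const er]) (auto simp: ws_def Vu Vn0)
  obtain Gw where Gw: "wg w0 Gw" "Dsq Gw \<le> 1"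
    using H1_lsc[of ws K "\<lambda>n. 1" 1 w0, OF XD(1)[OF wsX] nw Dw tendsto_const r(2) wl] by metis
  have m: "(\<lambda>x. V x * (w0 x)\<^sup>2) \<in> borel_measurable lebesgue" by (intro borel_measurable_times borel_measurable_power Vm r(2))
  have lV: "AE x in lebesgue. (\<lambda>n. V x * (ws n x)\<^sup>2) \<longlonglongrightarrow> V x * (w0 x)\<^sup>2"
    using wl by eventually_elim (intro tendsto_intros)
  have F: "integrable lebesgue (\<lambda>x. V x * (w0 x)\<^sup>2)" "(\<integral>x. V x * (w0 x)\<^sup>2 \<partial>lebesgue) \<le> 0"
    using Fatou_bound(1,2)[OF XD(5)[OF wsX] _ m lV order_refl Vw[unfolded Vn_def]] V0 by auto
  then have "(\<integral>x. V x * (w0 x)\<^sup>2 \<partial>lebesgue) = 0"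
    using Vn0[of w0] by (simp add: Vn_def)
  then have Vw0: "AE x in lebesgue. V x * (w0 x)\<^sup>2 = 0"
    using integral_nonneg_eq_0_iff_AE[OF F(1)] V0 by simp
  have w0X: "w0 \<in> X" using wg_H1[OF Gw(1)] F(1) by (simp add: Xspace_def)
  have "AE x in lebesgue. x \<notin> closure \<Omega> \<longrightarrow> w0 x = 0" using Vw0 by eventually_elim (auto simp: clO)
  then have H: "H10 \<Omega> w0" by (rule H10_of_vanishing[OF dom wg_H1[OF Gw(1)]])
  have D1: "D12_sq w0 \<le> 1" using D12_Dsq[OF Gw(1)] Gw(2) by simp
  have FO: "Fn w0 = (\<integral>x. fO x * (w0 x)\<^sup>2 \<partial>lebesgue)"
    unfolding Fn_def
  proof (rule integral_cong_AE)
    show "(\<lambda>x. f x * (w0 x)\<^sup>2) \<in> borel_measurable lebesgue" "(\<lambda>x. fO x * (w0 x)\<^sup>2) \<in> borel_measurable lebesgue"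
      by (intro borel_measurable_times borel_measurable_power fm fO_m r(2))+
    show "AE x in lebesgue. f x * (w0 x)\<^sup>2 = fO x * (w0 x)\<^sup>2"
      using H10_vanishes[OF H Gw(1)] by eventually_elim (auto simp: fO_def indicator_def)
  qed
  have Flim: "(\<lambda>n. Fn (ws n)) \<longlonglongrightarrow> Fn w0" by (rule Fn_limit[OF wsX Dw w0X D1 wl])
  have Ll: "(\<lambda>n. L (r n)) \<longlonglongrightarrow> lam1"
  proof (rule tendsto_sandwich[OF _ _ tendsto_const])
    show "\<forall>\<^sub>F n in sequentially. lam1 \<le> L (r n)" using us(1) by simp
    show "\<forall>\<^sub>F n in sequentially. L (r n) \<le> lam1 + e (r n)" using us(2) by (simp add: less_imp_le)
    show "(\<lambda>n. lam1 + e (r n)) \<longlonglongrightarrow> lam1" using tendsto_add[OF tendsto_const er, of lam1] by simp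
  qed
  have "1 - lam1 * Fn w0 \<le> 0"
  proof (rule LIMSEQ_le[OF tendsto_diff[OF tendsto_const tendsto_mult[OF Ll Flim]] er])
    show "\<exists>N. \<forall>n\<ge>N. 1 - L (r n) * Fn (ws n) \<le> e (r n)" using us(7) by (auto simp: ws_def less_imp_le)
  qed
  \<comment> \<open>This has two uses: with \<open>Dsq Gw \<le> 1\<close> it is the reversed
    Rayleigh inequality that \<open>eigenfunction_simple\<close> asks for, and it prevents the limit
    from being \<open>0\<close>.\<close>
  then have F1: "1 \<le> lam1 * Fn w0" by simp
  then have "Dsq Gw \<le> lam1 * (\<integral>x. fO x * (w0 x)\<^sup>2 \<partial>lebesgue)" using Gw(2) FO by simp
  then obtain k where k: "AE x in lebesgue. w0 x = k * \<phi> x" using eigenfunction_simple[OF H Gw(1)] by blast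
  have k0: "k \<noteq> 0"
  proof
    assume "k = 0"
    then have "AE x in lebesgue. w0 x = 0" using k by simp
    then have "Fn w0 = 0" by (rule zero_AE_functionals(2)[OF r(2)])
    then show False using F1 by simp
  qed
  have Bw: "Bn w0 = \<bar>k\<bar> powr p * Bn \<phi>"
  proof -
    have "Bn w0 = (\<integral>x. \<bar>k\<bar> powr p * (Q x * \<bar>\<phi> x\<bar> powr p) \<partial>lebesgue)"
      unfolding Bn_def
    proof (rule integral_cong_AE)
      show "(\<lambda>x. Q x * \<bar>w0 x\<bar> powr p) \<in> borel_measurable lebesgue" by (intro borel_measurable_times Qm powr_m r(2))
      show "(\<lambda>x. \<bar>k\<bar> powr p * (Q x * \<bar>\<phi> x\<bar> powr p)) \<in> borel_measurable lebesgue"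
        by (intro borel_measurable_times borel_measurable_const Qm powr_m phi_m)
      show "AE x in lebesgue. Q x * \<bar>w0 x\<bar> powr p = \<bar>k\<bar> powr p * (Q x * \<bar>\<phi> x\<bar> powr p)"
        using k by eventually_elim (simp add: abs_mult powr_mult)
    qed
    then show ?thesis by (simp add: Bn_def)
  qed
  have Bneg: "Bn w0 < 0" unfolding Bw using Bn_phi k0 by (simp add: mult_pos_neg)
  define v where "v n x = ws n x - w0 x" for n x
  have vX: "v n \<in> X" for n unfolding v_def[abs_def] by (rule X_add_diff(2)[OF wsX w0X])
  have vD: "D12_sq (v n) \<le> 4" for n
    unfolding v_def[abs_def] using parallelogram_X(1)[OF wsX w0X, of n] Dw[of n] D1 D0[of "\<lambda>x. (ws n x + w0 x) / 2"] by linarith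
  \<comment> \<open>The limit lives where \<open>V\<close> vanishes, so subtracting it does not
    change the potential energy, which tends to \<open>0\<close>.\<close>
  have vV: "Vn (v n) = Vn (ws n)" for n
    unfolding Vn_def
  proof (rule integral_cong_AE)
    show "(\<lambda>x. V x * (v n x)\<^sup>2) \<in> borel_measurable lebesgue" "(\<lambda>x. V x * (ws n x)\<^sup>2) \<in> borel_measurable lebesgue"
      by (intro borel_measurable_times borel_measurable_power Vm XD(6)[OF vX] XD(6)[OF wsX])+
    show "AE x in lebesgue. V x * (v n x)\<^sup>2 = V x * (ws n x)\<^sup>2" using Vw0 by eventually_elim (auto simp: v_def)
  qed
  have vl: "AE x in lebesgue. (\<lambda>n. v n x) \<longlonglongrightarrow> 0" using wl
    by eventually_elim (simp add: v_def LIM_zero)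
  \<comment> \<open>On the set of finite measure \<open>An_limit\<close> applies; on its complement
    the vanishing potential energy bounds the square integral.\<close>
  have n2v: "(\<lambda>n. n2 (v n)) \<longlonglongrightarrow> 0"
  proof (rule tendsto_sandwich[OF _ _ tendsto_const])
    show "\<forall>\<^sub>F n in sequentially. n2 (v n) \<le> An (v n) + Vn (ws n) / c" using n2_An[OF vX] by (simp add: vV)
    have "(\<lambda>n. An (v n) + Vn (ws n) / c) \<longlonglongrightarrow> 0 + 0 / c"
      by (intro tendsto_add tendsto_divide tendsto_const An_limit[OF vX vD vl] Vw) (use c0 in simp)
    then show "(\<lambda>n. An (v n) + Vn (ws n) / c) \<longlonglongrightarrow> 0" by simp
  qed simp
  obtain eb where eb: "eb \<longlonglongrightarrow> 0" "\<And>n. \<bar>Bn (ws n) - Bn w0\<bar> \<le> eb n + CQ * 2 powr p * Pn (v n)"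
    unfolding v_def[abs_def] using Bn_limit[OF wsX w0X wl] by blast
  \<comment> \<open>Along the sequence \<open>Bn\<close> is positive, so \<open>- Bn w0\<close> is
    at most the error in \<open>Bn_limit\<close>. The square term of that error vanishes in the
    limit; the remaining one is removed afterwards by letting \<open>s\<close> tend to
    infinity.\<close>
  have bound: "- Bn w0 \<le> CQ * 2 powr p * (s powr (p - 6) * (4096 * 4 ^ 3))" if s: "s > 0" for s
  proof (rule LIMSEQ_le[OF tendsto_const])
    have "(\<lambda>n. eb n + CQ * 2 powr p * (s powr (p - 2) * n2 (v n) + s powr (p - 6) * (4096 * 4 ^ 3))) \<longlonglongrightarrow>
      0 + CQ * 2 powr p * (s powr (p - 2) * 0 + s powr (p - 6) * (4096 * 4 ^ 3))"
      by (intro tendsto_add tendsto_mult tendsto_const eb(1) n2v)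
    then show "(\<lambda>n. eb n + CQ * 2 powr p * (s powr (p - 2) * n2 (v n) + s powr (p - 6) * (4096 * 4 ^ 3))) \<longlonglongrightarrow>
      CQ * 2 powr p * (s powr (p - 6) * (4096 * 4 ^ 3))" by simp
    have "- Bn w0 \<le> eb n + CQ * 2 powr p * (s powr (p - 2) * n2 (v n) + s powr (p - 6) * (4096 * 4 ^ 3))" for n
    proof -
      have "- Bn w0 \<le> \<bar>Bn (ws n) - Bn w0\<bar>" using us(5)[of "r n"] by (simp add: ws_def)
      also note eb(2)[of n]
      also have "CQ * 2 powr p * Pn (v n) \<le> CQ * 2 powr p * (s powr (p - 2) * n2 (v n) + s powr (p - 6) * (4096 * 4 ^ 3))"
        using CQ0 by (intro mult_left_mono Pn_bound(2)[OF XD(4)[OF vX] X_L6[OF vX vD] s]) auto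
      finally show ?thesis by simp
    qed
    then show "\<exists>N. \<forall>n\<ge>N. - Bn w0 \<le> eb n + CQ * 2 powr p * (s powr (p - 2) * n2 (v n) + s powr (p - 6) * (4096 * 4 ^ 3))"
      by blast
  qed
  have "((\<lambda>s. CQ * 2 powr p * (s powr (p - 6) * (4096 * 4 ^ 3))) \<longlongrightarrow> CQ * 2 powr p * (0 * (4096 * 4 ^ 3))) at_top"
    by (intro tendsto_mult tendsto_const tendsto_neg_powr filterlim_ident) (use p6 in simp)
  then have "- Bn w0 \<le> CQ * 2 powr p * (0 * (4096 * 4 ^ 3))"
    by (rule tendsto_lowerbound[OF _ eventually_mono[OF eventually_gt_at_top[of 0] bound]]) auto
  then show False using Bneg by simp
qed


text \<open>Inner regularity provides a compact subset of \<open>\<Omega>\<close>, not of measure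
  \<open>0\<close>, on which \<open>Q > 0\<close>. Mollified indicators of it take values in the
  unit interval and converge almost everywhere, so \<open>Bn\<close> converges to a positive
  number.\<close>

lemma positive_test_function:
  obtains v where "test_fun \<Omega> v" "Bn v > 0"
proof -
  define E where "E = {x \<in> \<Omega>. Q x > 0}"
  have "{x \<in> space lebesgue. 0 < Q x} \<in> sets lebesgue" by (rule borel_measurable_less[OF borel_measurable_const Qm])
  then have "\<Omega> \<inter> {x \<in> space lebesgue. 0 < Q x} \<in> sets lebesgue" by (rule sets.Int[OF Om_meas])
  then have Em: "E \<in> sets lebesgue" by (simp add: E_def Int_def)
  have Of: "emeasure lebesgue \<Omega> < \<infinity>" using lmeasurable_open[OF bd op] unfolding fmeasurable_def by blast
  have "emeasure lebesgue E \<le> emeasure lebesgue \<Omega>" by (rule emeasure_mono[OF _ Om_meas]) (auto simp: E_def)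
  then have "emeasure lebesgue E < \<infinity>" using Of by (rule le_less_trans)
  then have m1: "emeasure lebesgue E = ennreal (measure lebesgue E)"
    unfolding infinity_ennreal_def by (intro emeasure_eq_ennreal_measure less_imp_neq)
  have "emeasure lebesgue E \<noteq> 0"
  proof
    assume "emeasure lebesgue E = 0"
    then have "AE x in lebesgue. x \<notin> E" using Em by (intro AE_not_in) auto
    then have "AE x in lebesgue. x \<in> \<Omega> \<longrightarrow> Q x \<le> 0" by eventually_elim (auto simp: E_def)
    then show False using Qpos by simp
  qed
  then have "measure lebesgue E \<noteq> 0" using m1 by (metis ennreal_0)
  then have m: "measure lebesgue E > 0" using measure_nonneg[of lebesgue E] by linarith
  \<comment> \<open>The tolerance is the measure of \<open>E\<close> itself, so \<open>T\<close>
    cannot be a null set.\<close>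
  obtain T where T: "closed T" "T \<subseteq> E" "emeasure lebesgue (E - T) < ennreal (measure lebesgue E)"
    using sets_lebesgue_inner_closed[OF Em m] by metis
  have Tm: "T \<in> sets lebesgue" using T(1) by auto
  have Tn: "T \<notin> null_sets lebesgue"
  proof
    assume "T \<in> null_sets lebesgue"
    then show False using emeasure_Diff_null_set[OF _ Em] T(3) m1 by (metis less_irrefl)
  qed
  have TO: "T \<subseteq> \<Omega>" using T(2) by (auto simp: E_def)
  have cT: "compact T" using T(1) bounded_subset[OF bd TO] by (simp add: compact_eq_bounded_closed)
  have "T \<inter> - \<Omega> = {}" using TO by blast
  from separate_compact_closed[OF cT closed_Compl[OF op] this] obtain d where d: "d > 0" "\<And>x y. x \<in> T \<Longrightarrow> y \<in> - \<Omega> \<Longrightarrow> d \<le> dist x y"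
    by (elim exE conjE) (metis bspec)
  define e where "e n = d / 2 * inverse (real (Suc n))" for n
  have e: "e n > 0" "e n \<le> d / 2" for n using d(1) by (auto simp: e_def field_simps)
  have el: "e \<longlonglongrightarrow> 0" unfolding e_def[abs_def] using tendsto_mult_right_zero[OF LIMSEQ_inverse_real_of_nat] by blast
  define \<phi>s where "\<phi>s n = conv (e n) (indicat_real T)" for n
  have "integrable lebesgue (indicat_real T)"
    using lmeasurable_compact[OF cT] unfolding fmeasurable_def by (intro integrable_real_indicator) blast+
  moreover have "(\<lambda>x. (indicat_real T x)\<^sup>2) = indicat_real T" by (auto simp: indicator_def)
  ultimately have LT: "L2 (indicat_real T)" unfolding L2_def using Tm by (auto intro: borel_measurable_indicator)
  have t: "test_fun \<Omega> (\<phi>s n)" for n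
    unfolding \<phi>s_def
  proof (rule conv_test_fun[OF e(1) L2_loc_int[OF LT] _ cT])
    fix x assume x: "x \<in> T"
    show "cball x (e n) \<subseteq> \<Omega>"
    proof
      fix y assume "y \<in> cball x (e n)"
      then have "dist x y \<le> d / 2" using e(2)[of n] by simp
      then have "dist x y < d" using d(1) by linarith
      then show "y \<in> \<Omega>" using d(2)[OF x, of y] by auto
    qed
  qed simp
  have b: "0 \<le> \<phi>s n x" "\<phi>s n x \<le> 1" for n x
    unfolding \<phi>s_def by (rule conv_mono_bounds[OF e(1) L2_loc_int[OF LT]]; simp add: indicator_def)+
  have "L2lim \<phi>s (indicat_real T)" unfolding \<phi>s_def by (rule conv_L2lim[OF LT e(1) el])
  then obtain r where r: "strict_mono r" "AE x in lebesgue. (\<lambda>n. \<phi>s (r n) x) \<longlonglongrightarrow> indicat_real T x"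
    by (rule L2lim_AE_subseq)
  have "(\<lambda>n. Bn (\<phi>s (r n))) \<longlonglongrightarrow> Bn (indicat_real T)"
    unfolding Bn_def
  proof (rule integral_dominated_convergence[where w = "\<lambda>x. CQ * indicat_real \<Omega> x"])
    show "(\<lambda>x. Q x * \<bar>indicat_real T x\<bar> powr p) \<in> borel_measurable lebesgue"
      by (intro borel_measurable_times Qm powr_m L2_meas[OF LT])
    show "(\<lambda>x. Q x * \<bar>\<phi>s (r n) x\<bar> powr p) \<in> borel_measurable lebesgue" for n
      by (intro borel_measurable_times Qm powr_m L2_meas[OF wgD(1)[OF C1c_wg[OF test_fun_C1c[OF t]]]])
    show "integrable lebesgue (\<lambda>x. CQ * indicat_real \<Omega> x)"
      by (rule integrable_mult_right[OF integrable_real_indicator[OF Om_meas Of]])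
    show "AE x in lebesgue. (\<lambda>n. Q x * \<bar>\<phi>s (r n) x\<bar> powr p) \<longlonglongrightarrow> Q x * \<bar>indicat_real T x\<bar> powr p"
      using r(2)
    proof eventually_elim
      case (elim x)
      show ?case
        by (intro tendsto_mult tendsto_const tendsto_powr'[OF tendsto_rabs[OF elim] tendsto_const]) (use p4 in auto)
    qed
    show "AE x in lebesgue. norm (Q x * \<bar>\<phi>s (r n) x\<bar> powr p) \<le> CQ * indicat_real \<Omega> x" for n
      using QC
    proof eventually_elim
      case (elim x)
      show ?case
      proof (cases "x \<in> \<Omega>")
        case True
        have "\<bar>\<phi>s (r n) x\<bar> powr p \<le> 1" using b[where n = "r n" and x = x] p4 by (intro powr_le1) auto
        then have "\<bar>Q x\<bar> * \<bar>\<phi>s (r n) x\<bar> powr p \<le> CQ * 1" using elim CQ0 by (intro mult_mono) auto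
        then show ?thesis using True by (simp add: abs_mult)
      next
        case False
        then have "\<phi>s (r n) x = 0" using t[of "r n"] test_fun_outside[of x "\<phi>s (r n)"] by (auto simp: test_fun_def)
        then show ?thesis using CQ0 by simp
      qed
    qed
  qed
  moreover have "Bn (indicat_real T) > 0"
  proof -
    have eq: "Q x * \<bar>indicat_real T x\<bar> powr p = Q x * indicat_real T x" for x by (simp add: indicator_def)
    have n: "0 \<le> Q x * indicat_real T x" for x using T(2) by (auto simp: E_def indicator_def intro: less_imp_le)
    have i: "integrable lebesgue (\<lambda>x. Q x * indicat_real T x)" by (rule Q_integrable) fact
    have "Bn (indicat_real T) \<noteq> 0"
    proof
      assume "Bn (indicat_real T) = 0"
      then have "(\<integral>x. Q x * indicat_real T x \<partial>lebesgue) = 0" unfolding Bn_def eq .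
      then have "AE x in lebesgue. Q x * indicat_real T x = 0"
        using integral_nonneg_eq_0_iff_AE[OF i AE_I2[OF n]] by blast
      then have "AE x in lebesgue. x \<notin> T" by eventually_elim (use T(2) in \<open>auto simp: E_def indicator_def\<close>)
      then show False using Tn AE_iff_null_sets[OF Tm] by simp
    qed
    moreover have "Bn (indicat_real T) \<ge> 0" unfolding Bn_def eq by (rule Bochner_Integration.integral_nonneg) (rule n)
    ultimately show ?thesis by simp
  qed
  ultimately have "\<forall>\<^sub>F n in sequentially. Bn (\<phi>s (r n)) > 0" by (rule order_tendstoD)
  then obtain n where "Bn (\<phi>s (r n)) > 0" by (meson eventually_sequentially order_refl)
  with t that show thesis by blast
qed

section \<open>Fibre maps and the Nehari set\<close>

definition qf :: "real \<Rightarrow> real \<Rightarrow> (real^3 \<Rightarrow> real) \<Rightarrow> real" where "qf \<mu> lam u = nm \<mu> u - lam * Fn u"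

abbreviation J :: "real \<Rightarrow> real \<Rightarrow> (real^3 \<Rightarrow> real) \<Rightarrow> real" where "J \<equiv> Jfun a p V f Q"
abbreviation Nminus :: "real \<Rightarrow> real \<Rightarrow> (real^3 \<Rightarrow> real) set" where "Nminus \<equiv> Nehari_minus a p V f Q"

lemma J_eq: "J \<mu> lam u = a / 4 * (D12_sq u)\<^sup>2 + qf \<mu> lam u / 2 - Bn u / p"
  by (simp add: Jfun_def qf_def Bn_def Fn_def field_simps)

lemma fiber_eq:
  assumes "u \<in> X"
  shows "fiber a p V f Q \<mu> lam u t = a * (D12_sq u)\<^sup>2 / 4 * t ^ 4 + qf \<mu> lam u / 2 * t\<^sup>2 - Bn u / p * \<bar>t\<bar> powr p"
proof -
  have "t ^ 4 = t\<^sup>2 * t\<^sup>2" by (simp flip: power_add)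
  then show ?thesis unfolding fiber_def J_eq qf_def X_cmult(2-)[OF assms] by (simp add: power_mult_distrib power2_eq_square field_simps)
qed

lemma fiber_deriv:
  assumes "u \<in> X" "t > 0"
  shows "deriv (fiber a p V f Q \<mu> lam u) t = a * (D12_sq u)\<^sup>2 * t ^ 3 + qf \<mu> lam u * t - Bn u * t powr (p - 1)"
proof (rule DERIV_imp_deriv, rule has_field_derivative_transform_within_open[where S = "{0<..}"])
  show "((\<lambda>t. a * (D12_sq u)\<^sup>2 / 4 * t ^ 4 + qf \<mu> lam u / 2 * t\<^sup>2 - Bn u / p * t powr p) has_real_derivative
    a * (D12_sq u)\<^sup>2 * t ^ 3 + qf \<mu> lam u * t - Bn u * t powr (p - 1)) (at t)"
    using assms(2) p4 by (auto intro!: derivative_eq_intros has_real_derivative_powr simp: field_simps)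
qed (use assms in \<open>auto simp: fiber_eq\<close>)

lemma fiber_deriv2:
  assumes "u \<in> X"
  shows "deriv (deriv (fiber a p V f Q \<mu> lam u)) 1 = 3 * a * (D12_sq u)\<^sup>2 + qf \<mu> lam u - (p - 1) * Bn u"
proof (rule DERIV_imp_deriv, rule has_field_derivative_transform_within_open[where S = "{0<..}"])
  show "((\<lambda>t. a * (D12_sq u)\<^sup>2 * t ^ 3 + qf \<mu> lam u * t - Bn u * t powr (p - 1)) has_real_derivative
    3 * a * (D12_sq u)\<^sup>2 + qf \<mu> lam u - (p - 1) * Bn u) (at 1)"
    by (auto intro!: derivative_eq_intros has_real_derivative_powr simp: field_simps)
qed (use assms in \<open>auto simp: fiber_deriv\<close>)

lemma Nminus_iff:
  "u \<in> Nminus \<mu> lam \<longleftrightarrow> u \<in> X \<and> \<not> (AE x in lebesgue. u x = 0) \<and> a * (D12_sq u)\<^sup>2 + qf \<mu> lam u = Bn u \<and>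
    3 * a * (D12_sq u)\<^sup>2 + qf \<mu> lam u < (p - 1) * Bn u"
  by (auto simp: Nehari_minus_def Nehari_def fiber_deriv fiber_deriv2)

text \<open>Subtracting the Nehari equation from the second-order condition leaves
  \<open>2 * a * (D12_sq u)\<^sup>2 < (p - 2) * Bn u\<close>.\<close>

lemma Nminus_Bn_pos: assumes "u \<in> Nminus \<mu> lam" shows "Bn u > 0"
proof -
  have "0 \<le> a * (D12_sq u)\<^sup>2" using a0 by simp
  then have "0 < (p - 2) * Bn u" using assms by (simp add: Nminus_iff algebra_simps)
  then show ?thesis using p4 by (simp add: zero_less_mult_iff)
qed

text \<open>Eliminating \<open>Bn u\<close> leaves two terms with positive coefficients, as
  \<open>p > 4\<close>. Hence the energy bounds the norm from above once \<open>qf\<close> is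
  coercive, and no lower semicontinuity of \<open>Bn\<close> is involved in comparing
  energies.\<close>

lemma J_on_Nehari:
  assumes "a * (D12_sq u)\<^sup>2 + qf \<mu> lam u = Bn u"
  shows "J \<mu> lam u = (p - 4) / (4 * p) * (a * (D12_sq u)\<^sup>2) + (p - 2) / (2 * p) * qf \<mu> lam u"
  unfolding J_eq assms[symmetric] using p4 by (simp add: field_simps)

lemma nm_pos: assumes "u \<in> X" "\<mu> \<ge> 1" "Bn u > 0" shows "nm \<mu> u > 0"
proof (rule ccontr)
  assume "\<not> nm \<mu> u > 0"
  then have "nm \<mu> u = 0" using nm_ge(3)[of \<mu> u] assms(2) by simp
  then have "Bn u = 0" using zero_AE_functionals(1)[OF XD(6)[OF assms(1)] X_zero[OF assms(1,2)]] by simp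
  then show False using assms(3) by simp
qed

text \<open>The intermediate value theorem on the ray. The condition on \<open>T\<close> places the
  zero before \<open>T\<close>, which for \<open>T = 1\<close> gives a contraction towards
  \<open>0\<close>. At a zero the second-order condition is automatic, since \<open>p > 4\<close>
  and \<open>qf \<mu> lam u > 0\<close>.\<close>

lemma Nehari_projection:
  assumes u: "u \<in> X" and B: "Bn u > 0" and A: "qf \<mu> lam u > 0"
    and T: "T \<ge> 1" "a * (D12_sq u)\<^sup>2 + qf \<mu> lam u \<le> Bn u * T powr (p - 4)"
  obtains t where "0 < t" "t \<le> T" "(\<lambda>x. t * u x) \<in> Nminus \<mu> lam"
proof -
  \<comment> \<open>The fibre derivative divided by \<open>- t\<close>.\<close>
  define g where "g t = Bn u * t powr (p - 2) - a * (D12_sq u)\<^sup>2 * t\<^sup>2 - qf \<mu> lam u" for t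
  have aD: "0 \<le> a * (D12_sq u)\<^sup>2" using a0 by simp
  have "g 0 \<le> 0" using A by (simp add: g_def)
  moreover have "0 \<le> g T"
  proof -
    have "T powr (p - 2) = T powr (p - 4) * T\<^sup>2" using T(1) powr_add[of T "p - 4" 2] by simp
    moreover have "(a * (D12_sq u)\<^sup>2 + qf \<mu> lam u) * T\<^sup>2 \<le> Bn u * T powr (p - 4) * T\<^sup>2"
      by (rule mult_right_mono[OF T(2)]) simp
    moreover have "qf \<mu> lam u * 1 \<le> qf \<mu> lam u * T\<^sup>2" using T(1) A by (intro mult_left_mono one_le_power) auto
    ultimately show ?thesis by (simp add: g_def algebra_simps)
  qed
  moreover have "continuous_on {0..T} g"
    unfolding g_def by (intro continuous_intros continuous_on_powr') (use p4 in auto)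
  ultimately obtain t where t: "0 \<le> t" "t \<le> T" "g t = 0" using IVT'[of g 0 0 T] T(1) by auto
  have "t \<noteq> 0" using t(3) A by (auto simp: g_def)
  then have t0: "t > 0" using t(1) by simp
  let ?u = "\<lambda>x. t * u x"
  have q: "qf \<mu> lam ?u = t\<^sup>2 * qf \<mu> lam u" unfolding qf_def X_cmult(2-)[OF u] by (simp add: algebra_simps)
  have D: "a * (D12_sq ?u)\<^sup>2 = t\<^sup>2 * (a * (D12_sq u)\<^sup>2 * t\<^sup>2)" unfolding X_cmult(2)[OF u] by (simp add: power_mult_distrib power2_eq_square)
  have Bt: "Bn ?u = t\<^sup>2 * (Bn u * t powr (p - 2))"
    unfolding X_cmult(6)[OF u] using t0 powr_add[of t "p - 2" 2] by simp
  have eq: "a * (D12_sq ?u)\<^sup>2 + qf \<mu> lam ?u = Bn ?u"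
    unfolding q D Bt using t(3) by (simp add: g_def flip: distrib_left)
  have "0 \<le> (p - 4) * (a * (D12_sq ?u)\<^sup>2)" "0 < (p - 2) * qf \<mu> lam ?u" unfolding q using p4 a0 A t0 by auto
  then have "3 * a * (D12_sq ?u)\<^sup>2 + qf \<mu> lam ?u < (p - 1) * (a * (D12_sq ?u)\<^sup>2 + qf \<mu> lam ?u)" by (simp add: algebra_simps)
  moreover have "\<not> (AE x in lebesgue. ?u x = 0)"
  proof
    assume "AE x in lebesgue. ?u x = 0"
    then have "Bn ?u = 0" by (rule zero_AE_functionals(1)[OF XD(6)[OF X_cmult(1)[OF u]]])
    then show False unfolding Bt using t0 B by simp
  qed
  ultimately have "?u \<in> Nminus \<mu> lam" using eq X_cmult(1)[OF u, of t] by (simp add: Nminus_iff)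
  then show thesis using that t0 t(2) by blast
qed

text \<open>The energy of this competitor does not depend on \<open>\<mu>\<close>, because it lives where \<open>V\<close> vanishes.\<close>
lemma uniform_competitor:
  assumes gap: "\<And>\<mu> u. \<mu> > \<mu>s \<Longrightarrow> u \<in> X \<Longrightarrow> Bn u > 0 \<Longrightarrow> qf \<mu> lam u \<ge> \<delta> * nm \<mu> u" and \<mu>s: "\<mu>s \<ge> 1" and \<delta>: "\<delta> > 0"
  shows "\<exists>w J0. \<forall>\<mu>>\<mu>s. w \<in> Nminus \<mu> lam \<and> J \<mu> lam w = J0"
proof -
  obtain v where v: "test_fun \<Omega> v" "Bn v > 0" by (rule positive_test_function)
  have V0v: "V x * (v x)\<^sup>2 = 0" for x
  proof (cases "x \<in> \<Omega>")
    case True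
    then have "V x = 0" using clO closure_subset by fast
    then show ?thesis by simp
  next
    case False
    then show ?thesis using v(1) test_fun_outside[of x v] by (auto simp: test_fun_def)
  qed
  have vX: "v \<in> X"
    unfolding Xspace_def mem_Collect_eq V0v using wg_H1[OF C1c_wg[OF test_fun_C1c[OF v(1)]]] by simp
  have Vv: "Vn v = 0" unfolding Vn_def V0v by simp
  define \<mu> where "\<mu> = \<mu>s + 1"
  have "0 < \<delta> * nm \<mu> v" using nm_pos[OF vX, of \<mu>] v(2) \<mu>s \<delta> by (simp add: \<mu>_def)
  then have q: "qf \<mu> lam v > 0" using gap[of \<mu> v] vX v(2) by (simp add: \<mu>_def)
  define R where "R = (a * (D12_sq v)\<^sup>2 + qf \<mu> lam v) / Bn v"
  have R0: "R > 0" unfolding R_def using q v(2) a0 by (intro divide_pos_pos add_nonneg_pos) auto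
  \<comment> \<open>Chosen so that \<open>R \<le> T powr (p - 4)\<close>; the maximum meets the
    requirement \<open>T \<ge> 1\<close>.\<close>
  define T where "T = max 1 (R powr (1 / (p - 4)))"
  have "R = (R powr (1 / (p - 4))) powr (p - 4)" using R0 p4 by (simp add: powr_powr)
  also have "\<dots> \<le> T powr (p - 4)" unfolding T_def using p4 by (intro powr_mono2) auto
  finally have "a * (D12_sq v)\<^sup>2 + qf \<mu> lam v \<le> Bn v * T powr (p - 4)" using v(2) by (simp add: R_def pos_divide_le_eq mult.commute)
  then obtain t where t: "0 < t" "(\<lambda>x. t * v x) \<in> Nminus \<mu> lam"
    using Nehari_projection[OF vX v(2) q, of T] by (auto simp: T_def)
  have "Vn (\<lambda>x. t * v x) = 0" using X_cmult(3)[OF vX] Vv by simp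
  then have e: "qf \<mu>' lam (\<lambda>x. t * v x) = qf \<mu> lam (\<lambda>x. t * v x)" for \<mu>' by (simp add: qf_def nm_def)
  have "(\<lambda>x. t * v x) \<in> Nminus \<mu>' lam" for \<mu>' using t(2) by (simp add: Nminus_iff e[of \<mu>'])
  moreover have "J \<mu>' lam (\<lambda>x. t * v x) = J \<mu> lam (\<lambda>x. t * v x)" for \<mu>' by (simp add: J_eq e[of \<mu>'])
  ultimately show ?thesis by blast
qed

section \<open>Limits of minimizing sequences\<close>

lemma bounded_pair_subseq:
  fixes x y :: "nat \<Rightarrow> real"
  assumes "\<And>n. 0 \<le> x n" "\<And>n. x n \<le> M" "\<And>n. 0 \<le> y n" "\<And>n. y n \<le> M"
  obtains r l m where "strict_mono r" "(\<lambda>n. x (r n)) \<longlonglongrightarrow> l" "(\<lambda>n. y (r n)) \<longlonglongrightarrow> m"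
proof -
  have "range (\<lambda>n. (x n, y n)) \<subseteq> {0..M} \<times> {0..M}" using assms by auto
  then have "bounded (range (\<lambda>n. (x n, y n)))" by (rule bounded_subset[rotated]) (intro bounded_Times bounded_closed_interval)
  then obtain l r where r: "strict_mono r" "((\<lambda>n. (x n, y n)) \<circ> r) \<longlonglongrightarrow> l"
    using bounded_imp_convergent_subsequence by blast
  show thesis by (rule that[OF r(1)]) (use tendsto_fst[OF r(2)] tendsto_snd[OF r(2)] in \<open>auto simp: o_def\<close>)
qed

text \<open>Lower semicontinuity is applied to the averages \<open>(u\<^sub>n + u) / 2\<close>, and the parallelogram
  identity turns it into control of \<open>u\<^sub>n - u\<close>.\<close>
lemma bounded_subsequence:
  fixes us :: "nat \<Rightarrow> real^3 \<Rightarrow> real"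
  assumes us: "\<And>n. us n \<in> X" and \<mu>: "\<mu> \<ge> 1" and b: "\<And>n. nm \<mu> (us n) \<le> M" and M: "M > 0"
  obtains r u d w dv wv where "strict_mono r" "u \<in> X" "AE x in lebesgue. (\<lambda>n. us (r n) x) \<longlonglongrightarrow> u x"
    "(\<lambda>n. D12_sq (us (r n))) \<longlonglongrightarrow> d" "(\<lambda>n. Vn (us (r n))) \<longlonglongrightarrow> w" "D12_sq u \<le> d" "Vn u \<le> w"
    "(\<lambda>n. D12_sq (\<lambda>x. us (r n) x - u x)) \<longlonglongrightarrow> dv" "(\<lambda>n. Vn (\<lambda>x. us (r n) x - u x)) \<longlonglongrightarrow> wv"
    "dv \<le> 2 * (d - D12_sq u)" "wv \<le> 2 * (w - Vn u)" "d \<le> M"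
proof -
  have bD: "D12_sq (us n) \<le> M" for n using nm_ge(1)[of \<mu> "us n"] \<mu> b[of n] by simp
  have bV: "Vn (us n) \<le> M" for n
  proof -
    have "1 * Vn (us n) \<le> \<mu> * Vn (us n)" using \<mu> Vn0 by (intro mult_right_mono) auto
    then show ?thesis using b[of n] D0[of "us n"] by (simp add: nm_def)
  qed
  have bn: "n2 (us n) \<le> K * M" for n by (rule n2_bound[OF us \<mu> b M])
  have bnd: "n2 (us n) \<le> max (K * M) M" "Dsq (grad (us n)) \<le> max (K * M) M" for n using bn[of n] bD[of n] XD(3)[OF us[of n]] by auto
  obtain r1 u where r1: "strict_mono r1" "u \<in> borel_measurable lebesgue" "AE x in lebesgue. (\<lambda>n. us (r1 n) x) \<longlonglongrightarrow> u x"
    by (rule Rellich_AE[OF XD(2)[OF us] bnd])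
  obtain r2 d w where r2: "strict_mono r2" "(\<lambda>n. D12_sq (us (r1 (r2 n)))) \<longlonglongrightarrow> d" "(\<lambda>n. Vn (us (r1 (r2 n)))) \<longlonglongrightarrow> w"
    using bounded_pair_subseq[of "\<lambda>n. D12_sq (us (r1 n))" M "\<lambda>n. Vn (us (r1 n))"] D0 Vn0 bD bV by blast
  define z where "z n = us (r1 (r2 n))" for n
  have zl: "AE x in lebesgue. (\<lambda>n. z n x) \<longlonglongrightarrow> u x"
    using r1(3) by eventually_elim (use LIMSEQ_subseq_LIMSEQ[OF _ r2(1)] in \<open>auto simp: o_def z_def\<close>)
  have zX: "z n \<in> X" and zn: "n2 (z n) \<le> K * M" and zD: "D12_sq (z n) \<le> M" and zV: "Vn (z n) \<le> M" for n
    unfolding z_def by (rule us bn bD bV)+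
  have zd: "(\<lambda>n. D12_sq (z n)) \<longlonglongrightarrow> d" "(\<lambda>n. Vn (z n)) \<longlonglongrightarrow> w" using r2 by (simp_all add: z_def)
  note U = X_lsc[OF zX zn zd r1(2) zl]
  have dM: "d \<le> M" by (rule LIMSEQ_le_const2[OF zd(1)]) (use zD in auto)
  have wM: "w \<le> M" by (rule LIMSEQ_le_const2[OF zd(2)]) (use zV in auto)
  define y where "y n x = (z n x + u x) / 2" for n x
  have yX: "y n \<in> X" for n unfolding y_def[abs_def] by (rule X_avg[OF zX U(1)])
  have par: "D12_sq (\<lambda>x. z n x - u x) = 2 * D12_sq (z n) + 2 * D12_sq u - 4 * D12_sq (y n)"
    "Vn (\<lambda>x. z n x - u x) = 2 * Vn (z n) + 2 * Vn u - 4 * Vn (y n)" for n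
    unfolding y_def[abs_def] by (rule parallelogram_X[OF zX U(1)])+
  have yD: "D12_sq (y n) \<le> M" for n using par(1)[of n] D0[of "\<lambda>x. z n x - u x"] zD[of n] U(2) dM by linarith
  have yV: "Vn (y n) \<le> M" for n using par(2)[of n] Vn0[of "\<lambda>x. z n x - u x"] zV[of n] U(3) wM by linarith
  obtain r3 da wa where r3: "strict_mono r3" "(\<lambda>n. D12_sq (y (r3 n))) \<longlonglongrightarrow> da" "(\<lambda>n. Vn (y (r3 n))) \<longlonglongrightarrow> wa"
    using bounded_pair_subseq[of "\<lambda>n. D12_sq (y n)" M "\<lambda>n. Vn (y n)"] D0 Vn0 yD yV by blast
  have zl3: "AE x in lebesgue. (\<lambda>n. z (r3 n) x) \<longlonglongrightarrow> u x"
    using zl by eventually_elim (use LIMSEQ_subseq_LIMSEQ[OF _ r3(1)] in \<open>auto simp: o_def\<close>)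
  have zd3: "(\<lambda>n. D12_sq (z (r3 n))) \<longlonglongrightarrow> d" "(\<lambda>n. Vn (z (r3 n))) \<longlonglongrightarrow> w"
    using LIMSEQ_subseq_LIMSEQ[OF zd(1) r3(1)] LIMSEQ_subseq_LIMSEQ[OF zd(2) r3(1)] by (simp_all add: o_def)
  have yl: "AE x in lebesgue. (\<lambda>n. y (r3 n) x) \<longlonglongrightarrow> u x" using zl3
  proof eventually_elim
    case (elim x)
    have "(\<lambda>n. (z (r3 n) x + u x) / 2) \<longlonglongrightarrow> (u x + u x) / 2" by (intro tendsto_intros elim) simp
    then show ?case by (simp add: y_def)
  qed
  have yn: "n2 (y n) \<le> K * (2 * M)" for n
  proof (rule n2_bound[OF yX, where \<mu> = 1])
    show "nm 1 (y n) \<le> 2 * M" using yD[of n] yV[of n] by (simp add: nm_def)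
  qed (use M in auto)
  note Y = X_lsc[of "\<lambda>n. y (r3 n)", OF yX yn r3(2,3) r1(2) yl]
  have s: "strict_mono (\<lambda>n. r1 (r2 (r3 n)))" using strict_mono_o[OF r1(1) strict_mono_o[OF r2(1) r3(1)]] by (simp add: o_def)
  show thesis
  proof (rule that[OF s U(1) _ _ _ U(2,3) _ _ _ _ dM])
    show "AE x in lebesgue. (\<lambda>n. us (r1 (r2 (r3 n))) x) \<longlonglongrightarrow> u x" using zl3 by (simp add: z_def)
    show "(\<lambda>n. D12_sq (us (r1 (r2 (r3 n))))) \<longlonglongrightarrow> d" "(\<lambda>n. Vn (us (r1 (r2 (r3 n))))) \<longlonglongrightarrow> w" using zd3 by (simp_all add: z_def)
    have "(\<lambda>n. D12_sq (\<lambda>x. z (r3 n) x - u x)) \<longlonglongrightarrow> 2 * d + 2 * D12_sq u - 4 * da"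
      unfolding par by (intro tendsto_intros zd3 r3)
    then show "(\<lambda>n. D12_sq (\<lambda>x. us (r1 (r2 (r3 n))) x - u x)) \<longlonglongrightarrow> 2 * d + 2 * D12_sq u - 4 * da" by (simp add: z_def)
    have "(\<lambda>n. Vn (\<lambda>x. z (r3 n) x - u x)) \<longlonglongrightarrow> 2 * w + 2 * Vn u - 4 * wa"
      unfolding par by (intro tendsto_intros zd3 r3)
    then show "(\<lambda>n. Vn (\<lambda>x. us (r1 (r2 (r3 n))) x - u x)) \<longlonglongrightarrow> 2 * w + 2 * Vn u - 4 * wa" by (simp add: z_def)
    \<comment> \<open>Lower semicontinuity along the averages reads
      \<open>D12_sq u \<le> da\<close>, and the parallelogram limit becomes twice the loss of
      energy. The same holds for \<open>Vn\<close> in the next line.\<close>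
    show "2 * d + 2 * D12_sq u - 4 * da \<le> 2 * (d - D12_sq u)" using Y(2) by simp
    show "2 * w + 2 * Vn u - 4 * wa \<le> 2 * (w - Vn u)" using Y(3) by simp
  qed
qed

text \<open>The loss of \<open>Bn\<close> is linear in the limit \<open>\<nu>\<close> of the norm of
  \<open>us n - u\<close>. One coefficient is small for large \<open>\<mu>\<close>, because where
  \<open>V \<ge> c\<close> the square integral is at most the norm divided by
  \<open>c * \<mu>\<close>; the other is small for large \<open>s\<close>. What lies on
  \<open>{x. V x < c}\<close> disappears by \<open>An_limit\<close>.\<close>

lemma Bn_defect:
  assumes us: "\<And>n. us n \<in> X" and u: "u \<in> X" and l: "AE x in lebesgue. (\<lambda>n. us n x) \<longlonglongrightarrow> u x"
    and \<mu>: "\<mu> \<ge> 1" and s: "s > 0" and D: "\<And>n. D12_sq (\<lambda>x. us n x - u x) \<le> M"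
    and \<nu>: "(\<lambda>n. nm \<mu> (\<lambda>x. us n x - u x)) \<longlonglongrightarrow> \<nu>" and b: "(\<lambda>n. Bn (us n)) \<longlonglongrightarrow> b"
  shows "b \<le> Bn u + CQ * 2 powr p * ((s powr (p - 2) / (c * \<mu>) + s powr (p - 6) * (4096 * M\<^sup>2)) * \<nu>)"
proof -
  define v where "v n x = us n x - u x" for n x
  have vX: "v n \<in> X" for n unfolding v_def[abs_def] by (rule X_add_diff(2)[OF us u])
  have vD: "D12_sq (v n) \<le> M" for n using D[of n] by (simp add: v_def[abs_def])
  have vn: "(\<lambda>n. nm \<mu> (v n)) \<longlonglongrightarrow> \<nu>" using \<nu> by (simp add: v_def[abs_def])
  have vl: "AE x in lebesgue. (\<lambda>n. v n x) \<longlonglongrightarrow> 0" using l by eventually_elim (simp add: v_def LIM_zero)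
  have A0: "(\<lambda>n. An (v n)) \<longlonglongrightarrow> 0" by (rule An_limit[OF vX vD vl])
  define \<eta> where "\<eta> = s powr (p - 2) / (c * \<mu>) + s powr (p - 6) * (4096 * M\<^sup>2)"
  have Pv: "Pn (v n) \<le> s powr (p - 2) * An (v n) + \<eta> * nm \<mu> (v n)" for n
  proof -
    have "Pn (v n) \<le> s powr (p - 2) * n2 (v n) + s powr (p - 6) * (4096 * D12_sq (v n) ^ 3)"
      by (rule Pn_bound(2)[OF XD(4)[OF vX] X_L6[OF vX order_refl] s])
    also have "s powr (p - 2) * n2 (v n) \<le> s powr (p - 2) * (An (v n) + nm \<mu> (v n) / (c * \<mu>))"
    proof (rule mult_left_mono)
      have "Vn (v n) / c \<le> nm \<mu> (v n) / \<mu> / c" using nm_ge(2)[of \<mu> "v n"] \<mu> c0 by (intro divide_right_mono) auto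
      then show "n2 (v n) \<le> An (v n) + nm \<mu> (v n) / (c * \<mu>)" using n2_An[OF vX, of n] by (simp add: mult.commute)
    qed simp
    also have "s powr (p - 6) * (4096 * D12_sq (v n) ^ 3) \<le> s powr (p - 6) * (4096 * (M\<^sup>2 * nm \<mu> (v n)))"
    proof -
      \<comment> \<open>Two of the three factors from the Sobolev inequality are spent on the fixed
        bound \<open>M\<close>, so that the estimate stays linear in the norm.\<close>
      have "D12_sq (v n) ^ 3 = D12_sq (v n) ^ 2 * D12_sq (v n)" by (simp add: power3_eq_cube power2_eq_square)
      also have "\<dots> \<le> M\<^sup>2 * nm \<mu> (v n)"
        using nm_ge(1)[of \<mu> "v n"] \<mu> D0[of "v n"] vD[of n] by (intro mult_mono power_mono) auto
      finally show ?thesis by (intro mult_left_mono) auto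
    qed
    finally show ?thesis by (simp add: \<eta>_def algebra_simps)
  qed
  obtain e where e: "e \<longlonglongrightarrow> 0" "\<And>n. \<bar>Bn (us n) - Bn u\<bar> \<le> e n + CQ * 2 powr p * Pn (v n)"
    unfolding v_def[abs_def] using Bn_limit[OF us u l] by blast
  have "b \<le> Bn u + (0 + CQ * 2 powr p * (s powr (p - 2) * 0 + \<eta> * \<nu>))"
  proof (rule LIMSEQ_le[OF b])
    show "(\<lambda>n. Bn u + (e n + CQ * 2 powr p * (s powr (p - 2) * An (v n) + \<eta> * nm \<mu> (v n)))) \<longlonglongrightarrow>
      Bn u + (0 + CQ * 2 powr p * (s powr (p - 2) * 0 + \<eta> * \<nu>))"
      by (intro tendsto_add tendsto_mult tendsto_const e(1) A0 vn)
    have "Bn (us n) \<le> Bn u + (e n + CQ * 2 powr p * (s powr (p - 2) * An (v n) + \<eta> * nm \<mu> (v n)))" for n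
    proof -
      have "CQ * 2 powr p * Pn (v n) \<le> CQ * 2 powr p * (s powr (p - 2) * An (v n) + \<eta> * nm \<mu> (v n))"
        using CQ0 Pv[of n] by (intro mult_left_mono) auto
      then show ?thesis using e(2)[of n] by linarith
    qed
    then show "\<exists>N. \<forall>n\<ge>N. Bn (us n) \<le> Bn u + (e n + CQ * 2 powr p * (s powr (p - 2) * An (v n) + \<eta> * nm \<mu> (v n)))" by blast
  qed
  then show ?thesis by (simp add: \<eta>_def)
qed

text \<open>\<open>Bn\<close> is of order \<open>p / 2 > 1\<close> in the norm, but on
  \<open>Nminus\<close> it is at least \<open>qf\<close>, hence at least \<open>\<delta>\<close>
  times the norm. Small norms are impossible, and the bound does not depend on the minimizing
  sequence.\<close>

lemma Nminus_nm_lower: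
  assumes u: "u \<in> Nminus \<mu> lam" and \<mu>: "\<mu> \<ge> 1" and gap: "qf \<mu> lam u \<ge> \<delta> * nm \<mu> u"
  shows "\<delta> \<le> CQ * (K + 4096) * nm \<mu> u powr ((p - 2) / 2)"
proof -
  have uX: "u \<in> X" and eq: "a * (D12_sq u)\<^sup>2 + qf \<mu> lam u = Bn u" using u by (auto simp: Nminus_iff)
  have pos: "nm \<mu> u > 0" by (rule nm_pos[OF uX \<mu> Nminus_Bn_pos[OF u]])
  have "\<delta> * nm \<mu> u \<le> Bn u" using gap eq a0 by (smt (verit) mult_nonneg_nonneg zero_le_power2)
  also have "\<dots> \<le> CQ * (K + 4096) * (nm \<mu> u * nm \<mu> u powr ((p - 2) / 2))" by (rule Bn_le_nm[OF uX \<mu> order_refl pos])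
  finally have "\<delta> * nm \<mu> u \<le> (CQ * (K + 4096) * nm \<mu> u powr ((p - 2) / 2)) * nm \<mu> u" by (simp add: mult_ac)
  then show ?thesis using pos by simp
qed

text \<open>The order of choices avoids a circle: the competitor's energy \<open>J0\<close> is the
  same for all \<open>\<mu>\<close>, it fixes the bound \<open>M\<close>, this fixes the threshold
  \<open>s\<close>, and only then is \<open>\<mu>'\<close> taken large enough for
  \<open>s\<close>.\<close>

lemma minimizer_exists:
  assumes gap0: "\<And>\<mu> u. \<mu> > \<mu>s \<Longrightarrow> u \<in> X \<Longrightarrow> Bn u > 0 \<Longrightarrow> qf \<mu> lam u \<ge> \<delta> * nm \<mu> u"
    and \<mu>s: "\<mu>s \<ge> 1" and \<delta>: "0 < \<delta>" "\<delta> \<le> 1"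
  shows "\<exists>\<mu>'>0. \<forall>\<mu>>\<mu>'. \<exists>u0\<in>Nminus \<mu> lam. \<forall>v\<in>Nminus \<mu> lam. J \<mu> lam u0 \<le> J \<mu> lam v"
proof -
  obtain w0 J0 where w0: "\<And>\<mu>. \<mu> > \<mu>s \<Longrightarrow> w0 \<in> Nminus \<mu> lam" "\<And>\<mu>. \<mu> > \<mu>s \<Longrightarrow> J \<mu> lam w0 = J0"
    using uniform_competitor[OF gap0 \<mu>s \<delta>(1)] by blast
  define c1 where "c1 = (p - 4) / (4 * p) * a"
  define c2 where "c2 = (p - 2) / (2 * p)"
  have cp: "c1 > 0" "c2 > 0" using p4 a0 by (auto simp: c1_def c2_def)
  have gap: "qf \<mu> lam u \<ge> \<delta> * nm \<mu> u" if "\<mu> > \<mu>s" "u \<in> Nminus \<mu> lam" for \<mu> u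
    using gap0[OF that(1) _ Nminus_Bn_pos[OF that(2)]] that(2) by (simp add: Nminus_iff)
  have JN: "J \<mu> lam u = c1 * (D12_sq u)\<^sup>2 + c2 * qf \<mu> lam u" if "a * (D12_sq u)\<^sup>2 + qf \<mu> lam u = Bn u" for \<mu> u
    using J_on_Nehari[OF that] by (simp add: c1_def c2_def)
  have Jge: "c2 * \<delta> * nm \<mu> u \<le> J \<mu> lam u" if "\<mu> > \<mu>s" "u \<in> Nminus \<mu> lam" for \<mu> u
  proof -
    have "c2 * (\<delta> * nm \<mu> u) \<le> c2 * qf \<mu> lam u" using gap[OF that] cp by (intro mult_left_mono) auto
    moreover have "0 \<le> c1 * (D12_sq u)\<^sup>2" using cp by simp
    ultimately show ?thesis using JN[of u \<mu>] that(2) by (simp add: Nminus_iff mult.assoc)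
  qed
  have J0: "0 \<le> J \<mu> lam u" if "\<mu> > \<mu>s" "u \<in> Nminus \<mu> lam" for \<mu> u
    using Jge[OF that] nm_ge(3)[of \<mu> u] that(1) \<mu>s cp \<delta> by (smt (verit) mult_nonneg_nonneg)
  have "J0 \<ge> 0" using J0[OF _ w0(1), of "\<mu>s + 1"] w0(2)[of "\<mu>s + 1"] by simp
  \<comment> \<open>On \<open>Nminus\<close> the energy is at least \<open>c2 * \<delta>\<close>
    times the norm, and a minimizing sequence can be kept below \<open>J0 + 1\<close>.\<close>
  define M where "M = (J0 + 1) / (c2 * \<delta>)"
  have M: "M > 0" using \<open>J0 \<ge> 0\<close> cp \<delta> by (simp add: M_def)
  define \<theta> where "\<theta> = CQ * 2 powr p"
  have \<theta>: "\<theta> > 0" using CQ0 by (simp add: \<theta>_def)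
  \<comment> \<open>One half of the budget \<open>\<delta> / 4\<close> for
    \<open>\<theta> * \<eta>\<close>. By the parallelogram law \<open>4 * M\<close> bounds the
    Dirichlet energy of \<open>us n - u\<close>.\<close>
  have "((\<lambda>s. \<theta> * (s powr (p - 6) * (4096 * (4 * M)\<^sup>2))) \<longlongrightarrow> \<theta> * (0 * (4096 * (4 * M)\<^sup>2))) at_top"
    by (intro tendsto_mult tendsto_const tendsto_neg_powr filterlim_ident) (use p6 in simp)
  then have "\<forall>\<^sub>F s in at_top. \<theta> * (s powr (p - 6) * (4096 * (4 * M)\<^sup>2)) < \<delta> / 8"
    by (rule order_tendstoD) (use \<delta> in simp)
  then have "\<forall>\<^sub>F s in at_top. s > 0 \<and> \<theta> * (s powr (p - 6) * (4096 * (4 * M)\<^sup>2)) < \<delta> / 8"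
    using eventually_gt_at_top[of 0] by eventually_elim simp
  then obtain s where s: "s > 0" "\<theta> * (s powr (p - 6) * (4096 * (4 * M)\<^sup>2)) < \<delta> / 8"
    using eventually_happens'[OF trivial_limit_at_top_linorder] by blast
  \<comment> \<open>The other half of the budget: beyond this value
    \<open>\<theta> * (s powr (p - 2) / (c * \<mu>))\<close> is below
    \<open>\<delta> / 8\<close>.\<close>
  define \<mu>' where "\<mu>' = max \<mu>s (8 * \<theta> * s powr (p - 2) / (c * \<delta>))"
  show ?thesis
  proof (intro exI[of _ \<mu>'] conjI allI impI)
    show "\<mu>' > 0" using \<mu>s by (simp add: \<mu>'_def)
    fix \<mu> assume "\<mu> > \<mu>'"
    then have \<mu>: "\<mu> > \<mu>s" "8 * \<theta> * s powr (p - 2) / (c * \<delta>) < \<mu>" by (auto simp: \<mu>'_def)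
    have m1: "\<mu> \<ge> 1" using \<mu>(1) \<mu>s by simp
    define \<eta> where "\<eta> = s powr (p - 2) / (c * \<mu>) + s powr (p - 6) * (4096 * (4 * M)\<^sup>2)"
    have "\<theta> * (s powr (p - 2) / (c * \<mu>)) < \<delta> / 8"
    proof -
      have "8 * \<theta> * s powr (p - 2) < \<mu> * (c * \<delta>)" using \<mu>(2) c0 \<delta> by (simp only: pos_divide_less_eq mult_pos_pos)
      then have "\<theta> * s powr (p - 2) < \<delta> / 8 * (c * \<mu>)" by (simp add: mult_ac)
      then have "\<theta> * s powr (p - 2) / (c * \<mu>) < \<delta> / 8" using c0 m1 by (simp only: pos_divide_less_eq mult_pos_pos)
      then show ?thesis by simp
    qed
    then have \<eta>: "\<theta> * \<eta> \<le> \<delta> / 4" using s(2) unfolding \<eta>_def distrib_left by linarith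
    define m where "m = Inf (J \<mu> lam ` Nminus \<mu> lam)"
    have bdd: "bdd_below (J \<mu> lam ` Nminus \<mu> lam)" using J0[OF \<mu>(1)] by (intro bdd_belowI[of _ 0]) auto
    have mle: "m \<le> J \<mu> lam v" if "v \<in> Nminus \<mu> lam" for v unfolding m_def by (rule cINF_lower[OF bdd that])
    have "\<exists>u. u \<in> Nminus \<mu> lam \<and> J \<mu> lam u < m + inverse (real (Suc n))" for n
    proof -
      have "m < m + inverse (real (Suc n))" by simp
      then show ?thesis unfolding m_def using w0(1)[OF \<mu>(1)] cINF_less_iff[OF _ bdd] by blast
    qed
    then obtain us where us: "\<And>n. us n \<in> Nminus \<mu> lam" "\<And>n. J \<mu> lam (us n) < m + inverse (real (Suc n))" by metis
    have uX: "us n \<in> X" for n using us(1) by (simp add: Nminus_iff)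
    have mJ0: "m \<le> J0" using mle[OF w0(1)[OF \<mu>(1)]] w0(2)[OF \<mu>(1)] by simp
    have nmM: "nm \<mu> (us n) \<le> M" for n
    proof -
      have "inverse (real (Suc n)) \<le> 1" by (simp add: inverse_le_1_iff)
      then have "c2 * \<delta> * nm \<mu> (us n) \<le> J0 + 1" using Jge[OF \<mu>(1) us(1)[of n]] us(2)[of n] mJ0 by linarith
      then show ?thesis using cp \<delta> by (simp add: M_def pos_le_divide_eq mult.commute)
    qed
    have Jm: "(\<lambda>n. J \<mu> lam (us n)) \<longlonglongrightarrow> m"
    proof (rule tendsto_sandwich[OF _ _ tendsto_const])
      show "(\<lambda>n. m + inverse (real (Suc n))) \<longlonglongrightarrow> m" using tendsto_add[OF tendsto_const LIMSEQ_inverse_real_of_nat, of m] by simp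
    qed (use mle us(1) less_imp_le[OF us(2)] in \<open>auto simp del: of_nat_Suc\<close>)
    obtain r u d w dv wv where r: "strict_mono r" "u \<in> X" "AE x in lebesgue. (\<lambda>n. us (r n) x) \<longlonglongrightarrow> u x"
      "(\<lambda>n. D12_sq (us (r n))) \<longlonglongrightarrow> d" "(\<lambda>n. Vn (us (r n))) \<longlonglongrightarrow> w" "D12_sq u \<le> d" "Vn u \<le> w"
      "(\<lambda>n. D12_sq (\<lambda>x. us (r n) x - u x)) \<longlonglongrightarrow> dv" "(\<lambda>n. Vn (\<lambda>x. us (r n) x - u x)) \<longlonglongrightarrow> wv"
      "dv \<le> 2 * (d - D12_sq u)" "wv \<le> 2 * (w - Vn u)" "d \<le> M"
      by (rule bounded_subsequence[OF uX m1 nmM M])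
    have DM: "D12_sq (us (r n)) \<le> M" for n using nm_ge(1)[of \<mu> "us (r n)"] m1 nmM[of "r n"] by simp
    have vD: "D12_sq (\<lambda>x. us (r n) x - u x) \<le> 4 * M" for n
      using parallelogram_X(1)[OF uX r(2), of "r n"] D0[of "\<lambda>x. (us (r n) x + u x) / 2"] DM[of n] r(6,12) by linarith
    define S where "S = d + \<mu> * w"
    \<comment> \<open>The norm lost in the limit. The loss of \<open>Bn\<close> is measured against
      it.\<close>
    define \<sigma> where "\<sigma> = S - nm \<mu> u"
    have \<mu>w: "\<mu> * Vn u \<le> \<mu> * w" "\<mu> * wv \<le> \<mu> * (2 * (w - Vn u))" using r(7,11) m1 by (intro mult_left_mono; simp)+
    have "0 \<le> nm \<mu> u" using nm_ge(3) m1 by simp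
    then have \<sigma>: "0 \<le> \<sigma>" "\<sigma> \<le> S" using \<mu>w(1) r(6) unfolding \<sigma>_def S_def nm_def by linarith+
    have nS: "(\<lambda>n. nm \<mu> (us (r n))) \<longlonglongrightarrow> S" unfolding nm_def S_def by (intro tendsto_intros r)
    have \<nu>: "(\<lambda>n. nm \<mu> (\<lambda>x. us (r n) x - u x)) \<longlonglongrightarrow> dv + \<mu> * wv" unfolding nm_def by (intro tendsto_intros r)
    have \<nu>\<sigma>: "dv + \<mu> * wv \<le> 2 * \<sigma>" using r(10) \<mu>w(2) by (simp add: \<sigma>_def S_def nm_def algebra_simps)
    have DuM: "D12_sq u \<le> M" using r(6,12) by linarith
    have Fl: "(\<lambda>n. Fn (us (r n))) \<longlonglongrightarrow> Fn u" by (rule Fn_limit[OF uX DM r(2) DuM r(3)])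
    define A where "A = S - lam * Fn u"
    have Al: "(\<lambda>n. qf \<mu> lam (us (r n))) \<longlonglongrightarrow> A" unfolding qf_def A_def by (intro tendsto_intros nS Fl)
    have Dl: "(\<lambda>n. (D12_sq (us (r n)))\<^sup>2) \<longlonglongrightarrow> d\<^sup>2" by (intro tendsto_intros r)
    have eqs: "a * (D12_sq (us n))\<^sup>2 + qf \<mu> lam (us n) = Bn (us n)" for n using us(1)[of n] by (simp add: Nminus_iff)
    have bl: "(\<lambda>n. Bn (us (r n))) \<longlonglongrightarrow> a * d\<^sup>2 + A" unfolding eqs[symmetric] by (intro tendsto_intros Dl Al)
    have m_eq: "m = c1 * d\<^sup>2 + c2 * A"
    proof (rule LIMSEQ_unique)
      show "(\<lambda>n. J \<mu> lam (us (r n))) \<longlonglongrightarrow> m" using LIMSEQ_subseq_LIMSEQ[OF Jm r(1)] by (simp add: o_def)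
      show "(\<lambda>n. J \<mu> lam (us (r n))) \<longlonglongrightarrow> c1 * d\<^sup>2 + c2 * A" unfolding JN[OF eqs] by (intro tendsto_intros Dl Al)
    qed
    have AS: "\<delta> * S \<le> A"
      by (rule LIMSEQ_le[OF tendsto_mult[OF tendsto_const nS] Al]) (use gap[OF \<mu>(1) us(1)] in auto)
    \<comment> \<open>If the norms tended to \<open>0\<close>, the lower bound of
      \<open>Nminus_nm_lower\<close> would give \<open>\<delta> \<le> 0\<close>.\<close>
    have "S \<noteq> 0"
    proof
      assume "S = 0"
      have "(\<lambda>n. CQ * (K + 4096) * nm \<mu> (us (r n)) powr ((p - 2) / 2)) \<longlonglongrightarrow> CQ * (K + 4096) * S powr ((p - 2) / 2)"
        by (intro tendsto_mult tendsto_const tendsto_powr'[OF nS tendsto_const])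
          (use p4 m1 in \<open>simp_all add: nm_ge(3)\<close>)
      then have "\<delta> \<le> CQ * (K + 4096) * S powr ((p - 2) / 2)"
        by (rule LIMSEQ_le_const) (use Nminus_nm_lower[OF us(1) m1 gap[OF \<mu>(1) us(1)]] in blast)
      then show False using \<open>S = 0\<close> \<delta> by simp
    qed
    then have S: "S > 0" using \<sigma> by simp
    have "a * d\<^sup>2 + A \<le> Bn u + \<theta> * (\<eta> * (dv + \<mu> * wv))"
      unfolding \<theta>_def \<eta>_def by (rule Bn_defect[OF uX r(2,3) m1 s(1) vD \<nu> bl])
    \<comment> \<open>Combines \<open>\<theta> * \<eta> \<le> \<delta> / 4\<close> with
      \<open>dv + \<mu> * wv \<le> 2 * \<sigma>\<close>, the factor \<open>2\<close> coming from the
      parallelogram law.\<close>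
    also have "\<theta> * (\<eta> * (dv + \<mu> * wv)) \<le> \<delta> / 2 * \<sigma>"
    proof -
      have "\<eta> \<ge> 0" using c0 m1 by (simp add: \<eta>_def)
      then have "\<theta> * \<eta> * (dv + \<mu> * wv) \<le> \<theta> * \<eta> * (2 * \<sigma>)" using \<nu>\<sigma> \<theta> by (intro mult_left_mono) auto
      also have "\<dots> \<le> \<delta> / 4 * (2 * \<sigma>)" using \<eta> \<sigma> by (intro mult_right_mono) auto
      finally show ?thesis by (simp add: mult.assoc)
    qed
    finally have key: "a * d\<^sup>2 + A - \<delta> / 2 * \<sigma> \<le> Bn u" by simp
    have qu: "qf \<mu> lam u = A - \<sigma>" by (simp add: qf_def A_def \<sigma>_def)
    have ad: "0 \<le> a * d\<^sup>2" using a0 by simp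
    \<comment> \<open>At most half of the coercive lower bound \<open>\<delta> * S \<le> A\<close>
      is lost, so \<open>Bn u\<close> stays positive and the limit is not zero.\<close>
    have "\<delta> / 2 * \<sigma> \<le> \<delta> / 2 * S" "0 < \<delta> / 2 * S" using \<sigma> \<delta> S by auto
    then have Bu: "Bn u > 0" using key AS ad by (simp add: field_simps)
    have "\<delta> * nm \<mu> u > 0" using nm_pos[OF r(2) m1 Bu] \<delta> by simp
    then have qpos: "qf \<mu> lam u > 0" using gap0[OF \<mu>(1) r(2) Bu] by linarith
    have dd: "(D12_sq u)\<^sup>2 \<le> d\<^sup>2" using r(6) D0 by (intro power_mono) auto
    have "a * (D12_sq u)\<^sup>2 \<le> a * d\<^sup>2" using dd a0 by simp
    \<comment> \<open>Here \<open>\<delta> \<le> 1\<close> is used: the form \<open>qf\<close> drops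
      by the full \<open>\<sigma>\<close>, \<open>Bn\<close> by at most
      \<open>\<delta> / 2 * \<sigma>\<close>. The Nehari expression at \<open>u\<close> is thus at
      most \<open>Bn u\<close>, and the projection applies with \<open>T = 1\<close>.\<close>
    moreover have "\<delta> / 2 * \<sigma> \<le> 1 * \<sigma>" using \<sigma> \<delta> by (intro mult_right_mono) auto
    ultimately have "a * (D12_sq u)\<^sup>2 + qf \<mu> lam u \<le> Bn u * 1 powr (p - 4)" using key qu by simp
    then obtain t where t: "0 < t" "t \<le> 1" "(\<lambda>x. t * u x) \<in> Nminus \<mu> lam"
      using Nehari_projection[OF r(2) Bu qpos order_refl] by blast
    have "J \<mu> lam (\<lambda>x. t * u x) = c1 * (t\<^sup>2 * D12_sq u)\<^sup>2 + c2 * (t\<^sup>2 * qf \<mu> lam u)"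
    proof -
      have "qf \<mu> lam (\<lambda>x. t * u x) = t\<^sup>2 * qf \<mu> lam u" unfolding qf_def X_cmult(2-)[OF r(2)] by (simp add: algebra_simps)
      then show ?thesis using JN[of "\<lambda>x. t * u x" \<mu>] t(3) X_cmult(2)[OF r(2), of t] by (simp add: Nminus_iff)
    qed
    \<comment> \<open>Both positive terms decrease twice, in passing to the limit and through
      \<open>t \<le> 1\<close>.\<close>
    also have "\<dots> \<le> c1 * d\<^sup>2 + c2 * A"
    proof (intro add_mono mult_left_mono power_mono)
      have t2: "t\<^sup>2 \<le> 1" using t by (simp add: power_le_one)
      have "t\<^sup>2 * D12_sq u \<le> 1 * d" using t2 r(6) D0[of u] by (intro mult_mono) auto
      then show "t\<^sup>2 * D12_sq u \<le> d" by simp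
      have "t\<^sup>2 * qf \<mu> lam u \<le> 1 * A" using t2 qpos qu \<sigma> by (intro mult_mono) auto
      then show "t\<^sup>2 * qf \<mu> lam u \<le> A" by simp
    qed (use cp D0 in auto)
    also have "\<dots> = m" using m_eq by simp
    finally have "J \<mu> lam (\<lambda>x. t * u x) \<le> m" .
    then show "\<exists>u0\<in>Nminus \<mu> lam. \<forall>v\<in>Nminus \<mu> lam. J \<mu> lam u0 \<le> J \<mu> lam v"
      using t(3) mle by (meson order_trans)
  qed
qed

end

theorem theorem4p5:
  fixes a p :: real and V f Q :: "real^3 \<Rightarrow> real" and \<Omega> :: "(real^3) set"
    and lam1 :: real and phi1 :: "real^3 \<Rightarrow> real"
  assumes p_range: "4 < p" "p < 6" and a_pos: "a > 0"
    and V1: "continuous_on UNIV V" "\<forall>x. V x \<ge> 0"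
    and V2: "\<exists>c>0. {x. V x < c} \<noteq> {} \<and> emeasure lebesgue {x. V x < c} < \<infinity>"
    and V3: "\<Omega> = interior {x. V x = 0}" "\<Omega> \<noteq> {}" "smooth_bounded_domain \<Omega>"
            "closure \<Omega> = {x. V x = 0}"
    and D1: "f \<in> borel_measurable lebesgue" "integrable lebesgue (\<lambda>x. \<bar>f x\<bar> powr (3/2))"
            "\<not> (AE x in lebesgue. x \<in> \<Omega> \<longrightarrow> f x \<le> 0)"
    and D2: "Q \<in> borel_measurable lebesgue" "\<exists>C. AE x in lebesgue. \<bar>Q x\<bar> \<le> C"
            "\<not> (AE x in lebesgue. x \<in> \<Omega> \<longrightarrow> Q x \<le> 0)"
    and eig: "lam1 > 0" "dirichlet_eigenpair \<Omega> f lam1 phi1"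
             "AE x in lebesgue. x \<in> \<Omega> \<longrightarrow> phi1 x > 0"
             "(\<integral>x\<in>\<Omega>. f x * (phi1 x)\<^sup>2 \<partial>lebesgue) = 1"
    and Qneg: "(\<integral>x\<in>\<Omega>. Q x * phi1 x powr p \<partial>lebesgue) < 0"
  shows "\<exists>\<delta>0>0. \<forall>lam. lam1 \<le> lam \<and> lam < lam1 + \<delta>0 \<longrightarrow>
           (\<exists>\<mu>s>0. \<forall>\<mu>>\<mu>s. \<exists>u0 \<in> Nehari_minus a p V f Q \<mu> lam.
              \<forall>v \<in> Nehari_minus a p V f Q \<mu> lam.
                Jfun a p V f Q \<mu> lam u0 \<le> Jfun a p V f Q \<mu> lam v)"
proof -
  obtain c where c: "c > 0" "emeasure lebesgue {x. V x < c} < \<infinity>" using V2 by blast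
  obtain C where C: "AE x in lebesgue. \<bar>Q x\<bar> \<le> C" using D2(2) by blast
  note dom = smooth_bounded_domainD[OF V3(3)]
  \<comment> \<open>The maximum with \<open>1\<close> makes the bound on \<open>Q\<close> positive,
    as the locale asks.\<close>
  interpret kirchhoff \<Omega> f lam1 phi1 a p V Q c "max C 1"
  proof unfold_locales
    show "AE x in lebesgue. \<bar>Q x\<bar> \<le> max C 1" using C by eventually_elim simp
  qed (use assms c dom in auto)
  obtain \<delta> where \<delta>: "\<delta> > 0" "\<And>lam. lam1 \<le> lam \<Longrightarrow> lam < lam1 + \<delta> \<Longrightarrow>
    \<exists>\<mu>s\<ge>1. \<forall>\<mu>>\<mu>s. \<forall>u\<in>X. Bn u > 0 \<longrightarrow> nm \<mu> u - lam * Fn u \<ge> \<delta> * nm \<mu> u"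
    using spectral_gap by blast
  show ?thesis
  proof (rule exI[of _ \<delta>], intro conjI allI impI \<delta>(1))
    fix lam assume "lam1 \<le> lam \<and> lam < lam1 + \<delta>"
    then obtain \<mu>s where \<mu>s: "\<mu>s \<ge> 1" "\<And>\<mu> u. \<mu> > \<mu>s \<Longrightarrow> u \<in> X \<Longrightarrow> Bn u > 0 \<Longrightarrow> nm \<mu> u - lam * Fn u \<ge> \<delta> * nm \<mu> u"
      using \<delta>(2)[of lam] by blast
    \<comment> \<open>\<open>minimizer_exists\<close> wants a coercivity constant of at most
      \<open>1\<close>; the interval for \<open>lam\<close> keeps its length
      \<open>\<delta>\<close>.\<close>
    have "qf \<mu> lam u \<ge> min 1 \<delta> * nm \<mu> u" if "\<mu> > \<mu>s" "u \<in> X" "Bn u > 0" for \<mu> u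
    proof -
      have "min 1 \<delta> * nm \<mu> u \<le> \<delta> * nm \<mu> u" using nm_ge(3)[of \<mu> u] that(1) \<mu>s(1) by (intro mult_right_mono) auto
      then show ?thesis using \<mu>s(2)[OF that] by (simp add: qf_def)
    qed
    from minimizer_exists[OF this \<mu>s(1)]
    show "\<exists>\<mu>s>0. \<forall>\<mu>>\<mu>s. \<exists>u0\<in>Nminus \<mu> lam. \<forall>v\<in>Nminus \<mu> lam. J \<mu> lam u0 \<le> J \<mu> lam v"
      using \<delta>(1) by simp
  qed
qed

end
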